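(* Let $A \subseteq \mathbb{R}^2$ be a stationary Poisson point process (of any intensity $\rho>0$) and let $k \geq 1$. Define on $[0,\pi]$ $f(t) = \tfrac{4}{3}\big[(\pi - t)\cos t + \sin t\big]\sin t$, $g(t) = f(\pi - t)$, and $h(t) = \tfrac12[f(t)+g(t)] = \tfrac{2}{3}\big[(\pi - 2t)\cos t + 2\sin t\big]\sin t$. Then 1. $f$ is the (probability density of the) distribution of angles in $\mathrm{Del}_k(A)$; 2. $g$ is the distribution of angles in $\mathrm{Vor}_k(A)$; 3. $h$ is the distribution of angles in $\mathrm{Igl}_k(A)$ as well as of the angles in $\mathrm{Bri}_k(A)$.
   Context: The distribution of angles of a stationary random tiling means the distribution of the typical angle, i.e., of an interior angle at a vertex of a tile chosen uniformly among all angles per unit area. With probability 1 the process $A$ is locally finite, coarsely dense (every half-plane contains infinitely many points) and generic (no four points cocircular). Order-$k$ Voronoi tessellation $\mathrm{Vor}_k(A)$: for finite $B\subseteq A$ let $\mathrm{dom}(B)=\{x: \|x-b\|\le\|x-a\|\ \forall b\in B, a\in A\setminus B\}$; $\mathrm{Vor}_k(A)$ consists of all $\mathrm{dom}(B)$ with $|B|=k$ with their edges and vertices. Order-$k$ Brillouin tessellation $\mathrm{Bri}_k(A)$: the overlay (union of vertices and edges) of $\mathrm{Vor}_{k-1}(A)$ and $\mathrm{Vor}_k(A)$, with $\mathrm{Vor}_0(A)$ trivial. Order-$k$ Delaunay mosaic $\mathrm{Del}_k(A)$: vertical projection of the lower boundary complex of the convex hull in $\mathbb{R}^3$ of the points $\big(\tfrac1k\sum_{a\in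 B}a,\ \tfrac1k\sum_{a\in B}\|a\|^2\big)$, $B\subseteq A$, $|B|=k$. Order-$k$ Iglesias mosaic $\mathrm{Igl}_k(A)$: vertical projection of the lower boundary complex of the convex hull of the points $\big(\tfrac{1}{2k-1}b+\tfrac{2}{2k-1}\sum_{a\in B\setminus\{b\}}a,\ \tfrac{1}{2k-1}\|b\|^2+\tfrac{2}{2k-1}\sum_{a\in B\setminus\{b\}}\|a\|^2\big)$, $B\subseteq A$, $|B|=k$, $b\in B$.
   Formalization: Densities are taken with respect to the uniform measure dt/π on [0,π], since f, g, h each integrate to π there; item 3 is stated only for k ≥ 2, since Igl_1 = Del_1 has density f and Bri_1 = Vor_1 has density g, neither equal to h. *)

theory Defs
  imports "HOL-Probability.Probability"
begin

type_synonym point = "real^2"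

text \<open>
  The homogeneous Poisson process, as a random locally finite subset of the plane.  The counting
  law is spelled out instead of using the library's Poisson pmf because null sets (rate 0,
  with \<open>0 ^ 0 = 1\<close>) have to be covered.
\<close>

locale stationary_poisson_process = prob_space M
  for M :: "'w measure" and \<rho> :: real and A :: "'w \<Rightarrow> point set" +
  assumes intensity_pos: "\<rho> > 0"
    and locally_finite: "\<And>\<omega> B. \<omega> \<in> space M \<Longrightarrow> bounded B \<Longrightarrow> finite (A \<omega> \<inter> B)"
    and count_measurable: "\<And>B. B \<in> sets borel \<Longrightarrow> bounded B \<Longrightarrow>
          random_variable (count_space UNIV) (\<lambda>\<omega>. card (A \<omega> \<inter> B))"
    and count_poisson: "\<And>B n. B \<in> sets borel \<Longrightarrow> bounded B \<Longrightarrow>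
          prob {\<omega> \<in> space M. card (A \<omega> \<inter> B) = n} =
            (\<rho> * measure lborel B) ^ n / fact n * exp (- (\<rho> * measure lborel B))"
    and count_indep: "\<And>(I :: nat set) B. finite I \<Longrightarrow> disjoint_family_on B I \<Longrightarrow>
          (\<And>i. i \<in> I \<Longrightarrow> B i \<in> sets borel \<and> bounded (B i)) \<Longrightarrow>
          indep_vars (\<lambda>_. count_space UNIV) (\<lambda>i \<omega>. card (A \<omega> \<inter> B i)) I"

text \<open>
  A tiling is represented by the set of its tiles; edges and vertices are the
  one- and zero-dimensional faces of the tiles.
\<close>

definition dom_region :: "point set \<Rightarrow> point set \<Rightarrow> point set" where
  "dom_region A B = {x. \<forall>b\<in>B. \<forall>a\<in>A - B. norm (x - b) \<le> norm (x - a)}"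

text \<open>For \<open>k = 0\<close> this is the trivial tiling with the whole plane as its only tile.\<close>

definition Vor :: "nat \<Rightarrow> point set \<Rightarrow> point set set" where
  "Vor k A = {dom_region A B | B. B \<subseteq> A \<and> finite B \<and> card B = k}"

definition edge_union :: "point set set \<Rightarrow> point set" where
  "edge_union \<T> = \<Union>{e. \<exists>Q\<in>\<T>. e edge_of Q}"

text \<open>The overlay of two tilings is the tiling cut out by the edges of both.\<close>

definition overlay :: "point set set \<Rightarrow> point set set \<Rightarrow> point set set" where
  "overlay \<S> \<T> = closure ` components (- (edge_union \<S> \<union> edge_union \<T>))"

definition Bri :: "nat \<Rightarrow> point set \<Rightarrow> point set set" where
  "Bri k A = overlay (Vor (k - 1) A) (Vor k A)"

text \<open>
  A facet is on the lower boundary if it has a supporting plane that is not vertical and lies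
  below the convex set; the tiles are the projections of the lower facets.
\<close>

definition lower_facet_of :: "(point \<times> real) set \<Rightarrow> (point \<times> real) set \<Rightarrow> bool" where
  "lower_facet_of F C \<longleftrightarrow> F facet_of C \<and>
     (\<exists>u c. snd u > 0 \<and> C \<subseteq> {p. u \<bullet> p \<ge> c} \<and> F \<subseteq> {p. u \<bullet> p = c})"

definition projected_lower_boundary :: "(point \<times> real) set \<Rightarrow> point set set" where
  "projected_lower_boundary P = {fst ` F | F. lower_facet_of F (convex hull P)}"

definition Del :: "nat \<Rightarrow> point set \<Rightarrow> point set set" where
  "Del k A = projected_lower_boundary
     {((1 / real k) *\<^sub>R (\<Sum>a\<in>B. a), (1 / real k) * (\<Sum>a\<in>B. (norm a)\<^sup>2)) | B.
       B \<subseteq> A \<and> finite B \<and> card B = k}"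

definition Igl :: "nat \<Rightarrow> point set \<Rightarrow> point set set" where
  "Igl k A = projected_lower_boundary
     {((1 / (2 * real k - 1)) *\<^sub>R b + (2 / (2 * real k - 1)) *\<^sub>R (\<Sum>a\<in>B - {b}. a),
       (1 / (2 * real k - 1)) * (norm b)\<^sup>2 + (2 / (2 * real k - 1)) * (\<Sum>a\<in>B - {b}. (norm a)\<^sup>2)) | B b.
       B \<subseteq> A \<and> finite B \<and> card B = k \<and> b \<in> B}"

definition vec_angle :: "point \<Rightarrow> point \<Rightarrow> real" where
  "vec_angle u v = arccos ((u \<bullet> v) / (norm u * norm v))"

text \<open>
  All tiles considered here are convex, so that the interior angle at a vertex is the (unoriented)
  angle between the two edges that meet there.
\<close>

definition interior_angle :: "point set \<Rightarrow> point \<Rightarrow> real \<Rightarrow> bool" where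
  "interior_angle Q v \<theta> \<longleftrightarrow> v extreme_point_of Q \<and>
     (\<exists>e e' p q. e edge_of Q \<and> e' edge_of Q \<and> e \<noteq> e' \<and> v \<in> e \<and> v \<in> e' \<and>
        p \<in> e - {v} \<and> q \<in> e' - {v} \<and> \<theta> = vec_angle (p - v) (q - v))"

text \<open>Number (possibly infinite) of angles of size in \<open>T\<close> whose vertex lies in the window \<open>W\<close>.\<close>

definition angle_count :: "point set set \<Rightarrow> point set \<Rightarrow> real set \<Rightarrow> ennreal" where
  "angle_count \<T> W T = emeasure (count_space UNIV)
     {(Q, v, \<theta>). Q \<in> \<T> \<and> v \<in> W \<and> \<theta> \<in> T \<and> interior_angle Q v \<theta>}"

text \<open>
  The law of the typical angle, as the mark distribution of the stationary point process of vertices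
  marked by angles: the mean number of angles in a window is \<open>\<gamma>\<close> per unit area, and a
  fraction \<open>D T\<close> of them has size in \<open>T\<close>.
\<close>

definition typical_angle_distribution ::
    "'w measure \<Rightarrow> ('w \<Rightarrow> point set set) \<Rightarrow> real measure \<Rightarrow> bool" where
  "typical_angle_distribution M X D \<longleftrightarrow> prob_space D \<and> sets D = sets borel \<and>
     (\<exists>\<gamma>. 0 < \<gamma> \<and> \<gamma> < \<infinity> \<and>
       (\<forall>W\<in>sets borel. \<forall>T\<in>sets borel.
          (\<integral>\<^sup>+\<omega>. angle_count (X \<omega>) W T \<partial>M) = \<gamma> * emeasure lborel W * emeasure D T))"

text \<open>
  Densities are taken with respect to the uniform distribution \<open>dt / \<pi>\<close> on \<open>[0, \<pi>]\<close>: the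
  functions \<open>f\<close>, \<open>g\<close>, \<open>h\<close> below have Lebesgue integral \<open>\<pi>\<close>, not 1, over this interval.
\<close>

definition angle_density :: "'w measure \<Rightarrow> ('w \<Rightarrow> point set set) \<Rightarrow> (real \<Rightarrow> real) \<Rightarrow> bool" where
  "angle_density M X d \<longleftrightarrow> (\<forall>t\<in>{0..pi}. 0 \<le> d t) \<and>
     typical_angle_distribution M X
       (density (uniform_measure lborel {0..pi}) (\<lambda>t. ennreal (d t)))"

definition f_angle :: "real \<Rightarrow> real" where
  "f_angle t = 4 / 3 * ((pi - t) * cos t + sin t) * sin t"

definition g_angle :: "real \<Rightarrow> real" where
  "g_angle t = f_angle (pi - t)"

definition h_angle :: "real \<Rightarrow> real" where
  "h_angle t = 1 / 2 * (f_angle t + g_angle t)"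

end

theory Submission
  imports Defs "HOL-Real_Asymp.Real_Asymp"
begin

text \<open>
  All four tilings are governed by integer weights on \<open>A\<close>: the tiles of \<open>Vor\<close> and \<open>Bri\<close> are the
  regions of points that see the weights in decreasing order of proximity, and \<open>Del\<close> and \<open>Igl\<close> are
  the dual mosaics, whose vertices are the weighted means. In a generic set, every angle belongs to
  a triangle on \<open>A\<close> together with one of its corners and a weight that is maximal inside the
  circumcircle and zero outside; the angle is the angle of the triangle at that corner or its
  supplement, depending on the weights of the three vertices, and primal and dual angles add up to
  \<open>\<pi>\<close>. So the angles of each tiling are counted by the triangles with exactly \<open>j\<close> points of \<open>A\<close>
  inside the circumcircle, for at most four pairs of a number \<open>j\<close> and a choice between the angle and its supplement.

  By the Mecke formula, the expected number of such triangles is an integral over \<open>j + 3\<close> points.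
  Mass transport replaces the vertex of the tiling by a vertex of the triangle as the point that has
  to lie in the window. In the remaining integral the size of the triangle separates from its shape,
  which shows that the law of the angle is the same for every \<open>j\<close>, namely \<open>f\<close>. Supplements
  have the law \<open>g\<close>. Angles and supplements are equally frequent for \<open>Bri\<close> and \<open>Igl\<close>, which gives \<open>h\<close>.
\<close>

section \<open>Plane geometry of tiles and corners\<close>

text \<open>A tile can have arbitrarily many sides, but an angle is local: three points on a circle
  and the weight determine it. What makes the local description work is that at most one weight lies
  strictly between 0 and \<open>M\<close>. Two different weights of equal total then reverse the
  order of some pair, so open regions are disjoint, and all ties seen from a point lie on a single
  circle. The dual vertices depend on all \<open>j + 3\<close> points, while the shape integral is
  easy only with the corner of the angle at the origin; hence the mass transport. The law is
  independent of \<open>j\<close> because, for a side \<open>b\<close> at that corner and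
  \<open>L\<close> the squared circumradius of the similar triangle with unit side, rescaling
  \<open>b\<close> turns its integral into a factor \<open>1 / L^2\<close>, and the
  \<open>j\<close>-th power of the disc area only enters a Gamma integral. This leaves the frequency
  \<open>6 * \<rho> * (j + 1) / pi\<close> in front of \<open>f\<close>. For \<open>Igl\<close> and
  \<open>Bri\<close> the types with equal weights at \<open>b\<close> and \<open>c\<close> have
  total frequency proportional to \<open>k + (k - 2)\<close>, the others to
  \<open>2 * (k - 1)\<close>: this coincidence produces \<open>h\<close>. For \<open>k = 1\<close>
  only one type exists and there is nothing to balance it.\<close>

definition cross2 :: "point \<Rightarrow> point \<Rightarrow> real" where
  "cross2 u v = u $ 1 * v $ 2 - u $ 2 * v $ 1"

definition rot90 :: "point \<Rightarrow> point" where
  "rot90 u = vector [- u $ 2, u $ 1]"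

lemma rot90_nth [simp]: "rot90 u $ 1 = - u $ 2" "rot90 u $ 2 = u $ 1"
  by (simp_all add: rot90_def)

lemma inner_real2: "(u :: point) \<bullet> v = u $ 1 * v $ 1 + u $ 2 * v $ 2"
  by (simp add: inner_vec_def sum_2)

lemma norm_real2_sq: "(norm (u :: point))\<^sup>2 = (u $ 1)\<^sup>2 + (u $ 2)\<^sup>2"
  by (simp add: power2_norm_eq_inner inner_real2 flip: power2_eq_square)

lemma inner_rot90: "rot90 u \<bullet> v = cross2 u v"
  by (simp add: inner_real2 cross2_def)

lemma norm_rot90 [simp]: "norm (rot90 u) = norm u"
  by (rule power2_eq_imp_eq) (simp_all add: norm_real2_sq)

lemma cross2_simps [simp]:
  "cross2 u u = 0" "cross2 0 u = 0" "cross2 u 0 = 0"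
  "cross2 (- u) v = - cross2 u v" "cross2 u (- v) = - cross2 u v"
  "cross2 (c *\<^sub>R u) v = c * cross2 u v" "cross2 u (c *\<^sub>R v) = c * cross2 u v"
  by (simp_all add: cross2_def algebra_simps)

lemma cross2_add: "cross2 (u + v) w = cross2 u w + cross2 v w" "cross2 w (u + v) = cross2 w u + cross2 w v"
  by (simp_all add: cross2_def algebra_simps)

lemma cross2_commute: "cross2 v u = - cross2 u v"
  by (simp add: cross2_def)

text \<open>Cramer's rule for the basis \<open>u\<close>, \<open>v\<close> of the plane.\<close>

lemma cross2_decomp:
  assumes "cross2 u v \<noteq> 0"
  shows "x = (cross2 x v / cross2 u v) *\<^sub>R u + (cross2 u x / cross2 u v) *\<^sub>R v"
proof -
  have "cross2 u v *\<^sub>R x = cross2 x v *\<^sub>R u + cross2 u x *\<^sub>R v"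
    by (simp add: vec_eq_iff forall_2 cross2_def algebra_simps)
  then have "(1 / cross2 u v) *\<^sub>R (cross2 u v *\<^sub>R x) = (1 / cross2 u v) *\<^sub>R (cross2 x v *\<^sub>R u + cross2 u x *\<^sub>R v)"
    by simp
  then show ?thesis using assms by (simp add: scaleR_add_right)
qed

lemma orthogonal_both_imp_zero:
  assumes "cross2 u v \<noteq> 0" "x \<bullet> u = 0" "x \<bullet> v = 0"
  shows "x = 0"
proof -
  obtain \<alpha> \<beta> where "x = \<alpha> *\<^sub>R u + \<beta> *\<^sub>R v" using cross2_decomp[OF assms(1)] by blast
  then have "x \<bullet> x = \<alpha> * (x \<bullet> u) + \<beta> * (x \<bullet> v)" by (metis inner_add_right inner_scaleR_right)
  then show ?thesis using assms by simp
qed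

lemma cross2_independent:
  assumes "cross2 u v \<noteq> 0" "a *\<^sub>R u + b *\<^sub>R v = 0"
  shows "a = 0" "b = 0"
proof -
  have "cross2 (a *\<^sub>R u + b *\<^sub>R v) v = 0" "cross2 u (a *\<^sub>R u + b *\<^sub>R v) = 0" using assms(2) by simp_all
  then show "a = 0" "b = 0" using assms(1) by (simp_all add: cross2_add)
qed

lemma vec_angle_commute: "vec_angle u v = vec_angle v u"
  by (simp add: vec_angle_def inner_commute mult.commute)

lemma vec_angle_scaleR:
  assumes "s > 0" "t > 0"
  shows "vec_angle (s *\<^sub>R u) (t *\<^sub>R v) = vec_angle u v"
  using assms by (simp add: vec_angle_def)

lemma abs_inner_div_norm_le_1: "\<bar>(u \<bullet> v) / (norm u * norm v)\<bar> \<le> 1"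
  by (cases "u = 0 \<or> v = 0") (auto simp: field_simps Cauchy_Schwarz_ineq2)

lemma vec_angle_uminus:
  "vec_angle (- u) v = pi - vec_angle u v" "vec_angle u (- v) = pi - vec_angle u v"
proof -
  let ?x = "(u \<bullet> v) / (norm u * norm v)"
  have "- 1 \<le> ?x" "?x \<le> 1" using abs_inner_div_norm_le_1[of u v] by linarith+
  then have "arccos (- ?x) = pi - arccos ?x" by (rule arccos_minus)
  then show "vec_angle (- u) v = pi - vec_angle u v" "vec_angle u (- v) = pi - vec_angle u v"
    by (simp_all add: vec_angle_def)
qed

section \<open>Interior angles at the apex of a wedge\<close>

lemma aff_dim_ge_2:
  fixes S :: "point set"
  assumes "cross2 u v \<noteq> 0" "x \<in> S" "x + u \<in> S" "x + v \<in> S"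
  shows "aff_dim S \<ge> 2"
proof -
  have "aff_dim S = 2" 
  proof (rule ccontr)
    assume "aff_dim S \<noteq> 2"
    then have "aff_dim S < DIM(point)" using aff_dim_le_DIM[of S] by simp
    then obtain a b where ab: "a \<noteq> 0" "S \<subseteq> {x. a \<bullet> x = b}"
      using aff_lowdim_subset_hyperplane by blast
    then have "a \<bullet> x = b" "a \<bullet> (x + u) = b" "a \<bullet> (x + v) = b"
      using assms by blast+
    then have "a \<bullet> u = 0" "a \<bullet> v = 0"
      by (simp_all add: inner_add_right)
    then have "a = 0" by (rule orthogonal_both_imp_zero[OF assms(1)])
    with ab show False by simp
  qed
  then show ?thesis by simp
qed

text \<open>The definition of an interior angle quantifies over all edges at \<open>v\<close> and
  all points on them. If \<open>Q\<close> lies in the cone and reaches a positive distance along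
  both rays, exactly two edges contain \<open>v\<close> together with another point: the slices of
  \<open>Q\<close> along the rays. A face that contains \<open>v\<close> and a point off the rays
  would be two-dimensional. On an edge only the direction seen from \<open>v\<close> matters,
  because \<open>vec_angle\<close> ignores positive factors.\<close>

lemma interior_angle_cone:
  fixes r1 r2 v :: point
  assumes Q: "convex Q" and cr: "cross2 r1 r2 \<noteq> 0"
    and v: "v \<in> Q" and s: "s > 0" "v + s *\<^sub>R r1 \<in> Q" and t: "t > 0" "v + t *\<^sub>R r2 \<in> Q"
    and sub: "\<And>x. x \<in> Q \<Longrightarrow> \<exists>\<alpha> \<beta>. \<alpha> \<ge> 0 \<and> \<beta> \<ge> 0 \<and> x = v + \<alpha> *\<^sub>R r1 + \<beta> *\<^sub>R r2"
  shows "interior_angle Q v \<theta> \<longleftrightarrow> \<theta> = vec_angle r1 r2" and "v extreme_point_of Q"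
proof -
  have seg1: "v + \<alpha> *\<^sub>R r1 \<in> Q" if "0 \<le> \<alpha>" "\<alpha> \<le> s" for \<alpha>
  proof -
    have "(1 - \<alpha> / s) *\<^sub>R v + (\<alpha> / s) *\<^sub>R (v + s *\<^sub>R r1) \<in> Q"
      using that s v by (intro convexD[OF Q]) auto
    then show ?thesis using s by (simp add: algebra_simps)
  qed
  have seg2: "v + \<beta> *\<^sub>R r2 \<in> Q" if "0 \<le> \<beta>" "\<beta> \<le> t" for \<beta>
  proof -
    have "(1 - \<beta> / t) *\<^sub>R v + (\<beta> / t) *\<^sub>R (v + t *\<^sub>R r2) \<in> Q"
      using that t v by (intro convexD[OF Q]) auto
    then show ?thesis using t by (simp add: algebra_simps)
  qed
  define c where "c = cross2 r1 r2"
  \<comment> \<open>The functionals \<open>n1\<close> and \<open>n2\<close> are dual to the rays: up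
    to a constant, \<open>n1\<close> reads off the coefficient of \<open>r2\<close> and
    \<open>n2\<close> that of \<open>r1\<close>. Their minimal slices on \<open>Q\<close> are the
    two edges.\<close>
  define n1 where "n1 = (1 / c) *\<^sub>R rot90 r1"
  define n2 where "n2 = (- 1 / c) *\<^sub>R rot90 r2"
  have c0: "c \<noteq> 0" using cr by (simp add: c_def)
  have n1: "n1 \<bullet> (v + \<alpha> *\<^sub>R r1 + \<beta> *\<^sub>R r2) = n1 \<bullet> v + \<beta>" for \<alpha> \<beta>
    using c0 by (simp add: n1_def inner_add_right inner_rot90 c_def)
  have n2: "n2 \<bullet> (v + \<alpha> *\<^sub>R r1 + \<beta> *\<^sub>R r2) = n2 \<bullet> v + \<alpha>" for \<alpha> \<beta>
    using c0 by (simp add: n2_def inner_add_right inner_rot90 c_def cross2_commute[of r2 r1])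
  have n1': "n1 \<bullet> (v + \<alpha> *\<^sub>R r1) = n1 \<bullet> v" for \<alpha> using n1[of \<alpha> 0] by simp
  have n1'': "n1 \<bullet> (v + \<alpha> *\<^sub>R r2) = n1 \<bullet> v + \<alpha>" for \<alpha> using n1[of 0 \<alpha>] by simp
  have n2': "n2 \<bullet> (v + \<alpha> *\<^sub>R r1) = n2 \<bullet> v + \<alpha>" for \<alpha> using n2[of \<alpha> 0] by simp
  have n2'': "n2 \<bullet> (v + \<alpha> *\<^sub>R r2) = n2 \<bullet> v" for \<alpha> using n2[of 0 \<alpha>] by simp
  define F1 where "F1 = Q \<inter> {x. n1 \<bullet> x = n1 \<bullet> v}"
  define F2 where "F2 = Q \<inter> {x. n2 \<bullet> x = n2 \<bullet> v}"
  have face1: "F1 face_of Q" unfolding F1_def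
    using sub n1 by (intro face_of_Int_supporting_hyperplane_ge[OF Q]) fastforce
  have face2: "F2 face_of Q" unfolding F2_def
    using sub n2 by (intro face_of_Int_supporting_hyperplane_ge[OF Q]) fastforce
  have nz: "r1 \<noteq> 0" "r2 \<noteq> 0" using cr by auto
  have "n1 \<noteq> 0" "n2 \<noteq> 0" using n1''[of 1] n2'[of 1] by auto
  then have le1: "aff_dim F1 \<le> 1" "aff_dim F2 \<le> 1"
    using aff_dim_subset[of F1 "{x. n1 \<bullet> x = n1 \<bullet> v}"] aff_dim_subset[of F2 "{x. n2 \<bullet> x = n2 \<bullet> v}"]
    by (auto simp: F1_def F2_def aff_dim_hyperplane)
  have ge1: "aff_dim S \<ge> 1" if "v \<in> S" "p \<in> S" "p \<noteq> v" for S :: "point set" and p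
    using aff_dim_subset[of "{v, p}" S] that by (auto simp: aff_dim_2)
  have inF1: "v \<in> F1" "v + s *\<^sub>R r1 \<in> F1" and inF2: "v \<in> F2" "v + t *\<^sub>R r2 \<in> F2"
    using v s t n1' n2'' by (auto simp: F1_def F2_def)
  have ad: "aff_dim F1 = 1" "aff_dim F2 = 1"
    using le1 ge1[OF inF1] ge1[OF inF2] s t nz by auto
  have edges: "F1 edge_of Q" "F2 edge_of Q" using face1 face2 ad by (auto simp: edge_of_def)
  have "F1 \<inter> F2 = {v}"
  proof -
    have "x = v" if xF: "x \<in> F1" "x \<in> F2" for x
    proof -
      obtain \<alpha> \<beta> where x: "x = v + \<alpha> *\<^sub>R r1 + \<beta> *\<^sub>R r2" using sub[of x] xF by (auto simp: F1_def)
      have "n1 \<bullet> x = n1 \<bullet> v" "n2 \<bullet> x = n2 \<bullet> v" using xF unfolding F1_def F2_def by blast+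
      then have "\<alpha> = 0" "\<beta> = 0" unfolding x n1 n2 by simp_all
      then show ?thesis using x by simp
    qed
    then show ?thesis using inF1(1) inF2(1) by blast
  qed
  then have "{v} face_of Q" using face1 face2 by (metis face_of_Int)
  then show ext: "v extreme_point_of Q" by (simp add: face_of_singleton)
  \<comment> \<open>Edges sharing two points meet in a common face of dimension one; a proper face
    of an edge has smaller dimension, so both edges equal that face.\<close>
  have unique: "e = F" if e: "e edge_of Q" "F edge_of Q" and p: "v \<in> e" "p \<in> e" "v \<in> F" "p \<in> F" "p \<noteq> v" for e F p
  proof -
    have f: "e \<inter> F face_of e" "e \<inter> F face_of F"
      using e by (meson edge_of_def face_of_Int face_of_imp_subset face_of_subset inf_le1 inf_le2)+
    have "aff_dim (e \<inter> F) \<ge> 1" using ge1 p by auto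
    then show ?thesis using f e face_of_aff_dim_lt[of e "e \<inter> F"] face_of_aff_dim_lt[of F "e \<inter> F"]
      by (auto simp: edge_of_def dest: face_of_imp_convex)
  qed
  have onray: "(\<exists>\<alpha>>0. p = v + \<alpha> *\<^sub>R r1 \<and> e = F1) \<or> (\<exists>\<beta>>0. p = v + \<beta> *\<^sub>R r2 \<and> e = F2)"
    if e: "e edge_of Q" "v \<in> e" "p \<in> e" "p \<noteq> v" for e p
  proof -
    have "p \<in> Q" using e by (auto dest: edge_of_imp_subset)
    then obtain \<alpha> \<beta> where ab: "\<alpha> \<ge> 0" "\<beta> \<ge> 0" "p = v + \<alpha> *\<^sub>R r1 + \<beta> *\<^sub>R r2" using sub by blast
    consider "\<beta> = 0" | "\<alpha> = 0" | "\<alpha> > 0" "\<beta> > 0" using ab by linarith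
    then show ?thesis
    proof cases
      case 1
      then have "\<alpha> > 0" "p \<in> F1" using ab e \<open>p \<in> Q\<close> n1' by (auto simp: F1_def less_le)
      then show ?thesis using ab 1 unique[OF e(1) edges(1) e(2,3) inF1(1)] e by auto
    next
      case 2
      then have "\<beta> > 0" "p \<in> F2" using ab e \<open>p \<in> Q\<close> n2'' by (auto simp: F2_def less_le)
      then show ?thesis using ab 2 unique[OF e(1) edges(2) e(2,3) inF2(1)] e by auto
    next
      case 3
      \<comment> \<open>Small enough that the doubled coefficients stay within the known segments on
        the rays. The point \<open>v + \<epsilon> * (p - v)\<close> is then the midpoint of a point
        on each ray, and the face property pulls both into \<open>e\<close>.\<close>
      define \<epsilon> where "\<epsilon> = Min {1, s / (2 * \<alpha>), t / (2 * \<beta>)}"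
      have eps: "\<epsilon> > 0" "\<epsilon> \<le> 1" "\<epsilon> \<le> s / (2 * \<alpha>)" "\<epsilon> \<le> t / (2 * \<beta>)" using 3 s t by (auto simp: \<epsilon>_def)
      then have eps': "2 * \<epsilon> * \<alpha> \<le> s" "2 * \<epsilon> * \<beta> \<le> t" using 3 by (auto simp: field_simps)
      define x y where "x = v + (2 * \<epsilon> * \<alpha>) *\<^sub>R r1" and "y = v + (2 * \<epsilon> * \<beta>) *\<^sub>R r2"
      have xy: "x \<in> Q" "y \<in> Q" using seg1 seg2 eps eps' 3 by (auto simp: x_def y_def)
      have face: "e face_of Q" "convex e" using e by (auto simp: edge_of_def dest: face_of_imp_convex)
      have "(1 - \<epsilon>) *\<^sub>R v + \<epsilon> *\<^sub>R p \<in> e" using eps e by (intro convexD[OF face(2)]) auto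
      moreover have "(1 - \<epsilon>) *\<^sub>R v + \<epsilon> *\<^sub>R p = midpoint x y"
        by (simp add: x_def y_def ab midpoint_def vec_eq_iff field_simps)
      moreover have "x \<noteq> y"
      proof
        assume "x = y"
        then have "n1 \<bullet> x = n1 \<bullet> y" by simp
        then show False using n1' n1'' eps 3 by (simp add: x_def y_def)
      qed
      ultimately have "x \<in> e \<and> y \<in> e"
        using face(1) xy midpoint_in_open_segment[of x y] unfolding face_of_def by metis
      then have "x \<in> e" "y \<in> e" by auto
      then have "aff_dim e \<ge> 2" using e eps 3 cr
        by (intro aff_dim_ge_2[of "(2 * \<epsilon> * \<alpha>) *\<^sub>R r1" "(2 * \<epsilon> * \<beta>) *\<^sub>R r2" v]) (auto simp: x_def y_def)
      then show ?thesis using e by (simp add: edge_of_def)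
    qed
  qed
  have F12: "F1 \<noteq> F2"
  proof
    assume "F1 = F2"
    with \<open>F1 \<inter> F2 = {v}\<close> ad show False by simp
  qed
  show "interior_angle Q v \<theta> \<longleftrightarrow> \<theta> = vec_angle r1 r2"
  proof
    assume "interior_angle Q v \<theta>"
    then obtain e e' p q where h: "e edge_of Q" "e' edge_of Q" "e \<noteq> e'" "v \<in> e" "v \<in> e'"
        "p \<in> e" "p \<noteq> v" "q \<in> e'" "q \<noteq> v" "\<theta> = vec_angle (p - v) (q - v)"
      unfolding interior_angle_def by auto
    show "\<theta> = vec_angle r1 r2"
      using onray[OF h(1,4,6,7)] onray[OF h(2,5,8,9)] h(3,10)
      by (auto simp: vec_angle_scaleR vec_angle_commute[of r2 r1])
  next
    assume "\<theta> = vec_angle r1 r2"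
    then have "\<theta> = vec_angle (v + s *\<^sub>R r1 - v) (v + t *\<^sub>R r2 - v)" using s t by (simp add: vec_angle_scaleR)
    moreover have "v + s *\<^sub>R r1 \<in> F1 - {v}" "v + t *\<^sub>R r2 \<in> F2 - {v}" using inF1 inF2 s t nz by auto
    ultimately show "interior_angle Q v \<theta>"
      unfolding interior_angle_def using ext edges F12 inF1(1) inF2(1) by blast
  qed
qed

lemma inner_rot90_rot90: "rot90 u \<bullet> rot90 v = u \<bullet> v"
  by (simp add: inner_real2)

text \<open>The edges run along the bounding lines of two half-planes with outer normals
  \<open>P\<close> and \<open>Q\<close>. Turning the two normals by a right angle in opposite senses
  gives the edge directions, which is the source of the supplement. The wedge needs to be filled
  only near \<open>z\<close>, since an angle is local.\<close>

lemma interior_angle_halfplanes: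
  fixes P Q z :: point
  assumes R: "convex R" "z \<in> R" and cr: "cross2 P Q \<noteq> 0"
    and sub: "\<And>y. y \<in> R \<Longrightarrow> P \<bullet> (y - z) \<le> 0 \<and> Q \<bullet> (y - z) \<le> 0"
    and loc: "\<epsilon> > 0" "\<And>u. norm u < \<epsilon> \<Longrightarrow> P \<bullet> u \<le> 0 \<Longrightarrow> Q \<bullet> u \<le> 0 \<Longrightarrow> z + u \<in> R"
  shows "interior_angle R z \<theta> \<longleftrightarrow> \<theta> = pi - vec_angle P Q" and "z extreme_point_of R"
proof -
  \<comment> \<open>The sign of the orientation decides which way each normal has to be turned so
    that \<open>r1\<close> and \<open>r2\<close> bound the wedge itself and not the opposite
    one.\<close>
  define \<sigma> :: real where "\<sigma> = sgn (cross2 P Q)"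
  define r1 r2 where "r1 = - \<sigma> *\<^sub>R rot90 P" and "r2 = \<sigma> *\<^sub>R rot90 Q"
  have sg: "\<sigma> = 1 \<or> \<sigma> = - 1" and ab: "\<sigma> * cross2 P Q = \<bar>cross2 P Q\<bar>"
    using cr by (auto simp: \<sigma>_def sgn_if)
  have P: "P \<bullet> r1 = 0" "P \<bullet> r2 = - \<bar>cross2 P Q\<bar>" and Q: "Q \<bullet> r2 = 0" "Q \<bullet> r1 = - \<bar>cross2 P Q\<bar>"
    using ab by (simp_all add: r1_def r2_def inner_commute[of P] inner_commute[of Q] inner_rot90 cross2_commute[of Q P])
  have va: "vec_angle r1 r2 = pi - vec_angle P Q"
  proof -
    have "vec_angle (rot90 P) (rot90 Q) = vec_angle P Q" by (simp add: vec_angle_def inner_rot90_rot90)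
    then show ?thesis using sg by (auto simp: r1_def r2_def vec_angle_uminus)
  qed
  have cr12: "cross2 r1 r2 = - cross2 P Q"
    using sg by (auto simp: r1_def r2_def cross2_def)
  have nz: "r1 \<noteq> 0" "r2 \<noteq> 0" using cr cr12 by auto
  define s t where "s = \<epsilon> / (2 * norm r1)" and "t = \<epsilon> / (2 * norm r2)"
  have st: "s > 0" "t > 0" using loc nz by (simp_all add: s_def t_def)
  have s1: "z + s *\<^sub>R r1 \<in> R" using loc nz P Q st by (intro loc(2)) (auto simp: s_def)
  have t1: "z + t *\<^sub>R r2 \<in> R" using loc nz P Q st by (intro loc(2)) (auto simp: t_def)
  have cone: "\<exists>\<alpha> \<beta>. \<alpha> \<ge> 0 \<and> \<beta> \<ge> 0 \<and> y = z + \<alpha> *\<^sub>R r1 + \<beta> *\<^sub>R r2" if "y \<in> R" for y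
  proof -
    let ?\<alpha> = "cross2 (y - z) r2 / cross2 r1 r2" and ?\<beta> = "cross2 r1 (y - z) / cross2 r1 r2"
    have dec: "y - z = ?\<alpha> *\<^sub>R r1 + ?\<beta> *\<^sub>R r2" using cr cr12 by (intro cross2_decomp) auto
    have "P \<bullet> (y - z) = - ?\<beta> * \<bar>cross2 P Q\<bar>" "Q \<bullet> (y - z) = - ?\<alpha> * \<bar>cross2 P Q\<bar>"
      by (subst dec, simp add: inner_add_right P Q)+
    with sub[OF that] cr have "?\<beta> \<ge> 0" "?\<alpha> \<ge> 0"
      by (metis abs_ge_zero abs_le_zero_iff minus_mult_left mult_le_0_iff neg_le_0_iff_le order_antisym)+
    moreover have "y = z + ?\<alpha> *\<^sub>R r1 + ?\<beta> *\<^sub>R r2" using dec by (simp add: algebra_simps)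
    ultimately show ?thesis by blast
  qed
  have "cross2 r1 r2 \<noteq> 0" using cr cr12 by simp
  note * = interior_angle_cone[OF R(1) this R(2) st(1) s1 st(2) t1 cone]
  show "interior_angle R z \<theta> \<longleftrightarrow> \<theta> = pi - vec_angle P Q" using *(1)[of \<theta>] by (simp add: va)
  show "z extreme_point_of R" using *(2) by simp
qed

section \<open>Bisectors and circumcenters\<close>

lemma norm_le_norm_iff_inner:
  fixes y p q :: point
  shows "norm (y - p) \<le> norm (y - q) \<longleftrightarrow> 2 * ((q - p) \<bullet> y) \<le> q \<bullet> q - p \<bullet> p"
    and "norm (y - p) < norm (y - q) \<longleftrightarrow> 2 * ((q - p) \<bullet> y) < q \<bullet> q - p \<bullet> p"
  unfolding norm_le norm_lt by (auto simp: inner_diff_left inner_diff_right inner_commute)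

text \<open>With \<open>z\<close> on the bisector of \<open>p\<close> and \<open>q\<close>, the
  comparison of distances is the sign of a linear form in the displacement from \<open>z\<close>.
  All local descriptions of tiles near a vertex rest on this.\<close>

lemma norm_le_norm_iff_bisector:
  fixes y z p q :: point
  assumes "norm (z - p) = norm (z - q)"
  shows "norm (y - p) \<le> norm (y - q) \<longleftrightarrow> (q - p) \<bullet> (y - z) \<le> 0"
    and "norm (y - p) < norm (y - q) \<longleftrightarrow> (q - p) \<bullet> (y - z) < 0"
proof -
  have "2 * ((q - p) \<bullet> z) = q \<bullet> q - p \<bullet> p"
    using assms unfolding norm_eq by (simp add: inner_diff_left inner_diff_right inner_commute)
  then show "norm (y - p) \<le> norm (y - q) \<longleftrightarrow> (q - p) \<bullet> (y - z) \<le> 0"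
    and "norm (y - p) < norm (y - q) \<longleftrightarrow> (q - p) \<bullet> (y - z) < 0"
    unfolding norm_le_norm_iff_inner inner_diff_right by linarith+
qed

text \<open>Junk value \<open>a\<close> for collinear arguments.\<close>

definition circumcenter :: "point \<Rightarrow> point \<Rightarrow> point \<Rightarrow> point" where
  "circumcenter a b c = a + (1 / (2 * cross2 (b - a) (c - a))) *\<^sub>R
     ((norm (c - a))\<^sup>2 *\<^sub>R rot90 (b - a) - (norm (b - a))\<^sup>2 *\<^sub>R rot90 (c - a))"

lemma norm_eq_norm_iff_inner:
  fixes z a b :: point
  shows "norm (z - b) = norm (z - a) \<longleftrightarrow> 2 * ((z - a) \<bullet> (b - a)) = (norm (b - a))\<^sup>2"
  unfolding norm_eq power2_norm_eq_inner by (auto simp: inner_diff_left inner_diff_right inner_commute)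

lemma dist_circumcenter:
  assumes "cross2 (b - a) (c - a) \<noteq> 0"
  shows "norm (circumcenter a b c - b) = norm (circumcenter a b c - a)"
    and "norm (circumcenter a b c - c) = norm (circumcenter a b c - a)"
  using assms unfolding norm_eq_norm_iff_inner circumcenter_def
  by (simp_all add: inner_diff_left inner_rot90 cross2_commute[of "c - a" "b - a"])

lemma circumcenter_eqI:
  assumes cr: "cross2 (b - a) (c - a) \<noteq> 0"
    and "norm (z - b) = norm (z - a)" "norm (z - c) = norm (z - a)"
  shows "z = circumcenter a b c"
proof -
  let ?d = "z - circumcenter a b c"
  have "?d \<bullet> (b - a) = 0" "?d \<bullet> (c - a) = 0"
    using assms dist_circumcenter[OF cr] unfolding norm_eq_norm_iff_inner
    by (simp_all add: inner_diff_left)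
  then have "?d = 0" by (rule orthogonal_both_imp_zero[OF cr])
  then show ?thesis by simp
qed

section \<open>Weights and the regions that see them in order\<close>

definition supp :: "('a \<Rightarrow> nat) \<Rightarrow> 'a set" where "supp w = {p. w p \<noteq> 0}"

text \<open>
  The weights \<open>indicator B\<close> with \<open>card B = k\<close> (for \<open>M = 1\<close>, \<open>N = k\<close>) index the tiles of the
  order-\<open>k\<close> Voronoi tessellation and the vertices of the order-\<open>k\<close> Delaunay mosaic. The weights
  with value 2 on \<open>B - {b}\<close> and value 1 on \<open>b\<close> (for \<open>M = 2\<close>, \<open>N = 2 * k - 1\<close>) do the same for the
  Brillouin tessellation and the Iglesias mosaic.
\<close>

definition wts :: "nat \<Rightarrow> nat \<Rightarrow> 'a set \<Rightarrow> ('a \<Rightarrow> nat) set" where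
  "wts M N A = {w. finite (supp w) \<and> supp w \<subseteq> A \<and> (\<forall>p. w p \<le> M) \<and> sum w (supp w) = N \<and>
     (\<forall>p q. 0 < w p \<and> w p < M \<and> 0 < w q \<and> w q < M \<longrightarrow> p = q)}"

definition reg :: "point set \<Rightarrow> (point \<Rightarrow> nat) \<Rightarrow> point set" where
  "reg A w = {y. \<forall>p\<in>A. \<forall>q\<in>A. w q < w p \<longrightarrow> norm (y - p) \<le> norm (y - q)}"

definition sreg :: "point set \<Rightarrow> (point \<Rightarrow> nat) \<Rightarrow> point set" where
  "sreg A w = {y. \<forall>p\<in>A. \<forall>q\<in>A. w q < w p \<longrightarrow> norm (y - p) < norm (y - q)}"

lemma sreg_subset_reg: "sreg A w \<subseteq> reg A w"
  by (auto simp: sreg_def reg_def less_imp_le)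

lemma reg_eq_halfspaces:
  "reg A w = (\<Inter>p\<in>A. \<Inter>q\<in>{q\<in>A. w q < w p}. {y. (2 *\<^sub>R (q - p)) \<bullet> y \<le> q \<bullet> q - p \<bullet> p})"
  unfolding reg_def norm_le_norm_iff_inner by (auto simp: inner_scaleR_left)

lemma sreg_eq_halfspaces:
  "sreg A w = (\<Inter>p\<in>A. \<Inter>q\<in>{q\<in>A. w q < w p}. {y. (2 *\<^sub>R (q - p)) \<bullet> y < q \<bullet> q - p \<bullet> p})"
  unfolding sreg_def norm_le_norm_iff_inner by (auto simp: inner_scaleR_left)

lemma convex_reg: "convex (reg A w)"
  unfolding reg_eq_halfspaces by (intro convex_INT convex_halfspace_le)

lemma convex_sreg: "convex (sreg A w)"
  unfolding sreg_eq_halfspaces by (intro convex_INT convex_halfspace_lt)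

lemma closed_reg: "closed (reg A w)"
  unfolding reg_eq_halfspaces by (intro closed_INT ballI closed_halfspace_le)

lemma regD: "y \<in> reg A w \<Longrightarrow> p \<in> A \<Longrightarrow> q \<in> A \<Longrightarrow> w q < w p \<Longrightarrow> norm (y - p) \<le> norm (y - q)"
  by (auto simp: reg_def)

lemma sum_supp_superset:
  fixes f :: "'a \<Rightarrow> 'b::comm_monoid_add"
  assumes "finite S" "supp w \<subseteq> S" "\<And>p. w p = 0 \<Longrightarrow> f p = 0"
  shows "sum f (supp w) = sum f S"
  using assms by (intro sum.mono_neutral_left) (auto simp: supp_def)

lemma wtsD:
  assumes "w \<in> wts M N A"
  shows "finite (supp w)" "supp w \<subseteq> A" "w p \<le> M" "sum w (supp w) = N"
    "0 < w p \<Longrightarrow> w p < M \<Longrightarrow> 0 < w q \<Longrightarrow> w q < M \<Longrightarrow> p = q"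
  using assms by (auto simp: wts_def)

lemma wts_sum: "w \<in> wts M N A \<Longrightarrow> finite S \<Longrightarrow> supp w \<subseteq> S \<Longrightarrow> sum w S = N"
  using sum_supp_superset[of S w w] wtsD(4)[of w M N A] by simp

lemma wts_in_A: "w \<in> wts M N A \<Longrightarrow> 0 < w p \<Longrightarrow> p \<in> A"
  using wtsD(2) by (fastforce simp: supp_def)

lemma wts_swap:
  assumes w: "w \<in> wts M N A" and pq: "p \<in> A" "q \<in> A"
  shows "w \<circ> Transposition.transpose p q \<in> wts M N A"
proof -
  let ?S = "insert p (insert q (supp w))"
  have fS: "finite ?S" using wtsD[OF w] by simp
  have sub: "supp (w \<circ> Transposition.transpose p q) \<subseteq> ?S"
    by (auto simp: supp_def Transposition.transpose_def split: if_splits)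
  have "sum (w \<circ> Transposition.transpose p q) (supp (w \<circ> Transposition.transpose p q)) = sum (w \<circ> Transposition.transpose p q) ?S"
    using fS sub by (intro sum_supp_superset) auto
  also have "\<dots> = sum w ?S"
    using permutes_swap_id[of p ?S q] by (subst sum.permute[of "Transposition.transpose p q" ?S]) auto
  also have "\<dots> = N" by (rule wts_sum[OF w fS]) auto
  finally have sumN: "sum (w \<circ> Transposition.transpose p q) (supp (w \<circ> Transposition.transpose p q)) = N" .
  have uniq: "x = y" if "0 < (w \<circ> Transposition.transpose p q) x" "(w \<circ> Transposition.transpose p q) x < M"
      "0 < (w \<circ> Transposition.transpose p q) y" "(w \<circ> Transposition.transpose p q) y < M" for x y
  proof -
    have "Transposition.transpose p q x = Transposition.transpose p q y"
      by (rule wtsD(5)[OF w]) (use that in auto)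
    then show ?thesis by (metis transpose_involutory)
  qed
  have subA: "supp (w \<circ> Transposition.transpose p q) \<subseteq> A" using sub wtsD(2)[OF w] pq by blast
  have "(w \<circ> Transposition.transpose p q) x \<le> M" for x using wtsD(3)[OF w] by simp
  then show ?thesis
    unfolding wts_def using sumN subA finite_subset[OF sub fS] uniq by blast
qed

text \<open>At most one weight is strictly between 0 and \<open>M\<close>, which excludes nested exchanges.\<close>

lemma wts_cross:
  assumes w: "w \<in> wts M N A" "w' \<in> wts M N A" and "w' p < w p" "w q < w' q"
  shows "w q < w p" "w' p < w' q" "p \<in> A" "q \<in> A"
proof -
  show "w q < w p"
  proof (rule ccontr)
    assume "\<not> w q < w p"
    moreover have "w' q \<le> M" by (rule wtsD(3)[OF w(2)])
    ultimately have "p = q" using assms by (intro wtsD(5)[OF w(1)]) auto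
    then show False using assms by simp
  qed
  show "w' p < w' q"
  proof (rule ccontr)
    assume "\<not> w' p < w' q"
    moreover have "w p \<le> M" by (rule wtsD(3)[OF w(1)])
    ultimately have "p = q" using assms by (intro wtsD(5)[OF w(2)]) auto
    then show False using assms by simp
  qed
  show "p \<in> A" "q \<in> A" using assms wts_in_A by (metis gr_zeroI less_nat_zero_code)+
qed

text \<open>Both weights have the same total, so a pointwise inequality is an equality.\<close>

lemma wts_le_imp_eq:
  assumes w: "w \<in> wts M N A" "w' \<in> wts M N A" and le: "\<And>p. w p \<le> w' p"
  shows "w = w'"
proof
  fix p
  let ?S = "insert p (supp w \<union> supp w')"
  have fS: "finite ?S" using wtsD(1)[OF w(1)] wtsD(1)[OF w(2)] by simp
  have "sum w ?S = N" "sum w' ?S = N"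
    by (rule wts_sum[OF w(1) fS], force, rule wts_sum[OF w(2) fS], force)
  then show "w p = w' p" using fS le by (intro sum_mono_inv[of w ?S w']) auto
qed

lemma wts_neq_obtain:
  assumes w: "w \<in> wts M N A" "w' \<in> wts M N A" "w \<noteq> w'"
  obtains p q where "w' p < w p" "w q < w' q"
  using wts_le_imp_eq[OF w(1,2)] wts_le_imp_eq[OF w(2,1)] w(3) that by (metis not_le)

text \<open>Different weights of equal total exceed each other somewhere, say at \<open>p\<close>
  and at \<open>q\<close>, and \<open>wts_cross\<close> makes them order the pair \<open>p\<close>,
  \<open>q\<close> in opposite ways. A point that is strict for one weight cannot be admissible for
  the other.\<close>

lemma sreg_reg_unique:
  assumes w: "w \<in> wts M N A" "w' \<in> wts M N A" and y: "y \<in> sreg A w" "y \<in> reg A w'"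
  shows "w = w'"
proof (rule ccontr)
  assume "w \<noteq> w'"
  then obtain p q where pq: "w' p < w p" "w q < w' q" using wts_neq_obtain w by metis
  note c = wts_cross[OF w pq]
  have "norm (y - p) < norm (y - q)" using y(1) c by (auto simp: sreg_def)
  moreover have "norm (y - q) \<le> norm (y - p)" using y(2) c by (auto simp: reg_def)
  ultimately show False by simp
qed

text \<open>A constraint of the region that is tight at \<open>z\<close>: the bisector of
  \<open>p\<close> and \<open>q\<close> passes through \<open>z\<close>.\<close>

definition active :: "point set \<Rightarrow> (point \<Rightarrow> nat) \<Rightarrow> point \<Rightarrow> point \<Rightarrow> point \<Rightarrow> bool" where
  "active A w z p q \<longleftrightarrow> p \<in> A \<and> q \<in> A \<and> w q < w p \<and> norm (z - p) = norm (z - q)"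

text \<open>Two weights whose regions share \<open>z\<close> can differ only at points tied with
  another point at \<open>z\<close>, because the opposite orders of a crossing pair give both
  inequalities between the distances.\<close>

lemma wts_differ_active:
  assumes w: "w \<in> wts M N A" "w' \<in> wts M N A" and z: "z \<in> reg A w" "z \<in> reg A w'"
    and p: "w p \<noteq> w' p"
  obtains q where "active A w z p q \<or> active A w z q p"
proof -
  have ne: "w \<noteq> w'" using p by auto
  have eq: "active A w z p q" if "w' p < w p" "w q < w' q" for p q
  proof -
    note c = wts_cross[OF w that]
    have "norm (z - p) \<le> norm (z - q)" "norm (z - q) \<le> norm (z - p)" using z c regD by blast+
    then show ?thesis using c by (auto simp: active_def)
  qed
  obtain p' q' where pq: "w' p' < w p'" "w q' < w' q'" using wts_neq_obtain[OF w ne] .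
  show ?thesis
  proof (cases "w' p < w p")
    case True
    then show ?thesis using eq[OF True pq(2)] that by blast
  next
    case False
    then have "w p < w' p" using p by simp
    then show ?thesis using eq[OF pq(1)] that by blast
  qed
qed

text \<open>Tight pairs on two different circles would give the chain
  \<open>w q' < w p' \<le> w q < w p\<close>, with \<open>w p'\<close> and \<open>w q\<close> both
  strictly between 0 and \<open>M\<close>. Then \<open>p' = q\<close>, and the two radii coincide
  after all.\<close>

lemma active_same_circle:
  assumes w: "w \<in> wts M N A" and z: "z \<in> reg A w" and ac: "active A w z p q" "active A w z p' q'"
  shows "norm (z - p) = norm (z - p')"
proof -
  have *: "\<not> norm (z - p) < norm (z - p')" if ac: "active A w z p q" "active A w z p' q'" for p q p' q'
  proof
    assume lt: "norm (z - p) < norm (z - p')"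
    have le: "w p' \<le> w q"
    proof (rule ccontr)
      assume "\<not> w p' \<le> w q"
      then have "norm (z - p') \<le> norm (z - q)" using regD[OF z, of p' q] ac by (simp add: active_def)
      then show False using lt ac by (simp add: active_def)
    qed
    have "w p \<le> M" by (rule wtsD(3)[OF w])
    then have "0 < w p'" "w p' < M" "0 < w q" "w q < M" using le ac unfolding active_def by linarith+
    then have "p' = q" by (rule wtsD(5)[OF w])
    moreover have "norm (z - p) = norm (z - q)" using ac(1) unfolding active_def by blast
    ultimately show False using lt by (metis less_irrefl)
  qed
  show ?thesis using *[OF ac] *[OF ac(2,1)] by linarith
qed

section \<open>Locally finite infinite sets in general position\<close>

locale generic_set =
  fixes A :: "point set"
  assumes loc_fin: "bounded B \<Longrightarrow> finite (A \<inter> B)"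
    and infinite_A: "infinite A"
    and noncollinear: "a \<in> A \<Longrightarrow> b \<in> A \<Longrightarrow> c \<in> A \<Longrightarrow> a \<noteq> b \<Longrightarrow> a \<noteq> c \<Longrightarrow> b \<noteq> c \<Longrightarrow>
      cross2 (b - a) (c - a) \<noteq> 0"
    and noncocircular: "card (A \<inter> sphere z r) \<le> 3"
begin

text \<open>There are infinitely many strict comparisons, but a uniform margin exists: the nearer
  point \<open>p\<close> has positive weight, so it ranges over the finite support, and all points
  \<open>q\<close> beyond distance \<open>norm (z - p) + 1\<close> have a margin of at least 1. Only
  finitely many pairs remain.\<close>

lemma strict_pairs_stable:
  assumes w: "w \<in> wts M N A"
  obtains \<epsilon> where "\<epsilon> > 0"
    "\<And>y p q. norm (y - z) < \<epsilon> \<Longrightarrow> p \<in> A \<Longrightarrow> q \<in> A \<Longrightarrow> w q < w p \<Longrightarrow> norm (z - p) < norm (z - q) \<Longrightarrow>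
       norm (y - p) < norm (y - q)"
proof -
  let ?T = "\<lambda>p. A \<inter> cball z (norm (z - p) + 1)"
  define S where "S = insert 1 ((\<lambda>(p, q). norm (z - q) - norm (z - p)) `
     {(p, q) \<in> (SIGMA p:supp w. ?T p). norm (z - p) < norm (z - q)})"
  have "finite (SIGMA p:supp w. ?T p)" using wtsD(1)[OF w] loc_fin by (intro finite_SigmaI) auto
  then have fin: "finite S" unfolding S_def
    by (intro finite.insertI finite_imageI) (erule rev_finite_subset, auto)
  have pos: "s > 0" if "s \<in> S" for s using that by (auto simp: S_def)
  have ne: "S \<noteq> {}" by (simp add: S_def)
  \<comment> \<open>Moving by less than half the smallest margin changes the difference of two
    distances by less than that margin.\<close>
  define \<epsilon> where "\<epsilon> = Min S / 2"
  have "\<epsilon> > 0" using Min_in[OF fin ne] pos by (simp add: \<epsilon>_def)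
  moreover have "norm (y - p) < norm (y - q)"
    if y: "norm (y - z) < \<epsilon>" and h: "p \<in> A" "q \<in> A" "w q < w p" "norm (z - p) < norm (z - q)" for y p q
  proof -
    have "2 * \<epsilon> \<le> norm (z - q) - norm (z - p)"
    proof (cases "q \<in> ?T p")
      case True
      then have "norm (z - q) - norm (z - p) \<in> S"
        using h unfolding S_def by (intro insertI2 image_eqI[of _ _ "(p, q)"]) (auto simp: supp_def)
      then show ?thesis using Min_le[OF fin] by (simp add: \<epsilon>_def)
    next
      case False
      then have "norm (z - q) > norm (z - p) + 1" using h by (simp add: dist_norm)
      moreover have "Min S \<le> 1" using fin by (intro Min_le) (simp_all add: S_def)
      ultimately show ?thesis by (simp add: \<epsilon>_def)
    qed
    moreover have "norm (y - p) \<le> norm (y - z) + norm (z - p)" "norm (z - q) \<le> norm (y - z) + norm (y - q)"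
      using norm_triangle_ineq[of "y - z" "z - p"] norm_triangle_ineq[of "z - y" "y - q"]
      by (simp_all add: norm_minus_commute)
    ultimately show ?thesis using y by linarith
  qed
  ultimately show ?thesis using that by blast
qed

lemma open_sreg:
  assumes w: "w \<in> wts M N A"
  shows "open (sreg A w)"
  unfolding open_dist
proof
  fix z assume z: "z \<in> sreg A w"
  obtain \<epsilon> where e: "\<epsilon> > 0" "\<And>y p q. norm (y - z) < \<epsilon> \<Longrightarrow> p \<in> A \<Longrightarrow> q \<in> A \<Longrightarrow> w q < w p \<Longrightarrow>
      norm (z - p) < norm (z - q) \<Longrightarrow> norm (y - p) < norm (y - q)"
    using strict_pairs_stable[OF w] by blast
  then show "\<exists>e>0. \<forall>y. dist y z < e \<longrightarrow> y \<in> sreg A w"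
    using z by (intro exI[of _ \<epsilon>]) (auto simp: sreg_def dist_norm)
qed

lemma sphere_eq:
  assumes "finite O'" "O' \<subseteq> A" "card O' = 3" "\<And>x. x \<in> O' \<Longrightarrow> norm (z - x) = r"
  shows "A \<inter> sphere z r = O'"
proof -
  have "finite (A \<inter> sphere z r)" by (rule loc_fin) simp
  moreover have "O' \<subseteq> A \<inter> sphere z r" using assms by (auto simp: dist_norm)
  ultimately show ?thesis using card_seteq[of "A \<inter> sphere z r" O'] assms(3) noncocircular[of z r] by auto
qed

end

section \<open>Corners and the vertices of the primal tiles\<close>

definition sgw :: "(point \<Rightarrow> nat) \<Rightarrow> point \<Rightarrow> point \<Rightarrow> real" where
  "sgw w a b = (if w b < w a then 1 else - 1)"

text \<open>
  A corner is a ccw triangle on \<open>A\<close> together with a weight: the circumcenter is a vertex of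
  the tile \<open>reg A w\<close>, where the bisectors of \<open>a\<close> with \<open>b\<close> and with \<open>c\<close> meet. Dually, the weighted
  mean is a vertex of the tile of the circumcenter, with edges parallel to \<open>b - a\<close> and \<open>c - a\<close>.
\<close>

definition corner :: "nat \<Rightarrow> nat \<Rightarrow> point set \<Rightarrow> point \<Rightarrow> point \<Rightarrow> point \<Rightarrow> (point \<Rightarrow> nat) \<Rightarrow> bool" where
  "corner M N A a b c w \<longleftrightarrow> a \<in> A \<and> b \<in> A \<and> c \<in> A \<and> cross2 (b - a) (c - a) > 0 \<and> w \<in> wts M N A \<and>
     circumcenter a b c \<in> reg A w \<and> w b \<in> {0, M} \<and> w c \<in> {0, M} \<and> w a \<noteq> w b \<and> w a \<noteq> w c"

text \<open>The signed edge from \<open>a\<close> to \<open>b\<close> has two readings. For the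
  region it is the outer normal of the half-plane bounded by the bisector of \<open>a\<close> and
  \<open>b\<close>. For the dual tile it is the direction in which the weighted mean moves when the
  weights of \<open>a\<close> and \<open>b\<close> are exchanged. One formula therefore serves both
  mosaics, up to the supplement between normals and edges.\<close>

definition corner_angle :: "point \<Rightarrow> point \<Rightarrow> point \<Rightarrow> (point \<Rightarrow> nat) \<Rightarrow> real" where
  "corner_angle a b c w = vec_angle (sgw w a b *\<^sub>R (b - a)) (sgw w a c *\<^sub>R (c - a))"

lemma cornerD:
  assumes "corner M N A a b c w"
  shows "a \<in> A" "b \<in> A" "c \<in> A" "cross2 (b - a) (c - a) > 0" "w \<in> wts M N A"
    "circumcenter a b c \<in> reg A w" "w b \<in> {0, M}" "w c \<in> {0, M}" "w a \<noteq> w b" "w a \<noteq> w c"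
    "a \<noteq> b" "a \<noteq> c" "b \<noteq> c"
    "norm (circumcenter a b c - b) = norm (circumcenter a b c - a)"
    "norm (circumcenter a b c - c) = norm (circumcenter a b c - a)"
  using assms dist_circumcenter[of b a c] by (auto simp: corner_def)

lemma corner_cross_sgw:
  assumes "corner M N A a b c w"
  shows "cross2 (sgw w a b *\<^sub>R (b - a)) (sgw w a c *\<^sub>R (c - a)) \<noteq> 0"
  using cornerD(4)[OF assms] by (simp add: sgw_def)

context generic_set begin

lemma corner_sphere:
  assumes "corner M N A a b c w"
  shows "A \<inter> sphere (circumcenter a b c) (norm (circumcenter a b c - a)) = {a, b, c}"
  using cornerD[OF assms] by (intro sphere_eq) auto

text \<open>The apex forms a tight pair with \<open>b\<close>. All tight pairs lie on one circle,
  which by genericity carries no point of \<open>A\<close> other than \<open>a\<close>,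
  \<open>b\<close>, \<open>c\<close>.\<close>

lemma corner_active_subset:
  assumes c: "corner M N A a b c w" and ac: "active A w (circumcenter a b c) p q"
  shows "p \<in> {a, b, c}" "q \<in> {a, b, c}"
proof -
  note d = cornerD[OF c]
  let ?z = "circumcenter a b c"
  obtain p' q' where pq': "active A w ?z p' q'" "p' = a \<or> p' = b"
  proof (cases "w b < w a")
    case True
    then show ?thesis using that[of a b] d(1,2,14) by (simp add: active_def)
  next
    case False
    then show ?thesis using that[of b a] d(1,2,9,14) by (simp add: active_def)
  qed
  have "norm (?z - p) = norm (?z - p')" by (rule active_same_circle[OF d(5,6) ac pq'(1)])
  then have "norm (?z - p) = norm (?z - a)" using pq'(2) d(14) by metis
  then have "p \<in> A \<inter> sphere ?z (norm (?z - a))" "q \<in> A \<inter> sphere ?z (norm (?z - a))"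
    using ac by (simp_all add: active_def dist_norm)
  then show "p \<in> {a, b, c}" "q \<in> {a, b, c}" unfolding corner_sphere[OF c] by blast+
qed

text \<open>Near the circumcenter the strict comparisons persist, and the tight ones reduce to the
  two half-planes given by the pairs \<open>a\<close>, \<open>b\<close> and \<open>a\<close>,
  \<open>c\<close>.\<close>

lemma corner_local:
  assumes c: "corner M N A a b c w"
  obtains \<epsilon> where "\<epsilon> > 0"
    "\<And>u. norm u < \<epsilon> \<Longrightarrow> (sgw w a b *\<^sub>R (b - a)) \<bullet> u \<le> 0 \<Longrightarrow> (sgw w a c *\<^sub>R (c - a)) \<bullet> u \<le> 0 \<Longrightarrow>
       circumcenter a b c + u \<in> reg A w"
    "\<And>u. norm u < \<epsilon> \<Longrightarrow> (sgw w a b *\<^sub>R (b - a)) \<bullet> u < 0 \<Longrightarrow> (sgw w a c *\<^sub>R (c - a)) \<bullet> u < 0 \<Longrightarrow>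
       circumcenter a b c + u \<in> sreg A w"
proof -
  let ?z = "circumcenter a b c"
  note d = cornerD[OF c]
  obtain \<epsilon> where e: "\<epsilon> > 0" "\<And>y p q. norm (y - ?z) < \<epsilon> \<Longrightarrow> p \<in> A \<Longrightarrow> q \<in> A \<Longrightarrow> w q < w p \<Longrightarrow>
      norm (?z - p) < norm (?z - q) \<Longrightarrow> norm (y - p) < norm (y - q)"
    using strict_pairs_stable[OF d(5)] by blast
  have M: "w a \<le> M" by (rule wtsD(3)[OF d(5)])
  have key: "active A w ?z p q \<or> norm (?z - p) < norm (?z - q)" if "p \<in> A" "q \<in> A" "w q < w p" for p q
    using that regD[OF d(6), of p q] by (auto simp: active_def)
  \<comment> \<open>The pair \<open>b\<close>, \<open>c\<close> can be tight only if the two signs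
    differ. Its normal is then the sum of the two signed edges at \<open>a\<close>, so it adds no
    constraint.\<close>
  have sub: "(sgw w a b = 1 \<and> q = b \<and> p = a) \<or> (sgw w a b = - 1 \<and> q = a \<and> p = b) \<or>
      (sgw w a c = 1 \<and> q = c \<and> p = a) \<or> (sgw w a c = - 1 \<and> q = a \<and> p = c) \<or>
      (sgw w a b = - 1 \<and> sgw w a c = 1 \<and> q = c \<and> p = b) \<or>
      (sgw w a b = 1 \<and> sgw w a c = - 1 \<and> q = b \<and> p = c)"
    if ac: "active A w ?z p q" for p q
    using corner_active_subset[OF c ac] ac d(7-10) M by (auto simp: active_def sgw_def)
  have "?z + u \<in> reg A w"
    if u: "norm u < \<epsilon>" "(sgw w a b *\<^sub>R (b - a)) \<bullet> u \<le> 0" "(sgw w a c *\<^sub>R (c - a)) \<bullet> u \<le> 0" for u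
    unfolding reg_def
  proof (intro CollectI ballI impI)
    fix p q assume pq: "p \<in> A" "q \<in> A" "w q < w p"
    from key[OF pq] show "norm (?z + u - p) \<le> norm (?z + u - q)"
    proof
      assume ac: "active A w ?z p q"
      then have eq: "norm (?z - p) = norm (?z - q)" by (simp add: active_def)
      have "(q - p) \<bullet> u \<le> 0" using sub[OF ac] u by (elim disjE) (auto simp: inner_diff_left)
      then show ?thesis unfolding norm_le_norm_iff_bisector[OF eq] by simp
    next
      assume "norm (?z - p) < norm (?z - q)"
      then show ?thesis using e(2)[of "?z + u" p q] u(1) pq by simp
    qed
  qed
  moreover have "?z + u \<in> sreg A w"
    if u: "norm u < \<epsilon>" "(sgw w a b *\<^sub>R (b - a)) \<bullet> u < 0" "(sgw w a c *\<^sub>R (c - a)) \<bullet> u < 0" for u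
    unfolding sreg_def
  proof (intro CollectI ballI impI)
    fix p q assume pq: "p \<in> A" "q \<in> A" "w q < w p"
    from key[OF pq] show "norm (?z + u - p) < norm (?z + u - q)"
    proof
      assume ac: "active A w ?z p q"
      then have eq: "norm (?z - p) = norm (?z - q)" by (simp add: active_def)
      have "(q - p) \<bullet> u < 0" using sub[OF ac] u by (elim disjE) (auto simp: inner_diff_left)
      then show ?thesis unfolding norm_le_norm_iff_bisector[OF eq] by simp
    next
      assume "norm (?z - p) < norm (?z - q)"
      then show ?thesis using e(2)[of "?z + u" p q] u(1) pq by simp
    qed
  qed
  ultimately show ?thesis using that e(1) by blast
qed

lemma corner_reg_inner_le:
  assumes c: "corner M N A a b c w" and y: "y \<in> reg A w"
  shows "(sgw w a b *\<^sub>R (b - a)) \<bullet> (y - circumcenter a b c) \<le> 0 \<and>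
    (sgw w a c *\<^sub>R (c - a)) \<bullet> (y - circumcenter a b c) \<le> 0"
proof -
  note d = cornerD[OF c]
  have *: "(sgw w a x *\<^sub>R (x - a)) \<bullet> (y - circumcenter a b c) \<le> 0"
    if x: "x \<in> A" "w a \<noteq> w x" "norm (circumcenter a b c - x) = norm (circumcenter a b c - a)" for x
  proof (cases "w x < w a")
    case True
    then show ?thesis using regD[OF y d(1) x(1)] norm_le_norm_iff_bisector(1)[OF x(3)[symmetric], of y]
      by (simp add: sgw_def)
  next
    case False
    then have "norm (y - x) \<le> norm (y - a)" using regD[OF y x(1) d(1)] x(2) by simp
    then show ?thesis using norm_le_norm_iff_bisector(1)[OF x(3), of y] False
      by (simp add: sgw_def inner_diff_left)
  qed
  show ?thesis using *[OF d(2,9,14)] *[OF d(3,10,15)] by blast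
qed

lemma corner_interior_angle:
  assumes c: "corner M N A a b c w"
  shows "interior_angle (reg A w) (circumcenter a b c) \<theta> \<longleftrightarrow> \<theta> = pi - corner_angle a b c w"
proof -
  obtain \<epsilon> where e: "\<epsilon> > 0"
    "\<And>u. norm u < \<epsilon> \<Longrightarrow> (sgw w a b *\<^sub>R (b - a)) \<bullet> u \<le> 0 \<Longrightarrow> (sgw w a c *\<^sub>R (c - a)) \<bullet> u \<le> 0 \<Longrightarrow>
       circumcenter a b c + u \<in> reg A w"
    by (rule corner_local[OF c]) (rule that)
  show ?thesis unfolding corner_angle_def
    using interior_angle_halfplanes(1)[OF convex_reg cornerD(6)[OF c] corner_cross_sgw[OF c] _ e, of \<theta>]
      corner_reg_inner_le[OF c] by blast
qed

text \<open>A short step from the circumcenter into the open wedge reaches strict points. Tiles with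
  a vertex thus have interior points and determine their weight, which makes the enumeration by
  corners injective.\<close>

lemma corner_sreg_nonempty:
  assumes c: "corner M N A a b c w"
  shows "sreg A w \<noteq> {}"
proof -
  define P Q where "P = sgw w a b *\<^sub>R (b - a)" and "Q = sgw w a c *\<^sub>R (c - a)"
  obtain \<epsilon> where e': "\<epsilon> > 0"
    "\<And>u. norm u < \<epsilon> \<Longrightarrow> (sgw w a b *\<^sub>R (b - a)) \<bullet> u < 0 \<Longrightarrow> (sgw w a c *\<^sub>R (c - a)) \<bullet> u < 0 \<Longrightarrow>
       circumcenter a b c + u \<in> sreg A w"
    by (rule corner_local[OF c]) (rule that)
  note e = e'[folded P_def Q_def]
  define k where "k = cross2 P Q"
  have "k \<noteq> 0" unfolding k_def P_def Q_def by (rule corner_cross_sgw[OF c])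
  then have k: "k * k > 0" by (metis not_real_square_gt_zero)
  \<comment> \<open>A direction whose inner products with both normals are \<open>- (k * k)\<close>,
    whatever the orientation.\<close>
  define v where "v = k *\<^sub>R (rot90 Q - rot90 P)"
  have "P \<bullet> v = - (k * k)" "Q \<bullet> v = - (k * k)"
    unfolding v_def inner_scaleR_right inner_diff_right
    by (simp_all add: inner_commute[of P] inner_commute[of Q] inner_rot90 cross2_commute[of Q P] k_def)
  then have neg: "P \<bullet> v < 0" "Q \<bullet> v < 0" using k by linarith+
  then have "v \<noteq> 0" by auto
  define t where "t = \<epsilon> / (2 * norm v)"
  have "t > 0" using e \<open>v \<noteq> 0\<close> by (simp add: t_def)
  have "circumcenter a b c + t *\<^sub>R v \<in> sreg A w"
  proof (rule e(2))
    show "norm (t *\<^sub>R v) < \<epsilon>" using e(1) \<open>v \<noteq> 0\<close> by (simp add: t_def)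
    show "P \<bullet> (t *\<^sub>R v) < 0" "Q \<bullet> (t *\<^sub>R v) < 0"
      using neg \<open>t > 0\<close> by (simp_all add: mult_pos_neg)
  qed
  then show ?thesis by blast
qed

text \<open>The apex has to be found among three points on a circle. At most one of them has an
  intermediate weight; if there is one, it is the apex. Otherwise the tight pair shows that both 0
  and \<open>M\<close> occur, and the apex is the point whose value occurs once. The orientation
  fixes the order of the other two.\<close>

lemma cornerI_active:
  assumes w: "w \<in> wts M N A" and z: "z \<in> reg A w" and ac: "active A w z p q"
    and three: "card (A \<inter> sphere z (norm (z - p))) = 3"
  obtains a b c where "corner M N A a b c w" "z = circumcenter a b c"
proof -
  note found = that
  have pq: "p \<in> A" "q \<in> A" "w q < w p" "norm (z - q) = norm (z - p)" "p \<noteq> q"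
    using ac by (auto simp: active_def)
  let ?O = "A \<inter> sphere z (norm (z - p))"
  have fin: "finite ?O" using three by (simp add: card_ge_0_finite)
  have "p \<in> ?O" "q \<in> ?O" using pq by (auto simp: dist_norm)
  moreover have "?O \<noteq> {p, q}" using three pq(5) by (metis card_2_iff numeral_eq_iff semiring_norm(89))
  ultimately obtain t where t: "t \<in> ?O" "t \<noteq> p" "t \<noteq> q" by blast
  then have tA: "t \<in> A" "norm (z - t) = norm (z - p)" by (auto simp: dist_norm)
  have M: "w x \<le> M" for x by (rule wtsD(3)[OF w])
  have *: thesis if h: "{a, b, c} = {p, q, t}" "a \<noteq> b" "a \<noteq> c" "b \<noteq> c" "w b \<in> {0, M}" "w c \<in> {0, M}" "w a \<noteq> w b" "w a \<noteq> w c"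
    for a b c
  proof -
    have A: "a \<in> {p, q, t}" "b \<in> {p, q, t}" "c \<in> {p, q, t}" using h(1) by blast+
    then have inA: "a \<in> A" "b \<in> A" "c \<in> A" using pq tA by auto
    have n: "norm (z - b) = norm (z - a)" "norm (z - c) = norm (z - a)" using A pq tA by auto
    have cr: "cross2 (b - a) (c - a) \<noteq> 0" using noncollinear inA h by blast
    show thesis
    proof (cases "cross2 (b - a) (c - a) > 0")
      case True
      show ?thesis
        by (rule found[of a b c]) (use True circumcenter_eqI[OF cr n] z w inA h in \<open>simp_all add: corner_def\<close>)
    next
      case False
      then have cr': "cross2 (c - a) (b - a) > 0" using cr cross2_commute[of "b - a" "c - a"] by linarith
      show ?thesis
        by (rule found[of a c b]) (use cr' circumcenter_eqI[of c a b z] n z w inA h in \<open>simp_all add: corner_def\<close>)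
    qed
  qed
  have btw: "w x \<in> {0, M}" if "0 < w y" "w y < M" "x \<noteq> y" for x y
    using wtsD(5)[OF w, of y x] that M[of x] by fastforce
  show thesis
  proof (cases "\<exists>x\<in>{p, q, t}. 0 < w x \<and> w x < M")
    case True
    then consider "0 < w p" "w p < M" | "0 < w q" "w q < M" | "0 < w t" "w t < M" by auto
    then show ?thesis
    proof cases
      case 1
      show ?thesis by (rule *[of p q t]) (use 1 btw[OF 1, of q] btw[OF 1, of t] pq t in auto)
    next
      case 2
      show ?thesis by (rule *[of q p t]) (use 2 btw[OF 2, of p] btw[OF 2, of t] pq t in auto)
    next
      case 3
      show ?thesis by (rule *[of t p q]) (use 3 btw[OF 3, of p] btw[OF 3, of q] pq t in auto)
    qed
  next
    case False
    then have "w x = 0 \<or> w x = M" if "x \<in> {p, q, t}" for x using that M[of x] by fastforce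
    then have v: "w p = M" "w q = 0" "w t = 0 \<or> w t = M" "M \<noteq> 0" using pq(3) M[of p] by fastforce+
    show ?thesis
    proof (cases "w t = 0")
      case True
      show ?thesis by (rule *[of p q t]) (use v True pq t in auto)
    next
      case False
      show ?thesis by (rule *[of q p t]) (use v False pq t in auto)
    qed
  qed
qed

text \<open>General position leaves at most three points on a circle. If there are not three, a
  tight pair fills the circle and, as all tight pairs share this circle, it is the only one.\<close>

lemma active_two:
  assumes w: "w \<in> wts M N A" and z: "z \<in> reg A w" and ac: "active A w z p q"
    and three: "card (A \<inter> sphere z (norm (z - p))) \<noteq> 3"
  shows "A \<inter> sphere z (norm (z - p)) = {p, q}" and "active A w z p' q' \<Longrightarrow> p' = p \<and> q' = q"
proof -
  let ?O = "A \<inter> sphere z (norm (z - p))"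
  have pq: "p \<in> ?O" "q \<in> ?O" "p \<noteq> q" using ac by (auto simp: active_def dist_norm)
  have fin: "finite ?O" by (rule loc_fin) simp
  have "card ?O \<le> card {p, q}" using noncocircular[of z "norm (z - p)"] three pq(3) by simp
  then have "{p, q} = ?O" using card_seteq[OF fin, of "{p, q}"] pq by blast
  then show *: "?O = {p, q}" by simp
  assume ac': "active A w z p' q'"
  have "norm (z - p') = norm (z - p)" by (rule active_same_circle[OF w z ac' ac])
  then have "p' \<in> ?O" "q' \<in> ?O" using ac' by (simp_all add: active_def dist_norm)
  then have "p' \<in> {p, q}" "q' \<in> {p, q}" unfolding * by blast+
  moreover have "w q < w p" "w q' < w p'" using ac ac' by (simp_all add: active_def)
  ultimately show "p' = p \<and> q' = q" by auto
qed

text \<open>A displacement along the bisector of the only tight pair preserves that tie, and the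
  strict comparisons survive if it is short. Hence \<open>z\<close> is the midpoint of a segment in
  the region.\<close>

lemma active_two_line:
  assumes w: "w \<in> wts M N A" and z: "z \<in> reg A w" and ac: "active A w z p q"
    and three: "card (A \<inter> sphere z (norm (z - p))) \<noteq> 3"
  obtains u where "u \<noteq> 0" "u \<bullet> (q - p) = 0" "z + u \<in> reg A w" "z - u \<in> reg A w"
proof -
  obtain \<epsilon> where e: "\<epsilon> > 0" "\<And>y p q. norm (y - z) < \<epsilon> \<Longrightarrow> p \<in> A \<Longrightarrow> q \<in> A \<Longrightarrow> w q < w p \<Longrightarrow>
      norm (z - p) < norm (z - q) \<Longrightarrow> norm (y - p) < norm (y - q)"
    using strict_pairs_stable[OF w] by blast
  have pq: "norm (z - p) = norm (z - q)" "p \<noteq> q" using ac by (auto simp: active_def)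
  define u where "u = (\<epsilon> / (2 * norm (q - p))) *\<^sub>R rot90 (q - p)"
  have u: "norm u < \<epsilon>" "u \<bullet> (q - p) = 0" "u \<noteq> 0"
    using e pq by (simp_all add: u_def inner_rot90) (metis norm_rot90 norm_zero norm_eq_zero right_minus_eq)
  have "z + v \<in> reg A w" if v: "norm v < \<epsilon>" "v \<bullet> (q - p) = 0" for v
    unfolding reg_def
  proof (intro CollectI ballI impI)
    fix p' q' assume pq': "p' \<in> A" "q' \<in> A" "w q' < w p'"
    show "norm (z + v - p') \<le> norm (z + v - q')"
    proof (cases "norm (z - p') < norm (z - q')")
      case True
      then show ?thesis using e(2)[of "z + v" p' q'] v(1) pq' by simp
    next
      case False
      then have "active A w z p' q'" using regD[OF z pq'] pq' by (simp add: active_def)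
      then have "p' = p" "q' = q" using active_two(2)[OF w z ac three] by blast+
      then show ?thesis using norm_le_norm_iff_bisector(1)[OF pq(1), of "z + v"] v(2) by (simp add: inner_commute)
    qed
  qed
  from this[of u] this[of "- u"] show ?thesis using u that by simp
qed

text \<open>Without a tight pair the point is interior, and with two points on the circle it is
  inside a segment. An extreme point therefore sees three points on its circle, which is the
  situation of \<open>cornerI_active\<close>.\<close>

lemma extreme_point_of_reg_corner:
  assumes w: "w \<in> wts M N A" and ext: "z extreme_point_of (reg A w)"
  obtains a b c where "corner M N A a b c w" "z = circumcenter a b c"
proof -
  have z: "z \<in> reg A w" using ext by (simp add: extreme_point_of_def)
  have no: False if "u \<noteq> 0" "z + u \<in> reg A w" "z - u \<in> reg A w" for u
  proof -
    have "midpoint (z + u) (z - u) = z" by (simp add: midpoint_def scaleR_2[symmetric])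
    moreover have "z + u \<noteq> z - u" using that(1) by (simp add: eq_diff_eq add.assoc scaleR_2[symmetric])
    ultimately have "z \<in> open_segment (z + u) (z - u)" using midpoint_in_open_segment by metis
    then show False using ext that by (auto simp: extreme_point_of_def)
  qed
  show ?thesis
  proof (cases "\<exists>p q. active A w z p q")
    case True
    then obtain p q where ac: "active A w z p q" by blast
    show ?thesis
    proof (cases "card (A \<inter> sphere z (norm (z - p))) = 3")
      case True
      show ?thesis using cornerI_active[OF w z ac True] that .
    next
      case False
      show ?thesis using active_two_line[OF w z ac False] no by metis
    qed
  next
    case False
    then have "z \<in> sreg A w" using z by (auto simp: sreg_def reg_def active_def less_le)
    then obtain e where e: "e > 0" "ball z e \<subseteq> sreg A w"
      using open_sreg[OF w] by (auto simp: open_contains_ball)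
    obtain u :: point where u: "norm u = e / 2" using vector_choose_size[of "e / 2"] e by auto
    then have "z + u \<in> ball z e" "z - u \<in> ball z e" "u \<noteq> 0" using e by (auto simp: dist_norm)
    then show ?thesis using no e sreg_subset_reg by blast
  qed
qed

text \<open>Two different apices of the same triangle would give its vertices three pairwise
  different weights, all from the two values 0 and \<open>M\<close>. With the apex known, the
  orientation separates \<open>b\<close> from \<open>c\<close>.\<close>

lemma corner_unique:
  assumes c: "corner M N A a b c w" "corner M N A a' b' c' w"
    and eq: "circumcenter a b c = circumcenter a' b' c'"
  shows "a = a' \<and> b = b' \<and> c = c'"
proof -
  note d = cornerD[OF c(1)] and d' = cornerD[OF c(2)]
  have "active A w (circumcenter a b c) a b \<or> active A w (circumcenter a b c) b a" using d by (auto simp: active_def)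
  then have sub1: "a \<in> {a', b', c'}" "b \<in> {a', b', c'}"
    using corner_active_subset[OF c(2)] by (auto simp: eq)
  have "active A w (circumcenter a b c) a c \<or> active A w (circumcenter a b c) c a" using d by (auto simp: active_def)
  then have sub2: "c \<in> {a', b', c'}"
    using corner_active_subset[OF c(2)] by (auto simp: eq)
  have M: "w a \<le> M" "w a' \<le> M" by (rule wtsD(3)[OF d(5)])+
  have aa: "a = a'"
  proof (rule ccontr)
    assume "a \<noteq> a'"
    then have "a' \<in> {b, c}" "a \<in> {b', c'}" using sub1 sub2 d by auto
    then show False using sub1 sub2 d d' by auto
  qed
  have "b = b'"
  proof (rule ccontr)
    assume "b \<noteq> b'"
    then have "b = c'" "c = b'" using sub1 sub2 aa d by auto
    then have "cross2 (c - a) (b - a) > 0" using d'(4) aa by simp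
    then show False using d(4) cross2_commute[of "b - a" "c - a"] by linarith
  qed
  then show ?thesis using aa sub2 d by auto
qed

end

section \<open>Lower boundaries and dual mosaics\<close>

text \<open>A convex combination lies on a supporting hyperplane only if all points with positive
  coefficient do. The auxiliary set in the proof states this as a condition preserved by
  combinations, so \<open>P\<close> may be infinite.\<close>

lemma convex_hull_Int_supporting_hyperplane:
  fixes P :: "'a::real_inner set"
  assumes "\<And>p. p \<in> P \<Longrightarrow> u \<bullet> p \<ge> c"
  shows "convex hull P \<inter> {p. u \<bullet> p = c} = convex hull (P \<inter> {p. u \<bullet> p = c})"
proof
  let ?H = "convex hull (P \<inter> {p. u \<bullet> p = c})"
  have "convex {x. u \<bullet> x \<ge> c \<and> (u \<bullet> x = c \<longrightarrow> x \<in> ?H)}"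
  proof (intro convex_alt[THEN iffD2] ballI allI impI)
    fix x y :: 'a and t :: real
    assume x: "x \<in> {x. u \<bullet> x \<ge> c \<and> (u \<bullet> x = c \<longrightarrow> x \<in> ?H)}"
      and y: "y \<in> {x. u \<bullet> x \<ge> c \<and> (u \<bullet> x = c \<longrightarrow> x \<in> ?H)}" and t: "0 \<le> t \<and> t \<le> 1"
    have e: "u \<bullet> ((1 - t) *\<^sub>R x + t *\<^sub>R y) = (1 - t) * (u \<bullet> x) + t * (u \<bullet> y)" by (simp add: inner_add_right)
    have m: "(1 - t) * (u \<bullet> x - c) \<ge> 0" "t * (u \<bullet> y - c) \<ge> 0" using x y t by auto
    then have ge: "u \<bullet> ((1 - t) *\<^sub>R x + t *\<^sub>R y) \<ge> c" unfolding e by (simp add: algebra_simps)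
    have "(1 - t) *\<^sub>R x + t *\<^sub>R y \<in> ?H" if "u \<bullet> ((1 - t) *\<^sub>R x + t *\<^sub>R y) = c"
    proof -
    from that have "(1 - t) * (u \<bullet> x - c) + t * (u \<bullet> y - c) = 0" unfolding e by (simp add: algebra_simps)
    then have "(1 - t) * (u \<bullet> x - c) = 0" "t * (u \<bullet> y - c) = 0"
      using add_nonneg_eq_0_iff[OF m] by blast+
    then consider "t = 0" "u \<bullet> x = c" | "t = 1" "u \<bullet> y = c" | "u \<bullet> x = c" "u \<bullet> y = c" by force
    then show "(1 - t) *\<^sub>R x + t *\<^sub>R y \<in> ?H"
    proof cases
      case 3
      then show ?thesis using x y t by (intro convexD[OF convex_convex_hull]) auto
    qed (use x y in auto)
    qed
    with ge show "(1 - t) *\<^sub>R x + t *\<^sub>R y \<in> {x. u \<bullet> x \<ge> c \<and> (u \<bullet> x = c \<longrightarrow> x \<in> ?H)}" by blast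
  qed
  then have "convex hull P \<subseteq> {x. u \<bullet> x \<ge> c \<and> (u \<bullet> x = c \<longrightarrow> x \<in> ?H)}"
    using assms by (intro hull_minimal) (auto intro: hull_inc)
  then show "convex hull P \<inter> {p. u \<bullet> p = c} \<subseteq> ?H" by auto
  have "?H \<subseteq> {p. u \<bullet> p = c}" by (intro hull_minimal convex_hyperplane) auto
  moreover have "?H \<subseteq> convex hull P" by (intro hull_mono) auto
  ultimately show "?H \<subseteq> convex hull P \<inter> {p. u \<bullet> p = c}" by auto
qed

text \<open>The points of \<open>P\<close> first touched from below by a plane of gradient
  \<open>2 * z\<close>. This is the slope of the paraboloid of squared norms at \<open>z\<close>,
  hence \<open>z\<close> becomes the point dual to a lower facet.\<close>

definition lowpts :: "(point \<times> real) set \<Rightarrow> point \<Rightarrow> (point \<times> real) set" where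
  "lowpts P z = {p \<in> P. \<forall>q\<in>P. snd p - 2 * (z \<bullet> fst p) \<le> snd q - 2 * (z \<bullet> fst q)}"

lemma fst_hull: "fst ` (convex hull S) = convex hull (fst ` S)"
  by (simp add: convex_hull_linear_image linear_fst)

text \<open>On a plane that is not vertical the projection has an affine inverse, so it loses no
  dimension.\<close>

lemma aff_dim_fst_plane:
  fixes S :: "(point \<times> real) set"
  assumes "\<And>p. p \<in> S \<Longrightarrow> snd p - 2 * (z \<bullet> fst p) = c"
  shows "aff_dim (fst ` S) = aff_dim S"
proof (rule antisym)
  show "aff_dim (fst ` S) \<le> aff_dim S" by (rule aff_dim_linear_image_le[OF linear_fst])
  let ?f = "\<lambda>y::point. (y, 2 * (z \<bullet> y))"
  have lin: "linear ?f" by (rule linearI) (simp_all add: inner_add_right algebra_simps)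
  have "(+) (0, c) ` (?f ` (fst ` S)) = id ` S"
    unfolding image_image by (intro image_cong refl) (use assms in \<open>auto simp: prod_eq_iff algebra_simps\<close>)
  then have "S = (+) (0, c) ` (?f ` (fst ` S))" by simp
  then have "aff_dim S = aff_dim (?f ` (fst ` S))" by (metis aff_dim_translation_eq)
  also have "\<dots> \<le> aff_dim (fst ` S)" by (rule aff_dim_linear_image_le[OF lin])
  finally show "aff_dim S \<le> aff_dim (fst ` S)" .
qed

lemma lowpts_hull:
  assumes "p \<in> lowpts P z"
  defines "c \<equiv> snd p - 2 * (z \<bullet> fst p)"
  shows "convex hull P \<subseteq> {q. (- 2 *\<^sub>R z, 1) \<bullet> q \<ge> c}"
    and "lowpts P z = P \<inter> {q. (- 2 *\<^sub>R z, 1) \<bullet> q = c}"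
    and "convex hull (lowpts P z) = convex hull P \<inter> {q. (- 2 *\<^sub>R z, 1) \<bullet> q = c}"
proof -
  have e: "(- 2 *\<^sub>R z, 1::real) \<bullet> q = snd q - 2 * (z \<bullet> fst q)" for q
    by (cases q) simp
  show 1: "convex hull P \<subseteq> {q. (- 2 *\<^sub>R z, 1) \<bullet> q \<ge> c}"
    using assms by (intro hull_minimal convex_halfspace_ge) (auto simp: lowpts_def e)
  show 2: "lowpts P z = P \<inter> {q. (- 2 *\<^sub>R z, 1) \<bullet> q = c}"
    using assms(1) unfolding e c_def by (force simp: lowpts_def)
  show "convex hull (lowpts P z) = convex hull P \<inter> {q. (- 2 *\<^sub>R z, 1) \<bullet> q = c}"
    unfolding 2 using 1 hull_subset[of P convex] by (intro convex_hull_Int_supporting_hyperplane[symmetric]) blast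
qed

text \<open>A supporting plane below the hull that is not vertical is determined by its slope, so
  lower facets can be indexed by \<open>z\<close>. Full dimension of \<open>P\<close> makes a facet
  the same as a face of dimension two.\<close>

lemma projected_lower_boundary_eq:
  assumes dim: "aff_dim P = 3"
  shows "projected_lower_boundary P = {convex hull (fst ` lowpts P z) | z. aff_dim (fst ` lowpts P z) = 2}"
proof (intro equalityI subsetI)
  fix Q assume "Q \<in> projected_lower_boundary P"
  then obtain F u c where F: "Q = fst ` F" "F facet_of (convex hull P)" "snd u > 0"
      "convex hull P \<subseteq> {p. u \<bullet> p \<ge> c}" "F \<subseteq> {p. u \<bullet> p = c}"
    unfolding projected_lower_boundary_def lower_facet_of_def by blast
  have fF: "F face_of (convex hull P)" "F \<noteq> {}" "aff_dim F = 2"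
    using F(2) dim by (auto simp: facet_of_def aff_dim_convex_hull)
  \<comment> \<open>Scaling the normal to last coordinate 1 turns it into
    \<open>(- 2 *\<^sub>R z, 1)\<close>.\<close>
  define z where "z = (- 1 / (2 * snd u)) *\<^sub>R fst u"
  have e: "u \<bullet> p = snd u * (snd p - 2 * (z \<bullet> fst p))" for p
  proof -
    have alg: "a + s * h = s * (h - 2 * ((- 1 / (2 * s)) * a))" if "s > 0" for a s h :: real
      using that by (simp add: right_diff_distrib distrib_left)
    have "u \<bullet> p = fst u \<bullet> fst p + snd u * snd p" by (simp add: inner_prod_def)
    also have "\<dots> = snd u * (snd p - 2 * ((- 1 / (2 * snd u)) * (fst u \<bullet> fst p)))" by (rule alg[OF F(3)])
    also have "(- 1 / (2 * snd u)) * (fst u \<bullet> fst p) = z \<bullet> fst p" by (simp add: z_def)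
    finally show ?thesis .
  qed
  let ?F = "convex hull (P \<inter> {p. u \<bullet> p = c})"
  have ge: "u \<bullet> p \<ge> c" if "p \<in> P" for p
    using hull_inc[OF that, of convex] F(4) by blast
  have F': "?F = convex hull P \<inter> {p. u \<bullet> p = c}"
    by (rule convex_hull_Int_supporting_hyperplane[symmetric]) (rule ge)
  have sub: "F \<subseteq> ?F" unfolding F' using fF(1) F(5) face_of_imp_subset by blast
  have "F face_of ?F" using fF(1) sub by (rule face_of_subset) (auto simp: F')
  moreover have "u \<noteq> 0" using F(3) by auto
  then have "aff_dim ?F \<le> 2"
    using aff_dim_subset[of ?F "{p. u \<bullet> p = c}"] by (simp add: F' aff_dim_hyperplane)
  \<comment> \<open>A proper face would have smaller dimension, so the given facet is the whole
    slice cut out by its supporting plane.\<close>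
  ultimately have FF: "F = ?F"
    using face_of_aff_dim_lt[of ?F F] fF(3) by (metis convex_convex_hull linorder_not_le)
  then have "P \<inter> {p. u \<bullet> p = c} \<noteq> {}" using fF(2) by auto
  then obtain p0 where p0: "p0 \<in> P" "u \<bullet> p0 = c" by blast
  have low: "P \<inter> {p. u \<bullet> p = c} = lowpts P z"
  proof (intro equalityI subsetI)
    fix p assume p: "p \<in> P \<inter> {p. u \<bullet> p = c}"
    have "snd p - 2 * (z \<bullet> fst p) \<le> snd q - 2 * (z \<bullet> fst q)" if "q \<in> P" for q
    proof -
      have "snd u * (snd p - 2 * (z \<bullet> fst p)) \<le> snd u * (snd q - 2 * (z \<bullet> fst q))"
        using ge[OF that] p by (simp add: e)
      then show ?thesis using F(3) by simp
    qed
    then show "p \<in> lowpts P z" using p by (auto simp: lowpts_def)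
  next
    fix p assume p: "p \<in> lowpts P z"
    then have "u \<bullet> p \<le> u \<bullet> p0" using p0 F(3) by (auto simp: lowpts_def e)
    then show "p \<in> P \<inter> {p. u \<bullet> p = c}" using p p0 ge[of p] by (auto simp: lowpts_def)
  qed
  have "aff_dim (fst ` lowpts P z) = aff_dim (lowpts P z)"
    using p0 F(3) by (intro aff_dim_fst_plane[of _ z "c / snd u"]) (auto simp: low[symmetric] e)
  also have "\<dots> = 2" using fF(3) FF by (metis aff_dim_convex_hull low)
  finally show "Q \<in> {convex hull (fst ` lowpts P z) | z. aff_dim (fst ` lowpts P z) = 2}"
    using F(1) FF low by (auto simp: fst_hull)
next
  fix Q assume "Q \<in> {convex hull (fst ` lowpts P z) | z. aff_dim (fst ` lowpts P z) = 2}"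
  then obtain z where z: "Q = convex hull (fst ` lowpts P z)" "aff_dim (fst ` lowpts P z) = 2" by blast
  then have "lowpts P z \<noteq> {}" by auto
  then obtain p where p: "p \<in> lowpts P z" by blast
  define c where "c = snd p - 2 * (z \<bullet> fst p)"
  note l = lowpts_hull[OF p, folded c_def]
  let ?F = "convex hull (lowpts P z)"
  have "?F face_of (convex hull P)" unfolding l(3)
    using l(1) by (intro face_of_Int_supporting_hyperplane_ge) auto
  moreover have "aff_dim (lowpts P z) = 2"
    using z(2) aff_dim_fst_plane[of "lowpts P z" z c] l(2) by auto
  then have "aff_dim ?F = aff_dim (convex hull P) - 1" using dim by (simp add: aff_dim_convex_hull)
  ultimately have "?F facet_of (convex hull P)" using p by (auto simp: facet_of_def)
  then have "lower_facet_of ?F (convex hull P)"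
    unfolding lower_facet_of_def using l(1,3) by (intro conjI exI[of _ "(- 2 *\<^sub>R z, 1)"] exI[of _ c]) auto
  then show "Q \<in> projected_lower_boundary P"
    unfolding projected_lower_boundary_def z(1) fst_hull[symmetric] by blast
qed

text \<open>Both tiles lie below the same lower boundary, hence lift to the same plane over it.\<close>

lemma lowpts_tile_inj:
  assumes eq: "convex hull (fst ` lowpts P z) = convex hull (fst ` lowpts P z')"
    and dim: "aff_dim (fst ` lowpts P z) = 2"
  shows "z = z'"
proof (rule ccontr)
  assume ne: "z \<noteq> z'"
  have "lowpts P z \<noteq> {}" using dim by auto
  moreover from this have "lowpts P z' \<noteq> {}" using eq by (metis convex_hull_eq_empty image_is_empty)
  ultimately obtain p p' where p: "p \<in> lowpts P z" "p' \<in> lowpts P z'" by blast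
  define c c' where "c = snd p - 2 * (z \<bullet> fst p)" and "c' = snd p' - 2 * (z' \<bullet> fst p')"
  note l = lowpts_hull[OF p(1), folded c_def] and l' = lowpts_hull[OF p(2), folded c'_def]
  have "(2 *\<^sub>R (z - z')) \<bullet> y = c' - c" if y: "y \<in> convex hull (fst ` lowpts P z)" for y
  proof -
    obtain q where q: "q \<in> convex hull (lowpts P z)" "y = fst q" using y unfolding fst_hull[symmetric] by blast
    have "y \<in> fst ` (convex hull (lowpts P z'))" using y eq by (simp add: fst_hull)
    then obtain q' where q': "q' \<in> convex hull (lowpts P z')" "y = fst q'" by blast
    have "(- 2 *\<^sub>R z, 1) \<bullet> q = c" "(- 2 *\<^sub>R z, 1) \<bullet> q' \<ge> c" "(- 2 *\<^sub>R z', 1) \<bullet> q' = c'" "(- 2 *\<^sub>R z', 1) \<bullet> q \<ge> c'"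
      using q q' l l' by auto
    then have "snd q - 2 * (z \<bullet> y) = c" "snd q' - 2 * (z \<bullet> y) \<ge> c"
        "snd q' - 2 * (z' \<bullet> y) = c'" "snd q - 2 * (z' \<bullet> y) \<ge> c'"
      by (simp_all add: inner_prod_def q(2)[symmetric] q'(2)[symmetric])
    then have "2 * (z \<bullet> y) - 2 * (z' \<bullet> y) = c' - c" by linarith
    then show ?thesis by (simp add: inner_diff_left)
  qed
  then have "convex hull (fst ` lowpts P z) \<subseteq> {y. (2 *\<^sub>R (z - z')) \<bullet> y = c' - c}" by blast
  then have "aff_dim (convex hull (fst ` lowpts P z)) \<le> aff_dim {y. (2 *\<^sub>R (z - z')) \<bullet> y = c' - c}"
    by (rule aff_dim_subset)
  also have "\<dots> = 1" by (subst aff_dim_hyperplane) (use ne in auto)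
  finally have "aff_dim (convex hull (fst ` lowpts P z)) \<le> 1" .
  then show False using dim by (simp add: aff_dim_convex_hull)
qed

section \<open>Weighted means and their lifts\<close>

definition wpt :: "nat \<Rightarrow> (point \<Rightarrow> nat) \<Rightarrow> point" where
  "wpt N w = (1 / real N) *\<^sub>R (\<Sum>p\<in>supp w. real (w p) *\<^sub>R p)"

definition wlift :: "nat \<Rightarrow> (point \<Rightarrow> nat) \<Rightarrow> point \<times> real" where
  "wlift N w = (wpt N w, (1 / real N) * (\<Sum>p\<in>supp w. real (w p) * (norm p)\<^sup>2))"

lemma fst_wlift [simp]: "fst (wlift N w) = wpt N w" by (simp add: wlift_def)

lemma wpt_superset:
  assumes "finite S" "supp w \<subseteq> S"
  shows "wpt N w = (1 / real N) *\<^sub>R (\<Sum>p\<in>S. real (w p) *\<^sub>R p)"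
  unfolding wpt_def by (subst sum_supp_superset[OF assms]) auto

lemma wts_real_sum:
  assumes "w \<in> wts M N A" "finite S" "supp w \<subseteq> S"
  shows "(\<Sum>p\<in>S. real (w p)) = real N"
  using wts_sum[OF assms] by (simp flip: of_nat_sum)

text \<open>Completing the square: the height above a plane of slope \<open>2 * z\<close> is the
  weighted mean of the squared distances to \<open>z\<close>, up to a term that does not depend on
  the weight. Low points are weights placed close to \<open>z\<close>.\<close>

lemma wlift_height:
  assumes w: "w \<in> wts M N A" "N > 0" and S: "finite S" "supp w \<subseteq> S"
  shows "snd (wlift N w) - 2 * (z \<bullet> fst (wlift N w)) = (1 / real N) * (\<Sum>p\<in>S. real (w p) * (norm (z - p))\<^sup>2) - (norm z)\<^sup>2"
proof -
  have "(\<Sum>p\<in>S. real (w p) * (norm (z - p))\<^sup>2) =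
      (\<Sum>p\<in>S. real (w p) * (norm p)\<^sup>2 - 2 * (z \<bullet> (real (w p) *\<^sub>R p)) + real (w p) * (norm z)\<^sup>2)"
    by (intro sum.cong refl) (simp add: power2_norm_eq_inner inner_diff_left inner_diff_right inner_commute algebra_simps)
  also have "\<dots> = (\<Sum>p\<in>S. real (w p) * (norm p)\<^sup>2) - 2 * (z \<bullet> (\<Sum>p\<in>S. real (w p) *\<^sub>R p)) + real N * (norm z)\<^sup>2"
    by (simp only: sum.distrib sum_subtractf inner_sum_right sum_distrib_left[symmetric] sum_distrib_right[symmetric]
        wts_real_sum[OF w(1) S])
  finally show ?thesis using w(2)
    by (simp add: wlift_def wpt_superset[OF S] sum_supp_superset[OF S] field_simps)
qed

text \<open>Greedy exchange: weight moved from \<open>p\<close> to \<open>q\<close> moves away from \<open>z\<close>.\<close>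

lemma reg_imp_sum_le:
  assumes w: "w \<in> wts M N A" "w' \<in> wts M N A" and z: "z \<in> reg A w"
    and S: "finite S" "supp w \<subseteq> S" "supp w' \<subseteq> S"
  shows "(\<Sum>p\<in>S. real (w p) * (norm (z - p))\<^sup>2) \<le> (\<Sum>p\<in>S. real (w' p) * (norm (z - p))\<^sup>2)"
proof (cases "w = w'")
  case False
  let ?D = "{p. w' p < w p}" and ?U = "{q. w q < w' q}"
  have "?D \<subseteq> S" using S(2) by (auto simp: supp_def)
  then have fD: "finite ?D" using S(1) finite_subset by blast
  have nD: "?D \<noteq> {}" using wts_neq_obtain[OF w False] by blast
  define t where "t = Max ((\<lambda>p. (norm (z - p))\<^sup>2) ` ?D)"
  have tD: "(norm (z - p))\<^sup>2 \<le> t" if "p \<in> ?D" for p using that fD unfolding t_def by (intro Max_ge) auto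
  have tU: "t \<le> (norm (z - q))\<^sup>2" if "q \<in> ?U" for q
  proof -
    have "t \<in> (\<lambda>p. (norm (z - p))\<^sup>2) ` ?D" unfolding t_def using fD nD by (intro Max_in) auto
    then obtain p where p: "w' p < w p" "t = (norm (z - p))\<^sup>2" by auto
    have q: "w q < w' q" using that by simp
    have "norm (z - p) \<le> norm (z - q)" using wts_cross[OF w p(1) q] regD[OF z] by blast
    then show ?thesis using p(2) by simp
  qed
  have "0 \<le> (\<Sum>p\<in>S. (real (w' p) - real (w p)) * ((norm (z - p))\<^sup>2 - t))"
  proof (rule sum_nonneg)
    fix p assume "p \<in> S"
    consider "w' p < w p" | "w p < w' p" | "w p = w' p" by linarith
    then show "0 \<le> (real (w' p) - real (w p)) * ((norm (z - p))\<^sup>2 - t)"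
    proof cases
      case 1 then show ?thesis using tD[of p] by (intro mult_nonpos_nonpos) auto
    next
      case 2 then show ?thesis using tU[of p] by (intro mult_nonneg_nonneg) auto
    qed simp
  qed
  also have "\<dots> = (\<Sum>p\<in>S. real (w' p) * (norm (z - p))\<^sup>2) - (\<Sum>p\<in>S. real (w p) * (norm (z - p))\<^sup>2)
      - t * ((\<Sum>p\<in>S. real (w' p)) - (\<Sum>p\<in>S. real (w p)))"
    by (simp add: algebra_simps sum_subtractf sum.distrib sum_distrib_left)
  also have "(\<Sum>p\<in>S. real (w' p)) - (\<Sum>p\<in>S. real (w p)) = 0"
    using wts_real_sum[OF w(1) S(1,2)] wts_real_sum[OF w(2) S(1,3)] by simp
  finally show ?thesis by simp
qed simp

lemma sum_transpose_diff:
  fixes f :: "'a \<Rightarrow> 'b::real_vector" and w :: "'a \<Rightarrow> nat"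
  assumes "finite S" "p \<in> S" "q \<in> S" "p \<noteq> q"
  shows "(\<Sum>x\<in>S. real ((w \<circ> Transposition.transpose p q) x) *\<^sub>R f x) - (\<Sum>x\<in>S. real (w x) *\<^sub>R f x) =
    (real (w p) - real (w q)) *\<^sub>R (f q - f p)"
proof -
  have split: "sum g S = g p + (g q + sum g (S - {p} - {q}))" for g :: "'a \<Rightarrow> 'b"
    using assms by (simp add: sum.remove[of S p] sum.remove[of "S - {p}" q])
  have "(\<Sum>x\<in>S - {p} - {q}. real ((w \<circ> Transposition.transpose p q) x) *\<^sub>R f x) = (\<Sum>x\<in>S - {p} - {q}. real (w x) *\<^sub>R f x)"
    by (intro sum.cong) (auto simp: Transposition.transpose_def)
  then show ?thesis unfolding split by (simp add: algebra_simps)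
qed

text \<open>The duality between regions and the lower boundary. Towards minimality it is the
  exchange estimate \<open>reg_imp_sum_le\<close>; conversely, exchanging the values of
  \<open>p\<close> and \<open>q\<close> gives a competitor, and its excess height is a positive
  multiple of the difference of squared distances.\<close>

lemma reg_iff_lowpts:
  assumes w: "w \<in> wts M N A" and N: "N > 0"
  shows "z \<in> reg A w \<longleftrightarrow> wlift N w \<in> lowpts (wlift N ` wts M N A) z"
proof
  assume z: "z \<in> reg A w"
  have "snd (wlift N w) - 2 * (z \<bullet> fst (wlift N w)) \<le> snd (wlift N w') - 2 * (z \<bullet> fst (wlift N w'))"
    if w': "w' \<in> wts M N A" for w'
  proof -
    let ?S = "supp w \<union> supp w'"
    have S: "finite ?S" "supp w \<subseteq> ?S" "supp w' \<subseteq> ?S" using wtsD(1)[OF w] wtsD(1)[OF w'] by auto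
    show ?thesis unfolding wlift_height[OF w N S(1,2)] wlift_height[OF w' N S(1,3)]
      using reg_imp_sum_le[OF w w' z S] N by (simp add: divide_right_mono)
  qed
  then show "wlift N w \<in> lowpts (wlift N ` wts M N A) z" using w by (auto simp: lowpts_def simp del: fst_wlift)
next
  assume low: "wlift N w \<in> lowpts (wlift N ` wts M N A) z"
  show "z \<in> reg A w" unfolding reg_def
  proof (intro CollectI ballI impI)
    fix p q assume pq: "p \<in> A" "q \<in> A" "w q < w p"
    let ?w = "w \<circ> Transposition.transpose p q"
    let ?S = "insert p (insert q (supp w))"
    have w': "?w \<in> wts M N A" using wts_swap[OF w pq(1,2)] .
    have S: "finite ?S" "supp w \<subseteq> ?S" "supp ?w \<subseteq> ?S"
      using wtsD(1)[OF w] by (auto simp: supp_def Transposition.transpose_def split: if_splits)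
    have "snd (wlift N w) - 2 * (z \<bullet> fst (wlift N w)) \<le> snd (wlift N ?w) - 2 * (z \<bullet> fst (wlift N ?w))"
      using low w' unfolding lowpts_def by blast
    then have "(\<Sum>x\<in>?S. real (w x) * (norm (z - x))\<^sup>2) \<le> (\<Sum>x\<in>?S. real (?w x) * (norm (z - x))\<^sup>2)"
      unfolding wlift_height[OF w N S(1,2)] wlift_height[OF w' N S(1,3)] using N by (simp add: divide_le_cancel)
    then have "0 \<le> (real (w p) - real (w q)) * ((norm (z - q))\<^sup>2 - (norm (z - p))\<^sup>2)"
      using sum_transpose_diff[OF S(1), of p q w "\<lambda>x. (norm (z - x))\<^sup>2"] less_imp_neq[OF pq(3)] by force
    then have "(norm (z - p))\<^sup>2 \<le> (norm (z - q))\<^sup>2" using pq(3) by (simp add: zero_le_mult_iff)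
    then show "norm (z - p) \<le> norm (z - q)" by (simp add: power2_le_iff_abs_le)
  qed
qed

lemma wpt_diff:
  assumes w: "w \<in> wts M N A" "w' \<in> wts M N A" and S: "finite S" "\<And>x. x \<notin> S \<Longrightarrow> w' x = w x"
  shows "wpt N w' - wpt N w = (1 / real N) *\<^sub>R (\<Sum>x\<in>S. (real (w' x) - real (w x)) *\<^sub>R x)"
    and "(\<Sum>x\<in>S. real (w' x) - real (w x)) = 0"
proof -
  let ?T = "S \<union> supp w \<union> supp w'"
  have T: "finite ?T" "supp w \<subseteq> ?T" "supp w' \<subseteq> ?T" using S wtsD(1)[OF w(1)] wtsD(1)[OF w(2)] by auto
  have "wpt N w' - wpt N w = (1 / real N) *\<^sub>R (\<Sum>x\<in>?T. (real (w' x) - real (w x)) *\<^sub>R x)"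
    unfolding wpt_superset[OF T(1,2)] wpt_superset[OF T(1,3)]
    by (simp add: scaleR_diff_left sum_subtractf flip: scaleR_diff_right)
  also have "(\<Sum>x\<in>?T. (real (w' x) - real (w x)) *\<^sub>R x) = (\<Sum>x\<in>S. (real (w' x) - real (w x)) *\<^sub>R x)"
    using S T(1) by (intro sum.mono_neutral_right) auto
  finally show "wpt N w' - wpt N w = (1 / real N) *\<^sub>R (\<Sum>x\<in>S. (real (w' x) - real (w x)) *\<^sub>R x)" .
  have "(\<Sum>x\<in>S. real (w' x) - real (w x)) = (\<Sum>x\<in>?T. real (w' x) - real (w x))"
    using S T(1) by (intro sum.mono_neutral_left) auto
  then show "(\<Sum>x\<in>S. real (w' x) - real (w x)) = 0"
    using wts_real_sum[OF w(1) T(1,2)] wts_real_sum[OF w(2) T(1,3)] by (simp add: sum_subtractf)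
qed

section \<open>Tiles dual to a point\<close>

definition wts_at :: "nat \<Rightarrow> nat \<Rightarrow> point set \<Rightarrow> point \<Rightarrow> (point \<Rightarrow> nat) set" where
  "wts_at M N A z = {w \<in> wts M N A. z \<in> reg A w}"

text \<open>Defined for every \<open>z\<close>. It is a tile of the mosaic only if the means span
  the plane; otherwise it is an edge, a vertex or empty.\<close>

definition dual_tile :: "nat \<Rightarrow> nat \<Rightarrow> point set \<Rightarrow> point \<Rightarrow> point set" where
  "dual_tile M N A z = convex hull (wpt N ` wts_at M N A z)"

lemma lowpts_wlift:
  assumes "N > 0"
  shows "lowpts (wlift N ` wts M N A) z = wlift N ` wts_at M N A z"
proof (intro equalityI subsetI)
  fix p assume p: "p \<in> lowpts (wlift N ` wts M N A) z"
  then obtain w where "w \<in> wts M N A" "p = wlift N w" by (auto simp: lowpts_def)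
  then show "p \<in> wlift N ` wts_at M N A z" using p reg_iff_lowpts[OF _ assms, of w M A z] by (auto simp: wts_at_def)
next
  fix p assume "p \<in> wlift N ` wts_at M N A z"
  then show "p \<in> lowpts (wlift N ` wts M N A) z" using reg_iff_lowpts[OF _ assms] by (auto simp: wts_at_def)
qed

lemma fst_lowpts_wlift:
  assumes "N > 0"
  shows "fst ` lowpts (wlift N ` wts M N A) z = wpt N ` wts_at M N A z"
  by (simp add: lowpts_wlift[OF assms] image_image)

text \<open>Exchanging two points at the same distance from \<open>z\<close> alters no distance to
  \<open>z\<close>.\<close>

lemma wts_at_swap:
  assumes w: "w \<in> wts_at M N A z" and ab: "a \<in> A" "b \<in> A" "norm (z - a) = norm (z - b)"
  shows "w \<circ> Transposition.transpose a b \<in> wts_at M N A z"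
proof -
  have w': "w \<in> wts M N A" "z \<in> reg A w" using w by (auto simp: wts_at_def)
  have n: "norm (z - Transposition.transpose a b p) = norm (z - p)" for p
    using ab(3) by (simp add: Transposition.transpose_def)
  have i: "Transposition.transpose a b p \<in> A" if "p \<in> A" for p using that ab by (simp add: Transposition.transpose_def)
  have "z \<in> reg A (w \<circ> Transposition.transpose a b)" unfolding reg_def
  proof (intro CollectI ballI impI)
    fix p q assume pq: "p \<in> A" "q \<in> A" "(w \<circ> Transposition.transpose a b) q < (w \<circ> Transposition.transpose a b) p"
    then have "norm (z - Transposition.transpose a b p) \<le> norm (z - Transposition.transpose a b q)"
      by (intro regD[OF w'(2)] i) auto
    then show "norm (z - p) \<le> norm (z - q)" by (simp add: n)
  qed
  then show ?thesis using wts_swap[OF w'(1) ab(1,2)] by (simp add: wts_at_def)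
qed

lemma wpt_swap:
  assumes w: "w \<in> wts M N A" and ab: "a \<in> A" "b \<in> A" "a \<noteq> b"
  shows "wpt N (w \<circ> Transposition.transpose a b) = wpt N w + ((real (w a) - real (w b)) / real N) *\<^sub>R (b - a)"
proof -
  have "wpt N (w \<circ> Transposition.transpose a b) - wpt N w =
      (1 / real N) *\<^sub>R (\<Sum>x\<in>{a, b}. (real ((w \<circ> Transposition.transpose a b) x) - real (w x)) *\<^sub>R x)"
    by (rule wpt_diff(1)[OF w wts_swap[OF w ab(1,2)]]) (auto simp: Transposition.transpose_def)
  also have "\<dots> = (1 / real N) *\<^sub>R ((real (w a) - real (w b)) *\<^sub>R (b - a))"
    using ab(3) by (simp add: algebra_simps)
  also have "\<dots> = ((real (w a) - real (w b)) / real N) *\<^sub>R (b - a)" by simp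
  finally show ?thesis by (simp only: diff_eq_eq add.commute)
qed

lemma convex_cone2: "convex {v + \<alpha> *\<^sub>R r1 + \<beta> *\<^sub>R r2 | \<alpha> \<beta>. \<alpha> \<ge> 0 \<and> \<beta> \<ge> (0::real)}"
proof (rule convexI)
  fix x y and s t :: real
  assume "x \<in> {v + \<alpha> *\<^sub>R r1 + \<beta> *\<^sub>R r2 | \<alpha> \<beta>. \<alpha> \<ge> 0 \<and> \<beta> \<ge> (0::real)}" "y \<in> {v + \<alpha> *\<^sub>R r1 + \<beta> *\<^sub>R r2 | \<alpha> \<beta>. \<alpha> \<ge> 0 \<and> \<beta> \<ge> (0::real)}"
    and st: "0 \<le> s" "0 \<le> t" "s + t = 1"
  then obtain a b a' b' where x: "x = v + a *\<^sub>R r1 + b *\<^sub>R r2" "y = v + a' *\<^sub>R r1 + b' *\<^sub>R r2"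
      "a \<ge> 0" "b \<ge> 0" "a' \<ge> 0" "b' \<ge> 0" by blast
  have "s *\<^sub>R x + t *\<^sub>R y = (s + t) *\<^sub>R v + (s * a + t * a') *\<^sub>R r1 + (s * b + t * b') *\<^sub>R r2"
    unfolding x by (simp add: algebra_simps)
  then have "s *\<^sub>R x + t *\<^sub>R y = v + (s * a + t * a') *\<^sub>R r1 + (s * b + t * b') *\<^sub>R r2" using st by simp
  moreover have "s * a + t * a' \<ge> 0" "s * b + t * b' \<ge> 0" using st x by auto
  ultimately show "s *\<^sub>R x + t *\<^sub>R y \<in> {v + \<alpha> *\<^sub>R r1 + \<beta> *\<^sub>R r2 | \<alpha> \<beta>. \<alpha> \<ge> 0 \<and> \<beta> \<ge> (0::real)}" by blast
qed

context generic_set begin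

text \<open>If all lifts lay in one plane, exchanging a fixed support point \<open>p\<close> with
  any \<open>q\<close> outside the support would give \<open>\<phi> q = \<phi> p\<close>, where
  \<open>\<phi>\<close> is a linear form plus a multiple of the squared norm. Infinitely many points
  of \<open>A\<close> would then lie on a line or on a circle.\<close>

lemma aff_dim_wlift:
  assumes w: "w \<in> wts M N A" and N: "N > 0"
  shows "aff_dim (wlift N ` wts M N A) = 3"
proof (rule ccontr)
  assume "aff_dim (wlift N ` wts M N A) \<noteq> 3"
  then have "aff_dim (wlift N ` wts M N A) < DIM(point \<times> real)"
    using aff_dim_le_DIM[of "wlift N ` wts M N A"] by simp
  then obtain u d where u: "u \<noteq> 0" "wlift N ` wts M N A \<subseteq> {x. u \<bullet> x = d}"
    using aff_lowdim_subset_hyperplane by blast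
  have "supp w \<noteq> {}" using wtsD(4)[OF w] N by auto
  then obtain p where p: "w p > 0" "p \<in> A" using wtsD(2)[OF w] by (auto simp: supp_def)
  define \<phi> where "\<phi> x = fst u \<bullet> x + snd u * (norm x)\<^sup>2" for x
  have const: "\<phi> q = \<phi> p" if q: "q \<in> A - supp w" for q
  proof -
    let ?w = "w \<circ> Transposition.transpose p q"
    let ?S = "insert q (supp w)"
    have ne: "p \<noteq> q" using p q by (auto simp: supp_def)
    have S: "finite ?S" "supp w \<subseteq> ?S" "supp ?w \<subseteq> ?S" "p \<in> ?S"
      using wtsD(1)[OF w] p by (auto simp: supp_def Transposition.transpose_def split: if_splits)
    have val: "u \<bullet> wlift N v = (1 / real N) * (\<Sum>x\<in>?S. real (v x) * \<phi> x)" if "supp v \<subseteq> ?S" for v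
    proof -
      have "u \<bullet> wlift N v = fst u \<bullet> ((1 / real N) *\<^sub>R (\<Sum>x\<in>?S. real (v x) *\<^sub>R x)) +
          snd u * ((1 / real N) * (\<Sum>x\<in>?S. real (v x) * (norm x)\<^sup>2))"
        using wpt_superset[OF S(1) that] sum_supp_superset[OF S(1) that, of "\<lambda>x. real (v x) * (norm x)\<^sup>2"]
        by (simp add: wlift_def inner_prod_def)
      also have "\<dots> = (1 / real N) * ((\<Sum>x\<in>?S. real (v x) * (fst u \<bullet> x)) + (\<Sum>x\<in>?S. real (v x) * (snd u * (norm x)\<^sup>2)))"
        by (simp only: inner_scaleR_right inner_sum_right distrib_left sum_distrib_left mult.assoc mult.left_commute)
      finally show ?thesis by (simp only: \<phi>_def distrib_left sum.distrib)
    qed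
    have "u \<bullet> wlift N w = u \<bullet> wlift N ?w" using u(2) w wts_swap[OF w, of p q] p q by auto
    then have "(\<Sum>x\<in>?S. real (?w x) * \<phi> x) - (\<Sum>x\<in>?S. real (w x) * \<phi> x) = 0"
      using N by (simp add: val[OF S(2)] val[OF S(3)])
    then have "(real (w p) - real (w q)) * (\<phi> q - \<phi> p) = 0"
      using sum_transpose_diff[OF S(1,4) insertI1 ne, of w \<phi>] by simp
    then show ?thesis using p q by (auto simp: supp_def)
  qed
  have inf: "infinite (A - supp w)" using infinite_A wtsD(1)[OF w] by (simp add: Diff_infinite_finite)
  then obtain O' where O': "O' \<subseteq> A - supp w" "card O' = 4" "finite O'"
    using infinite_arbitrarily_large[of "A - supp w" 4] by blast
  show False
  \<comment> \<open>A vertical plane would put three points on a line; any other plane puts four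
    points on a circle around the \<open>z\<close> defined below.\<close>
  proof (cases "snd u = 0")
    case True
    then have nz: "fst u \<noteq> 0" using u(1) by (auto simp: prod_eq_iff)
    have "3 \<le> card O'" using O' by simp
    then obtain T where T: "T \<subseteq> O'" "card T = 3" "finite T" using obtain_subset_with_card_n by metis
    then obtain a b c where abc: "T = {a, b, c}" "a \<noteq> b" "a \<noteq> c" "b \<noteq> c" by (auto simp: card_3_iff)
    have "fst u \<bullet> x = \<phi> p" if "x \<in> T" for x using const[of x] that T O' True by (auto simp: \<phi>_def)
    then have "fst u \<bullet> (b - a) = 0" "fst u \<bullet> (c - a) = 0" using abc by (auto simp: inner_diff_right)
    moreover have "cross2 (b - a) (c - a) \<noteq> 0" using abc T O' by (intro noncollinear) auto
    ultimately show False using orthogonal_both_imp_zero nz by blast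
  next
    case False
    define z where "z = (- 1 / (2 * snd u)) *\<^sub>R fst u"
    have eq: "\<phi> x = snd u * ((norm (z - x))\<^sup>2 - (norm z)\<^sup>2)" for x
    proof -
      have "snd u * ((norm (z - x))\<^sup>2 - (norm z)\<^sup>2) = snd u * (norm x)\<^sup>2 - 2 * snd u * (z \<bullet> x)"
        by (simp add: power2_norm_eq_inner inner_diff_left inner_diff_right inner_commute algebra_simps)
      also have "2 * snd u * (z \<bullet> x) = - (fst u \<bullet> x)" using False by (simp add: z_def)
      finally show ?thesis by (simp add: \<phi>_def)
    qed
    have "norm (z - x) = norm (z - p)" if "x \<in> O'" for x
    proof -
      have "\<phi> x = \<phi> p" using const that O' by blast
      then have "(norm (z - x))\<^sup>2 = (norm (z - p))\<^sup>2" using False by (simp add: eq)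
      then show ?thesis by simp
    qed
    then have "O' \<subseteq> A \<inter> sphere z (norm (z - p))" using O' by (auto simp: dist_norm)
    then have "card O' \<le> card (A \<inter> sphere z (norm (z - p)))" using loc_fin by (intro card_mono) auto
    then show False using O'(2) noncocircular[of z "norm (z - p)"] by simp
  qed
qed

text \<open>With no tight pair at \<open>z\<close> only one weight is seen there. With a circle
  carrying just two points, all weights seen at \<open>z\<close> agree elsewhere, so their means lie
  on a line parallel to the pair. Two dimensions therefore require three points on the
  circle.\<close>

lemma wts_at_corner:
  assumes dim: "aff_dim (wpt N ` wts_at M N A z) = 2" and w: "w \<in> wts_at M N A z"
  obtains a b c where "corner M N A a b c w" "z = circumcenter a b c"
proof -
  have w': "w \<in> wts M N A" "z \<in> reg A w" using w by (auto simp: wts_at_def)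
  have "\<exists>p q. active A w z p q"
  proof (rule ccontr)
    assume "\<not> (\<exists>p q. active A w z p q)"
    then have "z \<in> sreg A w" using w'(2) by (auto simp: sreg_def reg_def active_def less_le)
    then have "wts_at M N A z = {w}" using sreg_reg_unique[OF w'(1)] w by (auto simp: wts_at_def)
    then show False using dim by simp
  qed
  then obtain p q where ac: "active A w z p q" by blast
  have "card (A \<inter> sphere z (norm (z - p))) = 3"
  proof (rule ccontr)
    assume three: "card (A \<inter> sphere z (norm (z - p))) \<noteq> 3"
    have ne: "p \<noteq> q" using ac by (auto simp: active_def)
    let ?n = "rot90 (p - q)"
    have "?n \<bullet> wpt N w' = ?n \<bullet> wpt N w" if w'': "w' \<in> wts_at M N A z" for w'
    proof -
      have w2: "w' \<in> wts M N A" "z \<in> reg A w'" using w'' by (auto simp: wts_at_def)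
      have out: "w' x = w x" if x: "x \<notin> {p, q}" for x
      proof (rule ccontr)
        assume "w' x \<noteq> w x"
        then obtain y where "active A w z x y \<or> active A w z y x"
          using wts_differ_active[OF w'(1) w2(1) w'(2) w2(2), of x] by metis
        then show False using active_two(2)[OF w' ac three] x by blast
      qed
      note d = wpt_diff[where S = "{p, q}", OF w'(1) w2(1) _ out]
      have "(real (w' p) - real (w p)) + (real (w' q) - real (w q)) = 0" using d(2) ne by simp
      then have e: "real (w' q) - real (w q) = - (real (w' p) - real (w p))" by linarith
      have "wpt N w' - wpt N w = (1 / real N) *\<^sub>R ((real (w' p) - real (w p)) *\<^sub>R p + (real (w' q) - real (w q)) *\<^sub>R q)"
        using d(1) ne by simp
      also have "\<dots> = (1 / real N) *\<^sub>R ((real (w' p) - real (w p)) *\<^sub>R (p - q))"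
        unfolding e by (simp add: algebra_simps)
      finally have "?n \<bullet> (wpt N w' - wpt N w) = 0" by (simp add: inner_rot90)
      then show ?thesis by (simp add: inner_diff_right)
    qed
    then have "wpt N ` wts_at M N A z \<subseteq> {y. ?n \<bullet> y = ?n \<bullet> wpt N w}" by blast
    then have "aff_dim (wpt N ` wts_at M N A z) \<le> aff_dim {y. ?n \<bullet> y = ?n \<bullet> wpt N w}" by (rule aff_dim_subset)
    moreover have "?n \<noteq> 0" using ne by (metis norm_rot90 norm_eq_zero right_minus_eq)
    then have "aff_dim {y. ?n \<bullet> y = ?n \<bullet> wpt N w} = 1" by (simp add: aff_dim_hyperplane)
    ultimately show False using dim by simp
  qed
  then show ?thesis using cornerI_active[OF w' ac] that by blast
qed

text \<open>Weights seen from the same circumcenter differ only on the triangle, and equal totals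
  eliminate the change at \<open>a\<close>. Their means are separated by a combination of the two
  edges at \<open>a\<close>.\<close>

lemma corner_wpt_diff:
  assumes c: "corner M N A a b c w" and w': "w' \<in> wts_at M N A (circumcenter a b c)"
  shows "wpt N w' = wpt N w + ((real (w' b) - real (w b)) / real N) *\<^sub>R (b - a) + ((real (w' c) - real (w c)) / real N) *\<^sub>R (c - a)"
    and "x \<notin> {a, b, c} \<Longrightarrow> w' x = w x"
    and "real (w' a) - real (w a) = - (real (w' b) - real (w b)) - (real (w' c) - real (w c))"
proof -
  note d = cornerD[OF c]
  have w2: "w' \<in> wts M N A" "circumcenter a b c \<in> reg A w'" using w' by (auto simp: wts_at_def)
  have out: "w' x = w x" if x: "x \<notin> {a, b, c}" for x
  proof (rule ccontr)
    assume "w' x \<noteq> w x"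
    then obtain y where "active A w (circumcenter a b c) x y \<or> active A w (circumcenter a b c) y x"
      using wts_differ_active[OF d(5) w2(1) d(6) w2(2), of x] by metis
    then show False using corner_active_subset[OF c] x by blast
  qed
  then show "x \<notin> {a, b, c} \<Longrightarrow> w' x = w x" .
  note e = wpt_diff[where S = "{a, b, c}", OF d(5) w2(1) _ out]
  have "(real (w' a) - real (w a)) + ((real (w' b) - real (w b)) + (real (w' c) - real (w c))) = 0"
    using e(2) d(11-13) by simp
  then show ea: "real (w' a) - real (w a) = - (real (w' b) - real (w b)) - (real (w' c) - real (w c))" by linarith
  have "wpt N w' - wpt N w = (1 / real N) *\<^sub>R ((real (w' a) - real (w a)) *\<^sub>R a + ((real (w' b) - real (w b)) *\<^sub>R b + (real (w' c) - real (w c)) *\<^sub>R c))"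
    using e(1) d(11-13) by simp
  also have "\<dots> = (1 / real N) *\<^sub>R ((real (w' b) - real (w b)) *\<^sub>R (b - a) + (real (w' c) - real (w c)) *\<^sub>R (c - a))"
    unfolding ea by (simp add: algebra_simps)
  also have "\<dots> = ((real (w' b) - real (w b)) / real N) *\<^sub>R (b - a) + ((real (w' c) - real (w c)) / real N) *\<^sub>R (c - a)"
    by (simp add: scaleR_add_right)
  finally show "wpt N w' = wpt N w + ((real (w' b) - real (w b)) / real N) *\<^sub>R (b - a) + ((real (w' c) - real (w c)) / real N) *\<^sub>R (c - a)"
    by (simp add: algebra_simps)
qed

lemma corner_wts_at: "corner M N A a b c w \<Longrightarrow> w \<in> wts_at M N A (circumcenter a b c)"
  using cornerD(5,6) by (auto simp: wts_at_def)

text \<open>The apex is equidistant with \<open>b\<close> and with \<open>c\<close> from the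
  circumcenter, so both exchanges stay among the weights seen there and provide a point on each edge
  of the cone.\<close>

lemma corner_neighbours:
  assumes c: "corner M N A a b c w" and N: "N > 0"
  obtains s t where "s > 0" "t > 0"
    "wpt N w + s *\<^sub>R (sgw w a b *\<^sub>R (b - a)) \<in> wpt N ` wts_at M N A (circumcenter a b c)"
    "wpt N w + t *\<^sub>R (sgw w a c *\<^sub>R (c - a)) \<in> wpt N ` wts_at M N A (circumcenter a b c)"
proof -
  note d = cornerD[OF c]
  have *: "\<exists>s>0. wpt N w + s *\<^sub>R (sgw w a x *\<^sub>R (x - a)) \<in> wpt N ` wts_at M N A (circumcenter a b c)"
    if x: "x \<in> A" "a \<noteq> x" "w a \<noteq> w x" "norm (circumcenter a b c - x) = norm (circumcenter a b c - a)" for x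
  proof -
    let ?s = "\<bar>real (w a) - real (w x)\<bar> / real N"
    have "(real (w a) - real (w x)) / real N = ?s * sgw w a x" by (simp add: sgw_def)
    then have "wpt N (w \<circ> Transposition.transpose a x) = wpt N w + ?s *\<^sub>R (sgw w a x *\<^sub>R (x - a))"
      using wpt_swap[OF d(5,1) x(1,2)] by simp
    moreover have "w \<circ> Transposition.transpose a x \<in> wts_at M N A (circumcenter a b c)"
      by (rule wts_at_swap[OF corner_wts_at[OF c] d(1) x(1) x(4)[symmetric]])
    ultimately have "wpt N w + ?s *\<^sub>R (sgw w a x *\<^sub>R (x - a)) \<in> wpt N ` wts_at M N A (circumcenter a b c)"
      by (metis imageI)
    moreover have "?s > 0" using x(3) N by simp
    ultimately show ?thesis by blast
  qed
  show ?thesis using *[OF d(2,11,9,14)] *[OF d(3,12,10,15)] that by blast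
qed

lemma corner_dual_tile:
  assumes c: "corner M N A a b c w" and N: "N > 0"
  shows "interior_angle (dual_tile M N A (circumcenter a b c)) (wpt N w) \<theta> \<longleftrightarrow> \<theta> = corner_angle a b c w"
    and "aff_dim (wpt N ` wts_at M N A (circumcenter a b c)) = 2"
proof -
  note d = cornerD[OF c]
  let ?W = "wts_at M N A (circumcenter a b c)"
  define P Q where "P = sgw w a b *\<^sub>R (b - a)" and "Q = sgw w a c *\<^sub>R (c - a)"
  have cr: "cross2 P Q \<noteq> 0" unfolding P_def Q_def by (rule corner_cross_sgw[OF c])
  obtain s t where st: "s > 0" "t > 0" "wpt N w + s *\<^sub>R P \<in> wpt N ` ?W" "wpt N w + t *\<^sub>R Q \<in> wpt N ` ?W"
    using corner_neighbours[OF c N] unfolding P_def Q_def by blast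
  have v: "wpt N w \<in> wpt N ` ?W" using corner_wts_at[OF c] by blast
  have "aff_dim (wpt N ` ?W) \<ge> 2"
    by (rule aff_dim_ge_2[of "s *\<^sub>R P" "t *\<^sub>R Q"]) (use cr st v in auto)
  then show "aff_dim (wpt N ` ?W) = 2" using aff_dim_le_DIM[of "wpt N ` ?W"] by simp
  have M: "w a \<le> M" by (rule wtsD(3)[OF d(5)])
  \<comment> \<open>Since \<open>w b\<close> and \<open>w c\<close> are extreme values, every other
    weight can change them in one direction only, and this is the direction recorded by
    \<open>sgw\<close>. So the dual tile lies in the cone.\<close>
  have coeff: "\<exists>\<alpha>\<ge>0. ((real (w' x) - real (w x)) / real N) *\<^sub>R (x - a) = \<alpha> *\<^sub>R (sgw w a x *\<^sub>R (x - a))"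
    if x: "w x \<in> {0, M}" "w a \<noteq> w x" and w': "w' \<in> ?W" for x w'
  proof -
    have "w' x \<le> M" using w' wtsD(3)[of w' M N A x] by (simp add: wts_at_def)
    then have "sgw w a x * ((real (w' x) - real (w x)) / real N) \<ge> 0"
      using x M by (auto simp: sgw_def divide_nonpos_nonneg)
    moreover have "(real (w' x) - real (w x)) / real N = (sgw w a x * ((real (w' x) - real (w x)) / real N)) * sgw w a x"
      by (simp add: sgw_def)
    then have "((real (w' x) - real (w x)) / real N) *\<^sub>R (x - a) =
        (sgw w a x * ((real (w' x) - real (w x)) / real N)) *\<^sub>R (sgw w a x *\<^sub>R (x - a))"
      by (metis scaleR_scaleR)
    ultimately show ?thesis by blast
  qed
  have "wpt N ` ?W \<subseteq> {wpt N w + \<alpha> *\<^sub>R P + \<beta> *\<^sub>R Q | \<alpha> \<beta>. \<alpha> \<ge> 0 \<and> \<beta> \<ge> 0}"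
  proof (intro image_subsetI)
    fix w' assume w': "w' \<in> ?W"
    obtain \<alpha> \<beta> where "\<alpha> \<ge> 0" "\<beta> \<ge> 0" "((real (w' b) - real (w b)) / real N) *\<^sub>R (b - a) = \<alpha> *\<^sub>R P"
        "((real (w' c) - real (w c)) / real N) *\<^sub>R (c - a) = \<beta> *\<^sub>R Q"
      using coeff[OF d(7,9) w'] coeff[OF d(8,10) w'] unfolding P_def Q_def by blast
    then show "wpt N w' \<in> {wpt N w + \<alpha> *\<^sub>R P + \<beta> *\<^sub>R Q | \<alpha> \<beta>. \<alpha> \<ge> 0 \<and> \<beta> \<ge> 0}"
      unfolding corner_wpt_diff(1)[OF c w'] by auto
  qed
  then have "dual_tile M N A (circumcenter a b c) \<subseteq> {wpt N w + \<alpha> *\<^sub>R P + \<beta> *\<^sub>R Q | \<alpha> \<beta>. \<alpha> \<ge> 0 \<and> \<beta> \<ge> 0}"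
    unfolding dual_tile_def by (intro hull_minimal convex_cone2)
  then have cone: "\<exists>\<alpha> \<beta>. \<alpha> \<ge> 0 \<and> \<beta> \<ge> 0 \<and> x = wpt N w + \<alpha> *\<^sub>R P + \<beta> *\<^sub>R Q" if "x \<in> dual_tile M N A (circumcenter a b c)" for x
    using that by blast
  have sub: "wpt N ` ?W \<subseteq> dual_tile M N A (circumcenter a b c)" unfolding dual_tile_def by (rule hull_subset)
  have conv: "convex (dual_tile M N A (circumcenter a b c))" by (simp add: dual_tile_def)
  show "interior_angle (dual_tile M N A (circumcenter a b c)) (wpt N w) \<theta> \<longleftrightarrow> \<theta> = corner_angle a b c w"
    unfolding corner_angle_def P_def[symmetric] Q_def[symmetric]
    using interior_angle_cone(1)[OF conv cr _ st(1) _ st(2) _ cone, of \<theta>] sub v st by blast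
qed

section \<open>Angles enumerated by corners\<close>

definition corners :: "nat \<Rightarrow> nat \<Rightarrow> (point \<times> point \<times> point \<times> (point \<Rightarrow> nat)) set" where
  "corners M N = {(a, b, c, w). corner M N A a b c w}"

text \<open>The assumptions bracket the family: it may contain regions with empty
  \<open>sreg\<close>, as \<open>Vor\<close> does, or omit them, as \<open>Bri\<close> does. Such
  regions have no corners and contribute no angles.\<close>

lemma primal_angles:
  assumes "\<T> \<subseteq> {reg A w | w. w \<in> wts M N A}"
    and "\<And>w. w \<in> wts M N A \<Longrightarrow> sreg A w \<noteq> {} \<Longrightarrow> reg A w \<in> \<T>"
  shows "{(Q, v, \<theta>). Q \<in> \<T> \<and> interior_angle Q v \<theta>} =
      (\<lambda>(a, b, c, w). (reg A w, circumcenter a b c, pi - corner_angle a b c w)) ` corners M N"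
    and "inj_on (\<lambda>(a, b, c, w). (reg A w, circumcenter a b c, pi - corner_angle a b c w)) (corners M N)"
proof -
  let ?F = "\<lambda>(a, b, c, w). (reg A w, circumcenter a b c, pi - corner_angle a b c w)"
  show "{(Q, v, \<theta>). Q \<in> \<T> \<and> interior_angle Q v \<theta>} = ?F ` corners M N"
  proof (intro equalityI subsetI)
    fix x assume "x \<in> {(Q, v, \<theta>). Q \<in> \<T> \<and> interior_angle Q v \<theta>}"
    then obtain Q v \<theta> where x: "x = (Q, v, \<theta>)" "Q \<in> \<T>" "interior_angle Q v \<theta>" by auto
    then obtain w where w: "w \<in> wts M N A" "Q = reg A w" using assms(1) by blast
    have "v extreme_point_of (reg A w)" using x w by (simp add: interior_angle_def)
    then obtain a b c where c: "corner M N A a b c w" "v = circumcenter a b c"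
      using extreme_point_of_reg_corner[OF w(1)] by blast
    then have "\<theta> = pi - corner_angle a b c w" using corner_interior_angle[OF c(1), of \<theta>] x w by simp
    then have "x = ?F (a, b, c, w)" using x w c by simp
    then show "x \<in> ?F ` corners M N" using c(1) unfolding corners_def by blast
  next
    fix x assume "x \<in> ?F ` corners M N"
    then obtain a b c w where c: "corner M N A a b c w" "x = ?F (a, b, c, w)" by (auto simp: corners_def)
    have "reg A w \<in> \<T>" using assms(2)[OF cornerD(5)[OF c(1)] corner_sreg_nonempty[OF c(1)]] .
    then show "x \<in> {(Q, v, \<theta>). Q \<in> \<T> \<and> interior_angle Q v \<theta>}" using c corner_interior_angle[OF c(1)] by simp
  qed
  show "inj_on ?F (corners M N)"
  proof (rule inj_onI)
    fix x y assume xy: "x \<in> corners M N" "y \<in> corners M N" "?F x = ?F y"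
    obtain a b c w where x: "x = (a, b, c, w)" "corner M N A a b c w" using xy(1) by (auto simp: corners_def)
    obtain a' b' c' w' where y: "y = (a', b', c', w')" "corner M N A a' b' c' w'" using xy(2) by (auto simp: corners_def)
    have e: "reg A w = reg A w'" "circumcenter a b c = circumcenter a' b' c'" using xy(3) x(1) y(1) by auto
    obtain q where q: "q \<in> sreg A w" using corner_sreg_nonempty[OF x(2)] by blast
    then have "q \<in> reg A w'" using sreg_subset_reg e(1) by blast
    then have "w = w'" using sreg_reg_unique[OF cornerD(5)[OF x(2)] cornerD(5)[OF y(2)] q] by blast
    then show "x = y" using corner_unique[OF x(2), of a' b' c'] y e(2) x(1) by blast
  qed
qed

text \<open>Injectivity needs both coordinates: the tile determines the circumcenter, and among the
  weights seen from it the mean determines the weight because the edges at \<open>a\<close> are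
  independent.\<close>

lemma dual_angles:
  assumes N: "N > 0" and ne: "wts M N A \<noteq> {}"
  shows "{(Q, v, \<theta>). Q \<in> projected_lower_boundary (wlift N ` wts M N A) \<and> interior_angle Q v \<theta>} =
      (\<lambda>(a, b, c, w). (dual_tile M N A (circumcenter a b c), wpt N w, corner_angle a b c w)) ` corners M N"
    and "inj_on (\<lambda>(a, b, c, w). (dual_tile M N A (circumcenter a b c), wpt N w, corner_angle a b c w)) (corners M N)"
proof -
  let ?F = "\<lambda>(a, b, c, w). (dual_tile M N A (circumcenter a b c), wpt N w, corner_angle a b c w)"
  obtain w0 where "w0 \<in> wts M N A" using ne by blast
  then have dim: "aff_dim (wlift N ` wts M N A) = 3" using aff_dim_wlift N by blast
  note tiles = projected_lower_boundary_eq[OF dim, unfolded fst_lowpts_wlift[OF N], folded dual_tile_def]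
  show "{(Q, v, \<theta>). Q \<in> projected_lower_boundary (wlift N ` wts M N A) \<and> interior_angle Q v \<theta>} = ?F ` corners M N"
  proof (intro equalityI subsetI)
    fix x assume "x \<in> {(Q, v, \<theta>). Q \<in> projected_lower_boundary (wlift N ` wts M N A) \<and> interior_angle Q v \<theta>}"
    then obtain v \<theta> z where x: "x = (dual_tile M N A z, v, \<theta>)" "aff_dim (wpt N ` wts_at M N A z) = 2"
        "interior_angle (dual_tile M N A z) v \<theta>" unfolding tiles by auto
    have "v extreme_point_of (dual_tile M N A z)" using x by (simp add: interior_angle_def)
    then have "v \<in> wpt N ` wts_at M N A z" unfolding dual_tile_def by (rule extreme_point_of_convex_hull)
    then obtain w where w: "w \<in> wts_at M N A z" "v = wpt N w" by blast
    obtain a b c where c: "corner M N A a b c w" "z = circumcenter a b c" using wts_at_corner[OF x(2) w(1)] .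
    then have "\<theta> = corner_angle a b c w" using corner_dual_tile(1)[OF c(1) N, of \<theta>] x w by simp
    then have "x = ?F (a, b, c, w)" using x w c by simp
    then show "x \<in> ?F ` corners M N" using c(1) unfolding corners_def by blast
  next
    fix x assume "x \<in> ?F ` corners M N"
    then obtain a b c w where c: "corner M N A a b c w" "x = ?F (a, b, c, w)" by (auto simp: corners_def)
    show "x \<in> {(Q, v, \<theta>). Q \<in> projected_lower_boundary (wlift N ` wts M N A) \<and> interior_angle Q v \<theta>}"
      unfolding tiles using c(2) corner_dual_tile[OF c(1) N] by auto
  qed
  show "inj_on ?F (corners M N)"
  proof (rule inj_onI)
    fix x y assume xy: "x \<in> corners M N" "y \<in> corners M N" "?F x = ?F y"
    obtain a b c w where x: "x = (a, b, c, w)" "corner M N A a b c w" using xy(1) by (auto simp: corners_def)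
    obtain a' b' c' w' where y: "y = (a', b', c', w')" "corner M N A a' b' c' w'" using xy(2) by (auto simp: corners_def)
    have e: "dual_tile M N A (circumcenter a b c) = dual_tile M N A (circumcenter a' b' c')" "wpt N w = wpt N w'"
      using xy(3) x(1) y(1) by auto
    \<comment> \<open>A two-dimensional projected tile determines the slope of the facet above
      it.\<close>
    have z: "circumcenter a b c = circumcenter a' b' c'"
      by (rule lowpts_tile_inj[of "wlift N ` wts M N A"])
        (use e(1) corner_dual_tile(2)[OF x(2) N] in \<open>simp_all add: fst_lowpts_wlift[OF N] dual_tile_def\<close>)
    have w': "w' \<in> wts_at M N A (circumcenter a b c)" using corner_wts_at[OF y(2)] z by simp
    note d = corner_wpt_diff[OF x(2) w']
    have "((real (w' b) - real (w b)) / real N) *\<^sub>R (b - a) + ((real (w' c) - real (w c)) / real N) *\<^sub>R (c - a) = 0"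
      using d(1) e(2) by (simp add: add.assoc)
    then have "(real (w' b) - real (w b)) / real N = 0" "(real (w' c) - real (w c)) / real N = 0"
      using cross2_independent[of "b - a" "c - a"] cornerD(4)[OF x(2)] by (metis less_irrefl)+
    then have bc: "w' b = w b" "w' c = w c" using N by simp_all
    then have "w' a = w a" using d(3) by simp
    have "w' p = w p" for p using d(2)[of p] bc \<open>w' a = w a\<close> by blast
    then have "w = w'" by auto
    then show "x = y" using corner_unique[OF x(2), of a' b' c'] y z x(1) by blast
  qed
qed

end

section \<open>The four tilings in terms of weights\<close>

lemma supp_of_bool [simp]: "supp (\<lambda>p. of_bool (p \<in> B)) = B"
  by (auto simp: supp_def)

lemma wts_1_eq: "wts 1 k A = {\<lambda>p. of_bool (p \<in> B) | B. B \<subseteq> A \<and> finite B \<and> card B = k}"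
proof (intro equalityI subsetI)
  fix w assume w: "w \<in> wts 1 k A"
  have eq: "w = (\<lambda>p. of_bool (p \<in> supp w))"
  proof
    fix p show "w p = of_bool (p \<in> supp w)" using wtsD(3)[OF w, of p] by (auto simp: supp_def)
  qed
  then have "sum w (supp w) = (\<Sum>p\<in>supp w. of_bool (p \<in> supp w))" by metis
  then have "card (supp w) = k" using wtsD(4)[OF w] by simp
  then show "w \<in> {\<lambda>p. of_bool (p \<in> B) | B. B \<subseteq> A \<and> finite B \<and> card B = k}"
    using wtsD(1,2)[OF w] eq by blast
qed (auto simp: wts_def)

lemma reg_of_bool:
  assumes "B \<subseteq> A"
  shows "reg A (\<lambda>p. of_bool (p \<in> B)) = dom_region A B"
  using assms by (auto simp: reg_def dom_region_def)

lemma Vor_eq: "Vor k A = {reg A w | w. w \<in> wts 1 k A}"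
  unfolding Vor_def wts_1_eq using reg_of_bool by blast

lemma Del_eq: "Del k A = projected_lower_boundary (wlift k ` wts 1 k A)"
proof -
  have "wlift k (\<lambda>p. of_bool (p \<in> B)) = ((1 / real k) *\<^sub>R (\<Sum>a\<in>B. a), (1 / real k) * (\<Sum>a\<in>B. (norm a)\<^sup>2))" for B
    by (simp add: wlift_def wpt_def)
  moreover have "wlift k ` wts 1 k A = {wlift k (\<lambda>p. of_bool (p \<in> B)) | B. B \<subseteq> A \<and> finite B \<and> card B = k}"
    unfolding wts_1_eq by blast
  ultimately show ?thesis unfolding Del_def by simp
qed

definition wts2 :: "'a set \<Rightarrow> 'a \<Rightarrow> 'a \<Rightarrow> nat" where
  "wts2 B b = (\<lambda>p. if p = b then 1 else if p \<in> B then 2 else 0)"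

lemma wts_2_eq:
  assumes k: "k \<ge> 1"
  shows "wts 2 (2 * k - 1) A = {wts2 B b | B b. B \<subseteq> A \<and> finite B \<and> card B = k \<and> b \<in> B}"
proof (intro equalityI subsetI)
  fix w assume w: "w \<in> wts 2 (2 * k - 1) A"
  note d = wtsD[OF w]
  \<comment> \<open>The total is odd and the values are 0, 1, 2, so the value 1 occurs; by the
    condition on intermediate values it occurs once.\<close>
  have "odd (sum w (supp w))" using d(4) k by simp
  then obtain b where b: "b \<in> supp w" "odd (w b)" by (meson dvd_sum)
  then have wb: "w b = 1" using d(3)[of b] by (cases "w b = 2") (auto simp: le_Suc_eq numeral_2_eq_2)
  have wp: "w p = 2" if "p \<in> supp w" "p \<noteq> b" for p
  proof (rule ccontr)
    assume "w p \<noteq> 2"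
    then have "0 < w p" "w p < 2" using d(3)[of p] that by (auto simp: supp_def)
    then have "p = b" by (rule d(5)) (simp_all add: wb)
    then show False using that by simp
  qed
  have eq: "w = wts2 (supp w) b"
  proof
    fix p show "w p = wts2 (supp w) b p" using wb wp[of p] by (cases "p \<in> supp w") (auto simp: wts2_def supp_def)
  qed
  have "2 * k - 1 = w b + sum w (supp w - {b})" using sum.remove[OF d(1) b(1), of w] d(4) by simp
  also have "sum w (supp w - {b}) = 2 * card (supp w - {b})" using wp by simp
  also have "card (supp w - {b}) = card (supp w) - 1" using b d(1) by simp
  finally have "2 * k - 1 = 1 + 2 * (card (supp w) - 1)" using wb by simp
  moreover have "card (supp w) > 0" using b d(1) by (metis card_gt_0_iff empty_iff)
  ultimately have "card (supp w) = k" using k by linarith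
  then show "w \<in> {wts2 B b | B b. B \<subseteq> A \<and> finite B \<and> card B = k \<and> b \<in> B}"
    using d(1,2) b eq by blast
next
  fix w assume "w \<in> {wts2 B b | B b. B \<subseteq> A \<and> finite B \<and> card B = k \<and> b \<in> B}"
  then obtain B b where B: "w = wts2 B b" "B \<subseteq> A" "finite B" "card B = k" "b \<in> B" by blast
  have s: "supp w = B" using B by (auto simp: supp_def wts2_def)
  have "sum w B = w b + sum w (B - {b})" using B by (simp add: sum.remove)
  also have "sum w (B - {b}) = 2 * (k - 1)" using B by (simp add: wts2_def)
  finally have "sum w B = 2 * k - 1" using B k by (simp add: wts2_def)
  then show "w \<in> wts 2 (2 * k - 1) A" using B s unfolding wts_def by (auto simp: wts2_def)
qed

lemma Igl_eq:
  assumes k: "k \<ge> 1"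
  shows "Igl k A = projected_lower_boundary (wlift (2 * k - 1) ` wts 2 (2 * k - 1) A)"
proof -
  have *: "wlift (2 * k - 1) (wts2 B b) =
     ((1 / (2 * real k - 1)) *\<^sub>R b + (2 / (2 * real k - 1)) *\<^sub>R (\<Sum>a\<in>B - {b}. a),
       (1 / (2 * real k - 1)) * (norm b)\<^sup>2 + (2 / (2 * real k - 1)) * (\<Sum>a\<in>B - {b}. (norm a)\<^sup>2))"
    if B: "finite B" "b \<in> B" for B b
  proof -
    have s: "supp (wts2 B b) = B" using B by (auto simp: supp_def wts2_def)
    have rk: "real (2 * k - 1) = 2 * real k - 1" using k by simp
    have 1: "(\<Sum>p\<in>B. real (wts2 B b p) *\<^sub>R p) = b + 2 *\<^sub>R (\<Sum>a\<in>B - {b}. a)"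
      using B by (simp add: sum.remove[of B b] wts2_def scaleR_sum_right)
    have 2: "(\<Sum>p\<in>B. real (wts2 B b p) * (norm p)\<^sup>2) = (norm b)\<^sup>2 + 2 * (\<Sum>a\<in>B - {b}. (norm a)\<^sup>2)"
      using B by (simp add: sum.remove[of B b] wts2_def sum_distrib_left)
    show ?thesis unfolding wlift_def wpt_def s rk 1 2 by (simp add: scaleR_add_right distrib_left)
  qed
  have "{((1 / (2 * real k - 1)) *\<^sub>R b + (2 / (2 * real k - 1)) *\<^sub>R (\<Sum>a\<in>B - {b}. a),
       (1 / (2 * real k - 1)) * (norm b)\<^sup>2 + (2 / (2 * real k - 1)) * (\<Sum>a\<in>B - {b}. (norm a)\<^sup>2)) | B b.
       B \<subseteq> A \<and> finite B \<and> card B = k \<and> b \<in> B} = wlift (2 * k - 1) ` wts 2 (2 * k - 1) A"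
    unfolding wts_2_eq[OF k] using * by (auto simp: image_iff) (metis+)
  then show ?thesis unfolding Igl_def by simp
qed

section \<open>Brillouin tiles as closures of open regions\<close>

lemma components_disjoint_open:
  fixes S :: "'i \<Rightarrow> 'a::real_normed_vector set"
  assumes op: "\<And>i. i \<in> I \<Longrightarrow> open (S i)" and con: "\<And>i. i \<in> I \<Longrightarrow> connected (S i)"
    and ne: "\<And>i. i \<in> I \<Longrightarrow> S i \<noteq> {}"
    and dis: "\<And>i j. i \<in> I \<Longrightarrow> j \<in> I \<Longrightarrow> i \<noteq> j \<Longrightarrow> S i \<inter> S j = {}"
  shows "components (\<Union>i\<in>I. S i) = S ` I"
proof -
  let ?U = "\<Union>i\<in>I. S i"
  have comp: "connected_component_set ?U x = S i" if i: "i \<in> I" "x \<in> S i" for x i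
  proof
    show "S i \<subseteq> connected_component_set ?U x" using i con by (intro connected_component_maximal) auto
    let ?C = "connected_component_set ?U x" and ?V = "\<Union>j\<in>I - {i}. S j"
    have "?C \<subseteq> S i \<union> ?V" using connected_component_subset[of ?U x] by blast
    moreover have "S i \<inter> ?V = {}" using dis i by blast
    moreover have "x \<in> S i \<inter> ?C" using i by (auto intro: connected_component_refl)
    moreover have "open (S i)" "open ?V" using op i by auto
    ultimately have "?V \<inter> ?C = {}"
      using connectedD[OF connected_connected_component, of "S i" ?V ?U x] by blast
    then show "?C \<subseteq> S i" using \<open>?C \<subseteq> S i \<union> ?V\<close> by blast
  qed
  show ?thesis
  proof (intro equalityI subsetI)
    fix C assume "C \<in> components ?U"
    then obtain x where "x \<in> ?U" "C = connected_component_set ?U x" by (auto simp: components_iff)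
    then show "C \<in> S ` I" using comp by blast
  next
    fix C assume "C \<in> S ` I"
    then obtain i where i: "i \<in> I" "C = S i" by blast
    then obtain x where "x \<in> S i" using ne by blast
    then show "C \<in> components ?U" using comp[OF i(1)] i by (auto simp: components_iff)
  qed
qed

text \<open>On the segment from a strict point to any point of the region all inequalities are
  strict, except perhaps at the far end.\<close>

lemma closure_sreg:
  assumes "sreg A w \<noteq> {}"
  shows "closure (sreg A w) = reg A w"
proof
  show "closure (sreg A w) \<subseteq> reg A w" by (rule closure_minimal[OF sreg_subset_reg closed_reg])
  obtain x where x: "x \<in> sreg A w" using assms by blast
  show "reg A w \<subseteq> closure (sreg A w)"
  proof
    fix y assume y: "y \<in> reg A w"
    show "y \<in> closure (sreg A w)"
    proof (cases "x = y")
      case True then show ?thesis using x closure_subset by blast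
    next
      case False
      have "open_segment x y \<subseteq> sreg A w"
      proof
        fix v assume "v \<in> open_segment x y"
        then obtain t where t: "0 < t" "t < 1" "v = (1 - t) *\<^sub>R x + t *\<^sub>R y" by (auto simp: in_segment)
        show "v \<in> sreg A w" unfolding sreg_def
        proof (intro CollectI ballI impI)
          fix p q assume pq: "p \<in> A" "q \<in> A" "w q < w p"
          have 1: "2 * ((q - p) \<bullet> x) < q \<bullet> q - p \<bullet> p"
            using x pq unfolding norm_le_norm_iff_inner(2)[symmetric] by (auto simp: sreg_def)
          have 2: "2 * ((q - p) \<bullet> y) \<le> q \<bullet> q - p \<bullet> p"
            using regD[OF y pq] unfolding norm_le_norm_iff_inner(1)[symmetric] .
          have "2 * ((q - p) \<bullet> v) = (1 - t) * (2 * ((q - p) \<bullet> x)) + t * (2 * ((q - p) \<bullet> y))"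
            unfolding t(3) inner_add_right inner_scaleR_right by (simp add: algebra_simps)
          also have "\<dots> < (1 - t) * (q \<bullet> q - p \<bullet> p) + t * (q \<bullet> q - p \<bullet> p)"
            using 1 2 t by (intro add_less_le_mono mult_strict_left_mono mult_left_mono) auto
          also have "\<dots> = q \<bullet> q - p \<bullet> p" by (simp add: algebra_simps)
          finally show "norm (v - p) < norm (v - q)" unfolding norm_le_norm_iff_inner(2) .
        qed
      qed
      then have "closure (open_segment x y) \<subseteq> closure (sreg A w)" by (rule closure_mono)
      then show ?thesis using False by (auto simp: closure_open_segment)
    qed
  qed
qed

context generic_set begin

text \<open>Nearest points are added one at a time; local finiteness provides a nearest remaining
  point and infinity of \<open>A\<close> ensures that one remains.\<close>

lemma ex_wts_1_reg: "\<exists>w\<in>wts 1 m A. y \<in> reg A w"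
proof -
  have "\<exists>B. B \<subseteq> A \<and> finite B \<and> card B = m \<and> y \<in> dom_region A B"
  proof (induction m)
    case 0
    show ?case by (rule exI[of _ "{}"]) (simp add: dom_region_def)
  next
    case (Suc m)
    then obtain B where B: "B \<subseteq> A" "finite B" "card B = m" "y \<in> dom_region A B" by blast
    have "infinite (A - B)" using infinite_A B(2) by (simp add: Diff_infinite_finite)
    then have "A - B \<noteq> {}" by (metis finite.emptyI)
    then obtain x0 where x0: "x0 \<in> A - B" by blast
    let ?S = "(A - B) \<inter> cball y (norm (y - x0))"
    have fin: "finite ?S" using loc_fin[of "cball y (norm (y - x0))"] by (rule rev_finite_subset) auto
    have "x0 \<in> ?S" using x0 by (auto simp: dist_norm)
    then obtain a where "is_arg_min (\<lambda>x. norm (y - x)) (\<lambda>x. x \<in> ?S) a"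
      using ex_is_arg_min_if_finite[OF fin, of "\<lambda>x. norm (y - x)"] by blast
    then have a: "a \<in> ?S" "\<And>x. x \<in> ?S \<Longrightarrow> norm (y - a) \<le> norm (y - x)"
      unfolding is_arg_min_linorder by blast+
    have "norm (y - a) \<le> norm (y - x)" if "x \<in> A - B" for x
    proof (cases "x \<in> ?S")
      case False
      then have "norm (y - x0) < norm (y - x)" using that by (auto simp: dist_norm)
      then show ?thesis using a(2)[OF \<open>x0 \<in> ?S\<close>] by linarith
    qed (rule a(2))
    then have "y \<in> dom_region A (insert a B)" using B(4) by (auto simp: dom_region_def)
    moreover have "insert a B \<subseteq> A" "finite (insert a B)" "card (insert a B) = Suc m" using a(1) B by auto
    ultimately show ?case by blast
  qed
  then show ?thesis unfolding wts_1_eq using reg_of_bool by blast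
qed

text \<open>Open regions are disjoint from all other regions and consist of interior points of their
  own, so no edge meets them. Conversely, a point that is strict for no weight has a tight pair for
  a weight that sees it, and lies on an edge: at a corner, or on a bisector through it.\<close>

lemma edge_union_Vor:
  "edge_union (Vor m A) = {y. \<forall>w\<in>wts 1 m A. y \<notin> sreg A w}"
proof (intro equalityI subsetI)
  fix y assume "y \<in> edge_union (Vor m A)"
  then obtain e w where e: "w \<in> wts 1 m A" "e edge_of (reg A w)" "y \<in> e"
    unfolding edge_union_def Vor_eq by blast
  have "y \<notin> sreg A w'" if w': "w' \<in> wts 1 m A" for w'
  proof
    assume y: "y \<in> sreg A w'"
    have "y \<in> reg A w" using e edge_of_imp_subset by blast
    then have "w' = w" using sreg_reg_unique[OF w' e(1) y] by blast
    then have "y \<in> sreg A w" using y by simp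
    then have yi: "y \<in> interior (reg A w)"
      using interior_maximal[OF sreg_subset_reg open_sreg[OF e(1)]] by blast
    then have "aff_dim (reg A w) = 2" using aff_dim_nonempty_interior[of "reg A w"] by auto
    then have "e \<noteq> reg A w" "e face_of reg A w" using e(2) by (auto simp: edge_of_def)
    then have "e \<inter> interior (reg A w) = {}" by (intro face_of_disjoint_interior)
    then show False using yi e(3) by blast
  qed
  then show "y \<in> {y. \<forall>w\<in>wts 1 m A. y \<notin> sreg A w}" by blast
next
  fix y assume y: "y \<in> {y. \<forall>w\<in>wts 1 m A. y \<notin> sreg A w}"
  obtain w where w: "w \<in> wts 1 m A" "y \<in> reg A w" using ex_wts_1_reg by blast
  then have "y \<notin> sreg A w" using y by blast
  then obtain p q where ac: "active A w y p q"
    using w(2) unfolding sreg_def reg_def active_def by (auto simp: less_le)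
  have "\<exists>e. e edge_of (reg A w) \<and> y \<in> e"
  proof (cases "card (A \<inter> sphere y (norm (y - p))) = 3")
    case True
    obtain a b c where c: "corner 1 m A a b c w" "y = circumcenter a b c" using cornerI_active[OF w ac True] .
    then have "interior_angle (reg A w) y (pi - corner_angle a b c w)" using corner_interior_angle by simp
    then show ?thesis by (auto simp: interior_angle_def)
  next
    case False
    obtain u where u: "u \<noteq> 0" "u \<bullet> (q - p) = 0" "y + u \<in> reg A w" "y - u \<in> reg A w"
      using active_two_line[OF w ac False] .
    let ?e = "reg A w \<inter> {x. (q - p) \<bullet> x = (q - p) \<bullet> y}"
    have pq: "p \<in> A" "q \<in> A" "w q < w p" "norm (y - p) = norm (y - q)" using ac by (auto simp: active_def)
    have "(q - p) \<bullet> x \<le> (q - p) \<bullet> y" if "x \<in> reg A w" for x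
      using regD[OF that pq(1-3)] unfolding norm_le_norm_iff_bisector(1)[OF pq(4)] by (simp add: inner_diff_right)
    then have face: "?e face_of reg A w" by (intro face_of_Int_supporting_hyperplane_le convex_reg)
    have "aff_dim ?e \<le> aff_dim {x. (q - p) \<bullet> x = (q - p) \<bullet> y}" by (rule aff_dim_subset) auto
    also have "\<dots> = 1" using pq(3) by (subst aff_dim_hyperplane) auto
    finally have "aff_dim ?e \<le> 1" .
    moreover have "{y, y + u} \<subseteq> ?e" using u w by (auto simp: inner_add_right inner_commute)
    then have "aff_dim {y, y + u} \<le> aff_dim ?e" by (rule aff_dim_subset)
    then have "1 \<le> aff_dim ?e" using u(1) by (simp add: aff_dim_2)
    ultimately have "?e edge_of reg A w" using face by (simp add: edge_of_def)
    then show ?thesis using w by blast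
  qed
  then show "y \<in> edge_union (Vor m A)" unfolding edge_union_def Vor_eq using w by blast
qed

text \<open>Off all edges the \<open>k - 1\<close> nearest points and the \<open>k\<close> nearest
  points are both unambiguous and nested. The weight that is 2 on the smaller set and 1 on the
  remaining point records both orders at once.\<close>

lemma Bri_eq:
  assumes k: "k \<ge> 1"
  shows "Bri k A = {reg A w | w. w \<in> wts 2 (2 * k - 1) A \<and> sreg A w \<noteq> {}}"
proof -
  let ?I = "{w \<in> wts 2 (2 * k - 1) A. sreg A w \<noteq> {}}"
  have "- (edge_union (Vor (k - 1) A) \<union> edge_union (Vor k A)) = (\<Union>w\<in>?I. sreg A w)"
  proof (intro equalityI subsetI)
    fix y assume "y \<in> - (edge_union (Vor (k - 1) A) \<union> edge_union (Vor k A))"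
    then obtain w1 w2 where w12: "w1 \<in> wts 1 (k - 1) A" "w2 \<in> wts 1 k A" "y \<in> sreg A w1" "y \<in> sreg A w2"
      unfolding edge_union_Vor by blast
    then obtain B1 B2 where B: "w1 = (\<lambda>p. of_bool (p \<in> B1))" "B1 \<subseteq> A" "finite B1" "card B1 = k - 1"
        "w2 = (\<lambda>p. of_bool (p \<in> B2))" "B2 \<subseteq> A" "finite B2" "card B2 = k"
      unfolding wts_1_eq by blast
    have y1: "norm (y - p) < norm (y - q)" if "p \<in> B1" "q \<in> A - B1" for p q
      using w12(3) that B(2) unfolding B(1) sreg_def by auto
    have y2: "norm (y - p) < norm (y - q)" if "p \<in> B2" "q \<in> A - B2" for p q
      using w12(4) that B(6) unfolding B(5) sreg_def by auto
    \<comment> \<open>Points of \<open>B1 - B2\<close> and \<open>B2 - B1\<close> would each be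
      strictly nearer than the other.\<close>
    have "B1 \<subseteq> B2"
    proof (rule ccontr)
      assume "\<not> B1 \<subseteq> B2"
      then obtain p where p: "p \<in> B1" "p \<notin> B2" by blast
      have "\<not> B2 \<subseteq> B1" using card_mono[OF B(3), of B2] B(4,8) k by auto
      then obtain q where q: "q \<in> B2" "q \<notin> B1" by blast
      have "p \<in> A" "q \<in> A" using p q B(2,6) by auto
      then show False using y1[of p q] y2[of q p] p q by auto
    qed
    moreover have "card (B2 - B1) = 1" using calculation B k by (simp add: card_Diff_subset)
    then obtain b where b: "B2 - B1 = {b}" by (auto simp: card_1_singleton_iff)
    ultimately have B1: "B1 = B2 - {b}" "b \<in> B2" by auto
    have "wts2 B2 b \<in> wts 2 (2 * k - 1) A" unfolding wts_2_eq[OF k] using B B1 by blast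
    moreover have "y \<in> sreg A (wts2 B2 b)" unfolding sreg_def
    proof (intro CollectI ballI impI)
      fix p q assume pq: "p \<in> A" "q \<in> A" "wts2 B2 b q < wts2 B2 b p"
      then consider "p \<in> B1" "q \<notin> B1" | "p \<in> B2" "q \<notin> B2"
        using B1 by (auto simp: wts2_def split: if_splits)
      then show "norm (y - p) < norm (y - q)" using y1 y2 pq by cases auto
    qed
    ultimately show "y \<in> (\<Union>w\<in>?I. sreg A w)" by blast
  next
    fix y assume "y \<in> (\<Union>w\<in>?I. sreg A w)"
    then obtain B b where B: "B \<subseteq> A" "finite B" "card B = k" "b \<in> B" "y \<in> sreg A (wts2 B b)"
      unfolding wts_2_eq[OF k] by blast
    have y: "norm (y - p) < norm (y - q)" if "p \<in> A" "q \<in> A" "wts2 B b q < wts2 B b p" for p q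
      using B(5) that unfolding sreg_def by blast
    have "(\<lambda>p. of_bool (p \<in> B)) \<in> wts 1 k A" unfolding wts_1_eq using B by blast
    moreover have "y \<in> sreg A (\<lambda>p. of_bool (p \<in> B))" unfolding sreg_def
      using B(4) by (auto intro!: y simp: wts2_def)
    ultimately have 1: "y \<notin> edge_union (Vor k A)" unfolding edge_union_Vor by blast
    have "B - {b} \<subseteq> A" "finite (B - {b})" "card (B - {b}) = k - 1" using B by auto
    then have "(\<lambda>p. of_bool (p \<in> B - {b})) \<in> wts 1 (k - 1) A" unfolding wts_1_eq by blast
    moreover have "y \<in> sreg A (\<lambda>p. of_bool (p \<in> B - {b}))" unfolding sreg_def
      by (auto intro!: y simp: wts2_def)
    ultimately have 2: "y \<notin> edge_union (Vor (k - 1) A)" unfolding edge_union_Vor by blast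
    show "y \<in> - (edge_union (Vor (k - 1) A) \<union> edge_union (Vor k A))" using 1 2 by blast
  qed
  moreover have "components (\<Union>w\<in>?I. sreg A w) = sreg A ` ?I"
  proof (rule components_disjoint_open)
    show "sreg A i \<inter> sreg A j = {}" if "i \<in> ?I" "j \<in> ?I" "i \<noteq> j" for i j
      using sreg_reg_unique[of i 2 "2 * k - 1" A j] sreg_subset_reg that by blast
  qed (auto intro: open_sreg convex_connected convex_sreg)
  ultimately have "Bri k A = (\<lambda>w. closure (sreg A w)) ` ?I"
    unfolding Bri_def overlay_def by (simp add: image_image)
  also have "\<dots> = reg A ` ?I" by (intro image_cong) (auto simp: closure_sreg)
  finally show ?thesis by blast
qed

end

section \<open>The Mecke formula\<close>

abbreviation tuple_space :: "nat \<Rightarrow> (nat \<Rightarrow> point) measure" where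
  "tuple_space n \<equiv> PiM {..<n} (\<lambda>_. lborel)"

definition tuples :: "nat \<Rightarrow> 'a set \<Rightarrow> (nat \<Rightarrow> 'a) set" where
  "tuples n A = {x \<in> {..<n} \<rightarrow>\<^sub>E A. inj_on x {..<n}}"

text \<open>The only functional of the remaining points that is needed is emptiness: apart from the
  entries of the tuple, no point of \<open>A\<close> lies in \<open>D x\<close>. For this case the
  counting laws of the locale suffice.\<close>

definition tset :: "nat \<Rightarrow> point set \<Rightarrow> ((nat \<Rightarrow> point) \<Rightarrow> point set) \<Rightarrow> (nat \<Rightarrow> point) set \<Rightarrow> (nat \<Rightarrow> point) set" where
  "tset n A D X = {x \<in> tuples n A. x \<in> X \<and> A \<inter> D x \<subseteq> x ` {..<n}}"

interpretation lborel_product: product_sigma_finite "\<lambda>_::nat. lborel :: point measure"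
  by standard

lemma sets_tuple_space:
  "sets (tuple_space n) = sigma_sets ({..<n} \<rightarrow>\<^sub>E UNIV) {PiE {..<n} X | X. X \<in> {..<n} \<rightarrow> sets borel}"
  by (simp add: sets_PiM prod_algebra_eq_finite)

lemma sums_poisson_mean: "(\<lambda>m. real m * (l ^ m / fact m * exp (- l))) sums l"
proof -
  have "(\<lambda>m. l * exp (- l) * (l ^ m /\<^sub>R fact m)) sums (l * exp (- l) * exp l)"
    by (intro sums_mult exp_converges)
  then have "(\<lambda>m. real (Suc m) * (l ^ Suc m / fact (Suc m) * exp (- l))) sums l"
    by (simp add: exp_minus field_simps del: of_nat_Suc)
  then show ?thesis using sums_Suc[of "\<lambda>m. real m * (l ^ m / fact m * exp (- l))" l] by simp
qed

section \<open>Poisson counts and tuples from separated rectangles\<close>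

context stationary_poisson_process begin

abbreviation Ncount :: "point set \<Rightarrow> 'w \<Rightarrow> nat" where "Ncount B \<omega> \<equiv> card (A \<omega> \<inter> B)"

lemma nn_integral_count:
  fixes f :: "nat \<Rightarrow> ennreal"
  assumes B: "B \<in> sets borel" "bounded B"
  shows "(\<integral>\<^sup>+\<omega>. f (Ncount B \<omega>) \<partial>M) =
    (\<Sum>m. f m * ennreal ((\<rho> * measure lborel B) ^ m / fact m * exp (- (\<rho> * measure lborel B))))"
proof -
  have [measurable]: "random_variable (count_space UNIV) (Ncount B)" by (rule count_measurable[OF B])
  have "f (Ncount B \<omega>) = (\<Sum>m. f m * indicator {\<omega> \<in> space M. Ncount B \<omega> = m} \<omega>)" if "\<omega> \<in> space M" for \<omega>
  proof -
    have "(\<Sum>m. f m * indicator {\<omega> \<in> space M. Ncount B \<omega> = m} \<omega>) = (\<Sum>m\<in>{Ncount B \<omega>}. f m * indicator {\<omega> \<in> space M. Ncount B \<omega> = m} \<omega>)"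
      by (rule suminf_finite) auto
    then show ?thesis using that by simp
  qed
  then have "(\<integral>\<^sup>+\<omega>. f (Ncount B \<omega>) \<partial>M) = (\<integral>\<^sup>+\<omega>. (\<Sum>m. f m * indicator {\<omega> \<in> space M. Ncount B \<omega> = m} \<omega>) \<partial>M)"
    by (intro nn_integral_cong) auto
  also have "\<dots> = (\<Sum>m. \<integral>\<^sup>+\<omega>. f m * indicator {\<omega> \<in> space M. Ncount B \<omega> = m} \<omega> \<partial>M)"
    by (intro nn_integral_suminf) measurable
  also have "\<dots> = (\<Sum>m. f m * emeasure M {\<omega> \<in> space M. Ncount B \<omega> = m})"
    by (intro suminf_cong nn_integral_cmult_indicator) measurable
  finally show ?thesis by (simp add: emeasure_eq_measure count_poisson[OF B])
qed

lemma count_mean: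
  assumes B: "B \<in> sets borel" "bounded B"
  shows "(\<integral>\<^sup>+\<omega>. of_nat (Ncount B \<omega>) \<partial>M) = ennreal (\<rho> * measure lborel B)"
proof -
  let ?l = "\<rho> * measure lborel B"
  have l: "?l \<ge> 0" using intensity_pos by simp
  have "(\<integral>\<^sup>+\<omega>. of_nat (Ncount B \<omega>) \<partial>M) = (\<Sum>m. of_nat m * ennreal (?l ^ m / fact m * exp (- ?l)))"
    by (rule nn_integral_count[OF B])
  also have "\<dots> = (\<Sum>m. ennreal (real m * (?l ^ m / fact m * exp (- ?l))))"
  proof (intro suminf_cong)
    have *: "of_nat m * ennreal r = ennreal (real m * r)" for m r
      by (simp add: ennreal_mult' ennreal_of_nat_eq_real_of_nat)
    show "of_nat m * ennreal (?l ^ m / fact m * exp (- ?l)) = ennreal (real m * (?l ^ m / fact m * exp (- ?l)))" for m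
      by (rule *)
  qed
  also have "\<dots> = ennreal ?l"
    using l by (intro suminf_ennreal_eq sums_poisson_mean) auto
  finally show ?thesis .
qed

lemma count_indicator:
  assumes B: "B \<in> sets borel" "bounded B"
  shows "(\<integral>\<^sup>+\<omega>. of_bool (Ncount B \<omega> = m) \<partial>M) =
    ennreal ((\<rho> * measure lborel B) ^ m / fact m * exp (- (\<rho> * measure lborel B)))"
proof -
  have "(\<integral>\<^sup>+\<omega>. of_bool (Ncount B \<omega> = m) \<partial>M) =
      (\<Sum>i. of_bool (i = m) * ennreal ((\<rho> * measure lborel B) ^ i / fact i * exp (- (\<rho> * measure lborel B))))"
    by (rule nn_integral_count[OF B])
  also have "\<dots> = (\<Sum>i\<in>{m}. of_bool (i = m) * ennreal ((\<rho> * measure lborel B) ^ i / fact i * exp (- (\<rho> * measure lborel B))))"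
    by (rule suminf_finite) auto
  finally show ?thesis by simp
qed

text \<open>The Mecke identity for emptiness of \<open>D x\<close>, bundled with measurability so
  that both are carried through the set operations. The exponential is the probability that a fixed
  region \<open>D x\<close> contains no point of the process.\<close>

definition good :: "nat \<Rightarrow> ((nat \<Rightarrow> point) \<Rightarrow> point set) \<Rightarrow> (nat \<Rightarrow> point) set \<Rightarrow> bool" where
  "good n D X \<longleftrightarrow> (\<lambda>\<omega>. emeasure (count_space UNIV) (tset n (A \<omega>) D X)) \<in> borel_measurable M \<and>
     (\<integral>\<^sup>+\<omega>. emeasure (count_space UNIV) (tset n (A \<omega>) D X) \<partial>M) =
     (\<integral>\<^sup>+x. ennreal (\<rho> ^ n * exp (- (\<rho> * measure lborel (D x)))) * indicator X x \<partial>tuple_space n)"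

text \<open>With disjoint sides, each inside or outside \<open>D\<close>, the number of tuples is a
  product of independent factors. A side inside \<open>D\<close> must contain exactly one point, a
  side outside contributes its number of points, and the rest of \<open>D\<close> must be empty. The
  exponentials combine to that of \<open>D\<close>.\<close>

lemma good_rectangle:
  assumes B: "\<And>i. i < n \<Longrightarrow> B i \<in> sets borel" "\<And>i. i < n \<Longrightarrow> bounded (B i)" "disjoint_family_on B {..<n}"
    and D: "D \<in> sets borel" "bounded D" and inout: "\<And>i. i < n \<Longrightarrow> B i \<subseteq> D \<or> B i \<inter> D = {}"
  shows "good n (\<lambda>_. D) (PiE {..<n} B)"
proof -
  define J where "J = {i \<in> {..<n}. B i \<subseteq> D}"
  define D' where "D' = D - (\<Union>i\<in>{..<n}. B i)"
  \<comment> \<open>Index \<open>n\<close> carries the rest of \<open>D\<close>, so that a single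
    independence statement covers all factors.\<close>
  define C where "C i = (if i < n then B i else D')" for i
  define g :: "nat \<Rightarrow> nat \<Rightarrow> ennreal" where
    "g i m = (if i \<in> J then of_bool (m = 1) else if i < n then of_nat m else of_bool (m = 0))" for i m
  have D': "D' \<in> sets borel" "bounded D'" unfolding D'_def using D B(1) by (auto intro!: sets.Diff sets.finite_UN bounded_diff)
  have C: "C i \<in> sets borel \<and> bounded (C i)" for i using B(1,2) D' by (simp add: C_def)
  have djC: "disjoint_family_on C {..n}"
    unfolding disjoint_family_on_def
  proof (intro ballI impI)
    fix i j assume ij: "i \<in> {..n}" "j \<in> {..n}" "i \<noteq> j"
    consider "i < n" "j < n" | "i = n" "j < n" | "i < n" "j = n" using ij by fastforce
    then show "C i \<inter> C j = {}"
      using B(3) ij by cases (auto simp: C_def D'_def disjoint_family_on_def)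
  qed
  have card_eq: "emeasure (count_space UNIV) (tset n (A \<omega>) (\<lambda>_. D) (PiE {..<n} B)) = (\<Prod>i\<in>{..n}. g i (Ncount (C i) \<omega>))"
    if \<omega>: "\<omega> \<in> space M" for \<omega>
  proof -
    let ?P = "PiE {..<n} (\<lambda>i. A \<omega> \<inter> B i)"
    let ?ok = "(\<forall>i\<in>J. Ncount (B i) \<omega> = 1) \<and> A \<omega> \<inter> D' = {}"
    have fin: "finite (A \<omega> \<inter> B i)" if "i < n" for i using locally_finite[OF \<omega> B(2)[OF that]] .
    have finD': "finite (A \<omega> \<inter> D')" using locally_finite[OF \<omega> D'(2)] .
    have inj: "inj_on x {..<n}" if "x \<in> ?P" for x
    proof (rule inj_onI, rule ccontr)
      fix i j assume ij: "i \<in> {..<n}" "j \<in> {..<n}" "x i = x j" "i \<noteq> j"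
      have "x i \<in> B i" "x j \<in> B j" using that ij(1,2) by auto
      moreover have "B i \<inter> B j = {}" using B(3) ij by (auto simp: disjoint_family_on_def)
      ultimately show False using ij(3) by auto
    qed
    have tset: "tset n (A \<omega>) (\<lambda>_. D) (PiE {..<n} B) = {x \<in> ?P. A \<omega> \<inter> D \<subseteq> x ` {..<n}}"
    proof (intro equalityI subsetI)
      fix x assume "x \<in> tset n (A \<omega>) (\<lambda>_. D) (PiE {..<n} B)"
      then show "x \<in> {x \<in> ?P. A \<omega> \<inter> D \<subseteq> x ` {..<n}}" by (auto simp: tset_def tuples_def PiE_iff)
    next
      fix x assume x: "x \<in> {x \<in> ?P. A \<omega> \<inter> D \<subseteq> x ` {..<n}}"
      then show "x \<in> tset n (A \<omega>) (\<lambda>_. D) (PiE {..<n} B)" using inj[of x] by (auto simp: tset_def tuples_def PiE_iff)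
    qed
    have ok: "(A \<omega> \<inter> D \<subseteq> x ` {..<n}) = ?ok" if x: "x \<in> ?P" for x
    proof
      have xi: "x i \<in> A \<omega> \<inter> B i" if "i < n" for i using x that by (auto simp: PiE_iff)
      assume sub: "A \<omega> \<inter> D \<subseteq> x ` {..<n}"
      have "A \<omega> \<inter> B i = {x i}" if i: "i \<in> J" for i
      proof (intro equalityI subsetI)
        fix y assume y: "y \<in> A \<omega> \<inter> B i"
        then obtain j where j: "j < n" "y = x j" using sub i by (auto simp: J_def)
        have "j = i"
        proof (rule ccontr)
          assume "j \<noteq> i"
          then have "B j \<inter> B i = {}" using B(3) i j by (auto simp: disjoint_family_on_def J_def)
          then show False using xi[OF j(1)] y j by auto
        qed
        then show "y \<in> {x i}" using j by simp
      qed (use xi i in \<open>auto simp: J_def\<close>)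
      then have "\<forall>i\<in>J. Ncount (B i) \<omega> = 1" by simp
      moreover have "A \<omega> \<inter> D' = {}"
      proof (rule ccontr)
        assume "A \<omega> \<inter> D' \<noteq> {}"
        then obtain y where y: "y \<in> A \<omega>" "y \<in> D" "\<And>i. i < n \<Longrightarrow> y \<notin> B i" by (auto simp: D'_def)
        then obtain j where "j < n" "y = x j" using sub by auto
        then show False using xi y by auto
      qed
      ultimately show ?ok by blast
    next
      assume okk: ?ok
      show "A \<omega> \<inter> D \<subseteq> x ` {..<n}"
      proof
        fix y assume y: "y \<in> A \<omega> \<inter> D"
        then obtain i where i: "i < n" "y \<in> B i" using okk by (auto simp: D'_def)
        then have "i \<in> J" using inout[OF i(1)] y by (auto simp: J_def)
        then obtain v where v: "A \<omega> \<inter> B i = {v}" using okk by (auto simp: card_1_singleton_iff)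
        moreover have "x i \<in> A \<omega> \<inter> B i" using x i by (auto simp: PiE_iff)
        ultimately have "y = x i" using y i by auto
        then show "y \<in> x ` {..<n}" using i by auto
      qed
    qed
    have prodC: "(\<Prod>i\<in>{..n}. g i (Ncount (C i) \<omega>)) = (\<Prod>i\<in>{..<n}. g i (Ncount (B i) \<omega>)) * of_bool (A \<omega> \<inter> D' = {})"
    proof -
      have "(\<Prod>i\<in>{..n}. g i (Ncount (C i) \<omega>)) = (\<Prod>i\<in>{..<n}. g i (Ncount (C i) \<omega>)) * g n (Ncount (C n) \<omega>)"
        by (simp add: lessThan_Suc_atMost[symmetric] lessThan_Suc mult.commute)
      also have "(\<Prod>i\<in>{..<n}. g i (Ncount (C i) \<omega>)) = (\<Prod>i\<in>{..<n}. g i (Ncount (B i) \<omega>))"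
        by (intro prod.cong) (auto simp: C_def)
      also have "g n (Ncount (C n) \<omega>) = of_bool (A \<omega> \<inter> D' = {})"
        using finD' by (simp add: g_def C_def J_def)
      finally show ?thesis .
    qed
    show ?thesis
    proof (cases ?ok)
      case True
      then have "tset n (A \<omega>) (\<lambda>_. D) (PiE {..<n} B) = ?P" unfolding tset using ok by blast
      moreover have "finite ?P" using fin by (intro finite_PiE) auto
      ultimately have "emeasure (count_space UNIV) (tset n (A \<omega>) (\<lambda>_. D) (PiE {..<n} B)) = of_nat (\<Prod>i\<in>{..<n}. Ncount (B i) \<omega>)"
        by (simp add: emeasure_count_space_finite card_PiE)
      also have "\<dots> = (\<Prod>i\<in>{..<n}. g i (Ncount (B i) \<omega>))"
        unfolding of_nat_prod using True by (intro prod.cong) (auto simp: g_def)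
      finally show ?thesis unfolding prodC using True by simp
    next
      case False
      then have "tset n (A \<omega>) (\<lambda>_. D) (PiE {..<n} B) = {}" unfolding tset using ok by blast
      moreover have "(\<Prod>i\<in>{..<n}. g i (Ncount (B i) \<omega>)) * of_bool (A \<omega> \<inter> D' = {}) = 0"
      proof (cases "A \<omega> \<inter> D' = {}")
        case True
        then obtain i where "i \<in> J" "Ncount (B i) \<omega> \<noteq> 1" using False by blast
        then have "i \<in> {..<n}" "g i (Ncount (B i) \<omega>) = 0" by (auto simp: g_def J_def)
        then have "(\<Prod>i\<in>{..<n}. g i (Ncount (B i) \<omega>)) = 0" by (intro prod_zero) auto
        then show ?thesis by simp
      qed simp
      ultimately show ?thesis unfolding prodC by simp
    qed
  qed
  have ind: "indep_vars (\<lambda>_. borel) (\<lambda>i \<omega>. g i (Ncount (C i) \<omega>)) {..n}"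
    by (rule indep_vars_compose2[OF count_indep[OF finite_atMost djC C]]) simp
  have meas: "(\<lambda>\<omega>. \<Prod>i\<in>{..n}. g i (Ncount (C i) \<omega>)) \<in> borel_measurable M"
    using ind by (intro borel_measurable_prod_ennreal) (auto simp: indep_vars_def)
  have Eg: "(\<integral>\<^sup>+\<omega>. g i (Ncount (C i) \<omega>) \<partial>M) =
      ennreal (\<rho> * measure lborel (B i) * (if i \<in> J then exp (- (\<rho> * measure lborel (B i))) else 1))" if i: "i < n" for i
    using i count_mean[of "B i"] count_indicator[of "B i" 1] B(1,2)[OF i]
    by (auto simp: g_def C_def J_def)
  have EgD: "(\<integral>\<^sup>+\<omega>. g n (Ncount (C n) \<omega>) \<partial>M) = ennreal (exp (- (\<rho> * measure lborel D')))"
    using count_indicator[OF D', of 0] by (simp add: g_def C_def J_def)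
  have bm: "S \<in> fmeasurable lborel" if "S \<in> sets borel" "bounded S" for S :: "point set"
    using that emeasure_bounded_finite[of S] by (auto simp: fmeasurable_def)
  have mD: "measure lborel D = measure lborel D' + (\<Sum>i\<in>J. measure lborel (B i))"
  proof -
    have "D = D' \<union> (\<Union>i\<in>J. B i)"
    proof (intro equalityI subsetI)
      fix y assume y: "y \<in> D"
      show "y \<in> D' \<union> (\<Union>i\<in>J. B i)"
      proof (cases "\<exists>i<n. y \<in> B i")
        case True
        then obtain i where "i < n" "y \<in> B i" by blast
        moreover from this have "i \<in> J" using inout[of i] y by (auto simp: J_def)
        ultimately show ?thesis by blast
      qed (use y in \<open>auto simp: D'_def\<close>)
    qed (auto simp: D'_def J_def)
    moreover have "D' \<inter> (\<Union>i\<in>J. B i) = {}" by (auto simp: D'_def J_def)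
    moreover have "(\<Union>i\<in>J. B i) \<in> fmeasurable lborel"
      using B(1,2) by (intro fmeasurable.finite_UN bm) (auto simp: J_def)
    ultimately have "measure lborel D = measure lborel D' + measure lborel (\<Union>i\<in>J. B i)"
      using measure_Un2[of D' lborel "\<Union>i\<in>J. B i"] bm[OF D'] by (simp add: Diff_triv Int_commute)
    also have "measure lborel (\<Union>i\<in>J. B i) = (\<Sum>i\<in>J. measure lborel (B i))"
      using B(1,2) bm B(3)
      by (intro measure_UNION') (auto simp: J_def pairwise_def disjnt_def disjoint_family_on_def)
    finally show ?thesis .
  qed
  have fin: "finite J" by (simp add: J_def)
  have "(\<integral>\<^sup>+\<omega>. (\<Prod>i\<in>{..n}. g i (Ncount (C i) \<omega>)) \<partial>M) = (\<Prod>i\<in>{..n}. \<integral>\<^sup>+\<omega>. g i (Ncount (C i) \<omega>) \<partial>M)"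
    using ind by (intro indep_vars_nn_integral) auto
  also have "\<dots> = (\<Prod>i\<in>{..<n}. \<integral>\<^sup>+\<omega>. g i (Ncount (C i) \<omega>) \<partial>M) * (\<integral>\<^sup>+\<omega>. g n (Ncount (C n) \<omega>) \<partial>M)"
    by (simp add: lessThan_Suc_atMost[symmetric] lessThan_Suc mult.commute)
  also have "\<dots> = (\<Prod>i\<in>{..<n}. ennreal (\<rho> * measure lborel (B i) * (if i \<in> J then exp (- (\<rho> * measure lborel (B i))) else 1))) *
      ennreal (exp (- (\<rho> * measure lborel D')))"
    using Eg EgD by simp
  also have "\<dots> = ennreal ((\<Prod>i\<in>{..<n}. \<rho> * measure lborel (B i) * (if i \<in> J then exp (- (\<rho> * measure lborel (B i))) else 1)) *
      exp (- (\<rho> * measure lborel D')))"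
    using intensity_pos by (subst prod_ennreal) (auto simp: ennreal_mult' prod_nonneg)
  also have "(\<Prod>i\<in>{..<n}. \<rho> * measure lborel (B i) * (if i \<in> J then exp (- (\<rho> * measure lborel (B i))) else 1)) =
      \<rho> ^ n * (\<Prod>i\<in>{..<n}. measure lborel (B i)) * (\<Prod>i\<in>{..<n}. if i \<in> J then exp (- (\<rho> * measure lborel (B i))) else 1)"
    by (simp add: prod.distrib)
  also have "(\<Prod>i\<in>{..<n}. if i \<in> J then exp (- (\<rho> * measure lborel (B i))) else 1) = (\<Prod>i\<in>J. exp (- (\<rho> * measure lborel (B i))))"
    by (simp add: prod.inter_filter[symmetric] J_def)
  also have "\<dots> = exp (- (\<rho> * (\<Sum>i\<in>J. measure lborel (B i))))"
    by (simp add: exp_sum[OF fin, symmetric] sum_negf sum_distrib_left)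
  also have "\<rho> ^ n * (\<Prod>i\<in>{..<n}. measure lborel (B i)) * exp (- (\<rho> * (\<Sum>i\<in>J. measure lborel (B i)))) * exp (- (\<rho> * measure lborel D'))
      = \<rho> ^ n * exp (- (\<rho> * measure lborel D)) * (\<Prod>i\<in>{..<n}. measure lborel (B i))"
    by (simp add: mD exp_add[symmetric] algebra_simps)
  also have "ennreal \<dots> = ennreal (\<rho> ^ n * exp (- (\<rho> * measure lborel D))) * emeasure (tuple_space n) (PiE {..<n} B)"
  proof -
    have "emeasure (tuple_space n) (PiE {..<n} B) = (\<Prod>i\<in>{..<n}. emeasure lborel (B i))"
      using B(1) by (intro lborel_product.emeasure_PiM) auto
    also have "\<dots> = (\<Prod>i\<in>{..<n}. ennreal (measure lborel (B i)))"
      using B(2) emeasure_bounded_finite by (intro prod.cong refl emeasure_eq_ennreal_measure) (auto simp: less_top)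
    also have "\<dots> = ennreal (\<Prod>i\<in>{..<n}. measure lborel (B i))" by (intro prod_ennreal) simp
    finally show ?thesis using intensity_pos by (simp add: ennreal_mult')
  qed
  also have "\<dots> = (\<integral>\<^sup>+x. ennreal (\<rho> ^ n * exp (- (\<rho> * measure lborel D))) * indicator (PiE {..<n} B) x \<partial>tuple_space n)"
    using B(1) by (subst nn_integral_cmult_indicator) (auto intro!: sets_PiM_I_finite)
  finally have "(\<integral>\<^sup>+\<omega>. (\<Prod>i\<in>{..n}. g i (Ncount (C i) \<omega>)) \<partial>M) =
    (\<integral>\<^sup>+x. ennreal (\<rho> ^ n * exp (- (\<rho> * measure lborel D))) * indicator (PiE {..<n} B) x \<partial>tuple_space n)" .
  then show ?thesis unfolding good_def using meas card_eq
    by (simp cong: measurable_cong nn_integral_cong)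
qed

end

section \<open>From rectangles to measurable sets of tuples\<close>

lemma tset_UN: "tset n A D (\<Union>i. X i) = (\<Union>i. tset n A D (X i))"
  by (auto simp: tset_def)

lemma tset_mono: "X \<subseteq> Y \<Longrightarrow> tset n A D X \<subseteq> tset n A D Y"
  by (auto simp: tset_def)

lemma emeasure_tset_UN:
  assumes "disjoint_family X"
  shows "emeasure (count_space UNIV) (tset n A D (\<Union>i. X i)) = (\<Sum>i. emeasure (count_space UNIV) (tset n A D (X i)))"
  unfolding tset_UN using assms
  by (intro suminf_emeasure[symmetric]) (auto simp: disjoint_family_on_def tset_def)

lemma emeasure_tset_Un:
  assumes "X \<inter> Y = {}"
  shows "emeasure (count_space UNIV) (tset n A D (X \<union> Y)) =
    emeasure (count_space UNIV) (tset n A D X) + emeasure (count_space UNIV) (tset n A D Y)"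
proof -
  have "tset n A D (X \<union> Y) = tset n A D X \<union> tset n A D Y" by (auto simp: tset_def)
  moreover have "tset n A D X \<inter> tset n A D Y = {}" using assms by (auto simp: tset_def)
  ultimately show ?thesis by (simp add: plus_emeasure)
qed

lemma finite_tset:
  assumes "X \<subseteq> PiE {..<n} B" "\<And>i. i < n \<Longrightarrow> finite (A \<inter> B i)"
  shows "finite (tset n A D X)"
proof (rule finite_subset)
  show "tset n A D X \<subseteq> PiE {..<n} (\<lambda>i. A \<inter> B i)" using assms(1) by (force simp: tset_def tuples_def PiE_iff)
  show "finite (PiE {..<n} (\<lambda>i. A \<inter> B i))" using assms(2) by (intro finite_PiE) auto
qed

lemma measurable_tuple_component: "i < n \<Longrightarrow> (\<lambda>x. x i) \<in> borel_measurable (tuple_space n)"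
  using measurable_component_singleton[of i "{..<n}" "\<lambda>_. lborel :: point measure"] by simp

lemma tuple_space_coincide_null:
  assumes ij: "i < n" "j < n" "i \<noteq> j"
  shows "{x \<in> space (tuple_space n). x i = x j} \<in> null_sets (tuple_space n)"
proof -
  let ?S = "{x \<in> space (tuple_space n). x i = x j}"
  let ?I = "{..<n} - {i}"
  have I: "insert i ?I = {..<n}" using ij by auto
  have "?S = {x \<in> space (tuple_space n). dist (x i) (x j) \<le> 0}" by auto
  also have "\<dots> \<in> sets (tuple_space n)"
    using measurable_tuple_component[OF ij(1)] measurable_tuple_component[OF ij(2)] by measurable
  finally have [measurable]: "?S \<in> sets (tuple_space n)" .
  have "emeasure (tuple_space n) ?S = (\<integral>\<^sup>+x. indicator ?S x \<partial>PiM (insert i ?I) (\<lambda>_. lborel))" unfolding I by simp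
  also have "\<dots> = (\<integral>\<^sup>+x. (\<integral>\<^sup>+y. indicator ?S (x(i := y)) \<partial>lborel) \<partial>PiM ?I (\<lambda>_. lborel))"
  proof (rule lborel_product.product_nn_integral_insert)
    show "indicator ?S \<in> borel_measurable (PiM (insert i ?I) (\<lambda>_. lborel))" unfolding I by measurable
  qed auto
  also have "\<dots> = (\<integral>\<^sup>+x. 0 \<partial>PiM ?I (\<lambda>_. lborel :: point measure))"
  proof (rule nn_integral_cong)
    fix x :: "nat \<Rightarrow> point"
    have "(\<integral>\<^sup>+y. indicator ?S (x(i := y)) \<partial>lborel) \<le> (\<integral>\<^sup>+y. indicator {x j} y \<partial>lborel)"
      using ij by (intro nn_integral_mono) (auto simp: indicator_def)
    then show "(\<integral>\<^sup>+y. indicator ?S (x(i := y)) \<partial>lborel) = 0" by simp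
  qed
  finally show ?thesis by (intro null_setsI) auto
qed

lemma AE_tuple_space_inj: "AE x in tuple_space n. inj_on x {..<n}"
proof -
  have "AE x in tuple_space n. \<forall>i\<in>{..<n}. \<forall>j\<in>{..<n}. i \<noteq> j \<longrightarrow> x i \<noteq> x j"
  proof (intro AE_finite_allI finite_lessThan)
    fix i j assume ij: "i \<in> {..<n}" "j \<in> {..<n}"
    show "AE x in tuple_space n. i \<noteq> j \<longrightarrow> x i \<noteq> x j"
    proof (cases "i = j")
      case False
      then show ?thesis using tuple_space_coincide_null[of i n j] ij
        by (intro AE_I'[where N = "{x \<in> space (tuple_space n). x i = x j}"]) auto
    qed simp
  qed
  then show ?thesis by eventually_elim (auto simp: inj_on_def)
qed

text \<open>Countably many rectangles with separated sides exhaust the injective tuples.\<close>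

lemma injective_tuples_cover:
  assumes "D \<in> sets borel"
  obtains R :: "nat \<Rightarrow> nat \<Rightarrow> point set"
  where "\<And>m i. i < n \<Longrightarrow> R m i \<in> sets borel" "\<And>m i. i < n \<Longrightarrow> bounded (R m i)"
    "\<And>m. disjoint_family_on (R m) {..<n}" "\<And>m i. i < n \<Longrightarrow> R m i \<subseteq> D \<or> R m i \<inter> D = {}"
    "\<And>x. x \<in> {..<n} \<rightarrow>\<^sub>E UNIV \<Longrightarrow> inj_on x {..<n} \<Longrightarrow> \<exists>m. x \<in> PiE {..<n} (R m)"
proof -
  obtain \<B> :: "point set set" where \<B>: "countable \<B>" "topological_basis \<B>" using ex_countable_basis by blast
  define \<S> where "\<S> = (\<lambda>b. b \<inter> D) ` {b \<in> \<B>. bounded b} \<union> (\<lambda>b. b - D) ` {b \<in> \<B>. bounded b}"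
  have open_basis: "open b" if "b \<in> \<B>" for b using topological_basis_open[OF \<B>(2) that] .
  have S: "s \<in> sets borel" "bounded s" "s \<subseteq> D \<or> s \<inter> D = {}" if "s \<in> \<S>" for s
    using that \<open>D \<in> sets borel\<close> open_basis unfolding \<S>_def
    by (auto intro: bounded_subset)
  define \<R> where "\<R> = {r \<in> {..<n} \<rightarrow>\<^sub>E \<S>. disjoint_family_on r {..<n}}"
  have "countable \<S>" unfolding \<S>_def using \<B>(1) by auto
  then have "countable ({..<n} \<rightarrow>\<^sub>E \<S>)" by (intro countable_PiE) auto
  then have cR: "countable \<R>" unfolding \<R>_def by (rule countable_subset[rotated]) auto
  have cover: "\<exists>r\<in>\<R>. x \<in> PiE {..<n} r" if x: "x \<in> {..<n} \<rightarrow>\<^sub>E UNIV" "inj_on x {..<n}" for x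
  proof -
    \<comment> \<open>Balls of half this radius around the entries are disjoint; the inserted 1
      keeps the minimum defined when there are fewer than two entries.\<close>
    define d where "d = Min (insert 1 ((\<lambda>(i, j). dist (x i) (x j)) ` {(i, j) \<in> {..<n} \<times> {..<n}. i \<noteq> j}))"
    have fin: "finite (insert 1 ((\<lambda>(i, j). dist (x i) (x j)) ` {(i, j) \<in> {..<n} \<times> {..<n}. i \<noteq> j}))"
      by (intro finite.insertI finite_imageI) (rule finite_subset[of _ "{..<n} \<times> {..<n}"], auto)
    have d0: "d > 0" unfolding d_def using fin x(2) by (subst Min_gr_iff) (auto simp: inj_on_def)
    have dle: "d \<le> dist (x i) (x j)" if "i < n" "j < n" "i \<noteq> j" for i j
      unfolding d_def using fin that by (intro Min_le) force+
    have "\<exists>b\<in>\<B>. x i \<in> b \<and> b \<subseteq> ball (x i) (d / 2)" for i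
      using topological_basisE[OF \<B>(2), of "ball (x i) (d / 2)" "x i"] d0 by (metis centre_in_ball half_gt_zero open_ball)
    then obtain b where b: "\<And>i. b i \<in> \<B>" "\<And>i. x i \<in> b i" "\<And>i. b i \<subseteq> ball (x i) (d / 2)" by metis
    define r where "r = (\<lambda>i\<in>{..<n}. if x i \<in> D then b i \<inter> D else b i - D)"
    have bb: "bounded (b i)" for i using b(3)[of i] bounded_subset bounded_ball by blast
    have "r \<in> {..<n} \<rightarrow>\<^sub>E \<S>" unfolding r_def \<S>_def using b(1) bb by (auto simp: PiE_iff)
    moreover have "disjoint_family_on r {..<n}"
      unfolding disjoint_family_on_def
    proof (intro ballI impI)
      fix i j assume ij: "i \<in> {..<n}" "j \<in> {..<n}" "i \<noteq> j"
      have "ball (x i) (d / 2) \<inter> ball (x j) (d / 2) = {}"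
        using dle[of i j] ij by (intro disjoint_ballI) auto
      then show "r i \<inter> r j = {}" using b(3)[of i] b(3)[of j] ij unfolding r_def by auto
    qed
    moreover have "x \<in> PiE {..<n} r" using x(1) b(2) by (auto simp: r_def PiE_iff)
    ultimately show ?thesis unfolding \<R>_def by blast
  qed
  show ?thesis
  proof (cases "\<R> = {}")
    case True
    show ?thesis
    proof (rule that[of "\<lambda>_ _. {}"])
      fix x assume "x \<in> {..<n} \<rightarrow>\<^sub>E (UNIV :: point set)" "inj_on x {..<n}"
      then show "\<exists>m. x \<in> PiE {..<n} (\<lambda>_. {})" using cover True by blast
    qed (auto simp: disjoint_family_on_def)
  next
    case False
    define R where "R = from_nat_into \<R>"
    have R: "R m \<in> \<R>" for m unfolding R_def by (rule from_nat_into[OF False])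
    show ?thesis
    proof (rule that[of R])
      fix m i assume "i < n"
      then have "R m i \<in> \<S>" using R[of m] by (auto simp: \<R>_def PiE_iff)
      then show "R m i \<in> sets borel" "bounded (R m i)" "R m i \<subseteq> D \<or> R m i \<inter> D = {}" using S by auto
    next
      show "disjoint_family_on (R m) {..<n}" for m using R[of m] by (simp add: \<R>_def)
    next
      fix x assume "x \<in> {..<n} \<rightarrow>\<^sub>E (UNIV :: point set)" "inj_on x {..<n}"
      then obtain r where "r \<in> \<R>" "x \<in> PiE {..<n} r" using cover by blast
      then show "\<exists>m. x \<in> PiE {..<n} (R m)" unfolding R_def using from_nat_into_surj[OF cR] by metis
    qed
  qed
qed

context stationary_poisson_process begin

lemma good_UN:
  assumes D: "(\<lambda>x. measure lborel (D x)) \<in> borel_measurable (tuple_space n)"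
    and X: "\<And>i::nat. X i \<in> sets (tuple_space n)" "disjoint_family X" "\<And>i. good n D (X i)"
  shows "good n D (\<Union>i. X i)"
proof -
  note [measurable] = D X(1)
  let ?h = "\<lambda>x. ennreal (\<rho> ^ n * exp (- (\<rho> * measure lborel (D x))))"
  have m: "(\<lambda>\<omega>. emeasure (count_space UNIV) (tset n (A \<omega>) D (X i))) \<in> borel_measurable M" for i
    using X(3) by (auto simp: good_def)
  have e: "emeasure (count_space UNIV) (tset n (A \<omega>) D (\<Union>i. X i)) = (\<Sum>i. emeasure (count_space UNIV) (tset n (A \<omega>) D (X i)))" for \<omega>
    by (rule emeasure_tset_UN[OF X(2)])
  have "(\<integral>\<^sup>+\<omega>. (\<Sum>i. emeasure (count_space UNIV) (tset n (A \<omega>) D (X i))) \<partial>M) =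
      (\<Sum>i. \<integral>\<^sup>+\<omega>. emeasure (count_space UNIV) (tset n (A \<omega>) D (X i)) \<partial>M)"
    using m by (rule nn_integral_suminf)
  also have "\<dots> = (\<Sum>i. \<integral>\<^sup>+x. ?h x * indicator (X i) x \<partial>tuple_space n)"
    using X(3) by (simp add: good_def)
  also have "\<dots> = (\<integral>\<^sup>+x. (\<Sum>i. ?h x * indicator (X i) x) \<partial>tuple_space n)"
    by (rule nn_integral_suminf[symmetric]) measurable
  also have "\<dots> = (\<integral>\<^sup>+x. ?h x * indicator (\<Union>i. X i) x \<partial>tuple_space n)"
    by (simp only: ennreal_suminf_cmult suminf_indicator[OF X(2)])
  finally show ?thesis unfolding good_def e using m by auto
qed

lemma good_empty: "good n D {}"
  by (simp add: good_def tset_def)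

lemma good_Un:
  assumes D: "(\<lambda>x. measure lborel (D x)) \<in> borel_measurable (tuple_space n)"
    and X: "X \<in> sets (tuple_space n)" "Y \<in> sets (tuple_space n)" "X \<inter> Y = {}" "good n D X" "good n D Y"
  shows "good n D (X \<union> Y)"
proof -
  have "good n D (\<Union>i. binaryset X Y i)"
    using X D good_empty
    by (intro good_UN) (auto simp: binaryset_def disjoint_family_on_def)
  then show ?thesis by (simp add: UN_binaryset_eq)
qed

text \<open>Counts and integrals take extended values, so subtraction needs finiteness: pointwise
  for the count, and through \<open>fin'\<close> for the integral.\<close>

lemma good_Diff:
  assumes D: "(\<lambda>x. measure lborel (D x)) \<in> borel_measurable (tuple_space n)"
    and R: "R \<in> sets (tuple_space n)" "X \<in> sets (tuple_space n)" "X \<subseteq> R" "good n D R" "good n D X"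
    and fin: "\<And>\<omega>. \<omega> \<in> space M \<Longrightarrow> finite (tset n (A \<omega>) D R)" and fin': "emeasure (tuple_space n) R < \<infinity>"
  shows "good n D (R - X)"
proof -
  note [measurable] = D R(1,2)
  let ?h = "\<lambda>x. ennreal (\<rho> ^ n * exp (- (\<rho> * measure lborel (D x))))"
  let ?N = "\<lambda>X \<omega>. emeasure (count_space UNIV) (tset n (A \<omega>) D X)"
  have mX [measurable]: "?N X \<in> borel_measurable M" "?N R \<in> borel_measurable M" using R by (auto simp: good_def)
  have add: "?N R \<omega> = ?N X \<omega> + ?N (R - X) \<omega>" for \<omega>
    using emeasure_tset_Un[of X "R - X" n "A \<omega>" D] R(3) by (simp add: Un_absorb1)
  have finX: "?N X \<omega> \<noteq> \<infinity>" if "\<omega> \<in> space M" for \<omega>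
    using fin[OF that] tset_mono[OF R(3), of n "A \<omega>" D] by (auto simp: finite_subset)
  have eq: "?N (R - X) \<omega> = ?N R \<omega> - ?N X \<omega>" if "\<omega> \<in> space M" for \<omega>
    using finX[OF that] unfolding add[of \<omega>] by simp
  have mRX: "?N (R - X) \<in> borel_measurable M"
  proof -
    have "(\<lambda>\<omega>. ?N R \<omega> - ?N X \<omega>) \<in> borel_measurable M" by measurable
    then show ?thesis using eq by (simp cong: measurable_cong)
  qed
  have hle: "?h x \<le> ennreal (\<rho> ^ n)" for x using intensity_pos by (intro ennreal_leI) (simp add: mult_le_cancel_left1)
  have "(\<integral>\<^sup>+x. ?h x * indicator X x \<partial>tuple_space n) \<le> (\<integral>\<^sup>+x. ennreal (\<rho> ^ n) * indicator R x \<partial>tuple_space n)"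
    using R(3) hle by (intro nn_integral_mono mult_mono) (auto simp: indicator_def)
  also have "\<dots> < \<infinity>" using fin' by (simp add: nn_integral_cmult_indicator ennreal_mult_less_top)
  finally have finh: "(\<integral>\<^sup>+x. ?h x * indicator X x \<partial>tuple_space n) < \<infinity>" .
  have "(\<integral>\<^sup>+\<omega>. ?N X \<omega> \<partial>M) + (\<integral>\<^sup>+\<omega>. ?N (R - X) \<omega> \<partial>M) = (\<integral>\<^sup>+\<omega>. ?N R \<omega> \<partial>M)"
    unfolding add using mX(1) mRX by (intro nn_integral_add[symmetric]) auto
  also have "\<dots> = (\<integral>\<^sup>+x. ?h x * indicator R x \<partial>tuple_space n)" using R(4) by (simp add: good_def)
  also have "\<dots> = (\<integral>\<^sup>+x. ?h x * indicator X x + ?h x * indicator (R - X) x \<partial>tuple_space n)"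
    using R(3) by (intro nn_integral_cong) (auto simp: indicator_def)
  also have "\<dots> = (\<integral>\<^sup>+x. ?h x * indicator X x \<partial>tuple_space n) + (\<integral>\<^sup>+x. ?h x * indicator (R - X) x \<partial>tuple_space n)"
    by (intro nn_integral_add) measurable
  finally have "(\<integral>\<^sup>+x. ?h x * indicator X x \<partial>tuple_space n) + (\<integral>\<^sup>+\<omega>. ?N (R - X) \<omega> \<partial>M) =
      (\<integral>\<^sup>+x. ?h x * indicator X x \<partial>tuple_space n) + (\<integral>\<^sup>+x. ?h x * indicator (R - X) x \<partial>tuple_space n)"
    using R(5) by (simp add: good_def)
  then have "(\<integral>\<^sup>+\<omega>. ?N (R - X) \<omega> \<partial>M) = (\<integral>\<^sup>+x. ?h x * indicator (R - X) x \<partial>tuple_space n)"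
    using finh by (auto simp: ennreal_add_left_cancel)
  then show ?thesis unfolding good_def using mRX by simp
qed

text \<open>A Dynkin argument inside a fixed bounded rectangle. Its subrectangles inherit disjoint
  sides and the dichotomy with respect to \<open>D\<close>, and its finite measure allows
  complements.\<close>

lemma good_within_rectangle:
  assumes B: "\<And>i. i < n \<Longrightarrow> B i \<in> sets borel" "\<And>i. i < n \<Longrightarrow> bounded (B i)" "disjoint_family_on B {..<n}"
    and D: "D \<in> sets borel" "bounded D" and inout: "\<And>i. i < n \<Longrightarrow> B i \<subseteq> D \<or> B i \<inter> D = {}"
    and X: "X \<in> sets (tuple_space n)"
  shows "good n (\<lambda>_. D) (X \<inter> PiE {..<n} B)"
proof -
  let ?\<Omega> = "{..<n} \<rightarrow>\<^sub>E (UNIV :: point set)" and ?G = "{PiE {..<n} X | X. X \<in> {..<n} \<rightarrow> (sets borel :: point set set)}"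
  let ?R = "PiE {..<n} B"
  have mR: "?R \<in> sets (tuple_space n)" using B(1) by (intro sets_PiM_I_finite) auto
  have sub: "?R \<subseteq> ?\<Omega>" by auto
  have "Int_stable ?G"
    using Int_stable_prod_algebra[of "{..<n}" "\<lambda>_. lborel :: point measure"] by (simp add: prod_algebra_eq_finite)
  moreover have "?G \<subseteq> Pow ?\<Omega>" by auto
  moreover have "X \<in> sigma_sets ?\<Omega> ?G" using X by (simp add: sets_tuple_space)
  ultimately show ?thesis
  proof (induction rule: sigma_sets_induct_disjoint)
    case (basic X)
    then obtain Y where Y: "X = PiE {..<n} Y" "Y \<in> {..<n} \<rightarrow> sets borel" by blast
    have "X \<inter> ?R = PiE {..<n} (\<lambda>i. Y i \<inter> B i)" using Y(1) by (simp add: PiE_Int)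
    moreover have "good n (\<lambda>_. D) (PiE {..<n} (\<lambda>i. Y i \<inter> B i))"
    proof (rule good_rectangle)
      show "disjoint_family_on (\<lambda>i. Y i \<inter> B i) {..<n}" using B(3) by (auto simp: disjoint_family_on_def)
      show "Y i \<inter> B i \<in> sets borel" if "i < n" for i using Y(2) B(1)[OF that] that by auto
      show "bounded (Y i \<inter> B i)" if "i < n" for i using B(2)[OF that] bounded_subset by blast
      show "Y i \<inter> B i \<subseteq> D \<or> Y i \<inter> B i \<inter> D = {}" if "i < n" for i using inout[OF that] by blast
    qed (use D in auto)
    ultimately show ?case by simp
  next
    case empty
    show ?case by (simp add: good_empty)
  next
    case (compl X)
    have mX: "X \<in> sets (tuple_space n)" using compl(1) by (simp add: sets_tuple_space)
    have eq: "(?\<Omega> - X) \<inter> ?R = ?R - X \<inter> ?R" using sub by blast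
    have fin: "emeasure (tuple_space n) ?R < \<infinity>"
    proof -
      have "emeasure (tuple_space n) ?R = (\<Prod>i\<in>{..<n}. emeasure lborel (B i))"
        using B(1) by (intro lborel_product.emeasure_PiM) auto
      also have "\<dots> = (\<Prod>i\<in>{..<n}. ennreal (measure lborel (B i)))"
        using B(2) emeasure_bounded_finite by (intro prod.cong refl emeasure_eq_ennreal_measure) (auto simp: less_top)
      also have "\<dots> = ennreal (\<Prod>i\<in>{..<n}. measure lborel (B i))" by (intro prod_ennreal) simp
      also have "\<dots> < \<infinity>" by simp
      finally show ?thesis .
    qed
    show ?case unfolding eq
      using mX mR good_rectangle[OF B D inout] compl(2) fin B(2) locally_finite
      by (intro good_Diff finite_tset[OF subset_refl]) auto
  next
    case (union X)
    have "(\<Union>i. X i) \<inter> ?R = (\<Union>i. X i \<inter> ?R)" by blast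
    moreover have "X i \<inter> ?R \<in> sets (tuple_space n)" for i
      using union(2) mR by (intro sets.Int) (auto simp: sets_tuple_space)
    then have "good n (\<lambda>_. D) (\<Union>i. X i \<inter> ?R)"
      using union by (intro good_UN) (auto simp: disjoint_family_on_def)
    ultimately show ?case by simp
  qed
qed

text \<open>The separated rectangles miss only tuples with repeated entries. These are excluded from
  \<open>tset\<close> by injectivity and form a null set on the other side of the identity.\<close>

lemma good_fixed:
  assumes D: "D \<in> sets borel" "bounded D" and X: "X \<in> sets (tuple_space n)"
  shows "good n (\<lambda>_. D) X"
proof -
  obtain R :: "nat \<Rightarrow> nat \<Rightarrow> point set"
    where R: "\<And>m i. i < n \<Longrightarrow> R m i \<in> sets borel" "\<And>m i. i < n \<Longrightarrow> bounded (R m i)"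
    "\<And>m. disjoint_family_on (R m) {..<n}" "\<And>m i. i < n \<Longrightarrow> R m i \<subseteq> D \<or> R m i \<inter> D = {}"
    "\<And>x. x \<in> {..<n} \<rightarrow>\<^sub>E UNIV \<Longrightarrow> inj_on x {..<n} \<Longrightarrow> \<exists>m. x \<in> PiE {..<n} (R m)"
    by (rule injective_tuples_cover[OF D(1)]) (rule that)
  define Q where "Q m = PiE {..<n} (R m)" for m
  have mQ: "Q m \<in> sets (tuple_space n)" for m unfolding Q_def using R(1) by (intro sets_PiM_I_finite) auto
  have mdQ: "disjointed Q m \<in> sets (tuple_space n)" for m
    unfolding disjointed_def using mQ by (intro sets.Diff sets.finite_UN) auto
  have g: "good n (\<lambda>_. D) (X \<inter> disjointed Q m)" for m
  proof -
    have "X \<inter> disjointed Q m = (X \<inter> disjointed Q m) \<inter> PiE {..<n} (R m)"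
      using disjointed_subset[of Q m] by (auto simp: Q_def)
    moreover have "good n (\<lambda>_. D) ((X \<inter> disjointed Q m) \<inter> PiE {..<n} (R m))"
      using R D X mdQ by (intro good_within_rectangle) auto
    ultimately show ?thesis by simp
  qed
  have "disjoint_family (\<lambda>m. X \<inter> disjointed Q m)"
    using disjoint_family_disjointed[of Q] unfolding disjoint_family_on_def by blast
  then have "good n (\<lambda>_. D) (\<Union>m. X \<inter> disjointed Q m)"
    using g X mdQ by (intro good_UN) auto
  then have g': "good n (\<lambda>_. D) (X \<inter> (\<Union>m. Q m))" by (simp add: UN_disjointed_eq Int_UN_distrib[symmetric])
  have cover: "x \<in> (\<Union>m. Q m)" if "x \<in> {..<n} \<rightarrow>\<^sub>E UNIV" "inj_on x {..<n}" for x using R(5)[OF that] by (auto simp: Q_def)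
  have "tset n (A \<omega>) (\<lambda>_. D) (X \<inter> (\<Union>m. Q m)) = tset n (A \<omega>) (\<lambda>_. D) X" for \<omega>
    using cover by (auto simp: tset_def tuples_def PiE_iff)
  moreover have "(\<integral>\<^sup>+x. ennreal (\<rho> ^ n * exp (- (\<rho> * measure lborel D))) * indicator (X \<inter> (\<Union>m. Q m)) x \<partial>tuple_space n) =
      (\<integral>\<^sup>+x. ennreal (\<rho> ^ n * exp (- (\<rho> * measure lborel D))) * indicator X x \<partial>tuple_space n)"
  proof (rule nn_integral_cong_AE)
    have "AE x in tuple_space n. x \<in> {..<n} \<rightarrow>\<^sub>E UNIV" by (rule AE_I2) (simp add: space_PiM)
    with AE_tuple_space_inj[of n]
    show "AE x in tuple_space n. ennreal (\<rho> ^ n * exp (- (\<rho> * measure lborel D))) * indicator (X \<inter> (\<Union>m. Q m)) x =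
        ennreal (\<rho> ^ n * exp (- (\<rho> * measure lborel D))) * indicator X x"
    proof eventually_elim
      case (elim x)
      then show ?case using cover[of x] by (simp add: indicator_def)
    qed
  qed
  ultimately show ?thesis using g' unfolding good_def by simp
qed

end

section \<open>Balls that depend on the tuple\<close>

lemma measure_ball_point:
  fixes c :: point
  shows "measure lborel (ball c r) = pi * (max 0 r)\<^sup>2"
proof (cases "r \<ge> 0")
  case True
  then show ?thesis using content_ball[of r c] by (simp add: unit_ball_vol_2)
next
  case False
  then show ?thesis by (simp add: ball_empty)
qed

text \<open>For approximating a ball that varies with the tuple: the first \<open>m\<close> members
  of a fixed countable family that fit into the ball give a region with finitely many possible
  values.\<close>

lemma rational_balls:
  obtains b :: "nat \<Rightarrow> point set" and q :: "nat \<Rightarrow> point" and s :: "nat \<Rightarrow> real"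
  where "\<And>l. b l = ball (q l) (s l)" "\<And>l. s l > 0" "\<And>c r. ball c r = (\<Union>l\<in>{l. b l \<subseteq> ball c r}. b l)"
proof -
  obtain Q :: "point set" where Q: "countable Q" "\<And>X. open X \<Longrightarrow> X \<noteq> {} \<Longrightarrow> \<exists>d\<in>Q. d \<in> X"
    by (rule countable_dense_setE) blast
  have ne: "Q \<noteq> {}" using Q(2)[of UNIV] by auto
  define q where "q l = from_nat_into Q (fst (prod_decode l))" for l
  define s where "s l = 1 / real (Suc (snd (prod_decode l)))" for l
  have "ball c r = (\<Union>l\<in>{l. ball (q l) (s l) \<subseteq> ball c r}. ball (q l) (s l))" for c r
  proof (intro equalityI subsetI)
    fix y assume y: "y \<in> ball c r"
    define e where "e = (r - dist c y) / 2"
    have e: "e > 0" using y by (simp add: e_def)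
    then obtain m where m: "1 / real (Suc m) < e" using nat_approx_posE by metis
    obtain d where d: "d \<in> Q" "d \<in> ball y (1 / real (Suc m))" using Q(2)[of "ball y (1 / real (Suc m))"] by auto
    obtain p where p: "from_nat_into Q p = d" using from_nat_into_surj[OF Q(1) d(1)] by blast
    define l where "l = prod_encode (p, m)"
    have l: "q l = d" "s l = 1 / real (Suc m)" by (simp_all add: l_def q_def s_def p)
    have "dist d c \<le> dist c y + 1 / real (Suc m)" using d(2) dist_triangle[of d c y] by (simp add: dist_commute)
    moreover have "a + t \<le> r" if "a \<le> b + t" "t < (r - b) / 2" for a b t :: real using that by argo
    ultimately have "dist d c + 1 / real (Suc m) \<le> r" using m unfolding e_def by blast
    then have "ball (q l) (s l) \<subseteq> ball c r" unfolding l ball_subset_ball_iff by blast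
    moreover have "y \<in> ball (q l) (s l)" using d(2) by (simp add: l dist_commute)
    ultimately show "y \<in> (\<Union>l\<in>{l. ball (q l) (s l) \<subseteq> ball c r}. ball (q l) (s l))" by blast
  qed auto
  then show ?thesis by (intro that[of "\<lambda>l. ball (q l) (s l)" q s]) (auto simp: s_def)
qed

context stationary_poisson_process begin

lemma good_cong:
  assumes "\<And>x. x \<in> X \<Longrightarrow> D x = D' x"
  shows "good n D X \<longleftrightarrow> good n D' X"
proof -
  have "tset n (A \<omega>) D X = tset n (A \<omega>) D' X" for \<omega> using assms by (auto simp: tset_def)
  moreover have "(\<integral>\<^sup>+x. ennreal (\<rho> ^ n * exp (- (\<rho> * measure lborel (D x)))) * indicator X x \<partial>tuple_space n) =
     (\<integral>\<^sup>+x. ennreal (\<rho> ^ n * exp (- (\<rho> * measure lborel (D' x)))) * indicator X x \<partial>tuple_space n)"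
    using assms by (intro nn_integral_cong) (auto simp: indicator_def)
  ultimately show ?thesis by (simp add: good_def)
qed

lemma good_finite_UN:
  assumes D: "(\<lambda>x. measure lborel (D x)) \<in> borel_measurable (tuple_space n)"
    and "finite I" "\<And>i. i \<in> I \<Longrightarrow> X i \<in> sets (tuple_space n)" "disjoint_family_on X I" "\<And>i. i \<in> I \<Longrightarrow> good n D (X i)"
  shows "good n D (\<Union>i\<in>I. X i)"
  using assms(2-)
proof (induction I rule: finite_induct)
  case empty
  show ?case by (simp add: good_empty)
next
  case (insert i I)
  have "good n D (X i \<union> (\<Union>i\<in>I. X i))"
  proof (rule good_Un[OF D])
    show "X i \<inter> (\<Union>i\<in>I. X i) = {}" using insert(2,5) by (fastforce simp: disjoint_family_on_def)
    show "good n D (\<Union>i\<in>I. X i)" using insert by (intro insert.IH) (auto simp: disjoint_family_on_def)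
  qed (use insert in auto)
  then show ?case by simp
qed

text \<open>The region is constant on each of the finitely many measurable sets where the selected
  indices form a given \<open>J\<close>, so the case of a fixed region applies piecewise.\<close>

lemma good_simple:
  fixes m :: nat
  assumes b: "\<And>l. l < m \<Longrightarrow> b l \<in> sets borel" "\<And>l. l < m \<Longrightarrow> bounded (b l)"
    and E: "\<And>l. l < m \<Longrightarrow> {x \<in> space (tuple_space n). P l x} \<in> sets (tuple_space n)"
    and X: "X \<in> sets (tuple_space n)"
  defines "D \<equiv> \<lambda>x. \<Union>l\<in>{l. l < m \<and> P l x}. b l"
  shows "good n D X" and "(\<lambda>x. measure lborel (D x)) \<in> borel_measurable (tuple_space n)"
proof -
  define F where "F J = {x \<in> space (tuple_space n). {l. l < m \<and> P l x} = J}" for J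
  have F: "F J \<in> sets (tuple_space n)" for J
  proof (cases "J \<subseteq> {..<m}")
    case True
    have "F J = {x \<in> space (tuple_space n). \<forall>l\<in>{..<m}. (P l x \<longleftrightarrow> l \<in> J)}" using True by (auto simp: F_def)
    also have "\<dots> \<in> sets (tuple_space n)"
    proof (intro sets.sets_Collect_finite_All)
      fix l assume "l \<in> {..<m}"
      then have "{x \<in> space (tuple_space n). P l x} \<in> sets (tuple_space n)" using E by simp
      then show "{x \<in> space (tuple_space n). P l x = (l \<in> J)} \<in> sets (tuple_space n)"
        by (cases "l \<in> J") (auto intro: sets.sets_Collect)
    qed simp
    finally show ?thesis .
  next
    case False
    then have "F J = {}" by (auto simp: F_def)
    then show ?thesis by simp
  qed
  have DJ: "D x = (\<Union>l\<in>J. b l)" if "x \<in> F J" for x J using that by (auto simp: F_def D_def)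
  have fin: "finite (Pow {..<m})" by simp
  have mD: "measure lborel (D x) = (\<Sum>J\<in>Pow {..<m}. measure lborel (\<Union>l\<in>J. b l) * indicator (F J) x)"
    if "x \<in> space (tuple_space n)" for x
  proof -
    let ?J = "{l. l < m \<and> P l x}"
    have "(\<Sum>J\<in>Pow {..<m}. measure lborel (\<Union>l\<in>J. b l) * indicator (F J) x) =
        (\<Sum>J\<in>{?J}. measure lborel (\<Union>l\<in>J. b l) * indicator (F J) x)"
      by (rule sum.mono_neutral_right) (auto simp: F_def indicator_def)
    then show ?thesis using that by (simp add: F_def D_def)
  qed
  note [measurable] = F
  have "(\<lambda>x. \<Sum>J\<in>Pow {..<m}. measure lborel (\<Union>l\<in>J. b l) * indicator (F J) x) \<in> borel_measurable (tuple_space n)" by measurable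
  then show D: "(\<lambda>x. measure lborel (D x)) \<in> borel_measurable (tuple_space n)"
    using mD by (simp cong: measurable_cong)
  have "good n D (\<Union>J\<in>Pow {..<m}. X \<inter> F J)"
  proof (rule good_finite_UN[OF D fin])
    show "X \<inter> F J \<in> sets (tuple_space n)" for J using X F by blast
    show "disjoint_family_on (\<lambda>J. X \<inter> F J) (Pow {..<m})" by (auto simp: disjoint_family_on_def F_def)
    fix J assume J: "J \<in> Pow {..<m}"
    have "good n (\<lambda>_. \<Union>l\<in>J. b l) (X \<inter> F J)"
      using J b X F by (intro good_fixed sets.finite_UN bounded_UN) (auto intro: finite_subset)
    then show "good n D (X \<inter> F J)" using good_cong[of "X \<inter> F J" D "\<lambda>_. \<Union>l\<in>J. b l"] DJ by auto
  qed
  moreover have "(\<Union>J\<in>Pow {..<m}. X \<inter> F J) = X"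
    using sets.sets_into_space[OF X] by (auto simp: F_def)
  ultimately show "good n D X" by simp
qed

text \<open>As the approximating regions increase to the ball, the counts decrease and the
  exponentials converge. Dominated convergence needs bounded tuples; the general case is a countable
  disjoint union of these.\<close>

theorem mecke_ball:
  assumes c: "c \<in> borel_measurable (tuple_space n)" and r: "r \<in> borel_measurable (tuple_space n)"
    and X: "X \<in> sets (tuple_space n)"
  shows "good n (\<lambda>x. ball (c x) (r x)) X"
proof -
  note [measurable] = c r X
  obtain b :: "nat \<Rightarrow> point set" and q s
    where b: "\<And>l. b l = ball (q l) (s l)" "\<And>l. s l > 0" "\<And>c r. ball c r = (\<Union>l\<in>{l. b l \<subseteq> ball c r}. b l)"
    using rational_balls by blast
  let ?D = "\<lambda>x. ball (c x) (r x)"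
  define D where "D m x = (\<Union>l\<in>{l. l < m \<and> b l \<subseteq> ?D x}. b l)" for m x
  have E: "{x \<in> space (tuple_space n). b l \<subseteq> ?D x} \<in> sets (tuple_space n)" for l
  proof -
    have "b l \<subseteq> ?D x \<longleftrightarrow> dist (q l) (c x) + s l \<le> r x" for x using b(1,2)[of l] by (simp add: ball_subset_ball_iff)
    then show ?thesis by simp
  qed
  have gm: "good n (D m) X" and Dm [measurable]: "(\<lambda>x. measure lborel (D m x)) \<in> borel_measurable (tuple_space n)"
    if "X \<in> sets (tuple_space n)" for m X
    unfolding D_def using E that by (intro good_simple; simp add: b(1))+
  have incD: "incseq (\<lambda>m. D m x)" for x
    unfolding incseq_def D_def by (intro allI impI UN_mono) auto
  have UD: "(\<Union>m. D m x) = ?D x" for x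
  proof -
    have "(\<Union>m. D m x) = (\<Union>l\<in>{l. b l \<subseteq> ?D x}. b l)" by (auto simp: D_def)
    then show ?thesis using b(3)[of "c x" "r x"] by simp
  qed
  have [measurable]: "(\<lambda>x. measure lborel (?D x)) \<in> borel_measurable (tuple_space n)"
    unfolding measure_ball_point by measurable
  have limD: "(\<lambda>m. measure lborel (D m x)) \<longlonglongrightarrow> measure lborel (?D x)" for x
  proof -
    have "(\<lambda>m. measure lborel (D m x)) \<longlonglongrightarrow> measure lborel (\<Union>m. D m x)"
    proof (rule Lim_measure_incseq[OF _ incD])
      show "range (\<lambda>m. D m x) \<subseteq> sets lborel" by (auto simp: D_def b(1))
      show "emeasure lborel (\<Union>m. D m x) \<noteq> \<infinity>" unfolding UD using emeasure_bounded_finite[of "?D x"] by (simp add: less_top)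
    qed
    then show ?thesis by (simp add: UD)
  qed
  have bounded_case: "good n ?D Y"
    if Y: "Y \<in> sets (tuple_space n)" "Y \<subseteq> PiE {..<n} (\<lambda>_. ball 0 R)" for Y R
  proof -
    note [measurable] = Y(1)
    let ?N = "\<lambda>D \<omega>. emeasure (count_space UNIV) (tset n (A \<omega>) D Y)"
    let ?h = "\<lambda>D x. ennreal (\<rho> ^ n * exp (- (\<rho> * measure lborel (D x)))) * indicator Y x"
    have fin: "finite (tset n (A \<omega>) D' Y)" if "\<omega> \<in> space M" for \<omega> D'
      using Y(2) locally_finite[OF that] by (intro finite_tset) auto
    have m: "?N (D m) \<in> borel_measurable M" for m using gm[OF Y(1)] by (simp add: good_def)
    have limN: "(\<lambda>m. ?N (D m) \<omega>) \<longlonglongrightarrow> ?N ?D \<omega>" if \<omega>: "\<omega> \<in> space M" for \<omega>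
    proof -
      have "(\<lambda>m. ?N (D m) \<omega>) \<longlonglongrightarrow> emeasure (count_space UNIV) (\<Inter>m. tset n (A \<omega>) (D m) Y)"
      proof (rule Lim_emeasure_decseq)
        show "decseq (\<lambda>m. tset n (A \<omega>) (D m) Y)"
          using incD by (fastforce simp: decseq_def incseq_def tset_def)
        show "emeasure (count_space UNIV) (tset n (A \<omega>) (D m) Y) \<noteq> \<infinity>" for m using fin[OF \<omega>] by simp
      qed simp
      moreover have "(\<Inter>m. tset n (A \<omega>) (D m) Y) = tset n (A \<omega>) ?D Y"
        unfolding tset_def UD[symmetric] by blast
      ultimately show ?thesis by simp
    qed
    have mN: "?N ?D \<in> borel_measurable M"
      by (rule borel_measurable_LIMSEQ_order[OF limN m])
    \<comment> \<open>The empty region imposes no condition. Its count and its integrand are the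
      majorants on the two sides, both integrable over bounded tuples.\<close>
    have g0: "good n (\<lambda>_. {}) Y" using Y(1) by (intro good_fixed) auto
    have fin0: "(\<integral>\<^sup>+\<omega>. ?N (\<lambda>_. {}) \<omega> \<partial>M) < \<infinity>"
    proof -
      have "(\<integral>\<^sup>+\<omega>. ?N (\<lambda>_. {}) \<omega> \<partial>M) = (\<integral>\<^sup>+x. ennreal (\<rho> ^ n) * indicator Y x \<partial>tuple_space n)"
        using g0 by (simp add: good_def)
      also have "\<dots> = ennreal (\<rho> ^ n) * emeasure (tuple_space n) Y" by (simp add: nn_integral_cmult_indicator)
      also have "\<dots> \<le> ennreal (\<rho> ^ n) * emeasure (tuple_space n) (PiE {..<n} (\<lambda>_. ball 0 R))"
        using Y(2) by (intro mult_left_mono emeasure_mono sets_PiM_I_finite) auto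
      also have "emeasure (tuple_space n) (PiE {..<n} (\<lambda>_. ball 0 R)) = (\<Prod>i\<in>{..<n}. emeasure lborel (ball 0 R :: point set))"
        by (intro lborel_product.emeasure_PiM) auto
      also have "\<dots> = ennreal (measure lborel (ball 0 R :: point set)) ^ n"
        using emeasure_bounded_finite[of "ball 0 R :: point set"] by (simp add: emeasure_eq_ennreal_measure less_top)
      finally show ?thesis by (simp add: ennreal_mult_less_top ennreal_power le_less_trans)
    qed
    have L: "(\<lambda>m. \<integral>\<^sup>+\<omega>. ?N (D m) \<omega> \<partial>M) \<longlonglongrightarrow> (\<integral>\<^sup>+\<omega>. ?N ?D \<omega> \<partial>M)"
    proof (rule nn_integral_dominated_convergence[where w = "?N (\<lambda>_. {})"])
      show "?N (\<lambda>_. {}) \<in> borel_measurable M" using g0 by (simp add: good_def)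
      show "AE \<omega> in M. ?N (D m) \<omega> \<le> ?N (\<lambda>_. {}) \<omega>" for m
        by (rule AE_I2, rule emeasure_mono) (auto simp: tset_def)
      show "AE \<omega> in M. (\<lambda>m. ?N (D m) \<omega>) \<longlonglongrightarrow> ?N ?D \<omega>" using limN by (rule AE_I2)
    qed (use m mN fin0 in auto)
    have Rlim: "(\<lambda>m. \<integral>\<^sup>+x. ?h (D m) x \<partial>tuple_space n) \<longlonglongrightarrow> (\<integral>\<^sup>+x. ?h ?D x \<partial>tuple_space n)"
    proof (rule nn_integral_dominated_convergence[where w = "\<lambda>x. ennreal (\<rho> ^ n) * indicator Y x"])
      show "AE x in tuple_space n. ?h (D m) x \<le> ennreal (\<rho> ^ n) * indicator Y x" for m
        using intensity_pos by (intro AE_I2 mult_right_mono ennreal_leI) (auto simp: mult_le_cancel_left1)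
      show "AE x in tuple_space n. (\<lambda>m. ?h (D m) x) \<longlonglongrightarrow> ?h ?D x"
      proof (rule AE_I2)
        fix x
        have "(\<lambda>m. ennreal (\<rho> ^ n * exp (- (\<rho> * measure lborel (D m x))))) \<longlonglongrightarrow> ennreal (\<rho> ^ n * exp (- (\<rho> * measure lborel (?D x))))"
          by (intro tendsto_ennrealI tendsto_intros limD)
        then show "(\<lambda>m. ?h (D m) x) \<longlonglongrightarrow> ?h ?D x" by (cases "x \<in> Y") auto
      qed
      have "(\<integral>\<^sup>+x. ennreal (\<rho> ^ n) * indicator Y x \<partial>tuple_space n) = (\<integral>\<^sup>+\<omega>. ?N (\<lambda>_. {}) \<omega> \<partial>M)"
        using g0 by (simp add: good_def)
      then show "(\<integral>\<^sup>+x. ennreal (\<rho> ^ n) * indicator Y x \<partial>tuple_space n) < \<infinity>" using fin0 by simp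
    qed (use Dm[OF Y(1)] in measurable)
    have "(\<integral>\<^sup>+\<omega>. ?N (D m) \<omega> \<partial>M) = (\<integral>\<^sup>+x. ?h (D m) x \<partial>tuple_space n)" for m using gm[OF Y(1)] by (simp add: good_def)
    then have "(\<integral>\<^sup>+\<omega>. ?N ?D \<omega> \<partial>M) = (\<integral>\<^sup>+x. ?h ?D x \<partial>tuple_space n)"
      using LIMSEQ_unique[OF L] Rlim by simp
    then show ?thesis using mN by (simp add: good_def)
  qed
  define P where "P R = PiE {..<n} (\<lambda>_. ball (0::point) (real R))" for R :: nat
  have mP: "P R \<in> sets (tuple_space n)" for R unfolding P_def by (intro sets_PiM_I_finite) auto
  have mdP: "disjointed P R \<in> sets (tuple_space n)" for R
    unfolding disjointed_def using mP by (intro sets.Diff sets.finite_UN) auto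
  have dis: "disjoint_family (\<lambda>R. X \<inter> disjointed P R)"
    using disjoint_family_disjointed[of P] unfolding disjoint_family_on_def by blast
  have "good n ?D (X \<inter> disjointed P R)" for R
  proof (rule bounded_case)
    show "X \<inter> disjointed P R \<in> sets (tuple_space n)" using X mdP by (rule sets.Int)
    show "X \<inter> disjointed P R \<subseteq> PiE {..<n} (\<lambda>_. ball 0 (real R))"
      using disjointed_subset[of P R] unfolding P_def by blast
  qed
  then have "good n ?D (\<Union>R. X \<inter> disjointed P R)" using X mdP dis by (intro good_UN) auto
  moreover have "(\<Union>R. X \<inter> disjointed P R) = X"
  proof -
    have "(\<Union>R. X \<inter> disjointed P R) = X \<inter> (\<Union>R. P R)" by (simp add: UN_disjointed_eq Int_UN_distrib[symmetric])
    moreover have "x \<in> (\<Union>R. P R)" if "x \<in> X" for x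
    proof -
      have x: "x \<in> {..<n} \<rightarrow>\<^sub>E UNIV" using sets.sets_into_space[OF X] that by (auto simp: space_PiM)
      obtain R :: nat where R: "(\<Sum>i<n. norm (x i)) < real R" using reals_Archimedean2 by blast
      have "norm (x i) < real R" if "i < n" for i
        using member_le_sum[of i "{..<n}" "\<lambda>i. norm (x i)"] R that by simp
      then have "x \<in> P R" using x by (auto simp: P_def PiE_iff)
      then show ?thesis by blast
    qed
    then have "X \<subseteq> (\<Union>R. P R)" by (rule subsetI)
    ultimately show ?thesis by (simp add: Int_absorb2)
  qed
  ultimately show ?thesis by simp
qed

end

section \<open>Genericity of the Poisson process\<close>

lemma borel_measurable_vec_nth_comp [measurable (raw)]:
  fixes f :: "'b \<Rightarrow> point"
  assumes "f \<in> borel_measurable N"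
  shows "(\<lambda>x. f x $ i) \<in> borel_measurable N"
  by (rule measurable_compose[OF assms]) (intro borel_measurable_continuous_onI continuous_intros)

lemma borel_measurable_cross2 [measurable (raw)]:
  assumes [measurable]: "f \<in> borel_measurable N" "g \<in> borel_measurable N"
  shows "(\<lambda>x. cross2 (f x) (g x)) \<in> borel_measurable N"
  unfolding cross2_def by measurable

lemma rot90_eq_axis: "rot90 u = (- u $ 2) *\<^sub>R axis 1 1 + (u $ 1) *\<^sub>R axis 2 1"
  by (simp add: vec_eq_iff forall_2 axis_def)

lemma borel_measurable_rot90 [measurable (raw)]:
  assumes [measurable]: "f \<in> borel_measurable N"
  shows "(\<lambda>x. rot90 (f x)) \<in> borel_measurable N"
  unfolding rot90_eq_axis by measurable

lemma borel_measurable_circumcenter [measurable (raw)]: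
  assumes [measurable]: "f \<in> borel_measurable N" "g \<in> borel_measurable N" "h \<in> borel_measurable N"
  shows "(\<lambda>x. circumcenter (f x) (g x) (h x)) \<in> borel_measurable N"
  unfolding circumcenter_def by measurable

lemma null_sets_lborel_negligible:
  fixes S :: "'a::euclidean_space set"
  assumes "negligible S" "S \<in> sets borel"
  shows "emeasure lborel S = 0"
  using assms by (simp add: negligible_iff_null_sets null_sets_def)

lemma rot90_eq_0_iff [simp]: "rot90 u = 0 \<longleftrightarrow> u = 0"
  by (metis norm_rot90 norm_eq_zero)

text \<open>Once the first two entries are fixed and distinct, the third is confined to a
  line.\<close>

lemma collinear_tuples_null:
  "{x \<in> space (tuple_space 3). cross2 (x 1 - x 0) (x 2 - x 0) = 0} \<in> null_sets (tuple_space 3)"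
proof -
  let ?S = "{x \<in> space (tuple_space 3). cross2 (x 1 - x 0) (x 2 - x 0) = 0}"
  have [measurable]: "(\<lambda>x. x 0) \<in> borel_measurable (tuple_space 3)" "(\<lambda>x. x 1) \<in> borel_measurable (tuple_space 3)"
      "(\<lambda>x. x 2) \<in> borel_measurable (tuple_space 3)"
    by (rule measurable_tuple_component; simp)+
  have S: "?S \<in> sets (tuple_space 3)" by measurable
  have I: "insert 2 {..<2} = {..<3::nat}" by auto
  have "emeasure (tuple_space 3) ?S = (\<integral>\<^sup>+x. indicator ?S x \<partial>PiM (insert 2 {..<2}) (\<lambda>_. lborel))"
    unfolding I using S by simp
  also have "\<dots> = (\<integral>\<^sup>+x. (\<integral>\<^sup>+y. indicator ?S (x(2 := y)) \<partial>lborel) \<partial>tuple_space 2)"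
  proof (rule lborel_product.product_nn_integral_insert)
    show "indicator ?S \<in> borel_measurable (PiM (insert 2 {..<2}) (\<lambda>_. lborel))" unfolding I using S by measurable
  qed auto
  also have "\<dots> = (\<integral>\<^sup>+x. 0 \<partial>tuple_space 2)"
  proof (rule nn_integral_cong_AE)
    show "AE x in tuple_space 2. (\<integral>\<^sup>+y. indicator ?S (x(2 := y)) \<partial>lborel) = 0"
      using AE_tuple_space_inj[of 2]
    proof eventually_elim
      case (elim x)
      have "x 0 \<noteq> x 1"
      proof
        assume "x 0 = x 1"
        then have "(0::nat) = 1" by (rule inj_onD[OF elim]) auto
        then show False by simp
      qed
      let ?n = "rot90 (x 1 - x 0)"
      have "(\<integral>\<^sup>+y. indicator ?S (x(2 := y)) \<partial>lborel) \<le> (\<integral>\<^sup>+y. indicator {y. ?n \<bullet> y = ?n \<bullet> x 0} y \<partial>lborel)"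
        by (intro nn_integral_mono) (auto simp: indicator_def inner_rot90[symmetric] inner_diff_right)
      also have "\<dots> = emeasure lborel {y. ?n \<bullet> y = ?n \<bullet> x 0}"
        by (rule nn_integral_indicator) (simp add: borel_closed closed_hyperplane)
      also have "\<dots> = 0" using \<open>x 0 \<noteq> x 1\<close>
        by (intro null_sets_lborel_negligible negligible_hyperplane) (auto simp: borel_closed closed_hyperplane)
      finally show ?case by simp
    qed
  qed
  finally show ?thesis using S by (intro null_setsI) auto
qed

text \<open>Once three entries are fixed, the fourth is confined to a circle. For a collinear triple
  the default \<open>circumcenter\<close> makes this circle a single point, which is still
  null.\<close>

lemma cocircular_tuples_null:
  "{x \<in> space (tuple_space 4). norm (circumcenter (x 0) (x 1) (x 2) - x 3) = norm (circumcenter (x 0) (x 1) (x 2) - x 0)}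
    \<in> null_sets (tuple_space 4)"
proof -
  let ?S = "{x \<in> space (tuple_space 4). norm (circumcenter (x 0) (x 1) (x 2) - x 3) = norm (circumcenter (x 0) (x 1) (x 2) - x 0)}"
  have [measurable]: "(\<lambda>x. x 0) \<in> borel_measurable (tuple_space 4)" "(\<lambda>x. x 1) \<in> borel_measurable (tuple_space 4)"
      "(\<lambda>x. x 2) \<in> borel_measurable (tuple_space 4)" "(\<lambda>x. x 3) \<in> borel_measurable (tuple_space 4)"
    by (rule measurable_tuple_component; simp)+
  have S: "?S \<in> sets (tuple_space 4)" by measurable
  have I: "insert 3 {..<3} = {..<4::nat}" by auto
  have "emeasure (tuple_space 4) ?S = (\<integral>\<^sup>+x. indicator ?S x \<partial>PiM (insert 3 {..<3}) (\<lambda>_. lborel))"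
    unfolding I using S by simp
  also have "\<dots> = (\<integral>\<^sup>+x. (\<integral>\<^sup>+y. indicator ?S (x(3 := y)) \<partial>lborel) \<partial>tuple_space 3)"
  proof (rule lborel_product.product_nn_integral_insert)
    show "indicator ?S \<in> borel_measurable (PiM (insert 3 {..<3}) (\<lambda>_. lborel))" unfolding I using S by measurable
  qed auto
  also have "\<dots> = (\<integral>\<^sup>+x. 0 \<partial>tuple_space 3)"
  proof (rule nn_integral_cong)
    fix x :: "nat \<Rightarrow> point"
    let ?z = "circumcenter (x 0) (x 1) (x 2)"
    have "(\<integral>\<^sup>+y. indicator ?S (x(3 := y)) \<partial>lborel) \<le> (\<integral>\<^sup>+y. indicator (sphere ?z (norm (?z - x 0))) y \<partial>lborel)"
      by (intro nn_integral_mono) (auto simp: indicator_def dist_norm)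
    also have "\<dots> = emeasure lborel (sphere ?z (norm (?z - x 0)))"
      by (rule nn_integral_indicator) (simp add: borel_closed)
    also have "\<dots> = 0" by (intro null_sets_lborel_negligible negligible_sphere) (auto simp: borel_closed)
    finally show "(\<integral>\<^sup>+y. indicator ?S (x(3 := y)) \<partial>lborel) = 0" by simp
  qed
  finally show ?thesis using S by (intro null_setsI) auto
qed

context stationary_poisson_process begin

text \<open>The Mecke identity with empty region: the expected number of tuples in a null set is
  zero.\<close>

lemma AE_no_tuple:
  assumes X: "X \<in> null_sets (tuple_space n)"
  shows "AE \<omega> in M. tset n (A \<omega>) (\<lambda>_. {}) X = {}"
proof -
  have g: "good n (\<lambda>_. {}) X" using X by (intro good_fixed) auto
  have "(\<integral>\<^sup>+\<omega>. emeasure (count_space UNIV) (tset n (A \<omega>) (\<lambda>_. {}) X) \<partial>M) =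
      (\<integral>\<^sup>+x. ennreal (\<rho> ^ n) * indicator X x \<partial>tuple_space n)" using g by (simp add: good_def)
  also have "\<dots> = 0" using X by (subst nn_integral_cmult_indicator) auto
  finally have "AE \<omega> in M. emeasure (count_space UNIV) (tset n (A \<omega>) (\<lambda>_. {}) X) = 0"
    using g by (subst (asm) nn_integral_0_iff_AE) (auto simp: good_def)
  then show ?thesis by eventually_elim (simp add: emeasure_count_space_eq_0)
qed

text \<open>The probability of at most \<open>K\<close> points in a ball around 0 tends to 0 as the
  radius grows, since the exponential beats the powers of the mean.\<close>

lemma AE_infinite: "AE \<omega> in M. infinite (A \<omega>)"
proof -
  define l where "l m = \<rho> * (pi * (real m)\<^sup>2)" for m :: nat
  have ev: "AE \<omega> in M. \<exists>m::nat. Ncount (ball 0 (real m)) \<omega> > K" for K :: nat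
  proof -
    let ?E = "\<lambda>m. {\<omega> \<in> space M. Ncount (ball 0 (real m)) \<omega> \<le> K}"
    let ?B = "{\<omega> \<in> space M. \<forall>m::nat. Ncount (ball 0 (real m)) \<omega> \<le> K}"
    have [measurable]: "random_variable (count_space UNIV) (Ncount (ball 0 (real m)))" for m
      by (rule count_measurable) auto
    have mB: "?B \<in> events" "?E m \<in> events" for m by measurable
    have pE: "prob (?E m) = (\<Sum>j\<le>K. l m ^ j / fact j * exp (- l m))" for m
    proof -
      have "?E m = (\<Union>j\<in>{..K}. {\<omega> \<in> space M. Ncount (ball 0 (real m)) \<omega> = j})" by auto
      also have "prob \<dots> = (\<Sum>j\<le>K. prob {\<omega> \<in> space M. Ncount (ball 0 (real m)) \<omega> = j})"
        by (rule finite_measure_finite_Union) (auto simp: disjoint_family_on_def)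
      finally show ?thesis by (simp add: count_poisson measure_ball_point l_def max_def)
    qed
    have "filterlim l at_top sequentially"
      unfolding l_def using intensity_pos
      by (intro filterlim_tendsto_pos_mult_at_top[OF tendsto_const] filterlim_pow_at_top filterlim_real_sequentially) auto
    then have "(\<lambda>m. l m ^ j / exp (l m)) \<longlonglongrightarrow> 0" for j by (rule filterlim_compose[OF tendsto_power_div_exp_0])
    then have "(\<lambda>m. l m ^ j / fact j * exp (- l m)) \<longlonglongrightarrow> 0" for j
      using tendsto_divide[OF _ tendsto_const, of "\<lambda>m. l m ^ j / exp (l m)" 0 sequentially "fact j"]
      by (simp add: exp_minus field_simps)
    then have "(\<lambda>m. \<Sum>j\<le>K. l m ^ j / fact j * exp (- l m)) \<longlonglongrightarrow> 0" by (intro tendsto_null_sum) auto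
    moreover have "prob ?B \<le> (\<Sum>j\<le>K. l m ^ j / fact j * exp (- l m))" for m
      unfolding pE[symmetric] using mB by (intro finite_measure_mono) auto
    ultimately have "prob ?B \<le> 0" by (intro LIMSEQ_le_const) auto
    then have "prob ?B = 0" using measure_nonneg[of M ?B] by linarith
    then have "?B \<in> null_sets M" using mB by (auto simp: null_sets_def emeasure_eq_measure)
    then show ?thesis by (rule AE_I'[of ?B]) (auto simp: not_less)
  qed
  have "AE \<omega> in M. \<forall>K. \<exists>m::nat. Ncount (ball 0 (real m)) \<omega> > K" using ev by (simp add: AE_all_countable)
  then show ?thesis
  proof eventually_elim
    case (elim \<omega>)
    show ?case
    proof
      assume fin: "finite (A \<omega>)"
      obtain m where "card (A \<omega>) < Ncount (ball 0 (real m)) \<omega>" using elim by blast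
      moreover have "Ncount (ball 0 (real m)) \<omega> \<le> card (A \<omega>)" using fin by (intro card_mono) auto
      ultimately show False by simp
    qed
  qed
qed

lemma AE_generic: "AE \<omega> in M. generic_set (A \<omega>)"
  using AE_no_tuple[OF collinear_tuples_null] AE_no_tuple[OF cocircular_tuples_null] AE_infinite AE_space
proof eventually_elim
  case (elim \<omega>)
  have tupI: "x \<in> tset n (A \<omega>) (\<lambda>_. {}) {x \<in> space (tuple_space n). P x}"
    if "x \<in> {..<n} \<rightarrow>\<^sub>E A \<omega>" "inj_on x {..<n}" "P x" for n x P
    using that by (auto simp: tset_def tuples_def space_PiM)
  have noncol: "cross2 (b - a) (c - a) \<noteq> 0"
    if abc: "a \<in> A \<omega>" "b \<in> A \<omega>" "c \<in> A \<omega>" "a \<noteq> b" "a \<noteq> c" "b \<noteq> c" for a b c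
  proof
    assume cr: "cross2 (b - a) (c - a) = 0"
    define x where "x = (\<lambda>i\<in>{..<3::nat}. if i = 0 then a else if i = 1 then b else c)"
    have "x \<in> {..<3} \<rightarrow>\<^sub>E A \<omega>" using abc by (auto simp: x_def)
    moreover have "inj_on x {..<3}" using abc by (auto simp: x_def inj_on_def)
    ultimately show False using tupI[of x 3 "\<lambda>x. cross2 (x 1 - x 0) (x 2 - x 0) = 0"] elim(1) cr by (simp add: x_def)
  qed
  have cocirc: "card (A \<omega> \<inter> sphere z r) \<le> 3" for z r
  proof (rule ccontr)
    assume "\<not> card (A \<omega> \<inter> sphere z r) \<le> 3"
    then have "4 \<le> card (A \<omega> \<inter> sphere z r)" by simp
    then obtain T where T: "T \<subseteq> A \<omega> \<inter> sphere z r" "card T = 4" "finite T" using obtain_subset_with_card_n by metis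
    obtain h where h: "bij_betw h {..<4::nat} T" using ex_bij_betw_nat_finite[OF T(3)] T(2) by (auto simp: atLeast0LessThan)
    define x where "x = restrict h {..<4}"
    have x: "x \<in> {..<4} \<rightarrow>\<^sub>E A \<omega>" "inj_on x {..<4}"
      using h T(1) by (auto simp: x_def bij_betw_def inj_on_def)
    have on: "x i \<in> A \<omega>" "norm (z - x i) = r" if "i < 4" for i
      using h T(1) that by (auto simp: x_def bij_betw_def dist_norm)
    have ne: "x i \<noteq> x j" if "i < 4" "j < 4" "i \<noteq> j" for i j using x(2) that by (auto simp: inj_on_def)
    have cr: "cross2 (x 1 - x 0) (x 2 - x 0) \<noteq> 0" using on ne by (intro noncol) auto
    have "z = circumcenter (x 0) (x 1) (x 2)" using on by (intro circumcenter_eqI[OF cr]) auto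
    then have "norm (circumcenter (x 0) (x 1) (x 2) - x 3) = norm (circumcenter (x 0) (x 1) (x 2) - x 0)" using on by simp
    then show False using tupI[OF x, of "\<lambda>x. norm (circumcenter (x 0) (x 1) (x 2) - x 3) = norm (circumcenter (x 0) (x 1) (x 2) - x 0)"]
        elim(2) by simp
  qed
  show ?case
    by unfold_locales (use locally_finite[OF elim(4)] elim(3) noncol cocirc in auto)
qed

end

section \<open>The shape integral\<close>

definition pt2 :: "real \<Rightarrow> real \<Rightarrow> point" where
  "pt2 x y = x *\<^sub>R axis 1 1 + y *\<^sub>R axis 2 1"

lemma pt2_nth [simp]: "pt2 x y $ 1 = x" "pt2 x y $ 2 = y"
  by (simp_all add: pt2_def axis_def)

lemma Basis_point: "(Basis :: point set) = {axis 1 1, axis 2 1}"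
  by (auto simp: Basis_vec_def UNIV_2)

lemma lborel_point: "lborel = distr (lborel \<Otimes>\<^sub>M lborel) borel (\<lambda>(x, y). pt2 x y)"
proof (rule lborel_eqI)
  have [measurable]: "(\<lambda>(x, y). pt2 x y) \<in> borel_measurable (lborel \<Otimes>\<^sub>M lborel)"
    unfolding pt2_def by measurable
  fix l u :: point assume lu: "\<And>b. b \<in> Basis \<Longrightarrow> l \<bullet> b \<le> u \<bullet> b"
  have le: "l $ 1 \<le> u $ 1" "l $ 2 \<le> u $ 2" using lu[of "axis 1 1"] lu[of "axis 2 1"]
    by (simp_all add: Basis_point inner_axis)
  have "(\<lambda>(x, y). pt2 x y) -` box l u \<inter> space (lborel \<Otimes>\<^sub>M lborel) = {l $ 1<..<u $ 1} \<times> {l $ 2<..<u $ 2}"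
    by (auto simp: mem_box_cart forall_2 space_pair_measure)
  then have "emeasure (distr (lborel \<Otimes>\<^sub>M lborel) borel (\<lambda>(x, y). pt2 x y)) (box l u) =
      emeasure (lborel \<Otimes>\<^sub>M lborel) ({l $ 1<..<u $ 1} \<times> {l $ 2<..<u $ 2})"
    by (subst emeasure_distr) simp_all
  also have "\<dots> = ennreal ((u $ 1 - l $ 1) * (u $ 2 - l $ 2))"
    using le by (subst lborel.emeasure_pair_measure_Times) (simp_all add: ennreal_mult)
  also have "(u $ 1 - l $ 1) * (u $ 2 - l $ 2) = (\<Prod>b\<in>Basis. (u - l) \<bullet> b)"
    by (simp add: Basis_point inner_axis axis_eq_axis inner_diff_left)
  finally show "emeasure (distr (lborel \<Otimes>\<^sub>M lborel) borel (\<lambda>(x, y). pt2 x y)) (box l u) = ennreal (\<Prod>b\<in>Basis. (u - l) \<bullet> b)" .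
qed simp

lemma nn_integral_point:
  assumes [measurable]: "\<phi> \<in> borel_measurable (borel :: point measure)"
  shows "(\<integral>\<^sup>+w. \<phi> w \<partial>lborel) = (\<integral>\<^sup>+y. \<integral>\<^sup>+x. \<phi> (pt2 x y) \<partial>lborel \<partial>lborel)"
proof -
  have [measurable]: "(\<lambda>(x, y). pt2 x y) \<in> borel_measurable (lborel \<Otimes>\<^sub>M lborel)"
    unfolding pt2_def by measurable
  have "(\<integral>\<^sup>+w. \<phi> w \<partial>lborel) = (\<integral>\<^sup>+p. \<phi> (case p of (x, y) \<Rightarrow> pt2 x y) \<partial>(lborel \<Otimes>\<^sub>M lborel))"
    by (subst lborel_point, subst nn_integral_distr) simp_all
  also have "\<dots> = (\<integral>\<^sup>+y. \<integral>\<^sup>+x. \<phi> (pt2 x y) \<partial>lborel \<partial>lborel)"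
    by (subst lborel_pair.nn_integral_snd[symmetric]) (auto simp: case_prod_unfold)
  finally show ?thesis .
qed

text \<open>In complex notation \<open>c\<close> is the product of \<open>b\<close> and
  \<open>w\<close>: the triangle \<open>0\<close>, \<open>b\<close>, \<open>c\<close> is similar to
  \<open>0\<close>, \<open>1\<close>, \<open>w\<close>. The Jacobian is the squared length of
  \<open>b\<close>.\<close>

lemma nn_integral_similarity:
  fixes b :: point
  assumes b: "b \<noteq> 0" and [measurable]: "\<phi> \<in> borel_measurable borel"
  shows "(\<integral>\<^sup>+c. \<phi> c \<partial>lborel) = ennreal ((norm b)\<^sup>2) * (\<integral>\<^sup>+w. \<phi> (w $ 1 *\<^sub>R b + w $ 2 *\<^sub>R rot90 b) \<partial>(lborel :: point measure))"
proof -
  define f where "f w = w $ 1 *\<^sub>R b + w $ 2 *\<^sub>R rot90 b" for w :: point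
  define g where "g c = pt2 ((c \<bullet> b) / (norm b)\<^sup>2) ((c \<bullet> rot90 b) / (norm b)\<^sup>2)" for c
  have lf: "linear f" by (rule linearI) (simp_all add: f_def algebra_simps)
  have lg: "linear g" by (rule linearI) (simp_all add: g_def pt2_def inner_add_left add_divide_distrib algebra_simps)
  have gf: "g (f w) = w" for w
  proof -
    have "f w \<bullet> b = w $ 1 * (norm b)\<^sup>2" "f w \<bullet> rot90 b = w $ 2 * (norm b)\<^sup>2"
      unfolding norm_real2_sq by (simp_all add: f_def inner_real2 power2_eq_square algebra_simps)
    then show ?thesis using b by (simp add: g_def vec_eq_iff forall_2)
  qed
  have fg: "f (g c) = c" for c
  proof -
    have "(c \<bullet> b) *\<^sub>R b + (c \<bullet> rot90 b) *\<^sub>R rot90 b = (norm b)\<^sup>2 *\<^sub>R c"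
      unfolding norm_real2_sq by (simp add: vec_eq_iff forall_2 inner_real2 power2_eq_square algebra_simps)
    moreover have "f (g c) = (1 / (norm b)\<^sup>2) *\<^sub>R ((c \<bullet> b) *\<^sub>R b + (c \<bullet> rot90 b) *\<^sub>R rot90 b)"
      by (simp add: f_def g_def scaleR_add_right)
    ultimately show ?thesis using b by simp
  qed
  have det: "det (matrix f) = (norm b)\<^sup>2"
    unfolding norm_real2_sq by (simp add: det_2 matrix_def f_def axis_def power2_eq_square)
  have [measurable]: "f \<in> borel_measurable borel" unfolding f_def by measurable
  have "lborel = density (distr lborel borel f) (\<lambda>_. ennreal ((norm b)\<^sup>2))"
  proof (rule lborel_eqI)
    fix l u :: point assume lu: "\<And>b. b \<in> Basis \<Longrightarrow> l \<bullet> b \<le> u \<bullet> b"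
    let ?S = "f -` box l u"
    have "?S = g ` box l u"
    proof (intro equalityI subsetI)
      fix x assume "x \<in> ?S"
      then have "g (f x) \<in> g ` box l u" by blast
      then show "x \<in> g ` box l u" by (simp add: gf)
    qed (auto simp: fg)
    moreover have "bounded (g ` box l u)" using lg by (intro bounded_linear_image) (auto simp: linear_conv_bounded_linear)
    moreover have "open ?S" using lf by (intro continuous_open_vimage linear_continuous_at) (auto simp: linear_conv_bounded_linear)
    ultimately have lm: "?S \<in> lmeasurable" and op: "open ?S" by (auto intro: lmeasurable_open)
    have fS: "f ` ?S = box l u"
    proof (intro equalityI subsetI)
      fix x assume "x \<in> box l u"
      then have "f (g x) \<in> f ` ?S" by (intro imageI) (simp add: fg)
      then show "x \<in> f ` ?S" by (simp add: fg)
    qed auto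
    have "emeasure (density (distr lborel borel f) (\<lambda>_. ennreal ((norm b)\<^sup>2))) (box l u) = ennreal ((norm b)\<^sup>2) * emeasure lborel ?S"
      by (subst emeasure_density) (auto simp: nn_integral_cmult_indicator emeasure_distr)
    also have "emeasure lborel ?S = ennreal (measure lborel ?S)"
      using lm op by (intro emeasure_eq_ennreal_measure) (auto simp: fmeasurable_def less_top)
    also have "ennreal ((norm b)\<^sup>2) * ennreal (measure lborel ?S) = ennreal ((norm b)\<^sup>2 * measure lebesgue ?S)"
      using op by (simp add: ennreal_mult')
    also have "(norm b)\<^sup>2 * measure lebesgue ?S = measure lebesgue (f ` ?S)"
      using measure_linear_image[OF lf lm] det by simp
    also have "measure lebesgue (f ` ?S) = (\<Prod>b\<in>Basis. (u - l) \<bullet> b)"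
      unfolding fS using lu by (simp add: measure_lborel_box_eq)
    finally show "emeasure (density (distr lborel borel f) (\<lambda>_. ennreal ((norm b)\<^sup>2))) (box l u) = (\<Prod>b\<in>Basis. (u - l) \<bullet> b)" .
  qed simp
  then have "(\<integral>\<^sup>+c. \<phi> c \<partial>lborel) = (\<integral>\<^sup>+c. \<phi> c \<partial>density (distr lborel borel f) (\<lambda>_. ennreal ((norm b)\<^sup>2)))" by simp
  also have "\<dots> = ennreal ((norm b)\<^sup>2) * (\<integral>\<^sup>+w. \<phi> (f w) \<partial>lborel)"
    by (simp add: nn_integral_density nn_integral_distr nn_integral_cmult)
  finally show ?thesis by (simp add: f_def)
qed

lemma nn_integral_scale_point:
  fixes s :: real
  assumes s: "s > 0" and [measurable]: "\<phi> \<in> borel_measurable (borel :: point measure)"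
  shows "(\<integral>\<^sup>+b. \<phi> b \<partial>lborel) = ennreal (s\<^sup>2) * (\<integral>\<^sup>+b. \<phi> (s *\<^sub>R b) \<partial>lborel)"
proof -
  have "lborel = density (distr lborel borel (\<lambda>x::point. 0 + s *\<^sub>R x)) (\<lambda>_. \<bar>s\<bar> ^ DIM(point))"
    using s by (intro lborel_affine) simp
  then have "(\<integral>\<^sup>+b. \<phi> b \<partial>lborel) = (\<integral>\<^sup>+b. \<phi> b \<partial>density (distr lborel borel (\<lambda>x::point. s *\<^sub>R x)) (\<lambda>_. ennreal (s\<^sup>2)))"
    using s by simp
  also have "\<dots> = ennreal (s\<^sup>2) * (\<integral>\<^sup>+b. \<phi> (s *\<^sub>R b) \<partial>lborel)"
    by (simp add: nn_integral_density nn_integral_distr nn_integral_cmult)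
  finally show ?thesis .
qed

text \<open>The area of the disc reaching up to \<open>b\<close> is distributed as Lebesgue measure
  on the half-line, because the set where it is at most \<open>t\<close> is itself a disc of area
  \<open>t\<close>.\<close>

lemma nn_integral_radial:
  assumes [measurable]: "\<phi> \<in> borel_measurable borel"
  shows "(\<integral>\<^sup>+b. \<phi> (pi * (norm (b :: point))\<^sup>2) \<partial>lborel) = (\<integral>\<^sup>+u. \<phi> u * indicator {0..} u \<partial>lborel)"
proof -
  let ?N = "distr lborel borel (\<lambda>b :: point. pi * (norm b)\<^sup>2)"
  let ?D = "density lborel (indicator {0::real..})"
  have e: "emeasure ?N {..t} = ennreal t" "emeasure ?D {..t} = ennreal t" for t :: real
  proof -
    have "(\<lambda>b :: point. pi * (norm b)\<^sup>2) -` {..t} = (if t < 0 then {} else cball 0 (sqrt (t / pi)))"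
    proof (cases "t < 0")
      case True
      then have "\<not> pi * (norm (b::point))\<^sup>2 \<le> t" for b by (smt (verit) mult_nonneg_nonneg pi_ge_zero zero_le_power2)
      then show ?thesis using True by auto
    next
      case False
      have "pi * (norm b)\<^sup>2 \<le> t \<longleftrightarrow> norm b \<le> sqrt (t / pi)" for b :: point
      proof -
        have "norm b \<le> sqrt (t / pi) \<longleftrightarrow> sqrt ((norm b)\<^sup>2) \<le> sqrt (t / pi)" by simp
        also have "\<dots> \<longleftrightarrow> (norm b)\<^sup>2 \<le> t / pi" by (rule real_sqrt_le_iff)
        finally show ?thesis by (simp add: pos_le_divide_eq mult.commute)
      qed
      then show ?thesis using False by auto
    qed
    then have "emeasure ?N {..t} = emeasure lborel (if t < 0 then {} else cball 0 (sqrt (t / pi)) :: point set)"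
      by (subst emeasure_distr) auto
    also have "\<dots> = ennreal t" by (simp add: emeasure_cball unit_ball_vol_2 ennreal_neg)
    finally show "emeasure ?N {..t} = ennreal t" .
    have "emeasure ?D {..t} = emeasure lborel ({0..} \<inter> {..t})"
      by (subst emeasure_density) (auto simp: indicator_inter_arith[symmetric])
    also have "{0..} \<inter> {..t} = {0..t}" by auto
    finally show "emeasure ?D {..t} = ennreal t" by (cases "t \<ge> 0") (auto simp: ennreal_neg)
  qed
  have "?N = ?D"
  proof (rule measure_eqI_generator_eq[where E = "range atMost" and A = "\<lambda>n. {..real n}" and \<Omega> = UNIV])
    show "Int_stable (range (atMost :: real \<Rightarrow> real set))"
    proof (rule Int_stableI)
      fix a b :: "real set" assume "a \<in> range atMost" "b \<in> range atMost"
      then obtain s t where "a = {..s}" "b = {..t}" by blast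
      then have "a \<inter> b = {..min s t}" by auto
      then show "a \<inter> b \<in> range atMost" by blast
    qed
    show "(\<Union>i. {..real i}) = UNIV" by (auto simp: real_arch_simple)
    show "sets ?N = sigma_sets UNIV (range atMost)" "sets ?D = sigma_sets UNIV (range atMost)"
      by (simp_all add: borel_eq_atMost)
  qed (auto simp: e)
  have "(\<integral>\<^sup>+b. \<phi> (pi * (norm (b :: point))\<^sup>2) \<partial>lborel) = (\<integral>\<^sup>+u. \<phi> u \<partial>?N)" by (subst nn_integral_distr) auto
  also have "\<dots> = (\<integral>\<^sup>+u. \<phi> u * indicator {0..} u \<partial>lborel)"
    unfolding \<open>?N = ?D\<close> by (subst nn_integral_density) (auto simp: mult.commute)
  finally show ?thesis .
qed

section \<open>Size, height and angle of a random triangle\<close>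

lemma nn_integral_gamma:
  assumes r: "r > 0"
  shows "(\<integral>\<^sup>+u. ennreal (u ^ m * exp (- (r * u))) * indicator {0..} u \<partial>lborel) = ennreal (fact m / r ^ Suc m)"
proof -
  have "(\<integral>\<^sup>+u. ennreal (u ^ m * exp (- (r * u))) * indicator {0..} u \<partial>lborel) =
      ennreal \<bar>1 / r\<bar> * (\<integral>\<^sup>+u. ennreal ((0 + 1 / r * u) ^ m * exp (- (r * (0 + 1 / r * u)))) * indicator {0..} (0 + 1 / r * u) \<partial>lborel)"
    using r by (intro nn_integral_real_affine) auto
  also have "(\<integral>\<^sup>+u. ennreal ((0 + 1 / r * u) ^ m * exp (- (r * (0 + 1 / r * u)))) * indicator {0..} (0 + 1 / r * u) \<partial>lborel) =
      (\<integral>\<^sup>+u. ennreal ((1 / r) ^ m) * (ennreal (u ^ m * exp (- u)) * indicator {0..} u) \<partial>lborel)"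
  proof (intro nn_integral_cong)
    fix u :: real
    have "indicator {0..} (0 + 1 / r * u) = (indicator {0..} u :: ennreal)" using r by (simp add: indicator_def zero_le_divide_iff)
    moreover have "ennreal ((0 + 1 / r * u) ^ m * exp (- (r * (0 + 1 / r * u)))) = ennreal ((1 / r) ^ m) * ennreal (u ^ m * exp (- u))"
      using r by (subst ennreal_mult'[symmetric]) (auto simp: power_divide)
    ultimately show "ennreal ((0 + 1 / r * u) ^ m * exp (- (r * (0 + 1 / r * u)))) * indicator {0..} (0 + 1 / r * u) =
        ennreal ((1 / r) ^ m) * (ennreal (u ^ m * exp (- u)) * indicator {0..} u)" by (simp add: mult.assoc)
  qed
  also have "\<dots> = ennreal ((1 / r) ^ m) * ennreal (fact m)"
    by (subst nn_integral_cmult) (auto simp: nn_intergal_power_times_exp_Ici)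
  also have "\<dots> = ennreal ((1 / r) ^ m * fact m)" using r by (intro ennreal_mult'[symmetric]) simp
  also have "ennreal \<bar>1 / r\<bar> * \<dots> = ennreal (\<bar>1 / r\<bar> * ((1 / r) ^ m * fact m))"
    by (rule ennreal_mult'[symmetric]) simp
  also have "\<bar>1 / r\<bar> * ((1 / r) ^ m * fact m) = fact m / r ^ Suc m" using r by (simp add: power_divide field_simps)
  finally show ?thesis .
qed

text \<open>In terms of the disc area, the factor from the similarity raises the power from
  \<open>j\<close> to \<open>j + 1\<close>, which leaves a Gamma integral.\<close>

lemma nn_integral_radial_moment:
  assumes r: "r > 0"
  shows "(\<integral>\<^sup>+b. ennreal ((norm b)\<^sup>2 * ((pi * (norm b)\<^sup>2) ^ j * exp (- (r * (pi * (norm b)\<^sup>2))))) \<partial>(lborel :: point measure)) =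
    ennreal (fact (Suc j) / (pi * r ^ (j + 2)))"
proof -
  have "(\<integral>\<^sup>+b. ennreal ((norm b)\<^sup>2 * ((pi * (norm b)\<^sup>2) ^ j * exp (- (r * (pi * (norm b)\<^sup>2))))) \<partial>(lborel :: point measure)) =
      (\<integral>\<^sup>+b. ennreal (1 / pi * ((pi * (norm b)\<^sup>2) ^ Suc j * exp (- (r * (pi * (norm b)\<^sup>2))))) \<partial>(lborel :: point measure))"
    by (intro nn_integral_cong arg_cong[where f = ennreal]) simp
  also have "\<dots> = (\<integral>\<^sup>+u. ennreal (1 / pi * (u ^ Suc j * exp (- (r * u)))) * indicator {0..} u \<partial>lborel)"
    by (rule nn_integral_radial) measurable
  also have "\<dots> = (\<integral>\<^sup>+u. ennreal (1 / pi) * (ennreal (u ^ Suc j * exp (- (r * u))) * indicator {0..} u) \<partial>lborel)"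
    by (intro nn_integral_cong) (simp only: ennreal_mult' mult.assoc pi_ge_zero divide_nonneg_nonneg zero_le_one)
  also have "\<dots> = ennreal (1 / pi) * ennreal (fact (Suc j) / r ^ Suc (Suc j))"
    by (subst nn_integral_cmult) (simp_all only: nn_integral_gamma[OF r], measurable)
  also have "\<dots> = ennreal (fact (Suc j) / (pi * r ^ (j + 2)))"
    using r by (subst ennreal_mult'[symmetric]) (simp_all add: field_simps)
  finally show ?thesis .
qed

text \<open>With \<open>m\<close> the cotangent of the angle at the origin and \<open>y\<close> the height of \<open>w\<close>.\<close>

lemma nn_integral_height:
  "(\<integral>\<^sup>+y. ennreal (y / ((1 - y * m)\<^sup>2 + y\<^sup>2)\<^sup>2) * indicator {0..} y \<partial>lborel) = ennreal ((1 + m * (pi / 2 + arctan m)) / 2)"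
proof -
  define q where "q y = (1 - y * m)\<^sup>2 + y\<^sup>2" for y
  have q: "q y > 0" for y
    unfolding q_def by (cases "y = 0") (auto intro: add_nonneg_pos)
  have q': "q y = (1 + m\<^sup>2) * y\<^sup>2 - 2 * m * y + 1" for y by (simp add: q_def power2_eq_square algebra_simps)
  \<comment> \<open>An antiderivative of the integrand. As a quadratic in \<open>y\<close>,
    \<open>q\<close> has discriminant -4, and completing the square produces the arctangent.\<close>
  define F where "F y = (m * y - 1) / (2 * q y) + m / 2 * arctan ((1 + m\<^sup>2) * y - m)" for y
  have dq: "(q has_real_derivative (2 * (1 + m\<^sup>2) * y - 2 * m)) (at y)" for y
    unfolding q'[abs_def] by (auto intro!: derivative_eq_intros)
  have qq: "1 + ((1 + m\<^sup>2) * y - m)\<^sup>2 = (1 + m\<^sup>2) * q y" for y by (simp add: q' power2_eq_square algebra_simps)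
  have dF: "(F has_real_derivative y / (q y)\<^sup>2) (at y)" for y
  proof -
    have m2: "1 + m\<^sup>2 \<noteq> 0" by (smt (verit) zero_le_power2)
    have qn: "q y \<noteq> 0" using q[of y] by simp
    have "((\<lambda>y. (m * y - 1) / (2 * q y)) has_real_derivative
        (m * (2 * q y) - (m * y - 1) * (2 * (2 * (1 + m\<^sup>2) * y - 2 * m))) / (2 * q y * (2 * q y))) (at y)"
      by (rule DERIV_divide) (use qn in \<open>auto intro!: derivative_eq_intros dq\<close>)
    moreover have "((\<lambda>y. m / 2 * arctan ((1 + m\<^sup>2) * y - m)) has_real_derivative
        m / 2 * (inverse (1 + ((1 + m\<^sup>2) * y - m)\<^sup>2) * (1 + m\<^sup>2))) (at y)"
      by (intro DERIV_cmult DERIV_chain2[OF DERIV_arctan]) (auto intro!: derivative_eq_intros)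
    ultimately have "(F has_real_derivative ((m * (2 * q y) - (m * y - 1) * (2 * (2 * (1 + m\<^sup>2) * y - 2 * m))) / (2 * q y * (2 * q y)) +
        m / 2 * (inverse (1 + ((1 + m\<^sup>2) * y - m)\<^sup>2) * (1 + m\<^sup>2)))) (at y)"
      unfolding F_def[abs_def] by (rule DERIV_add)
    also have "inverse (1 + ((1 + m\<^sup>2) * y - m)\<^sup>2) * (1 + m\<^sup>2) = 1 / q y"
    proof -
      have "inverse (a * x) * a = 1 / x" if "a \<noteq> 0" for a x :: real using that by (simp add: field_simps)
      then show ?thesis unfolding qq using m2 by blast
    qed
    also have "(m * (2 * q y) - (m * y - 1) * (2 * (2 * (1 + m\<^sup>2) * y - 2 * m))) / (2 * q y * (2 * q y)) + m / 2 * (1 / q y) =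
        (m * q y - (m * y - 1) * ((1 + m\<^sup>2) * y - m)) / (q y)\<^sup>2"
      using qn by (simp add: field_simps power2_eq_square)
    also have "m * q y - (m * y - 1) * ((1 + m\<^sup>2) * y - m) = y" by (simp add: q' power2_eq_square algebra_simps)
    finally show ?thesis .
  qed
  have "(F \<longlongrightarrow> 0 + m / 2 * (pi / 2)) at_top"
    unfolding F_def[abs_def]
  proof (intro tendsto_add tendsto_mult tendsto_const)
    have pos: "1 + m\<^sup>2 > 0" by (smt (verit) zero_le_power2)
    show "((\<lambda>y. (m * y - 1) / (2 * q y)) \<longlongrightarrow> 0) at_top"
      unfolding q'[abs_def] using pos by real_asymp
    have "filterlim (\<lambda>y. (1 + m\<^sup>2) * y - m) at_top at_top" using pos by real_asymp
    then show "((\<lambda>y. arctan ((1 + m\<^sup>2) * y - m)) \<longlongrightarrow> pi / 2) at_top"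
      by (rule filterlim_compose[OF tendsto_arctan_at_top])
  qed
  then have "(\<integral>\<^sup>+y. ennreal (y / (q y)\<^sup>2) * indicator {0..} y \<partial>lborel) = ennreal (0 + m / 2 * (pi / 2) - F 0)"
    by (intro nn_integral_FTC_atLeast dF) (auto simp: q_def)
  also have "0 + m / 2 * (pi / 2) - F 0 = (1 + m * (pi / 2 + arctan m)) / 2"
    by (simp add: F_def q_def arctan_minus algebra_simps)
  finally show ?thesis by (simp add: q_def)
qed

text \<open>The classical formula: the circumradius is the product of the sides over four times the
  area, and the cross product is twice the signed area.\<close>

lemma circumradius_sq:
  assumes "cross2 b c \<noteq> 0"
  shows "(norm (circumcenter 0 b c))\<^sup>2 = (norm b)\<^sup>2 * (norm c)\<^sup>2 * (norm (b - c))\<^sup>2 / (4 * (cross2 b c)\<^sup>2)"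
proof -
  let ?v = "(norm c)\<^sup>2 *\<^sub>R rot90 b - (norm b)\<^sup>2 *\<^sub>R rot90 c"
  have "(norm (circumcenter 0 b c))\<^sup>2 = (1 / (2 * cross2 b c))\<^sup>2 * (norm ?v)\<^sup>2"
    by (simp add: circumcenter_def power_mult_distrib[symmetric] power_divide)
  also have "(norm ?v)\<^sup>2 = (norm b)\<^sup>2 * (norm c)\<^sup>2 * (norm (b - c))\<^sup>2"
  proof -
    have "(norm ?v)\<^sup>2 = ((norm c)\<^sup>2)\<^sup>2 * (rot90 b \<bullet> rot90 b) - 2 * (norm c)\<^sup>2 * (norm b)\<^sup>2 * (rot90 b \<bullet> rot90 c) + ((norm b)\<^sup>2)\<^sup>2 * (rot90 c \<bullet> rot90 c)"
      unfolding power2_norm_eq_inner[of ?v] by (simp add: inner_diff_left inner_diff_right inner_commute algebra_simps power2_eq_square)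
    also have "\<dots> = (norm b)\<^sup>2 * (norm c)\<^sup>2 * ((norm c)\<^sup>2 - 2 * (b \<bullet> c) + (norm b)\<^sup>2)"
      unfolding power2_norm_eq_inner inner_rot90_rot90 by (simp add: algebra_simps power2_eq_square)
    also have "(norm c)\<^sup>2 - 2 * (b \<bullet> c) + (norm b)\<^sup>2 = (norm (b - c))\<^sup>2"
      by (simp add: power2_norm_eq_inner inner_diff_left inner_diff_right inner_commute)
    finally show ?thesis .
  qed
  finally show ?thesis by (simp add: power_divide power_mult_distrib)
qed

text \<open>The squared circumradius of the triangle with vertices \<open>0\<close>,
  \<open>(1, 0)\<close> and \<open>w\<close>.\<close>

definition shapeL :: "point \<Rightarrow> real" where
  "shapeL w = (norm w)\<^sup>2 * ((1 - w $ 1)\<^sup>2 + (w $ 2)\<^sup>2) / (4 * (w $ 2)\<^sup>2)"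

lemma shapeL_pos: "w $ 2 > 0 \<Longrightarrow> shapeL w > 0"
  unfolding shapeL_def norm_real2_sq by (intro divide_pos_pos mult_pos_pos add_nonneg_pos) auto

lemma similarity_triangle:
  fixes b w :: point
  defines "c \<equiv> w $ 1 *\<^sub>R b + w $ 2 *\<^sub>R rot90 b"
  shows "cross2 b c = w $ 2 * (norm b)\<^sup>2" "b \<bullet> c = w $ 1 * (norm b)\<^sup>2"
    "(norm c)\<^sup>2 = (norm b)\<^sup>2 * (norm w)\<^sup>2" "(norm (b - c))\<^sup>2 = (norm b)\<^sup>2 * ((1 - w $ 1)\<^sup>2 + (w $ 2)\<^sup>2)"
  unfolding norm_real2_sq
  by (simp_all add: c_def cross2_def inner_real2 power2_eq_square algebra_simps)

lemma similarity_circumradius: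
  fixes b w :: point
  assumes "b \<noteq> 0" "w $ 2 \<noteq> 0"
  shows "(norm (circumcenter 0 b (w $ 1 *\<^sub>R b + w $ 2 *\<^sub>R rot90 b)))\<^sup>2 = (norm b)\<^sup>2 * shapeL w"
proof -
  let ?c = "w $ 1 *\<^sub>R b + w $ 2 *\<^sub>R rot90 b"
  have cr: "cross2 b ?c \<noteq> 0" unfolding similarity_triangle using assms by simp
  have "B * (B * W) * (B * P) / (4 * (y * B)\<^sup>2) = B * (W * P / (4 * y\<^sup>2))" if "B \<noteq> 0" "y \<noteq> 0" for B W P y :: real
    using that by (simp add: field_simps power2_eq_square)
  then show ?thesis unfolding circumradius_sq[OF cr] similarity_triangle shapeL_def
    using assms norm_eq_zero power_not_zero by blast
qed

lemma similarity_angle: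
  fixes b w :: point
  assumes "b \<noteq> 0"
  shows "vec_angle b (w $ 1 *\<^sub>R b + w $ 2 *\<^sub>R rot90 b) = arccos (w $ 1 / norm w)"
proof -
  let ?c = "w $ 1 *\<^sub>R b + w $ 2 *\<^sub>R rot90 b"
  have "(norm ?c)\<^sup>2 = (norm b * norm w)\<^sup>2" unfolding similarity_triangle by (simp add: power_mult_distrib)
  then have nc: "norm ?c = norm b * norm w" by simp
  have "(b \<bullet> ?c) / (norm b * norm ?c) = w $ 1 / norm w"
    unfolding nc similarity_triangle using assms by (simp add: power2_eq_square)
  then show ?thesis by (simp add: vec_angle_def)
qed

lemma borel_measurable_vec_angle [measurable (raw)]:
  assumes [measurable]: "f \<in> borel_measurable N" "g \<in> borel_measurable N"
  shows "(\<lambda>x. vec_angle (f x) (g x)) \<in> borel_measurable N"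
proof -
  have "continuous_on UNIV (\<lambda>x::real. arccos (max (- 1) (min 1 x)))"
    by (intro continuous_on_arccos continuous_intros) auto
  then have [measurable]: "(\<lambda>x::real. arccos (max (- 1) (min 1 x))) \<in> borel_measurable borel"
    by (rule borel_measurable_continuous_onI)
  have "vec_angle u v = arccos (max (- 1) (min 1 ((u \<bullet> v) / (norm u * norm v))))" for u v
    using abs_inner_div_norm_le_1[of u v] unfolding vec_angle_def by (metis abs_le_iff max_absorb2 min_absorb2 minus_le_iff)
  then show ?thesis by simp
qed

lemma borel_measurable_arccos_axis [measurable]: "(\<lambda>w :: point. arccos (w $ 1 / norm w)) \<in> borel_measurable borel"
proof -
  have "arccos (w $ 1 / norm w) = vec_angle (axis 1 1) w" for w :: point
    by (simp add: vec_angle_def inner_axis' )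
  then show ?thesis by simp
qed

lemma nn_integral_UN_incseq:
  fixes S :: "nat \<Rightarrow> real set"
  assumes [measurable]: "g \<in> borel_measurable borel" "\<And>i. S i \<in> sets borel" and "incseq S"
  shows "(\<integral>\<^sup>+x. g x * indicator (\<Union>i. S i) x \<partial>lborel) = (SUP i. \<integral>\<^sup>+x. g x * indicator (S i) x \<partial>lborel)"
proof -
  have "(\<integral>\<^sup>+x. g x * indicator (\<Union>i. S i) x \<partial>lborel) = emeasure (density lborel g) (\<Union>i. S i)"
    by (simp add: emeasure_density)
  also have "\<dots> = (SUP i. emeasure (density lborel g) (S i))"
    using assms(3) by (intro SUP_emeasure_incseq[symmetric]) auto
  finally show ?thesis by (simp add: emeasure_density)
qed

text \<open>The substitution \<open>m = tan s\<close> followed by \<open>t = pi / 2 - s\<close>, so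
  that \<open>m\<close> is the cotangent of the angle \<open>t\<close>. It turns the integrand into
  \<open>8 * sin t * (sin t + (pi - t) * cos t)\<close>, which is
  \<open>6 * f_angle t\<close>.\<close>

lemma nn_integral_cotangent:
  assumes T [measurable]: "T \<in> sets borel"
  shows "(\<integral>\<^sup>+m. ennreal (8 * (1 + m * (pi / 2 + arctan m)) / (1 + m\<^sup>2)\<^sup>2) * indicator T (pi / 2 - arctan m) \<partial>lborel) =
    (\<integral>\<^sup>+t. ennreal (6 * f_angle t) * indicator ({0..pi} \<inter> T) t \<partial>lborel)"
proof -
  let ?g = "\<lambda>m. ennreal (8 * (1 + m * (pi / 2 + arctan m)) / (1 + m\<^sup>2)\<^sup>2) * indicator T (pi / 2 - arctan m)"
  define F where "F s = ennreal (8 * (cos s * (cos s + (pi / 2 + s) * sin s))) * indicator T (pi / 2 - s)" for s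
  have [measurable]: "F \<in> borel_measurable borel" unfolding F_def by measurable
  have Fg: "F (arctan m) * ennreal (inverse (1 + m\<^sup>2)) = ?g m" for m
  proof -
    have pos: "1 + m\<^sup>2 > 0" by (smt (verit) zero_le_power2)
    have sq: "sqrt (1 + m\<^sup>2) * sqrt (1 + m\<^sup>2) = 1 + m\<^sup>2" using pos by simp
    have "cos (arctan m) * (cos (arctan m) + (pi / 2 + arctan m) * sin (arctan m)) = (1 + m * (pi / 2 + arctan m)) / (sqrt (1 + m\<^sup>2) * sqrt (1 + m\<^sup>2))"
      unfolding cos_arctan sin_arctan by (simp add: add_divide_distrib algebra_simps)
    also have "\<dots> = (1 + m * (pi / 2 + arctan m)) / (1 + m\<^sup>2)" unfolding sq ..
    finally have "8 * (cos (arctan m) * (cos (arctan m) + (pi / 2 + arctan m) * sin (arctan m))) * inverse (1 + m\<^sup>2) =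
        8 * (1 + m * (pi / 2 + arctan m)) / (1 + m\<^sup>2)\<^sup>2"
      by (simp add: power2_eq_square inverse_eq_divide)
    then have eq: "ennreal (8 * (cos (arctan m) * (cos (arctan m) + (pi / 2 + arctan m) * sin (arctan m)))) * ennreal (inverse (1 + m\<^sup>2)) =
        ennreal (8 * (1 + m * (pi / 2 + arctan m)) / (1 + m\<^sup>2)\<^sup>2)"
      using pos by (subst ennreal_mult''[symmetric]) auto
    have comm: "(a * d) * i = (a * i) * d" for a d i :: ennreal by (simp add: mult_ac)
    show ?thesis unfolding F_def comm eq ..
  qed
  \<comment> \<open>The substitution is carried out on compact intervals, which then exhaust the
    line.\<close>
  have piece: "(\<integral>\<^sup>+s. F s * indicator {arctan (- real K)..arctan (real K)} s \<partial>lborel) = (\<integral>\<^sup>+m. ?g m * indicator {- real K..real K} m \<partial>lborel)" if "K > 0" for K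
  proof -
    have "(\<integral>\<^sup>+s. F s * indicator {arctan (- real K)..arctan (real K)} s \<partial>lborel) =
        (\<integral>\<^sup>+m. F (arctan m) * ennreal (inverse (1 + m\<^sup>2)) * indicator {- real K..real K} m \<partial>lborel)"
    proof (rule nn_integral_substitution_aux)
      show "(arctan has_real_derivative inverse (1 + x\<^sup>2)) (at x)" for x by (rule DERIV_arctan)
      have "1 + x\<^sup>2 \<noteq> 0" for x :: real by (smt (verit) zero_le_power2)
      then show "continuous_on {- real K..real K} (\<lambda>x. inverse (1 + x\<^sup>2))" by (intro continuous_intros) auto
      show "0 \<le> inverse (1 + x\<^sup>2)" for x :: real by simp
    qed (use that in auto)
    then show ?thesis unfolding Fg .
  qed
  have U1: "(\<Union>K. {arctan (- real (Suc K))..arctan (real (Suc K))}) = {- (pi / 2)<..<pi / 2}"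
  proof (intro equalityI subsetI)
    fix s assume "s \<in> (\<Union>K. {arctan (- real (Suc K))..arctan (real (Suc K))})"
    then obtain K where "arctan (- real (Suc K)) \<le> s" "s \<le> arctan (real (Suc K))" by auto
    then show "s \<in> {- (pi / 2)<..<pi / 2}" using arctan_lbound[of "- real (Suc K)"] arctan_ubound[of "real (Suc K)"] by auto
  next
    fix s assume s: "s \<in> {- (pi / 2)<..<pi / 2}"
    then have e: "arctan (tan s) = s" by (intro arctan_tan) auto
    obtain K where K: "\<bar>tan s\<bar> \<le> real K" using real_arch_simple by blast
    then have "- real (Suc K) \<le> tan s" "tan s \<le> real (Suc K)" by auto
    then have "arctan (- real (Suc K)) \<le> s" "s \<le> arctan (real (Suc K))" using arctan_le_iff e by metis+
    then show "s \<in> (\<Union>K. {arctan (- real (Suc K))..arctan (real (Suc K))})" by auto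
  qed
  have U2: "(\<Union>K. {- real (Suc K)..real (Suc K)}) = UNIV"
  proof -
    have "\<exists>K. - real (Suc K) \<le> m \<and> m \<le> real (Suc K)" for m :: real
    proof -
      obtain K where "\<bar>m\<bar> \<le> real K" using real_arch_simple by blast
      then show ?thesis by (intro exI[of _ K]) auto
    qed
    then show ?thesis by auto
  qed
  have [measurable]: "?g \<in> borel_measurable borel" by measurable
  have "(\<integral>\<^sup>+m. ?g m \<partial>lborel) = (\<integral>\<^sup>+m. ?g m * indicator (\<Union>K. {- real (Suc K)..real (Suc K)}) m \<partial>lborel)" by (simp only: U2) simp
  also have "\<dots> = (SUP K. \<integral>\<^sup>+m. ?g m * indicator {- real (Suc K)..real (Suc K)} m \<partial>lborel)"
    by (rule nn_integral_UN_incseq) (auto simp: incseq_def)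
  also have "\<dots> = (SUP K. \<integral>\<^sup>+s. F s * indicator {arctan (- real (Suc K))..arctan (real (Suc K))} s \<partial>lborel)"
    by (intro SUP_cong refl piece[symmetric]) simp
  also have "\<dots> = (\<integral>\<^sup>+s. F s * indicator (\<Union>K. {arctan (- real (Suc K))..arctan (real (Suc K))}) s \<partial>lborel)"
    by (rule nn_integral_UN_incseq[symmetric]) (auto simp: incseq_def arctan_le_iff intro: order_trans)
  also have "\<dots> = (\<integral>\<^sup>+s. F s * indicator {- (pi / 2)<..<pi / 2} s \<partial>lborel)" unfolding U1 ..
  also have "\<dots> = ennreal \<bar>- 1\<bar> * (\<integral>\<^sup>+t. F (pi / 2 + - 1 * t) * indicator {- (pi / 2)<..<pi / 2} (pi / 2 + - 1 * t) \<partial>lborel)"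
    by (intro nn_integral_real_affine) auto
  also have "\<dots> = (\<integral>\<^sup>+t. ennreal (6 * f_angle t) * indicator ({0<..<pi} \<inter> T) t \<partial>lborel)"
  proof -
    have F': "F (pi / 2 - t) = ennreal (6 * f_angle t) * indicator T t" for t
    proof -
      have "cos (pi / 2 - t) = sin t" "sin (pi / 2 - t) = cos t" by (simp_all add: cos_diff sin_diff)
      then have "8 * (cos (pi / 2 - t) * (cos (pi / 2 - t) + (pi / 2 + (pi / 2 - t)) * sin (pi / 2 - t))) =
          8 * (sin t * (sin t + (pi - t) * cos t))" by simp
      also have "\<dots> = 6 * f_angle t" unfolding f_angle_def by (simp add: mult.commute add.commute)
      finally have e: "8 * (cos (pi / 2 - t) * (cos (pi / 2 - t) + (pi / 2 + (pi / 2 - t)) * sin (pi / 2 - t))) = 6 * f_angle t" .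
      show ?thesis unfolding F_def e by simp
    qed
    have "F (pi / 2 + - 1 * t) * indicator {- (pi / 2)<..<pi / 2} (pi / 2 + - 1 * t) = ennreal (6 * f_angle t) * indicator ({0<..<pi} \<inter> T) t" for t
      using F'[of t] by (auto simp: indicator_def)
    then show ?thesis by simp
  qed
  also have "\<dots> = (\<integral>\<^sup>+t. ennreal (6 * f_angle t) * indicator ({0..pi} \<inter> T) t \<partial>lborel)"
  proof (rule nn_integral_cong_AE)
    have "AE t in lborel. t \<noteq> 0 \<and> t \<noteq> pi" using AE_lborel_singleton[of 0] AE_lborel_singleton[of pi] by eventually_elim auto
    then show "AE t in lborel. ennreal (6 * f_angle t) * indicator ({0<..<pi} \<inter> T) t = ennreal (6 * f_angle t) * indicator ({0..pi} \<inter> T) t"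
      by eventually_elim (auto simp: indicator_def)
  qed
  finally show ?thesis .
qed

lemma arccos_cotangent:
  assumes "y > 0"
  shows "arccos (y * m / norm (pt2 (y * m) y)) = pi / 2 - arctan m"
proof -
  have "(norm (pt2 (y * m) y))\<^sup>2 = (y * sqrt (1 + m\<^sup>2))\<^sup>2"
    unfolding norm_real2_sq by (simp add: power_mult_distrib algebra_simps)
  then have "norm (pt2 (y * m) y) = y * sqrt (1 + m\<^sup>2)" using assms by simp
  then have "y * m / norm (pt2 (y * m) y) = cos (pi / 2 - arctan m)" using assms by (simp add: sin_arctan cos_diff)
  moreover have "0 \<le> pi / 2 - arctan m" "pi / 2 - arctan m \<le> pi" using arctan_bounded[of m] by auto
  ultimately show ?thesis by (simp add: arccos_cos)
qed

text \<open>On the horizontal line at height \<open>y\<close> the abscissa is \<open>y * m\<close>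
  with \<open>m\<close> the cotangent of the angle at the origin. The angle then depends on
  \<open>m\<close> only, so the height can be integrated out first, by
  \<open>nn_integral_height\<close>.\<close>

lemma nn_integral_shape:
  assumes T [measurable]: "T \<in> sets borel"
  shows "(\<integral>\<^sup>+w. ennreal (1 / (shapeL w)\<^sup>2) * indicator {0<..} (w $ 2) * indicator T (arccos (w $ 1 / norm w)) \<partial>lborel) =
    (\<integral>\<^sup>+t. ennreal (6 * f_angle t) * indicator ({0..pi} \<inter> T) t \<partial>lborel)"
proof -
  have [measurable]: "shapeL \<in> borel_measurable borel" unfolding shapeL_def by measurable
  let ?\<phi> = "\<lambda>w. ennreal (1 / (shapeL w)\<^sup>2) * indicator {0<..} (w $ 2) * indicator T (arccos (w $ 1 / norm w))"
  have [measurable]: "(\<lambda>(x, y). pt2 x y) \<in> borel_measurable (borel \<Otimes>\<^sub>M borel)"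
    unfolding pt2_def by measurable
  let ?h = "\<lambda>m y. ennreal (16 / (1 + m\<^sup>2)\<^sup>2) * indicator T (pi / 2 - arctan m) * (ennreal (y / ((1 - y * m)\<^sup>2 + y\<^sup>2)\<^sup>2) * indicator {0..} y)"
  have "(\<integral>\<^sup>+w. ?\<phi> w \<partial>lborel) = (\<integral>\<^sup>+y. \<integral>\<^sup>+x. ?\<phi> (pt2 x y) \<partial>lborel \<partial>lborel)"
    by (rule nn_integral_point) measurable
  also have "\<dots> = (\<integral>\<^sup>+y. \<integral>\<^sup>+m. ?h m y \<partial>lborel \<partial>lborel)"
  proof (rule nn_integral_cong)
    fix y :: real
    show "(\<integral>\<^sup>+x. ?\<phi> (pt2 x y) \<partial>lborel) = (\<integral>\<^sup>+m. ?h m y \<partial>lborel)"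
    proof (cases "y > 0")
      case False
      then have "(\<integral>\<^sup>+x. ?\<phi> (pt2 x y) \<partial>lborel) = 0" "(\<integral>\<^sup>+m. ?h m y \<partial>lborel) = 0"
        by (intro nn_integral_zero' AE_I2; auto simp: indicator_def)+
      then show ?thesis by simp
    next
      case True
      have m1: "(\<lambda>x. ?\<phi> (pt2 x y)) \<in> borel_measurable borel" unfolding pt2_def by measurable
      have m2: "(\<lambda>m. ?\<phi> (pt2 (y * m) y)) \<in> borel_measurable lborel" unfolding pt2_def by measurable
      have "(\<integral>\<^sup>+x. ?\<phi> (pt2 x y) \<partial>lborel) = ennreal \<bar>y\<bar> * (\<integral>\<^sup>+m. ?\<phi> (pt2 (0 + y * m) y) \<partial>lborel)"
        by (rule nn_integral_real_affine[OF m1]) (use True in simp)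
      also have "\<dots> = (\<integral>\<^sup>+m. ennreal y * ?\<phi> (pt2 (y * m) y) \<partial>lborel)"
        unfolding nn_integral_cmult[OF m2] using True by simp
      also have "\<dots> = (\<integral>\<^sup>+m. ?h m y \<partial>lborel)"
      proof (rule nn_integral_cong)
        fix m :: real
        have pos: "1 + m\<^sup>2 > 0" by (smt (verit) zero_le_power2)
        have sh: "shapeL (pt2 (y * m) y) = (1 + m\<^sup>2) * ((1 - y * m)\<^sup>2 + y\<^sup>2) / 4"
          using True unfolding shapeL_def norm_real2_sq by (simp add: power2_eq_square field_simps)
        have "1 / (shapeL (pt2 (y * m) y))\<^sup>2 = 16 / (1 + m\<^sup>2)\<^sup>2 * (1 / ((1 - y * m)\<^sup>2 + y\<^sup>2)\<^sup>2)"
          unfolding sh by (simp add: power_divide power_mult_distrib)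
        then have "y * (1 / (shapeL (pt2 (y * m) y))\<^sup>2) = 16 / (1 + m\<^sup>2)\<^sup>2 * (y / ((1 - y * m)\<^sup>2 + y\<^sup>2)\<^sup>2)" by simp
        then have "ennreal y * ennreal (1 / (shapeL (pt2 (y * m) y))\<^sup>2) = ennreal (16 / (1 + m\<^sup>2)\<^sup>2) * ennreal (y / ((1 - y * m)\<^sup>2 + y\<^sup>2)\<^sup>2)"
          using True by (subst (1 2) ennreal_mult'[symmetric]) auto
        then show "ennreal y * ?\<phi> (pt2 (y * m) y) = ?h m y"
          using True arccos_cotangent[OF True, of m] by (simp add: mult.assoc[symmetric]) (simp add: mult_ac)
      qed
      finally show ?thesis .
    qed
  qed
  also have "\<dots> = (\<integral>\<^sup>+m. \<integral>\<^sup>+y. ?h m y \<partial>lborel \<partial>lborel)"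
    by (rule lborel_pair.Fubini') measurable
  also have "\<dots> = (\<integral>\<^sup>+m. ennreal (8 * (1 + m * (pi / 2 + arctan m)) / (1 + m\<^sup>2)\<^sup>2) * indicator T (pi / 2 - arctan m) \<partial>lborel)"
  proof (rule nn_integral_cong)
    fix m :: real
    have "(\<integral>\<^sup>+y. ?h m y \<partial>lborel) = ennreal (16 / (1 + m\<^sup>2)\<^sup>2) * indicator T (pi / 2 - arctan m) * ennreal ((1 + m * (pi / 2 + arctan m)) / 2)"
      by (subst nn_integral_cmult) (auto simp: nn_integral_height)
    also have "\<dots> = ennreal (16 / (1 + m\<^sup>2)\<^sup>2 * ((1 + m * (pi / 2 + arctan m)) / 2)) * indicator T (pi / 2 - arctan m)"
      by (subst ennreal_mult') (auto simp: mult_ac)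
    also have "16 / (1 + m\<^sup>2)\<^sup>2 * ((1 + m * (pi / 2 + arctan m)) / 2) = 8 * (1 + m * (pi / 2 + arctan m)) / (1 + m\<^sup>2)\<^sup>2"
    proof -
      have "16 / d * (a / 2) = 8 * a / d" for a d :: real by (simp add: field_simps)
      then show ?thesis .
    qed
    finally show "(\<integral>\<^sup>+y. ?h m y \<partial>lborel) = ennreal (8 * (1 + m * (pi / 2 + arctan m)) / (1 + m\<^sup>2)\<^sup>2) * indicator T (pi / 2 - arctan m)" .
  qed
  also have "\<dots> = (\<integral>\<^sup>+t. ennreal (6 * f_angle t) * indicator ({0..pi} \<inter> T) t \<partial>lborel)" by (rule nn_integral_cotangent) fact
  finally show ?thesis .
qed

text \<open>Separation of size and shape. The squared circumradius is
  \<open>(norm b)\<^sup>2 * shapeL w\<close>, so for fixed \<open>w\<close> the integral over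
  \<open>b\<close> is a radial moment after rescaling. All dependence on \<open>j\<close> and
  \<open>r\<close> stays in the constant.\<close>

lemma nn_integral_triangles:
  assumes T [measurable]: "T \<in> sets borel" and r: "r > 0"
  shows "(\<integral>\<^sup>+b. \<integral>\<^sup>+c. ennreal ((pi * (norm (circumcenter 0 b c))\<^sup>2) ^ j * exp (- (r * (pi * (norm (circumcenter 0 b c))\<^sup>2)))) *
      indicator {0<..} (cross2 b c) * indicator T (vec_angle b c) \<partial>lborel \<partial>lborel) =
    ennreal (fact (Suc j) / (pi * r ^ (j + 2))) * (\<integral>\<^sup>+t. ennreal (6 * f_angle t) * indicator ({0..pi} \<inter> T) t \<partial>lborel)"
proof -
  have [measurable]: "shapeL \<in> borel_measurable borel" unfolding shapeL_def by measurable
  define K where "K s = (pi * s) ^ j * exp (- (r * (pi * s)))" for s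
  have [measurable]: "K \<in> borel_measurable borel" unfolding K_def by measurable
  let ?\<psi> = "\<lambda>b c. ennreal (K ((norm (circumcenter 0 b c))\<^sup>2)) * indicator {0<..} (cross2 b c) * indicator T (vec_angle b c)"
  let ?\<chi> = "\<lambda>w. indicator {0<..} (w $ 2) * indicator T (arccos (w $ 1 / norm w)) :: ennreal"
  let ?C = "ennreal (fact (Suc j) / (pi * r ^ (j + 2)))"
  have K0: "K s \<ge> 0" if "s \<ge> 0" for s using that by (simp add: K_def)
  have "(\<integral>\<^sup>+b. \<integral>\<^sup>+c. ?\<psi> b c \<partial>lborel \<partial>lborel) = (\<integral>\<^sup>+b. \<integral>\<^sup>+w. ennreal ((norm b)\<^sup>2 * K ((norm b)\<^sup>2 * shapeL w)) * ?\<chi> w \<partial>lborel \<partial>(lborel :: point measure))"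
  proof (rule nn_integral_cong)
    fix b :: point
    show "(\<integral>\<^sup>+c. ?\<psi> b c \<partial>lborel) = (\<integral>\<^sup>+w. ennreal ((norm b)\<^sup>2 * K ((norm b)\<^sup>2 * shapeL w)) * ?\<chi> w \<partial>lborel)"
    proof (cases "b = 0")
      case False
      have "(\<integral>\<^sup>+c. ?\<psi> b c \<partial>lborel) = ennreal ((norm b)\<^sup>2) * (\<integral>\<^sup>+w. ?\<psi> b (w $ 1 *\<^sub>R b + w $ 2 *\<^sub>R rot90 b) \<partial>(lborel :: point measure))"
        by (rule nn_integral_similarity[OF False]) measurable
      also have "\<dots> = (\<integral>\<^sup>+w. ennreal ((norm b)\<^sup>2) * ?\<psi> b (w $ 1 *\<^sub>R b + w $ 2 *\<^sub>R rot90 b) \<partial>(lborel :: point measure))"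
        by (rule nn_integral_cmult[symmetric]) measurable
      also have "\<dots> = (\<integral>\<^sup>+w. ennreal ((norm b)\<^sup>2 * K ((norm b)\<^sup>2 * shapeL w)) * ?\<chi> w \<partial>lborel)"
      proof (rule nn_integral_cong)
        fix w :: point
        have ind: "indicator {0<..} (cross2 b (w $ 1 *\<^sub>R b + w $ 2 *\<^sub>R rot90 b)) = (indicator {0<..} (w $ 2) :: ennreal)"
          using False unfolding similarity_triangle by (simp add: indicator_def zero_less_mult_iff)
        show "ennreal ((norm b)\<^sup>2) * ?\<psi> b (w $ 1 *\<^sub>R b + w $ 2 *\<^sub>R rot90 b) = ennreal ((norm b)\<^sup>2 * K ((norm b)\<^sup>2 * shapeL w)) * ?\<chi> w"
        proof (cases "w $ 2 > 0")
          case True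
          then show ?thesis using similarity_circumradius[OF False, of w]
            unfolding ind similarity_angle[OF False] by (simp add: ennreal_mult' mult.assoc)
        next
          case False
          then have "indicator {0<..} (w $ 2) = (0::ennreal)" by simp
          then show ?thesis unfolding ind by simp
        qed
      qed
      finally show ?thesis .
    qed simp
  qed
  also have "\<dots> = (\<integral>\<^sup>+w. \<integral>\<^sup>+b. ennreal ((norm b)\<^sup>2 * K ((norm b)\<^sup>2 * shapeL w)) * ?\<chi> w \<partial>(lborel :: point measure) \<partial>lborel)"
    by (rule lborel_pair.Fubini') measurable
  also have "\<dots> = (\<integral>\<^sup>+w. ?C * (ennreal (1 / (shapeL w)\<^sup>2) * indicator {0<..} (w $ 2) * indicator T (arccos (w $ 1 / norm w))) \<partial>lborel)"
  proof (rule nn_integral_cong)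
    fix w :: point
    show "(\<integral>\<^sup>+b. ennreal ((norm b)\<^sup>2 * K ((norm b)\<^sup>2 * shapeL w)) * ?\<chi> w \<partial>(lborel :: point measure)) =
        ?C * (ennreal (1 / (shapeL w)\<^sup>2) * indicator {0<..} (w $ 2) * indicator T (arccos (w $ 1 / norm w)))"
    proof (cases "w $ 2 > 0")
      case True
      define L where "L = shapeL w"
      have L: "L > 0" using shapeL_pos[OF True] by (simp add: L_def)
      \<comment> \<open>Rescaling \<open>b\<close> by \<open>1 / sqrt L\<close> gives one factor
        \<open>1 / L\<close> from the area element and one from the squared norm; the argument of
        \<open>K\<close> loses its dependence on \<open>L\<close>.\<close>
      have "(\<integral>\<^sup>+b. ennreal ((norm b)\<^sup>2 * K ((norm b)\<^sup>2 * L)) \<partial>(lborel :: point measure)) =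
          ennreal ((1 / sqrt L)\<^sup>2) * (\<integral>\<^sup>+b. ennreal ((norm ((1 / sqrt L) *\<^sub>R b))\<^sup>2 * K ((norm ((1 / sqrt L) *\<^sub>R b))\<^sup>2 * L)) \<partial>(lborel :: point measure))"
        using L by (intro nn_integral_scale_point) auto
      also have "(\<integral>\<^sup>+b. ennreal ((norm ((1 / sqrt L) *\<^sub>R b))\<^sup>2 * K ((norm ((1 / sqrt L) *\<^sub>R b))\<^sup>2 * L)) \<partial>(lborel :: point measure)) =
          (\<integral>\<^sup>+b. ennreal (1 / L) * ennreal ((norm b)\<^sup>2 * K ((norm b)\<^sup>2)) \<partial>(lborel :: point measure))"
      proof (rule nn_integral_cong)
        fix b :: point
        have "(norm ((1 / sqrt L) *\<^sub>R b))\<^sup>2 = (norm b)\<^sup>2 / L" using L by (simp add: power_divide)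
        then have "(norm ((1 / sqrt L) *\<^sub>R b))\<^sup>2 * K ((norm ((1 / sqrt L) *\<^sub>R b))\<^sup>2 * L) = 1 / L * ((norm b)\<^sup>2 * K ((norm b)\<^sup>2))"
          using L by simp
        then show "ennreal ((norm ((1 / sqrt L) *\<^sub>R b))\<^sup>2 * K ((norm ((1 / sqrt L) *\<^sub>R b))\<^sup>2 * L)) = ennreal (1 / L) * ennreal ((norm b)\<^sup>2 * K ((norm b)\<^sup>2))"
          using L by (simp only:) (subst ennreal_mult', auto)
      qed
      also have "\<dots> = ennreal (1 / L) * (\<integral>\<^sup>+b. ennreal ((norm b)\<^sup>2 * K ((norm b)\<^sup>2)) \<partial>(lborel :: point measure))"
        by (rule nn_integral_cmult) measurable
      also have "(\<integral>\<^sup>+b. ennreal ((norm b)\<^sup>2 * K ((norm b)\<^sup>2)) \<partial>(lborel :: point measure)) = ?C"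
        unfolding K_def by (rule nn_integral_radial_moment[OF r])
      also have "ennreal ((1 / sqrt L)\<^sup>2) * (ennreal (1 / L) * ?C) = ?C * ennreal (1 / L\<^sup>2)"
      proof -
        have "ennreal ((1 / sqrt L)\<^sup>2) * ennreal (1 / L) = ennreal (1 / L\<^sup>2)"
          using L by (subst ennreal_mult'[symmetric]) (auto simp: power_divide power2_eq_square)
        moreover have "a * (b * d) = d * (a * b)" for a b d :: ennreal by (simp add: mult_ac)
        ultimately show ?thesis by metis
      qed
      finally have e: "(\<integral>\<^sup>+b. ennreal ((norm b)\<^sup>2 * K ((norm b)\<^sup>2 * L)) \<partial>(lborel :: point measure)) = ?C * ennreal (1 / L\<^sup>2)" .
      have "(\<integral>\<^sup>+b. ennreal ((norm b)\<^sup>2 * K ((norm b)\<^sup>2 * L)) * ?\<chi> w \<partial>(lborel :: point measure)) = (\<integral>\<^sup>+b. ennreal ((norm b)\<^sup>2 * K ((norm b)\<^sup>2 * L)) \<partial>(lborel :: point measure)) * ?\<chi> w"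
        by (rule nn_integral_multc) measurable
      then show ?thesis unfolding e L_def[symmetric] by (simp add: mult.assoc)
    qed simp
  qed
  also have "\<dots> = ?C * (\<integral>\<^sup>+w. ennreal (1 / (shapeL w)\<^sup>2) * indicator {0<..} (w $ 2) * indicator T (arccos (w $ 1 / norm w)) \<partial>lborel)"
    by (rule nn_integral_cmult) measurable
  also have "\<dots> = ?C * (\<integral>\<^sup>+t. ennreal (6 * f_angle t) * indicator ({0..pi} \<inter> T) t \<partial>lborel)"
    unfolding nn_integral_shape[OF T] ..
  finally show ?thesis unfolding K_def .
qed

section \<open>Translation invariance and the reference point\<close>

definition tshift :: "nat \<Rightarrow> point \<Rightarrow> (nat \<Rightarrow> point) \<Rightarrow> nat \<Rightarrow> point" where
  "tshift n s x = (\<lambda>i\<in>{..<n}. x i + s)"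

lemma measurable_tshift: "tshift n s \<in> measurable (tuple_space n) (tuple_space n)"
  unfolding tshift_def[abs_def]
proof (rule measurable_restrict)
  fix i assume "i \<in> {..<n}"
  then have [measurable]: "(\<lambda>x. x i) \<in> borel_measurable (tuple_space n)" by (intro measurable_tuple_component) simp
  show "(\<lambda>x. x i + s) \<in> measurable (tuple_space n) lborel" by measurable
qed

lemma distr_tshift: "distr (tuple_space n) (tuple_space n) (tshift n s) = tuple_space n"
proof (rule lborel_product.PiM_eqI)
  note [measurable] = measurable_tshift
  fix B :: "nat \<Rightarrow> point set" assume B: "\<And>i. i \<in> {..<n} \<Longrightarrow> B i \<in> sets lborel"
  have vim: "tshift n s -` PiE {..<n} B \<inter> space (tuple_space n) = PiE {..<n} (\<lambda>i. (+) s -` B i)"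
    by (auto simp: tshift_def space_PiM PiE_iff add.commute)
  have sB: "(+) s -` B i \<in> sets borel" if "i \<in> {..<n}" for i
    using measurable_sets[of "(+) s" borel borel "B i"] B[OF that] by simp
  have "PiE {..<n} B \<in> sets (tuple_space n)" using B by (intro sets_PiM_I_finite) auto
  then have "emeasure (distr (tuple_space n) (tuple_space n) (tshift n s)) (PiE {..<n} B) = emeasure (tuple_space n) (PiE {..<n} (\<lambda>i. (+) s -` B i))"
    by (subst emeasure_distr) (auto simp: vim)
  also have "\<dots> = (\<Prod>i\<in>{..<n}. emeasure lborel ((+) s -` B i))" using sB by (intro lborel_product.emeasure_PiM) auto
  also have "\<dots> = (\<Prod>i\<in>{..<n}. emeasure lborel (B i))"
  proof (intro prod.cong refl)
    fix i assume i: "i \<in> {..<n}"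
    have "emeasure (distr lborel borel ((+) s)) (B i) = emeasure lborel ((+) s -` B i)"
      using B[OF i] by (subst emeasure_distr) auto
    then show "emeasure lborel ((+) s -` B i) = emeasure lborel (B i)" by (simp add: lborel_distr_plus)
  qed
  finally show "emeasure (distr (tuple_space n) (tuple_space n) (tshift n s)) (PiE {..<n} B) = (\<Prod>i\<in>{..<n}. emeasure lborel (B i))" .
qed auto

lemma nn_integral_tshift:
  assumes "f \<in> borel_measurable (tuple_space n)"
  shows "(\<integral>\<^sup>+x. f (tshift n s x) \<partial>tuple_space n) = (\<integral>\<^sup>+x. f x \<partial>tuple_space n)"
proof -
  have "(\<integral>\<^sup>+x. f x \<partial>distr (tuple_space n) (tuple_space n) (tshift n s)) = (\<integral>\<^sup>+x. f (tshift n s x) \<partial>tuple_space n)"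
    using assms by (intro nn_integral_distr[OF measurable_tshift]) auto
  then show ?thesis by (simp add: distr_tshift)
qed

lemma nn_integral_lborel_shift:
  fixes a :: "'a::euclidean_space"
  assumes [measurable]: "f \<in> borel_measurable borel"
  shows "(\<integral>\<^sup>+x. f (a + x) \<partial>lborel) = (\<integral>\<^sup>+x. f x \<partial>lborel)"
proof -
  have "(\<integral>\<^sup>+x. f x \<partial>lborel) = (\<integral>\<^sup>+x. f x \<partial>distr lborel borel ((+) a))" by (simp add: lborel_distr_plus)
  also have "\<dots> = (\<integral>\<^sup>+x. f (a + x) \<partial>lborel)" by (subst nn_integral_distr) auto
  finally show ?thesis by simp
qed

lemma nn_integral_lborel_reflect:
  fixes a :: point
  assumes W [measurable]: "W \<in> sets borel"
  shows "(\<integral>\<^sup>+s. indicator W (a - s) \<partial>lborel) = emeasure lborel W"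
proof -
  have "lborel = density (distr lborel borel (\<lambda>x. a - x)) (\<lambda>_. 1)" using lborel_affine[of "- 1" a] by simp
  then have "emeasure lborel W = (\<integral>\<^sup>+s. indicator W s \<partial>density (distr lborel borel (\<lambda>x. a - x)) (\<lambda>_. 1))"
    by (metis W nn_integral_indicator sets_lborel)
  also have "\<dots> = (\<integral>\<^sup>+s. indicator W s \<partial>distr lborel borel (\<lambda>x. a - x))" by (simp only: density_1)
  also have "\<dots> = (\<integral>\<^sup>+s. indicator W (a - s) \<partial>lborel)" by (rule nn_integral_distr) measurable
  finally show ?thesis by simp
qed

text \<open>
  Mass transport: inserting the integral over all shifts of the indicator of a set \<open>U\<close> of unit area
  shows that the reference point \<open>loc\<close> of a tuple may be replaced by its first entry.
\<close>

lemma nn_integral_reference_point: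
  assumes n: "n > 0" and G [measurable]: "G \<in> borel_measurable (tuple_space n)" and loc [measurable]: "loc \<in> borel_measurable (tuple_space n)"
    and inv: "\<And>x s. x \<in> space (tuple_space n) \<Longrightarrow> G (tshift n s x) = G x" "\<And>x s. x \<in> space (tuple_space n) \<Longrightarrow> loc (tshift n s x) = loc x + s"
    and W [measurable]: "W \<in> sets borel" and U [measurable]: "U \<in> sets borel" and U1: "emeasure lborel U = 1"
  shows "(\<integral>\<^sup>+x. G x * indicator W (loc x) \<partial>tuple_space n) = emeasure lborel W * (\<integral>\<^sup>+x. G x * indicator U (x 0) \<partial>tuple_space n)"
proof -
  have [measurable]: "(\<lambda>x. x 0) \<in> borel_measurable (tuple_space n)" using n by (rule measurable_tuple_component)
  interpret pair_sigma_finite "tuple_space n" "lborel :: point measure"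
    by (intro pair_sigma_finite.intro lborel_product.sigma_finite lborel.sigma_finite_measure_axioms) auto
  have "(\<integral>\<^sup>+x. G x * indicator W (loc x) \<partial>tuple_space n) = (\<integral>\<^sup>+x. (\<integral>\<^sup>+s. G x * indicator W (loc x) * indicator U (x 0 + s) \<partial>lborel) \<partial>tuple_space n)"
  proof (rule nn_integral_cong)
    fix x
    have "(\<integral>\<^sup>+s. G x * indicator W (loc x) * indicator U (x 0 + s) \<partial>lborel) = G x * indicator W (loc x) * (\<integral>\<^sup>+s. indicator U (x 0 + s) \<partial>lborel)"
      by (rule nn_integral_cmult) measurable
    also have "(\<integral>\<^sup>+s. indicator U (x 0 + s) \<partial>lborel) = 1"
      using nn_integral_lborel_shift[of "indicator U" "x 0"] U1 by simp
    finally show "G x * indicator W (loc x) = (\<integral>\<^sup>+s. G x * indicator W (loc x) * indicator U (x 0 + s) \<partial>lborel)" by simp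
  qed
  also have "\<dots> = (\<integral>\<^sup>+s. (\<integral>\<^sup>+x. G x * indicator W (loc x) * indicator U (x 0 + s) \<partial>tuple_space n) \<partial>lborel)"
    by (rule Fubini'[symmetric]) measurable
  \<comment> \<open>For fixed \<open>s\<close> the whole tuple is translated. The shift passes from
    the test on \<open>x 0\<close> to the test on \<open>loc x\<close>, where integrating over
    \<open>s\<close> yields the area of \<open>W\<close>.\<close>
  also have "\<dots> = (\<integral>\<^sup>+s. (\<integral>\<^sup>+x. G x * indicator W (loc x - s) * indicator U (x 0) \<partial>tuple_space n) \<partial>lborel)"
  proof (rule nn_integral_cong)
    fix s :: point
    have "(\<integral>\<^sup>+x. G x * indicator W (loc x - s) * indicator U (x 0) \<partial>tuple_space n) =
        (\<integral>\<^sup>+x. G (tshift n s x) * indicator W (loc (tshift n s x) - s) * indicator U (tshift n s x 0) \<partial>tuple_space n)"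
      by (rule nn_integral_tshift[symmetric]) measurable
    also have "\<dots> = (\<integral>\<^sup>+x. G x * indicator W (loc x) * indicator U (x 0 + s) \<partial>tuple_space n)"
    proof (rule nn_integral_cong)
      fix x assume x: "x \<in> space (tuple_space n)"
      have "tshift n s x 0 = x 0 + s" using n by (simp add: tshift_def)
      then show "G (tshift n s x) * indicator W (loc (tshift n s x) - s) * indicator U (tshift n s x 0) =
          G x * indicator W (loc x) * indicator U (x 0 + s)" by (simp add: inv[OF x])
    qed
    finally show "(\<integral>\<^sup>+x. G x * indicator W (loc x) * indicator U (x 0 + s) \<partial>tuple_space n) =
        (\<integral>\<^sup>+x. G x * indicator W (loc x - s) * indicator U (x 0) \<partial>tuple_space n)" by simp
  qed
  also have "\<dots> = (\<integral>\<^sup>+x. (\<integral>\<^sup>+s. G x * indicator W (loc x - s) * indicator U (x 0) \<partial>lborel) \<partial>tuple_space n)"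
    by (rule Fubini') measurable
  also have "\<dots> = (\<integral>\<^sup>+x. emeasure lborel W * (G x * indicator U (x 0)) \<partial>tuple_space n)"
  proof (rule nn_integral_cong)
    fix x
    have "(\<integral>\<^sup>+s. G x * indicator W (loc x - s) * indicator U (x 0) \<partial>lborel) = (\<integral>\<^sup>+s. (G x * indicator U (x 0)) * indicator W (loc x - s) \<partial>lborel)"
      by (rule nn_integral_cong) (simp add: mult_ac)
    also have "\<dots> = (G x * indicator U (x 0)) * (\<integral>\<^sup>+s. indicator W (loc x - s) \<partial>lborel)"
      by (rule nn_integral_cmult) measurable
    finally show "(\<integral>\<^sup>+s. G x * indicator W (loc x - s) * indicator U (x 0) \<partial>lborel) = emeasure lborel W * (G x * indicator U (x 0))"
      by (simp add: nn_integral_lborel_reflect mult_ac)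
  qed
  also have "\<dots> = emeasure lborel W * (\<integral>\<^sup>+x. G x * indicator U (x 0) \<partial>tuple_space n)"
    by (rule nn_integral_cmult) measurable
  finally show ?thesis .
qed

lemma nn_integral_tuple3:
  assumes H [measurable]: "(\<lambda>p. H (fst p) (fst (snd p)) (snd (snd p))) \<in> borel_measurable (borel \<Otimes>\<^sub>M (borel \<Otimes>\<^sub>M borel))"
  shows "(\<integral>\<^sup>+x. H (x 0) (x 1) (x 2) \<partial>tuple_space 3) = (\<integral>\<^sup>+a. \<integral>\<^sup>+b. \<integral>\<^sup>+c. H a b c \<partial>lborel \<partial>lborel \<partial>lborel)"
proof -
  have Hm: "(\<lambda>x. H (f x) (g x) (h x)) \<in> borel_measurable N"
    if [measurable]: "f \<in> borel_measurable N" "g \<in> borel_measurable N" "h \<in> borel_measurable N" for N f g h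
  proof -
    have "(\<lambda>x. (f x, g x, h x)) \<in> measurable N (borel \<Otimes>\<^sub>M (borel \<Otimes>\<^sub>M borel))" by measurable
    from measurable_compose[OF this H] show ?thesis by simp
  qed
  have I3: "insert 2 {..<2} = {..<3::nat}" and I2: "insert 1 {..<1} = {..<2::nat}" and I1: "{..<1} = {0::nat}" by auto
  have c3: "(\<lambda>x. x 0) \<in> borel_measurable (tuple_space 3)" "(\<lambda>x. x 1) \<in> borel_measurable (tuple_space 3)" "(\<lambda>x. x 2) \<in> borel_measurable (tuple_space 3)"
    by (rule measurable_tuple_component; simp)+
  have c2 [measurable]: "(\<lambda>x. x 0) \<in> borel_measurable (tuple_space 2)" "(\<lambda>x. x 1) \<in> borel_measurable (tuple_space 2)"
    by (rule measurable_tuple_component; simp)+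
  have c1 [measurable]: "(\<lambda>x. x 0) \<in> borel_measurable (tuple_space 1)" by (rule measurable_tuple_component) simp
  have "(\<integral>\<^sup>+x. H (x 0) (x 1) (x 2) \<partial>tuple_space 3) = (\<integral>\<^sup>+x. H (x 0) (x 1) (x 2) \<partial>PiM (insert (2::nat) {..<2}) (\<lambda>_. lborel))" unfolding I3 ..
  also have "\<dots> = (\<integral>\<^sup>+x. \<integral>\<^sup>+c. H ((x(2 := c)) 0) ((x(2 := c)) 1) ((x(2 := c)) 2) \<partial>lborel \<partial>tuple_space 2)"
  proof (rule lborel_product.product_nn_integral_insert)
    show "(\<lambda>x. H (x 0) (x 1) (x 2)) \<in> borel_measurable (PiM (insert (2::nat) {..<2}) (\<lambda>_. lborel))" unfolding I3 by (intro Hm c3)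
  qed auto
  also have "\<dots> = (\<integral>\<^sup>+x. \<integral>\<^sup>+c. H (x 0) (x 1) c \<partial>lborel \<partial>PiM (insert (1::nat) {..<1}) (\<lambda>_. lborel))" unfolding I2 by simp
  also have "\<dots> = (\<integral>\<^sup>+x. \<integral>\<^sup>+b. \<integral>\<^sup>+c. H ((x(1 := b)) 0) ((x(1 := b)) 1) c \<partial>lborel \<partial>lborel \<partial>tuple_space 1)"
  proof (rule lborel_product.product_nn_integral_insert)
    have "(\<lambda>p. H (fst p 0) (fst p 1) (snd p)) \<in> borel_measurable (tuple_space 2 \<Otimes>\<^sub>M lborel)"
      by (rule Hm) measurable
    then show "(\<lambda>x. \<integral>\<^sup>+c. H (x 0) (x 1) c \<partial>lborel) \<in> borel_measurable (PiM (insert (1::nat) {..<1}) (\<lambda>_. lborel))"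
      unfolding I2 by (intro lborel.borel_measurable_nn_integral) (simp add: case_prod_unfold)
  qed auto
  also have "\<dots> = (\<integral>\<^sup>+x. \<integral>\<^sup>+b. \<integral>\<^sup>+c. H (x 0) b c \<partial>lborel \<partial>lborel \<partial>PiM {0::nat} (\<lambda>_. lborel))" unfolding I1[symmetric] by simp
  also have "\<dots> = (\<integral>\<^sup>+a. \<integral>\<^sup>+b. \<integral>\<^sup>+c. H a b c \<partial>lborel \<partial>lborel \<partial>lborel)"
  proof (rule lborel_product.product_nn_integral_singleton)
    have "(\<lambda>p. H (fst (fst p)) (snd (fst p)) (snd p)) \<in> borel_measurable ((borel \<Otimes>\<^sub>M lborel) \<Otimes>\<^sub>M lborel)"
      by (rule Hm) measurable
    then have "(\<lambda>p. \<integral>\<^sup>+c. H (fst p) (snd p) c \<partial>lborel) \<in> borel_measurable (borel \<Otimes>\<^sub>M lborel)"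
      by (intro lborel.borel_measurable_nn_integral) (simp add: case_prod_unfold)
    then show "(\<lambda>a. \<integral>\<^sup>+b. \<integral>\<^sup>+c. H a b c \<partial>lborel \<partial>lborel) \<in> borel_measurable lborel"
      by (intro lborel.borel_measurable_nn_integral[of _ lborel]) (simp add: case_prod_unfold cong: measurable_cong_sets)
  qed
  finally show ?thesis .
qed

lemma circumcenter_translate: "circumcenter a b c - a = circumcenter 0 (b - a) (c - a)"
  by (simp add: circumcenter_def)

section \<open>Triangles with a given number of points inside\<close>

abbreviation tctr :: "(nat \<Rightarrow> point) \<Rightarrow> point" where "tctr x \<equiv> circumcenter (x 0) (x 1) (x 2)"
abbreviation trad :: "(nat \<Rightarrow> point) \<Rightarrow> real" where "trad x \<equiv> norm (circumcenter (x 0) (x 1) (x 2) - x 0)"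

definition tcond :: "nat \<Rightarrow> real set \<Rightarrow> (nat \<Rightarrow> point) \<Rightarrow> bool" where
  "tcond j T x \<longleftrightarrow> cross2 (x 1 - x 0) (x 2 - x 0) > 0 \<and> vec_angle (x 1 - x 0) (x 2 - x 0) \<in> T \<and>
     (\<forall>i\<in>{3..<j + 3}. x i \<in> ball (tctr x) (trad x))"

lemma tcond_measurable:
  assumes [measurable]: "T \<in> sets borel"
  shows "Measurable.pred (tuple_space (j + 3)) (tcond j T)"
proof -
  have [measurable]: "(\<lambda>x. x 0) \<in> borel_measurable (tuple_space (j + 3))" "(\<lambda>x. x 1) \<in> borel_measurable (tuple_space (j + 3))"
      "(\<lambda>x. x 2) \<in> borel_measurable (tuple_space (j + 3))"
    by (rule measurable_tuple_component; simp)+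
  have "Measurable.pred (tuple_space (j + 3)) (\<lambda>x. \<forall>i\<in>{3..<j + 3}. x i \<in> ball (tctr x) (trad x))"
  proof (rule pred_intros_finite)
    fix i assume "i \<in> {3..<j + 3}"
    then have [measurable]: "(\<lambda>x. x i) \<in> borel_measurable (tuple_space (j + 3))" by (intro measurable_tuple_component) simp
    show "Measurable.pred (tuple_space (j + 3)) (\<lambda>x. x i \<in> ball (tctr x) (trad x))" unfolding mem_ball by measurable
  qed simp
  then show ?thesis unfolding tcond_def[abs_def] by measurable
qed

text \<open>Given the triangle, each of the \<open>j\<close> inner entries integrates to the area of
  the circumdisc, which is the power \<open>j\<close> in \<open>nn_integral_triangles\<close>. Of
  the powers of \<open>r\<close> a single factor survives, as it must for a density per unit
  area.\<close>

lemma nn_integral_tcond: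
  assumes r: "r > 0" and T [measurable]: "T \<in> sets borel" and U [measurable]: "U \<in> sets borel" and U1: "emeasure lborel U = 1"
  shows "(\<integral>\<^sup>+x. ennreal (r ^ (j + 3) * exp (- (r * (pi * (trad x)\<^sup>2)))) * indicator {x. tcond j T x} x * indicator U (x 0) \<partial>tuple_space (j + 3)) =
    ennreal (r * fact (Suc j) / pi) * (\<integral>\<^sup>+t. ennreal (6 * f_angle t) * indicator ({0..pi} \<inter> T) t \<partial>lborel)"
proof -
  let ?I = "{..<3::nat}" and ?J = "{3..<j + 3::nat}"
  let ?f = "\<lambda>x. ennreal (r ^ (j + 3) * exp (- (r * (pi * (trad x)\<^sup>2)))) * indicator {x. tcond j T x} x * indicator U (x 0)"
  have IJ: "{..<j + 3} = ?I \<union> ?J" "?I \<inter> ?J = {}" by auto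
  have c [measurable]: "(\<lambda>x. x 0) \<in> borel_measurable (tuple_space (j + 3))" "(\<lambda>x. x 1) \<in> borel_measurable (tuple_space (j + 3))"
      "(\<lambda>x. x 2) \<in> borel_measurable (tuple_space (j + 3))"
    by (rule measurable_tuple_component; simp)+
  note [measurable] = tcond_measurable[OF T, of j]
  have fm: "?f \<in> borel_measurable (tuple_space (j + 3))" by measurable
  define \<psi> where "\<psi> b c = ennreal ((pi * (norm (circumcenter 0 b c))\<^sup>2) ^ j * exp (- (r * (pi * (norm (circumcenter 0 b c))\<^sup>2)))) *
      indicator {0<..} (cross2 b c) * indicator T (vec_angle b c)" for b c
  have [measurable]: "(\<lambda>x. \<psi> (f x) (g x)) \<in> borel_measurable N"
    if [measurable]: "f \<in> borel_measurable N" "g \<in> borel_measurable N" for N f and g :: "'z \<Rightarrow> point"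
    unfolding \<psi>_def by measurable
  have "(\<integral>\<^sup>+x. ?f x \<partial>tuple_space (j + 3)) = (\<integral>\<^sup>+x. (\<integral>\<^sup>+y. ?f (merge ?I ?J (x, y)) \<partial>PiM ?J (\<lambda>_. lborel)) \<partial>tuple_space 3)"
    unfolding IJ(1) by (rule lborel_product.product_nn_integral_fold[OF IJ(2)]) (use fm IJ(1) in auto)
  also have "\<dots> = (\<integral>\<^sup>+x. ennreal (r ^ (j + 3)) * (indicator U (x 0) * \<psi> (x 1 - x 0) (x 2 - x 0)) \<partial>tuple_space 3)"
  proof (rule nn_integral_cong)
    fix x assume x: "x \<in> space (tuple_space 3)"
    have m: "merge ?I ?J (x, y) 0 = x 0" "merge ?I ?J (x, y) 1 = x 1" "merge ?I ?J (x, y) 2 = x 2" for y by (simp_all add: merge_def)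
    have mJ: "merge ?I ?J (x, y) i = y i" if "i \<in> ?J" for y i using that by (simp add: merge_def)
    let ?B = "ball (tctr x) (trad x)"
    let ?c = "ennreal (r ^ (j + 3) * exp (- (r * (pi * (trad x)\<^sup>2)))) * (indicator {0<..} (cross2 (x 1 - x 0) (x 2 - x 0)) *
        indicator T (vec_angle (x 1 - x 0) (x 2 - x 0)) * indicator U (x 0))"
    have mB: "PiE ?J (\<lambda>_. ?B) \<in> sets (PiM ?J (\<lambda>_. lborel))" by (intro sets_PiM_I_finite) auto
    have "(\<integral>\<^sup>+y. ?f (merge ?I ?J (x, y)) \<partial>PiM ?J (\<lambda>_. lborel)) = (\<integral>\<^sup>+y. ?c * indicator (PiE ?J (\<lambda>_. ?B)) y \<partial>PiM ?J (\<lambda>_. lborel))"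
    proof (rule nn_integral_cong)
      fix y assume y: "y \<in> space (PiM ?J (\<lambda>_. lborel :: point measure))"
      have "tcond j T (merge ?I ?J (x, y)) \<longleftrightarrow> cross2 (x 1 - x 0) (x 2 - x 0) > 0 \<and> vec_angle (x 1 - x 0) (x 2 - x 0) \<in> T \<and> y \<in> PiE ?J (\<lambda>_. ?B)"
        using y unfolding tcond_def m by (auto simp: mJ space_PiM PiE_iff)
      then show "?f (merge ?I ?J (x, y)) = ?c * indicator (PiE ?J (\<lambda>_. ?B)) y"
        unfolding m by (simp add: indicator_def)
    qed
    also have "\<dots> = ?c * emeasure (PiM ?J (\<lambda>_. lborel)) (PiE ?J (\<lambda>_. ?B))"
      using mB by (rule nn_integral_cmult_indicator)
    also have "emeasure (PiM ?J (\<lambda>_. lborel)) (PiE ?J (\<lambda>_. ?B)) = (\<Prod>i\<in>?J. emeasure lborel ?B)"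
      by (rule lborel_product.emeasure_PiM) auto
    also have "\<dots> = ennreal ((pi * (trad x)\<^sup>2) ^ j)"
    proof -
      have "emeasure lborel ?B = ennreal (measure lborel ?B)"
        using emeasure_bounded_finite[of ?B] by (intro emeasure_eq_ennreal_measure) (auto simp: less_top)
      then show ?thesis unfolding measure_ball_point by (simp add: ennreal_power)
    qed
    also have "?c * ennreal ((pi * (trad x)\<^sup>2) ^ j) = ennreal (r ^ (j + 3)) * (indicator U (x 0) * \<psi> (x 1 - x 0) (x 2 - x 0))"
    proof -
      have e: "ennreal (r ^ (j + 3) * exp (- (r * (pi * (trad x)\<^sup>2)))) = ennreal (r ^ (j + 3)) * ennreal (exp (- (r * (pi * (trad x)\<^sup>2))))"
        using r by (intro ennreal_mult') simp
      have e': "ennreal ((pi * (trad x)\<^sup>2) ^ j * exp (- (r * (pi * (trad x)\<^sup>2)))) = ennreal ((pi * (trad x)\<^sup>2) ^ j) * ennreal (exp (- (r * (pi * (trad x)\<^sup>2))))"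
        by (intro ennreal_mult') simp
      show ?thesis unfolding \<psi>_def circumcenter_translate[symmetric] e e' by (simp only: mult_ac)
    qed
    finally show "(\<integral>\<^sup>+y. ?f (merge ?I ?J (x, y)) \<partial>PiM ?J (\<lambda>_. lborel)) = ennreal (r ^ (j + 3)) * (indicator U (x 0) * \<psi> (x 1 - x 0) (x 2 - x 0))" .
  qed
  also have "\<dots> = (\<integral>\<^sup>+a. \<integral>\<^sup>+b. \<integral>\<^sup>+c. ennreal (r ^ (j + 3)) * (indicator U a * \<psi> (b - a) (c - a)) \<partial>lborel \<partial>lborel \<partial>lborel)"
    by (rule nn_integral_tuple3[where H = "\<lambda>a b c. ennreal (r ^ (j + 3)) * (indicator U a * \<psi> (b - a) (c - a))"]) measurable
  also have "\<dots> = (\<integral>\<^sup>+a. ennreal (r ^ (j + 3)) * (\<integral>\<^sup>+b. \<integral>\<^sup>+c. \<psi> b c \<partial>lborel \<partial>lborel) * indicator U a \<partial>lborel)"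
  proof (rule nn_integral_cong)
    fix a :: point
    have cc: "(\<integral>\<^sup>+c. \<psi> b (c - a) \<partial>lborel) = (\<integral>\<^sup>+c. \<psi> b c \<partial>lborel)" for b
      using nn_integral_lborel_shift[of "\<lambda>c. \<psi> b c" "- a"] by simp
    have "(\<integral>\<^sup>+b. \<integral>\<^sup>+c. ennreal (r ^ (j + 3)) * (indicator U a * \<psi> (b - a) (c - a)) \<partial>lborel \<partial>lborel) =
        (\<integral>\<^sup>+b. ennreal (r ^ (j + 3)) * indicator U a * (\<integral>\<^sup>+c. \<psi> (b - a) (c - a) \<partial>lborel) \<partial>lborel)"
      by (rule nn_integral_cong, subst nn_integral_cmult[symmetric]) (auto simp: mult.assoc)
    also have "\<dots> = (\<integral>\<^sup>+b. ennreal (r ^ (j + 3)) * indicator U a * (\<integral>\<^sup>+c. \<psi> (b - a) c \<partial>lborel) \<partial>lborel)" unfolding cc ..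
    also have "\<dots> = ennreal (r ^ (j + 3)) * indicator U a * (\<integral>\<^sup>+b. \<integral>\<^sup>+c. \<psi> (b - a) c \<partial>lborel \<partial>lborel)"
      by (rule nn_integral_cmult) measurable
    also have "(\<integral>\<^sup>+b. \<integral>\<^sup>+c. \<psi> (b - a) c \<partial>lborel \<partial>lborel) = (\<integral>\<^sup>+b. \<integral>\<^sup>+c. \<psi> b c \<partial>lborel \<partial>lborel)"
      using nn_integral_lborel_shift[of "\<lambda>b. \<integral>\<^sup>+c. \<psi> b c \<partial>lborel" "- a"] by simp
    finally show "(\<integral>\<^sup>+b. \<integral>\<^sup>+c. ennreal (r ^ (j + 3)) * (indicator U a * \<psi> (b - a) (c - a)) \<partial>lborel \<partial>lborel) =
        ennreal (r ^ (j + 3)) * (\<integral>\<^sup>+b. \<integral>\<^sup>+c. \<psi> b c \<partial>lborel \<partial>lborel) * indicator U a" by (simp add: mult_ac)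
  qed
  also have "\<dots> = ennreal (r ^ (j + 3)) * (\<integral>\<^sup>+b. \<integral>\<^sup>+c. \<psi> b c \<partial>lborel \<partial>lborel)"
    using U1 by (subst nn_integral_cmult_indicator) auto
  also have "(\<integral>\<^sup>+b. \<integral>\<^sup>+c. \<psi> b c \<partial>lborel \<partial>lborel) = ennreal (fact (Suc j) / (pi * r ^ (j + 2))) *
      (\<integral>\<^sup>+t. ennreal (6 * f_angle t) * indicator ({0..pi} \<inter> T) t \<partial>lborel)"
    unfolding \<psi>_def by (rule nn_integral_triangles[OF T r])
  also have "ennreal (r ^ (j + 3)) * (ennreal (fact (Suc j) / (pi * r ^ (j + 2))) * (\<integral>\<^sup>+t. ennreal (6 * f_angle t) * indicator ({0..pi} \<inter> T) t \<partial>lborel)) =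
      ennreal (r * fact (Suc j) / pi) * (\<integral>\<^sup>+t. ennreal (6 * f_angle t) * indicator ({0..pi} \<inter> T) t \<partial>lborel)"
  proof -
    have "r ^ (j + 3) * (F / (pi * r ^ (j + 2))) = r * F / pi" for F :: real
      using r by (simp add: field_simps power_add power2_eq_square power3_eq_cube)
    then have "ennreal (r ^ (j + 3)) * ennreal (fact (Suc j) / (pi * r ^ (j + 2))) = ennreal (r * fact (Suc j) / pi)"
      using r by (subst ennreal_mult'[symmetric]) auto
    then show ?thesis by (simp only: mult.assoc[symmetric])
  qed
  finally show ?thesis .
qed

section \<open>Expected numbers of angles\<close>

definition circum_pts :: "point set \<Rightarrow> point \<Rightarrow> point \<Rightarrow> point \<Rightarrow> point set" where
  "circum_pts A a b c = A \<inter> ball (circumcenter a b c) (norm (circumcenter a b c - a))"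

text \<open>Ordered triples whose first entry is the corner under consideration: a triangle occurs
  three times, once for each of its corners.\<close>

definition tris :: "nat \<Rightarrow> point set \<Rightarrow> (point \<times> point \<times> point) set" where
  "tris j A = {(a, b, c). a \<in> A \<and> b \<in> A \<and> c \<in> A \<and> cross2 (b - a) (c - a) > 0 \<and> card (circum_pts A a b c) = j}"

lemma vertices_not_inside:
  assumes "cross2 (b - a) (c - a) \<noteq> 0"
  shows "a \<notin> circum_pts A a b c" "b \<notin> circum_pts A a b c" "c \<notin> circum_pts A a b c"
  using dist_circumcenter[OF assms] by (auto simp: circum_pts_def dist_norm)

lemma card_bijections:
  assumes "finite I" "card I = j"
  shows "card {g \<in> {3..<j + 3::nat} \<rightarrow>\<^sub>E I. inj_on g {3..<j + 3}} = fact j"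
proof -
  have "card {g \<in> {3..<j + 3::nat} \<rightarrow>\<^sub>E I. inj_on g {3..<j + 3}} = (\<Prod>i\<in>{0..<j}. j - i)"
    using card_inj_on_subset_funcset[of "{3..<j + 3::nat}" I "{3..<j + 3}"] assms by simp
  then show ?thesis by (simp add: fact_prod_rev)
qed

text \<open>A triangle with \<open>j\<close> inner points comes from \<open>fact j\<close> tuples,
  one for each order of these points. The location \<open>L\<close> sees the inner points only
  through their sum, so all these tuples agree on it.\<close>

lemma emeasure_tset_tris:
  assumes fin: "\<And>B. bounded B \<Longrightarrow> finite (A \<inter> B)"
  shows "emeasure (count_space UNIV) (tset (j + 3) A (\<lambda>x. ball (tctr x) (trad x))
      {x \<in> space (tuple_space (j + 3)). tcond j T x \<and> L (x 0) (x 1) (x 2) (\<Sum>i\<in>{3..<j + 3}. x i) \<in> W}) =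
    fact j * emeasure (count_space UNIV)
      {(a, b, c) \<in> tris j A. L a b c (\<Sum>(circum_pts A a b c)) \<in> W \<and> vec_angle (b - a) (c - a) \<in> T}"
proof -
  let ?n = "j + 3" and ?J = "{3..<j + 3::nat}"
  let ?S = "tset ?n A (\<lambda>x. ball (tctr x) (trad x)) {x \<in> space (tuple_space ?n). tcond j T x \<and> L (x 0) (x 1) (x 2) (\<Sum>i\<in>?J. x i) \<in> W}"
  let ?T = "{(a, b, c) \<in> tris j A. L a b c (\<Sum>(circum_pts A a b c)) \<in> W \<and> vec_angle (b - a) (c - a) \<in> T}"
  define P where "P = (\<lambda>(a, b, c). {x \<in> {..<?n} \<rightarrow>\<^sub>E UNIV. x 0 = a \<and> x 1 = b \<and> x 2 = c \<and> bij_betw x ?J (circum_pts A a b c)})"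
  have finI: "finite (circum_pts A a b c)" for a b c unfolding circum_pts_def by (rule fin) simp
  have J3: "{..<?n} = {0, 1, 2} \<union> ?J" by auto
  have SP: "?S = (\<Union>\<tau>\<in>?T. P \<tau>)"
  proof (intro equalityI subsetI)
    fix x assume x: "x \<in> ?S"
    let ?a = "x 0" and ?b = "x 1" and ?c = "x 2"
    have xA: "x \<in> {..<?n} \<rightarrow>\<^sub>E A" "inj_on x {..<?n}" and cr: "cross2 (?b - ?a) (?c - ?a) > 0"
      and ang: "vec_angle (?b - ?a) (?c - ?a) \<in> T" and inb: "\<And>i. i \<in> ?J \<Longrightarrow> x i \<in> ball (tctr x) (trad x)"
      and LW: "L ?a ?b ?c (\<Sum>i\<in>?J. x i) \<in> W" and emp: "A \<inter> ball (tctr x) (trad x) \<subseteq> x ` {..<?n}"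
      using x by (auto simp: tset_def tuples_def tcond_def)
    have xi: "x i \<in> A" if "i < ?n" for i using xA(1) that by auto
    have "x ` ?J = circum_pts A ?a ?b ?c"
    proof (intro equalityI subsetI)
      fix p assume "p \<in> x ` ?J"
      then show "p \<in> circum_pts A ?a ?b ?c" using inb xi unfolding circum_pts_def by auto
    next
      fix p assume p: "p \<in> circum_pts A ?a ?b ?c"
      then obtain i where i: "i < ?n" "p = x i" using emp unfolding circum_pts_def by auto
      have "p \<noteq> ?a" "p \<noteq> ?b" "p \<noteq> ?c" using vertices_not_inside[of ?b ?a ?c A] cr p by auto
      then have "i \<noteq> 0" "i \<noteq> 1" "i \<noteq> 2" using i(2) by metis+
      then have "i \<in> ?J" using i(1) by auto
      then show "p \<in> x ` ?J" using i(2) by blast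
    qed
    moreover have "inj_on x ?J" using xA(2) by (rule inj_on_subset) auto
    ultimately have bij: "bij_betw x ?J (circum_pts A ?a ?b ?c)" by (simp add: bij_betw_def)
    have "card (circum_pts A ?a ?b ?c) = j" using bij_betw_same_card[OF bij] by simp
    moreover have "(\<Sum>i\<in>?J. x i) = \<Sum>(circum_pts A ?a ?b ?c)" using sum.reindex_bij_betw[OF bij, of "\<lambda>p. p"] by simp
    ultimately have "(?a, ?b, ?c) \<in> ?T" using xi cr ang LW by (auto simp: tris_def)
    moreover have "x \<in> P (?a, ?b, ?c)" using xA(1) bij by (auto simp: P_def)
    ultimately show "x \<in> (\<Union>\<tau>\<in>?T. P \<tau>)" by blast
  next
    fix x assume "x \<in> (\<Union>\<tau>\<in>?T. P \<tau>)"
    then obtain a b c where abc: "(a, b, c) \<in> ?T" "x \<in> P (a, b, c)" by auto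
    have x: "x \<in> {..<?n} \<rightarrow>\<^sub>E UNIV" "x 0 = a" "x 1 = b" "x 2 = c" and bij: "bij_betw x ?J (circum_pts A a b c)"
      using abc(2) by (auto simp: P_def)
    have t: "a \<in> A" "b \<in> A" "c \<in> A" "cross2 (b - a) (c - a) > 0" "L a b c (\<Sum>(circum_pts A a b c)) \<in> W" "vec_angle (b - a) (c - a) \<in> T"
      using abc(1) by (auto simp: tris_def)
    have im: "x ` ?J = circum_pts A a b c" and injJ: "inj_on x ?J" using bij by (auto simp: bij_betw_def)
    have xJ: "x i \<in> circum_pts A a b c" if "i \<in> ?J" for i using im that by blast
    have ni: "a \<notin> circum_pts A a b c" "b \<notin> circum_pts A a b c" "c \<notin> circum_pts A a b c" using vertices_not_inside[of b a c A] t(4) by auto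
    have ne: "a \<noteq> b" "a \<noteq> c" "b \<noteq> c" using t(4) by auto
    have "inj_on x ({0, 1, 2} \<union> ?J)"
    proof (rule inj_on_Un[THEN iffD2], intro conjI injJ)
      show "inj_on x {0, 1, 2}" using ne x by (auto simp: inj_on_def)
      show "x ` ({0, 1, 2} - ?J) \<inter> x ` (?J - {0, 1, 2}) = {}" using ni xJ x(2-4) by fastforce
    qed
    then have inj: "inj_on x {..<?n}" unfolding J3 .
    have "x i \<in> A" if "i \<in> {0, 1, 2} \<union> ?J" for i using that t x(2-4) xJ by (auto simp: circum_pts_def)
    then have xA: "x \<in> {..<?n} \<rightarrow>\<^sub>E A" using x(1) unfolding J3 by (auto simp: PiE_iff)
    have "(\<Sum>i\<in>?J. x i) = \<Sum>(circum_pts A a b c)" using sum.reindex_bij_betw[OF bij, of "\<lambda>p. p"] by simp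
    then have LW: "L (x 0) (x 1) (x 2) (\<Sum>i\<in>?J. x i) \<in> W" using t(5) x(2-4) by simp
    have "x i \<in> ball (tctr x) (trad x)" if "i \<in> ?J" for i using xJ[OF that] unfolding x(2-4) circum_pts_def by blast
    then have tc: "tcond j T x" using t x(2-4) unfolding tcond_def by auto
    have "A \<inter> ball (tctr x) (trad x) \<subseteq> x ` {..<?n}" unfolding x(2-4) circum_pts_def[symmetric] im[symmetric] by (intro image_mono) auto
    then show "x \<in> ?S" using xA inj LW tc x(1) by (auto simp: tset_def tuples_def space_PiM)
  qed
  have cardP: "emeasure (count_space UNIV) (P \<tau>) = fact j" if "\<tau> \<in> ?T" for \<tau>
  proof -
    obtain a b c where \<tau>: "\<tau> = (a, b, c)" by (cases \<tau>)
    have cI: "card (circum_pts A a b c) = j" using that by (auto simp: \<tau> tris_def)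
    let ?G = "{g \<in> ?J \<rightarrow>\<^sub>E circum_pts A a b c. inj_on g ?J}"
    define h where "h g = (\<lambda>i. if i = 0 then a else if i = 1 then b else if i = 2 then c else (g :: nat \<Rightarrow> point) i)" for g
    have hJ: "h g i = g i" if "i \<in> ?J" for g i using that by (simp add: h_def)
    have "bij_betw h ?G (P \<tau>)"
    proof (rule bij_betw_byWitness[where f' = "\<lambda>x. restrict x ?J"])
      show "\<forall>g\<in>?G. restrict (h g) ?J = g"
      proof
        fix g assume "g \<in> ?G"
        then show "restrict (h g) ?J = g" by (intro ext) (auto simp: hJ PiE_iff extensional_def restrict_def)
      qed
      show "\<forall>x\<in>P \<tau>. h (restrict x ?J) = x"
      proof
        fix x assume x: "x \<in> P \<tau>"
        show "h (restrict x ?J) = x"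
        proof
          fix i
          consider "i = 0" | "i = 1" | "i = 2" | "i \<in> ?J" | "i \<ge> ?n" by fastforce
          then show "h (restrict x ?J) i = x i"
            using x by cases (auto simp: h_def P_def \<tau> PiE_iff extensional_def)
        qed
      qed
      show "h ` ?G \<subseteq> P \<tau>"
      proof
        fix x assume "x \<in> h ` ?G"
        then obtain g where g: "x = h g" "g \<in> ?J \<rightarrow>\<^sub>E circum_pts A a b c" "inj_on g ?J" by auto
        have "g ` ?J = circum_pts A a b c"
          using g finI cI by (intro card_subset_eq) (auto simp: card_image)
        then have "bij_betw g ?J (circum_pts A a b c)" using g(3) by (simp add: bij_betw_def)
        then have "bij_betw (h g) ?J (circum_pts A a b c)" using bij_betw_cong[of ?J "h g" g] hJ by auto
        moreover have "h g \<in> {..<?n} \<rightarrow>\<^sub>E UNIV" using g(2) by (auto simp: h_def PiE_iff extensional_def)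
        ultimately show "x \<in> P \<tau>" unfolding g(1) P_def \<tau> by (simp add: h_def)
      qed
      show "(\<lambda>x. restrict x ?J) ` P \<tau> \<subseteq> ?G"
        by (auto simp: P_def \<tau> bij_betw_def)
    qed
    then have "card (P \<tau>) = fact j" "finite (P \<tau>)"
      using bij_betw_same_card[of h ?G "P \<tau>"] card_bijections[OF finI cI] bij_betw_finite[of h ?G "P \<tau>"]
        finite_subset[of ?G "?J \<rightarrow>\<^sub>E circum_pts A a b c"] finI by (auto intro: finite_PiE)
    then show ?thesis by (simp add: of_nat_fact)
  qed
  have "A = (\<Union>m::nat. A \<inter> ball 0 (real m))"
  proof -
    have "\<exists>m::nat. norm p < real m" for p :: point by (rule reals_Archimedean2)
    then show ?thesis by auto
  qed
  moreover have "countable (A \<inter> ball 0 (real m))" for m :: nat using fin[of "ball 0 (real m)"] by (intro countable_finite) simp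
  then have "countable (\<Union>m::nat. A \<inter> ball 0 (real m))" by (rule countable_UN[OF countableI_type])
  ultimately have "countable A" by metis
  then have "countable (A \<times> A \<times> A)" by auto
  then have cT: "countable ?T" by (rule countable_subset[rotated]) (auto simp: tris_def)
  have "emeasure (count_space UNIV) ?S = (\<integral>\<^sup>+\<tau>. emeasure (count_space UNIV) (P \<tau>) \<partial>count_space ?T)"
    unfolding SP using cT by (intro emeasure_UN_countable) (auto simp: disjoint_family_on_def P_def)
  also have "\<dots> = (\<integral>\<^sup>+\<tau>. fact j \<partial>count_space ?T)" by (rule nn_integral_cong) (simp add: cardP)
  also have "\<dots> = fact j * emeasure (count_space ?T) ?T" by simp
  also have "emeasure (count_space ?T) ?T = emeasure (count_space UNIV) ?T"
    by (cases "finite ?T") (simp_all add: emeasure_count_space)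
  finally show ?thesis .
qed

context stationary_poisson_process begin

definition fmass :: "real set \<Rightarrow> ennreal" where
  "fmass T = (\<integral>\<^sup>+t. ennreal (f_angle t) * indicator ({0..pi} \<inter> T) t \<partial>lborel)"

text \<open>The Gamma integral gives \<open>fact (Suc j)\<close> and the orders of the inner points
  divide by \<open>fact j\<close>, hence \<open>j + 1\<close>; the 6 comes from the shape integral.
  In \<open>Lc\<close>, translating all points by \<open>s\<close> moves the sum of the
  \<open>j\<close> inner points by \<open>j\<close> times \<open>s\<close>. For \<open>j = 0\<close>
  and unit area the mean number of angles is \<open>6 * \<rho>\<close>.\<close>

lemma expected_tris:
  assumes T: "T \<in> sets borel" and W: "W \<in> sets borel"
    and Lm: "\<And>N f g h k. f \<in> borel_measurable N \<Longrightarrow> g \<in> borel_measurable N \<Longrightarrow> h \<in> borel_measurable N \<Longrightarrow> k \<in> borel_measurable N \<Longrightarrow>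
        (\<lambda>x :: nat \<Rightarrow> point. L (f x) (g x) (h x) (k x)) \<in> borel_measurable N"
    and Lc: "\<And>a b c S s. L (a + s) (b + s) (c + s) (S + real j *\<^sub>R s) = L a b c S + s"
  defines "K \<equiv> \<lambda>\<omega>. emeasure (count_space UNIV)
      {(a, b, c) \<in> tris j (A \<omega>). L a b c (\<Sum>(circum_pts (A \<omega>) a b c)) \<in> W \<and> vec_angle (b - a) (c - a) \<in> T}"
  shows "K \<in> borel_measurable M" and "(\<integral>\<^sup>+\<omega>. K \<omega> \<partial>M) = ennreal (6 * \<rho> * (real j + 1) / pi) * emeasure lborel W * fmass T"
proof -
  let ?n = "j + 3"
  let ?D = "\<lambda>x. ball (tctr x) (trad x)"
  let ?l = "\<lambda>x. L (x 0) (x 1) (x 2) (\<Sum>i\<in>{3..<?n}. x i)"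
  let ?X = "{x \<in> space (tuple_space ?n). tcond j T x \<and> ?l x \<in> W}"
  note [measurable] = tcond_measurable[OF T, of j] T W
  have c [measurable]: "(\<lambda>x. x 0) \<in> borel_measurable (tuple_space ?n)" "(\<lambda>x. x 1) \<in> borel_measurable (tuple_space ?n)"
      "(\<lambda>x. x 2) \<in> borel_measurable (tuple_space ?n)"
    by (rule measurable_tuple_component; simp)+
  have lm [measurable]: "?l \<in> borel_measurable (tuple_space ?n)"
    by (intro Lm c borel_measurable_sum measurable_tuple_component) auto
  have X: "?X \<in> sets (tuple_space ?n)" by measurable
  have g: "good ?n ?D ?X" by (rule mecke_ball) (use X in measurable)
  let ?N = "\<lambda>\<omega>. emeasure (count_space UNIV) (tset ?n (A \<omega>) ?D ?X)"
  have NK: "?N \<omega> = fact j * K \<omega>" if "\<omega> \<in> space M" for \<omega>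
    unfolding K_def using emeasure_tset_tris[of "A \<omega>" j T L W] locally_finite[OF that] by blast
  have fj: "(fact j :: ennreal) \<noteq> 0" "(fact j :: ennreal) \<noteq> \<top>"
    by (simp, metis ennreal_of_nat_eq_real_of_nat ennreal_neq_top of_nat_fact)
  have KN: "K \<omega> = ?N \<omega> / fact j" if "\<omega> \<in> space M" for \<omega>
    unfolding NK[OF that] mult.commute[of "fact j"] using fj by (simp add: ennreal_mult_divide_eq)
  have mN: "?N \<in> borel_measurable M" using g by (simp add: good_def)
  then have "(\<lambda>\<omega>. ?N \<omega> / fact j) \<in> borel_measurable M" by measurable
  then show Km: "K \<in> borel_measurable M" by (simp only: KN cong: measurable_cong)
  \<comment> \<open>The unit square, as the set of unit area used in the mass transport.\<close>
  obtain U :: "point set" where U: "U \<in> sets borel" "emeasure lborel U = 1"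
  proof
    show "emeasure lborel (cbox 0 One :: point set) = 1" by (simp add: emeasure_lborel_cbox_eq inner_sum_left_Basis)
  qed simp
  define G where "G x = ennreal (\<rho> ^ ?n * exp (- (\<rho> * (pi * (trad x)\<^sup>2)))) * indicator {x. tcond j T x} x" for x
  have Gm: "G \<in> borel_measurable (tuple_space ?n)" unfolding G_def by measurable
  have tr: "tshift ?n s x 0 = x 0 + s" "tshift ?n s x 1 = x 1 + s" "tshift ?n s x 2 = x 2 + s"
      "\<And>i. i \<in> {3..<?n} \<Longrightarrow> tshift ?n s x i = x i + s" for s x by (auto simp: tshift_def)
  have cctr: "circumcenter (a + s) (b + s) (c + s) = circumcenter a b c + s" for a b c s :: point by (simp add: circumcenter_def)
  have Gi: "G (tshift ?n s x) = G x" for s x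
  proof -
    have "tcond j T (tshift ?n s x) = tcond j T x" unfolding tcond_def tr(1-3) cctr by (auto simp: tr(4) dist_norm)
    then show ?thesis unfolding G_def tr(1-3) cctr by (simp add: indicator_def)
  qed
  have li: "?l (tshift ?n s x) = ?l x + s" for s x
  proof -
    have "(\<Sum>i\<in>{3..<?n}. tshift ?n s x i) = (\<Sum>i\<in>{3..<?n}. x i + s)" by (intro sum.cong refl tr(4))
    also have "\<dots> = (\<Sum>i\<in>{3..<?n}. x i) + (\<Sum>i\<in>{3..<?n}. s)" by (rule sum.distrib)
    also have "(\<Sum>i\<in>{3..<?n}. s) = real j *\<^sub>R s" by (subst sum_constant_scaleR) simp
    finally have "(\<Sum>i\<in>{3..<?n}. tshift ?n s x i) = (\<Sum>i\<in>{3..<?n}. x i) + real j *\<^sub>R s" .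
    then show ?thesis unfolding tr(1-3) by (simp add: Lc)
  qed
  have "fact j * (\<integral>\<^sup>+\<omega>. K \<omega> \<partial>M) = (\<integral>\<^sup>+\<omega>. fact j * K \<omega> \<partial>M)" using Km by (rule nn_integral_cmult[symmetric])
  also have "\<dots> = (\<integral>\<^sup>+\<omega>. ?N \<omega> \<partial>M)" by (rule nn_integral_cong) (rule NK[symmetric])
  also have "\<dots> = (\<integral>\<^sup>+x. ennreal (\<rho> ^ ?n * exp (- (\<rho> * measure lborel (?D x)))) * indicator ?X x \<partial>tuple_space ?n)"
    using g by (simp add: good_def)
  also have "\<dots> = (\<integral>\<^sup>+x. G x * indicator W (?l x) \<partial>tuple_space ?n)"
    by (rule nn_integral_cong) (auto simp: G_def measure_ball_point indicator_def)
  also have "\<dots> = emeasure lborel W * (\<integral>\<^sup>+x. G x * indicator U (x 0) \<partial>tuple_space ?n)"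
    by (rule nn_integral_reference_point[OF _ Gm lm Gi li W U]) simp
  also have "(\<integral>\<^sup>+x. G x * indicator U (x 0) \<partial>tuple_space ?n) =
      ennreal (\<rho> * fact (Suc j) / pi) * (\<integral>\<^sup>+t. ennreal (6 * f_angle t) * indicator ({0..pi} \<inter> T) t \<partial>lborel)"
    unfolding G_def by (rule nn_integral_tcond[OF intensity_pos T U])
  also have "(\<integral>\<^sup>+t. ennreal (6 * f_angle t) * indicator ({0..pi} \<inter> T) t \<partial>lborel) = ennreal 6 * fmass T"
  proof -
    have "(\<lambda>t. ennreal (f_angle t) * indicator ({0..pi} \<inter> T) t) \<in> borel_measurable lborel" unfolding f_angle_def by measurable
    from nn_integral_cmult[OF this, of "ennreal 6"] show ?thesis
      unfolding fmass_def by (simp only: ennreal_mult' mult.assoc zero_le_numeral)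
  qed
  also have "emeasure lborel W * (ennreal (\<rho> * fact (Suc j) / pi) * (ennreal 6 * fmass T)) =
      fact j * (ennreal (6 * \<rho> * (real j + 1) / pi) * emeasure lborel W * fmass T)"
  proof -
    have "ennreal (\<rho> * fact (Suc j) / pi) * ennreal 6 = ennreal (fact j * (6 * \<rho> * (real j + 1) / pi))"
      using intensity_pos by (subst ennreal_mult'[symmetric]) (simp_all add: algebra_simps)
    also have "\<dots> = ennreal (fact j) * ennreal (6 * \<rho> * (real j + 1) / pi)" by (rule ennreal_mult') simp
    also have "ennreal (fact j) = fact j" by (metis ennreal_of_nat_eq_real_of_nat of_nat_fact)
    finally have e: "ennreal (\<rho> * fact (Suc j) / pi) * ennreal 6 = fact j * ennreal (6 * \<rho> * (real j + 1) / pi)" .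
    have "emeasure lborel W * (ennreal (\<rho> * fact (Suc j) / pi) * (ennreal 6 * fmass T)) =
        (ennreal (\<rho> * fact (Suc j) / pi) * ennreal 6) * (emeasure lborel W * fmass T)" by (simp only: mult_ac)
    then show ?thesis unfolding e by (simp only: mult_ac)
  qed
  finally show "(\<integral>\<^sup>+\<omega>. K \<omega> \<partial>M) = ennreal (6 * \<rho> * (real j + 1) / pi) * emeasure lborel W * fmass T"
    using fj by (simp add: ennreal_mult_cancel_left)
qed

end

section \<open>Types of corners\<close>

definition corner_types :: "nat \<Rightarrow> nat \<Rightarrow> (nat \<times> nat \<times> nat \<times> nat) set" where
  "corner_types M N = {(x, y, y', j). y \<in> {0, M} \<and> y' \<in> {0, M} \<and> x \<le> M \<and> x \<noteq> y \<and> x \<noteq> y' \<and> M * j + x + y + y' = N}"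

text \<open>A type lists the weights at \<open>a\<close>, \<open>b\<close>, \<open>c\<close> and the
  number \<open>j\<close> of points inside the circumcircle; its last condition in
  \<open>corner_types\<close> is that the total weight is \<open>N\<close>.\<close>

definition type_weight :: "nat \<Rightarrow> point set \<Rightarrow> nat \<Rightarrow> nat \<Rightarrow> nat \<Rightarrow> point \<Rightarrow> point \<Rightarrow> point \<Rightarrow> point \<Rightarrow> nat" where
  "type_weight M A x y y' a b c = (\<lambda>p. if p = a then x else if p = b then y else if p = c then y' else if p \<in> circum_pts A a b c then M else 0)"

lemma finite_corner_types: "M > 0 \<Longrightarrow> finite (corner_types M N)"
proof (rule finite_subset)
  assume M: "M > 0"
  have "j \<le> N" if "M * j + x + y + y' = N" for j x y y' using M that by (cases M) auto
  then show "corner_types M N \<subseteq> {..M} \<times> {..M} \<times> {..M} \<times> {..N}" by (auto simp: corner_types_def)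
qed auto

context generic_set begin

lemma finite_inside: "finite (circum_pts A a b c)"
  unfolding circum_pts_def by (rule loc_fin) simp

text \<open>The weight of a corner is forced away from the triangle. Vertices cannot outweigh inner
  points nor be outweighed by outer points, and a second intermediate value next to the apex is
  impossible, so inner points have weight \<open>M\<close> and outer points 0.\<close>

lemma corner_iff_type:
  assumes M: "M > 0"
  shows "corner M N A a b c w \<longleftrightarrow> (\<exists>(x, y, y', j)\<in>corner_types M N. (a, b, c) \<in> tris j A \<and> w = type_weight M A x y y' a b c)"
proof
  assume c: "corner M N A a b c w"
  note d = cornerD[OF c]
  let ?z = "circumcenter a b c"
  have wM: "w p \<le> M" for p by (rule wtsD(3)[OF d(5)])
  have mid: "w p = 0 \<or> w p = M" if "0 < w q" "w q < M" "p \<noteq> q" for p q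
    using wtsD(5)[OF d(5) that(1,2), of p] that(3) wM[of p] by fastforce
  have ge: "w v \<le> w p" if "p \<in> circum_pts A a b c" "v \<in> {a, b, c}" for p v
  proof (rule ccontr)
    assume "\<not> w v \<le> w p"
    then have "norm (?z - v) \<le> norm (?z - p)" using that d(1-3) by (intro regD[OF d(6)]) (auto simp: circum_pts_def)
    then show False using that d(14,15) by (auto simp: circum_pts_def dist_norm)
  qed
  have le: "w p \<le> w v" if "p \<in> A" "p \<notin> circum_pts A a b c" "p \<notin> {a, b, c}" "v \<in> {a, b, c}" for p v
  proof (rule ccontr)
    assume "\<not> w p \<le> w v"
    then have "norm (?z - p) \<le> norm (?z - v)" using that d(1-3) by (intro regD[OF d(6)]) auto
    moreover have "norm (?z - v) = norm (?z - a)" using that(4) d(14,15) by auto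
    moreover have "norm (?z - p) \<ge> norm (?z - a)" using that(1,2) by (auto simp: circum_pts_def dist_norm)
    ultimately have "p \<in> A \<inter> sphere ?z (norm (?z - a))" using that(1) by (auto simp: dist_norm)
    then show False using that(3) unfolding corner_sphere[OF c] by blast
  qed
  \<comment> \<open>A smaller weight at \<open>p\<close> forces \<open>w b = w c = 0\<close>, hence
    \<open>0 < w a \<le> w p < M\<close>: two intermediate values. The argument for outer points is
    the mirror image.\<close>
  have inM: "w p = M" if p: "p \<in> circum_pts A a b c" for p
  proof (rule ccontr)
    assume "w p \<noteq> M"
    then have lt: "w p < M" using wM[of p] by simp
    have "w b = 0" "w c = 0" using ge[OF p, of b] ge[OF p, of c] d(7,8) lt by auto
    then have a: "0 < w a" "w a < M" using d(9) ge[OF p, of a] lt by auto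
    have "p \<noteq> a" using vertices_not_inside[of b a c A] d(4) p by auto
    then show False using mid[OF a, of p] lt ge[OF p, of a] a by auto
  qed
  have out0: "w p = 0" if p: "p \<notin> circum_pts A a b c" "p \<notin> {a, b, c}" for p
  proof (rule ccontr)
    assume nz: "w p \<noteq> 0"
    then have pA: "p \<in> A" using wts_in_A[OF d(5), of p] by simp
    have "w b = M" "w c = M" using le[OF pA p, of b] le[OF pA p, of c] d(7,8) nz by auto
    then have a: "0 < w a" "w a < M" using d(9) le[OF pA p, of a] nz wM[of a] by auto
    have "p \<noteq> a" using p by auto
    then show False using mid[OF a, of p] nz le[OF pA p, of a] a by auto
  qed
  let ?j = "card (circum_pts A a b c)"
  have w: "w = type_weight M A (w a) (w b) (w c) a b c"
  proof
    fix p show "w p = type_weight M A (w a) (w b) (w c) a b c p"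
      using inM[of p] out0[of p] by (auto simp: type_weight_def)
  qed
  let ?S = "insert a (insert b (insert c (circum_pts A a b c)))"
  have ni: "a \<notin> circum_pts A a b c" "b \<notin> circum_pts A a b c" "c \<notin> circum_pts A a b c" using vertices_not_inside[of b a c A] d(4) by auto
  have "supp w \<subseteq> ?S"
  proof
    fix p assume "p \<in> supp w"
    then have "w p \<noteq> 0" by (simp add: supp_def)
    then show "p \<in> ?S" using out0[of p] by auto
  qed
  then have "sum w ?S = N" using finite_inside by (intro wts_sum[OF d(5)]) auto
  moreover have "sum w (circum_pts A a b c) = ?j * M" using inM by simp
  then have "sum w ?S = w a + (w b + (w c + ?j * M))" using ni d(11-13) finite_inside by simp
  ultimately have N: "M * ?j + w a + w b + w c = N" by (simp add: algebra_simps)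
  have "(w a, w b, w c, ?j) \<in> corner_types M N" using N d(7-10) wM[of a] unfolding corner_types_def by blast
  moreover have "(a, b, c) \<in> tris ?j A" using d(1-4) by (simp add: tris_def)
  ultimately show "\<exists>(x, y, y', j)\<in>corner_types M N. (a, b, c) \<in> tris j A \<and> w = type_weight M A x y y' a b c"
    using w by blast
next
  assume "\<exists>(x, y, y', j)\<in>corner_types M N. (a, b, c) \<in> tris j A \<and> w = type_weight M A x y y' a b c"
  then obtain x y y' j where t: "y \<in> {0, M}" "y' \<in> {0, M}" "x \<le> M" "x \<noteq> y" "x \<noteq> y'" "M * j + x + y + y' = N"
    and tri: "a \<in> A" "b \<in> A" "c \<in> A" "cross2 (b - a) (c - a) > 0" "card (circum_pts A a b c) = j"
    and w: "w = type_weight M A x y y' a b c" by (auto simp: corner_types_def tris_def)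
  let ?z = "circumcenter a b c"
  have ne: "a \<noteq> b" "a \<noteq> c" "b \<noteq> c" using tri(4) by auto
  have ni: "a \<notin> circum_pts A a b c" "b \<notin> circum_pts A a b c" "c \<notin> circum_pts A a b c" using vertices_not_inside[of b a c A] tri(4) by auto
  have dd: "norm (?z - b) = norm (?z - a)" "norm (?z - c) = norm (?z - a)" using dist_circumcenter[of b a c] tri(4) by auto
  have wv: "w a = x" "w b = y" "w c = y'" using w ne by (auto simp: type_weight_def)
  have wi: "w p = M" if "p \<in> circum_pts A a b c" for p using that ni w by (auto simp: type_weight_def)
  have wo: "w p = 0" if "p \<notin> circum_pts A a b c" "p \<notin> {a, b, c}" for p using that w by (auto simp: type_weight_def)
  have wM: "w p \<le> M" for p using t w by (auto simp: type_weight_def)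
  have mid: "p = a" if p: "0 < w p" "w p < M" for p
  proof -
    have "p \<notin> circum_pts A a b c" using wi[of p] p by auto
    then have "p \<in> {a, b, c}" using wo[of p] p by auto
    moreover have "p \<noteq> b" "p \<noteq> c" using p t(1,2) wv by auto
    ultimately show ?thesis by blast
  qed
  let ?S = "insert a (insert b (insert c (circum_pts A a b c)))"
  have sub: "supp w \<subseteq> ?S"
  proof
    fix p assume "p \<in> supp w"
    then have "w p \<noteq> 0" by (simp add: supp_def)
    then show "p \<in> ?S" using wo[of p] by auto
  qed
  have fS: "finite ?S" using finite_inside by simp
  have "sum w (supp w) = sum w ?S" using fS sub by (intro sum_supp_superset) auto
  also have "\<dots> = x + (y + (y' + sum w (circum_pts A a b c)))" using ni ne finite_inside wv by simp
  also have "sum w (circum_pts A a b c) = M * j" using wi tri(5) by simp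
  finally have "sum w (supp w) = N" using t(6) by simp
  moreover have "supp w \<subseteq> A" using sub tri(1-3) by (auto simp: circum_pts_def)
  moreover have "finite (supp w)" using finite_subset[OF sub fS] .
  ultimately have wts: "w \<in> wts M N A" unfolding wts_def using wM mid by blast
  have "?z \<in> reg A w" unfolding reg_def
  proof (intro CollectI ballI impI)
    fix p q assume pq: "p \<in> A" "q \<in> A" "w q < w p"
    have "q \<notin> circum_pts A a b c" using wi[of q] wM[of p] pq(3) by auto
    then have q: "norm (?z - a) \<le> norm (?z - q)" using pq(2) by (auto simp: circum_pts_def dist_norm)
    have "p \<in> circum_pts A a b c \<or> p \<in> {a, b, c}" using wo[of p] pq(3) by auto
    then have "norm (?z - p) \<le> norm (?z - a)" using dd by (auto simp: circum_pts_def dist_norm)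
    then show "norm (?z - p) \<le> norm (?z - q)" using q by simp
  qed
  then show "corner M N A a b c w" unfolding corner_def using tri wts wv t by auto
qed

lemma emeasure_corners:
  assumes M: "M > 0"
    and R: "\<And>x y y' j a b c. (x, y, y', j) \<in> corner_types M N \<Longrightarrow> (a, b, c) \<in> tris j A \<Longrightarrow>
      R a b c (type_weight M A x y y' a b c) \<longleftrightarrow> R' (x, y, y', j) a b c"
  shows "emeasure (count_space UNIV) {(a, b, c, w) \<in> corners M N. R a b c w} =
    (\<Sum>t\<in>corner_types M N. emeasure (count_space UNIV) {(a, b, c) \<in> tris (snd (snd (snd t))) A. R' t a b c})"
proof -
  define G where "G = (\<lambda>(x, y, y', j::nat) (a, b, c). (a, b, c, type_weight M A x y y' a b c))"
  let ?K = "\<lambda>t. {(a, b, c) \<in> tris (snd (snd (snd t))) A. R' t a b c}"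
  have "{(a, b, c, w) \<in> corners M N. R a b c w} = (\<Union>t\<in>corner_types M N. G t ` ?K t)"
  proof (intro equalityI subsetI)
    fix k assume "k \<in> {(a, b, c, w) \<in> corners M N. R a b c w}"
    then obtain a b c w where k: "k = (a, b, c, w)" "corner M N A a b c w" "R a b c w" by (auto simp: corners_def)
    then obtain x y y' j where t: "(x, y, y', j) \<in> corner_types M N" "(a, b, c) \<in> tris j A" "w = type_weight M A x y y' a b c"
      using corner_iff_type[OF M] by blast
    then have "(a, b, c) \<in> ?K (x, y, y', j)" using R[OF t(1,2)] k(3) by simp
    moreover have "k = G (x, y, y', j) (a, b, c)" using k t by (simp add: G_def)
    ultimately show "k \<in> (\<Union>t\<in>corner_types M N. G t ` ?K t)" using t(1) by blast
  next
    fix k assume "k \<in> (\<Union>t\<in>corner_types M N. G t ` ?K t)"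
    then obtain x y y' j a b c where t: "(x, y, y', j) \<in> corner_types M N" "(a, b, c) \<in> tris j A" "R' (x, y, y', j) a b c"
        "k = (a, b, c, type_weight M A x y y' a b c)" by (auto simp: G_def)
    then have "corner M N A a b c (type_weight M A x y y' a b c)" using corner_iff_type[OF M] by blast
    then show "k \<in> {(a, b, c, w) \<in> corners M N. R a b c w}" using t R[OF t(1,2)] by (simp add: corners_def)
  qed
  moreover have "disjoint_family_on (\<lambda>t. G t ` ?K t) (corner_types M N)"
    unfolding disjoint_family_on_def
  proof (intro ballI impI)
    fix t t' assume tt: "t \<in> corner_types M N" "t' \<in> corner_types M N" "t \<noteq> t'"
    show "G t ` ?K t \<inter> G t' ` ?K t' = {}"
    proof (rule ccontr)
      assume "G t ` ?K t \<inter> G t' ` ?K t' \<noteq> {}"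
      then obtain k where k: "k \<in> G t ` ?K t" "k \<in> G t' ` ?K t'" by blast
      obtain x y y' j where t: "t = (x, y, y', j)" by (cases t)
      obtain x2 y2 y2' j2 where t': "t' = (x2, y2, y2', j2)" by (cases t')
      obtain a b c where e1: "(a, b, c) \<in> tris j A" "k = (a, b, c, type_weight M A x y y' a b c)"
        using k(1) unfolding t by (auto simp: G_def)
      obtain a2 b2 c2 where e2: "(a2, b2, c2) \<in> tris j2 A" "k = (a2, b2, c2, type_weight M A x2 y2 y2' a2 b2 c2)"
        using k(2) unfolding t' by (auto simp: G_def)
      have e: "t = (x, y, y', j)" "t' = (x2, y2, y2', j2)" "(a, b, c) \<in> tris j A" "(a, b, c) \<in> tris j2 A"
          "type_weight M A x y y' a b c = type_weight M A x2 y2 y2' a b c"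
        using t t' e1 e2 by auto
      have ne: "a \<noteq> b" "a \<noteq> c" "b \<noteq> c" using e(3) by (auto simp: tris_def)
      have "x = x2" "y = y2" "y' = y2'"
        using fun_cong[OF e(5), of a] fun_cong[OF e(5), of b] fun_cong[OF e(5), of c] ne by (simp_all add: type_weight_def)
      moreover have "j = j2" using e(3,4) by (simp add: tris_def)
      ultimately show False using tt(3) e(1,2) by simp
    qed
  qed
  moreover have "emeasure (count_space UNIV) (G t ` ?K t) = emeasure (count_space UNIV) (?K t)" for t
  proof -
    have inj: "inj_on (G t) (?K t)" by (cases t) (auto simp: G_def inj_on_def)
    show ?thesis
      by (simp add: emeasure_count_space finite_image_iff[OF inj] card_image[OF inj])
  qed
  ultimately show ?thesis
    using sum_emeasure[of "\<lambda>t. G t ` ?K t" "corner_types M N" "count_space UNIV"] finite_corner_types[OF M]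
    by simp
qed

lemma wpt_type_weight:
  assumes t: "(x, y, y', j) \<in> corner_types M N" and tri: "(a, b, c) \<in> tris j A"
  shows "wpt N (type_weight M A x y y' a b c) =
    (1 / real N) *\<^sub>R (real M *\<^sub>R (\<Sum>(circum_pts A a b c)) + real x *\<^sub>R a + real y *\<^sub>R b + real y' *\<^sub>R c)"
proof -
  let ?w = "type_weight M A x y y' a b c"
  have cr: "cross2 (b - a) (c - a) > 0" using tri by (simp add: tris_def)
  then have ne: "a \<noteq> b" "a \<noteq> c" "b \<noteq> c" by auto
  have ni: "a \<notin> circum_pts A a b c" "b \<notin> circum_pts A a b c" "c \<notin> circum_pts A a b c" using vertices_not_inside[of b a c A] cr by auto
  let ?S = "insert a (insert b (insert c (circum_pts A a b c)))"
  have sub: "supp ?w \<subseteq> ?S" by (auto simp: supp_def type_weight_def)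
  have "(\<Sum>p\<in>circum_pts A a b c. real (?w p) *\<^sub>R p) = (\<Sum>p\<in>circum_pts A a b c. real M *\<^sub>R p)"
    using ni by (intro sum.cong) (auto simp: type_weight_def)
  then have "(\<Sum>p\<in>?S. real (?w p) *\<^sub>R p) = real x *\<^sub>R a + (real y *\<^sub>R b + (real y' *\<^sub>R c + real M *\<^sub>R (\<Sum>(circum_pts A a b c))))"
    using ne ni finite_inside by (simp add: scaleR_sum_right) (simp add: type_weight_def)
  moreover have "wpt N ?w = (1 / real N) *\<^sub>R (\<Sum>p\<in>?S. real (?w p) *\<^sub>R p)"
    using finite_inside sub by (intro wpt_superset) auto
  ultimately show ?thesis by (simp add: add_ac)
qed

text \<open>If \<open>b\<close> and \<open>c\<close> have equal weights, both edges at
  \<open>a\<close> are reversed or neither is. If the weights differ, they are 0 and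
  \<open>M\<close> with \<open>w a\<close> in between, so exactly one edge is reversed.\<close>

lemma corner_angle_type_weight:
  assumes t: "(x, y, y', j) \<in> corner_types M N" and tri: "(a, b, c) \<in> tris j A"
  shows "corner_angle a b c (type_weight M A x y y' a b c) =
    (if y = y' then vec_angle (b - a) (c - a) else pi - vec_angle (b - a) (c - a))"
proof -
  have "cross2 (b - a) (c - a) > 0" using tri by (simp add: tris_def)
  then have ne: "a \<noteq> b" "a \<noteq> c" "b \<noteq> c" by auto
  have s: "sgw (type_weight M A x y y' a b c) a b = (if y < x then 1 else - 1)"
      "sgw (type_weight M A x y y' a b c) a c = (if y' < x then 1 else - 1)"
    using ne by (auto simp: sgw_def type_weight_def)
  have m: "vec_angle (- u) (- v) = vec_angle u v" "vec_angle (- u) v = pi - vec_angle u v" "vec_angle u (- v) = pi - vec_angle u v" for u v :: point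
    using vec_angle_uminus[of u v] vec_angle_uminus[of u "- v"] by auto
  have "y \<in> {0, M}" "y' \<in> {0, M}" "x \<le> M" "x \<noteq> y" "x \<noteq> y'" using t by (auto simp: corner_types_def)
  then consider "y = y'" "y < x" "y' < x" | "y = y'" "\<not> y < x" "\<not> y' < x" | "y \<noteq> y'" "y < x" "\<not> y' < x" | "y \<noteq> y'" "\<not> y < x" "y' < x" by fastforce
  then show ?thesis unfolding corner_angle_def s
  proof cases
    case 1 then show "vec_angle ((if y < x then 1 else - 1) *\<^sub>R (b - a)) ((if y' < x then 1 else - 1) *\<^sub>R (c - a)) = (if y = y' then vec_angle (b - a) (c - a) else pi - vec_angle (b - a) (c - a))" by simp
  next
    case 2 then show "vec_angle ((if y < x then 1 else - 1) *\<^sub>R (b - a)) ((if y' < x then 1 else - 1) *\<^sub>R (c - a)) = (if y = y' then vec_angle (b - a) (c - a) else pi - vec_angle (b - a) (c - a))"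
      using m(1)[of "b - a" "c - a"] by simp
  next
    case 3 then show "vec_angle ((if y < x then 1 else - 1) *\<^sub>R (b - a)) ((if y' < x then 1 else - 1) *\<^sub>R (c - a)) = (if y = y' then vec_angle (b - a) (c - a) else pi - vec_angle (b - a) (c - a))"
      using m(3)[of "b - a" "c - a"] by simp
  next
    case 4 then show "vec_angle ((if y < x then 1 else - 1) *\<^sub>R (b - a)) ((if y' < x then 1 else - 1) *\<^sub>R (c - a)) = (if y = y' then vec_angle (b - a) (c - a) else pi - vec_angle (b - a) (c - a))"
      using m(2)[of "b - a" "c - a"] by simp
  qed
qed

end

lemma corner_types_1:
  assumes "k \<ge> 1"
  shows "corner_types 1 k = {(1, 0, 0, k - 1)} \<union> (if k \<ge> 2 then {(0, 1, 1, k - 2)} else {})"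
  using assms unfolding corner_types_def by (auto simp: le_Suc_eq)

text \<open>The total is odd while \<open>y\<close> and \<open>y'\<close> are even, so the apex
  always has weight 1.\<close>

lemma corner_types_2:
  assumes "k \<ge> 2"
  shows "corner_types 2 (2 * k - 1) =
    {(1, 0, 0, k - 1), (1, 2, 0, k - 2), (1, 0, 2, k - 2)} \<union> (if k \<ge> 3 then {(1, 2, 2, k - 3)} else {})"
    (is "?L = ?R")
proof (intro equalityI subsetI)
  fix t assume "t \<in> ?L"
  then obtain x y y' j where t: "t = (x, y, y', j)" "y = 0 \<or> y = 2" "y' = 0 \<or> y' = 2" "x \<le> 2" "x \<noteq> y" "x \<noteq> y'" "2 * j + x + y + y' = 2 * k - 1"
    by (auto simp: corner_types_def)
  have "odd (2 * j + x + y + y')" unfolding t(7) using assms by simp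
  then have "odd x" using t(2,3) by auto
  then have "x = 1" using t(4) by (cases "x = 2") (auto simp: le_Suc_eq numeral_2_eq_2)
  then show "t \<in> ?R" using t(1,2,3,7) assms by (elim disjE) auto
next
  fix t assume "t \<in> ?R"
  then show "t \<in> ?L" using assms unfolding corner_types_def by (auto split: if_splits)
qed

section \<open>From expected counts to densities\<close>

lemma angle_count_image:
  assumes img: "{(Q, v, \<theta>). Q \<in> \<T> \<and> interior_angle Q v \<theta>} = (\<lambda>(a, b, c, w). (q a b c w, v a b c w, th a b c w)) ` C"
    and inj: "inj_on (\<lambda>(a, b, c, w). (q a b c w, v a b c w, th a b c w)) C"
  shows "angle_count \<T> W T = emeasure (count_space UNIV) {(a, b, c, w) \<in> C. v a b c w \<in> W \<and> th a b c w \<in> T}"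
proof -
  let ?F = "\<lambda>(a, b, c, w). (q a b c w, v a b c w, th a b c w)"
  let ?K = "{(a, b, c, w) \<in> C. v a b c w \<in> W \<and> th a b c w \<in> T}"
  have "{(Q, v, \<theta>). Q \<in> \<T> \<and> v \<in> W \<and> \<theta> \<in> T \<and> interior_angle Q v \<theta>} =
      {(Q, v, \<theta>). Q \<in> \<T> \<and> interior_angle Q v \<theta>} \<inter> {(Q, v, \<theta>). v \<in> W \<and> \<theta> \<in> T}" by auto
  also have "\<dots> = ?F ` ?K"
  proof (intro equalityI subsetI)
    fix t assume "t \<in> {(Q, v, \<theta>). Q \<in> \<T> \<and> interior_angle Q v \<theta>} \<inter> {(Q, v, \<theta>). v \<in> W \<and> \<theta> \<in> T}"
    then obtain a b c w where "(a, b, c, w) \<in> C" and t: "t = ?F (a, b, c, w)" "v a b c w \<in> W" "th a b c w \<in> T"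
      unfolding img by auto
    then have "(a, b, c, w) \<in> ?K" by simp
    then show "t \<in> ?F ` ?K" unfolding t(1) by (rule imageI)
  next
    fix t assume "t \<in> ?F ` ?K"
    then obtain a b c w where C: "(a, b, c, w) \<in> C" and t: "t = ?F (a, b, c, w)" "v a b c w \<in> W" "th a b c w \<in> T" by auto
    have "t \<in> ?F ` C" unfolding t(1) using C by (rule imageI)
    then show "t \<in> {(Q, v, \<theta>). Q \<in> \<T> \<and> interior_angle Q v \<theta>} \<inter> {(Q, v, \<theta>). v \<in> W \<and> \<theta> \<in> T}"
      unfolding img using t by simp
  qed
  finally have eq: "{(Q, v, \<theta>). Q \<in> \<T> \<and> v \<in> W \<and> \<theta> \<in> T \<and> interior_angle Q v \<theta>} = ?F ` ?K" .
  have inj': "inj_on ?F ?K" using inj by (rule inj_on_subset) auto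
  show ?thesis unfolding angle_count_def eq
    by (simp add: emeasure_count_space finite_image_iff[OF inj'] card_image[OF inj'])
qed

text \<open>With \<open>s = pi - t\<close> the bracket is \<open>sin s - s * cos s\<close>, which
  vanishes at 0 and has derivative \<open>s * sin s\<close>.\<close>

lemma f_angle_nonneg:
  assumes "t \<in> {0..pi}"
  shows "f_angle t \<ge> 0"
proof -
  have "sin s - s * cos s \<ge> 0" if s: "0 \<le> s" "s \<le> pi" for s :: real
  proof -
    have "(\<lambda>s. sin s - s * cos s) 0 \<le> (\<lambda>s. sin s - s * cos s) s"
    proof (rule DERIV_nonneg_imp_nondecreasing[OF s(1)])
      fix x assume x: "0 \<le> x" "x \<le> s"
      have "((\<lambda>s. sin s - s * cos s) has_real_derivative x * sin x) (at x)"
        by (auto intro!: derivative_eq_intros)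
      moreover have "x * sin x \<ge> 0" using x s by (intro mult_nonneg_nonneg sin_ge_zero) auto
      ultimately show "\<exists>y. ((\<lambda>s. sin s - s * cos s) has_real_derivative y) (at x) \<and> 0 \<le> y" by blast
    qed
    then show ?thesis by simp
  qed
  from this[of "pi - t"] have "(pi - t) * cos t + sin t \<ge> 0" using assms by simp
  moreover have "sin t \<ge> 0" using assms by (intro sin_ge_zero) auto
  ultimately show ?thesis unfolding f_angle_def by (intro mult_nonneg_nonneg) auto
qed

lemma f_angle_integral: "(\<integral>\<^sup>+t. ennreal (f_angle t) * indicator {0..pi} t \<partial>lborel) = ennreal pi"
proof -
  \<comment> \<open>The first two terms integrate \<open>2 * (sin t)\<^sup>2\<close>;
    differentiating the last gives the product term of \<open>f\<close> and corrects the coefficient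
    of the squared sine.\<close>
  define F where "F t = t - sin t * cos t + 2 / 3 * (pi - t) * (sin t)\<^sup>2" for t :: real
  have "(\<integral>\<^sup>+t. ennreal (f_angle t) * indicator {0..pi} t \<partial>lborel) = ennreal (F pi - F 0)"
  proof (rule nn_integral_FTC_Icc)
    show "f_angle \<in> borel_measurable borel" unfolding f_angle_def[abs_def] by measurable
    fix x assume "x \<in> {0..pi}"
    have "(F has_real_derivative f_angle x) (at x)"
    proof -
      have "(F has_real_derivative 1 - (cos x * cos x + sin x * - sin x) + (2 / 3 * (- 1) * (sin x)\<^sup>2 + 2 / 3 * (pi - x) * (2 * sin x * cos x))) (at x)"
        unfolding F_def[abs_def] by (auto intro!: derivative_eq_intros simp: power2_eq_square) (simp add: field_simps)
      also have "1 - (cos x * cos x + sin x * - sin x) + (2 / 3 * (- 1) * (sin x)\<^sup>2 + 2 / 3 * (pi - x) * (2 * sin x * cos x)) = f_angle x"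
      proof -
        have c: "cos x * cos x = 1 - sin x * sin x" using sin_cos_squared_add[of x] by (simp add: power2_eq_square)
        show ?thesis unfolding f_angle_def c by (simp add: power2_eq_square field_simps)
      qed
      finally show ?thesis .
    qed
    then show "(F has_real_derivative f_angle x) (at x)" .
    show "0 \<le> f_angle x" using \<open>x \<in> {0..pi}\<close> by (rule f_angle_nonneg)
  qed simp
  then show ?thesis by (simp add: F_def)
qed

text \<open>Here \<open>c\<close> is the mean number of angles per unit area. The factor
  \<open>1 / pi\<close> passes from the count to the uniform reference measure on
  \<open>{0..pi}\<close>.\<close>

lemma angle_densityI:
  fixes X :: "'w \<Rightarrow> point set set"
  assumes d: "\<And>t. t \<in> {0..pi} \<Longrightarrow> d t \<ge> 0" and dm [measurable]: "d \<in> borel_measurable borel"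
    and one: "(\<integral>\<^sup>+t. ennreal (d t) * indicator {0..pi} t \<partial>lborel) = ennreal pi" and c: "c > 0"
    and E: "\<And>W T. W \<in> sets borel \<Longrightarrow> T \<in> sets borel \<Longrightarrow>
      (\<integral>\<^sup>+\<omega>. angle_count (X \<omega>) W T \<partial>M) = ennreal (c / pi) * emeasure lborel W * (\<integral>\<^sup>+t. ennreal (d t) * indicator ({0..pi} \<inter> T) t \<partial>lborel)"
  shows "angle_density M X d"
proof -
  let ?D = "density (uniform_measure lborel {0..pi}) (\<lambda>t. ennreal (d t))"
  have D: "emeasure ?D T = (\<integral>\<^sup>+t. ennreal (d t) * indicator ({0..pi} \<inter> T) t \<partial>lborel) / ennreal pi" if [measurable]: "T \<in> sets borel" for T
  proof -
    have "emeasure ?D T = (\<integral>\<^sup>+t. ennreal (d t) * indicator T t \<partial>uniform_measure lborel {0..pi})"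
      by (rule emeasure_density) auto
    also have "\<dots> = (\<integral>\<^sup>+t. ennreal (d t) * indicator T t * indicator {0..pi} t \<partial>lborel) / emeasure lborel {0..pi}"
      by (rule nn_integral_uniform_measure) auto
    also have "(\<integral>\<^sup>+t. ennreal (d t) * indicator T t * indicator {0..pi} t \<partial>lborel) = (\<integral>\<^sup>+t. ennreal (d t) * indicator ({0..pi} \<inter> T) t \<partial>lborel)"
      by (rule nn_integral_cong) (auto simp: indicator_def)
    finally show ?thesis by simp
  qed
  have pi0: "ennreal pi \<noteq> 0" "ennreal pi \<noteq> \<top>" by auto
  have "prob_space ?D"
  proof
    have "emeasure ?D UNIV = ennreal pi / ennreal pi" using D[of UNIV] one by simp
    then show "emeasure ?D (space ?D) = 1" using pi0 by (simp add: ennreal_divide_self)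
  qed
  moreover have "(\<integral>\<^sup>+\<omega>. angle_count (X \<omega>) W T \<partial>M) = ennreal c * emeasure lborel W * emeasure ?D T"
    if W: "W \<in> sets borel" and T: "T \<in> sets borel" for W T
  proof -
    have "ennreal (c / pi) = ennreal c / ennreal pi" using c by (simp add: divide_ennreal)
    then show ?thesis unfolding E[OF W T] D[OF T] by (simp add: divide_ennreal_def mult_ac)
  qed
  ultimately show ?thesis
    unfolding angle_density_def typical_angle_distribution_def using d c
    by (intro conjI ballI exI[of _ "ennreal c"]) auto
qed

definition refl_angles :: "real set \<Rightarrow> real set" where "refl_angles T = {t. pi - t \<in> T}"

lemma refl_angles_borel [measurable]: "T \<in> sets borel \<Longrightarrow> refl_angles T \<in> sets borel"
  unfolding refl_angles_def using measurable_sets[of "\<lambda>t::real. pi - t" borel borel T] by (simp add: vimage_def)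

context stationary_poisson_process begin

lemma fmass_refl:
  assumes [measurable]: "T \<in> sets borel"
  shows "fmass (refl_angles T) = (\<integral>\<^sup>+t. ennreal (g_angle t) * indicator ({0..pi} \<inter> T) t \<partial>lborel)"
proof -
  have [measurable]: "f_angle \<in> borel_measurable borel" unfolding f_angle_def[abs_def] by measurable
  have "fmass (refl_angles T) = ennreal \<bar>- 1\<bar> * (\<integral>\<^sup>+t. ennreal (f_angle (pi + - 1 * t)) * indicator ({0..pi} \<inter> refl_angles T) (pi + - 1 * t) \<partial>lborel)"
    unfolding fmass_def by (rule nn_integral_real_affine) auto
  also have "\<dots> = (\<integral>\<^sup>+t. ennreal (g_angle t) * indicator ({0..pi} \<inter> T) t \<partial>lborel)"
    unfolding g_angle_def by (auto intro!: nn_integral_cong simp: indicator_def refl_angles_def)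
  finally show ?thesis .
qed

lemma fmass_UNIV: "fmass UNIV = ennreal pi"
  using f_angle_integral by (simp add: fmass_def)

text \<open>The vertex is a weighted mean of the triangle and of the sum of the inner points, and it
  moves along with translations because the weights of a type add up to \<open>N\<close>.\<close>

lemma expected_dual:
  assumes M: "m > 0" and N: "N > 0" and ne: "\<And>B. generic_set B \<Longrightarrow> wts m N B \<noteq> {}"
    and W: "W \<in> sets borel" and T: "T \<in> sets borel"
  shows "(\<integral>\<^sup>+\<omega>. angle_count (projected_lower_boundary (wlift N ` wts m N (A \<omega>))) W T \<partial>M) =
    (\<Sum>(x, y, y', j)\<in>corner_types m N. ennreal (6 * \<rho> * (real j + 1) / pi) * emeasure lborel W * fmass (if y = y' then T else refl_angles T))"
proof -
  define L where "L = (\<lambda>(x, y, y', j::nat) a b c (S::point). (1 / real N) *\<^sub>R (real m *\<^sub>R S + real x *\<^sub>R a + real y *\<^sub>R b + real y' *\<^sub>R (c::point)))"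
  define TT where "TT = (\<lambda>(x::nat, y::nat, y'::nat, j::nat). if y = y' then T else refl_angles T)"
  let ?j = "\<lambda>t. snd (snd (snd t)) :: nat"
  define K where "K t \<omega> = emeasure (count_space UNIV) {(a, b, c) \<in> tris (?j t) (A \<omega>). L t a b c (\<Sum>(circum_pts (A \<omega>) a b c)) \<in> W \<and> vec_angle (b - a) (c - a) \<in> TT t}" for t \<omega>
  have mT: "TT t \<in> sets borel" for t using T by (auto simp: TT_def split: prod.split)
  have Lm: "(\<lambda>z. L t (f z) (g z) (h z) (k z)) \<in> borel_measurable Z"
    if [measurable]: "f \<in> borel_measurable Z" "g \<in> borel_measurable Z" "h \<in> borel_measurable Z" "k \<in> borel_measurable Z" for Z :: "(nat \<Rightarrow> point) measure" and f g h k t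
    unfolding L_def by (cases t) simp
  have Lc: "L t (a + s) (b + s) (c + s) (S + real (?j t) *\<^sub>R s) = L t a b c S + s" if t: "t \<in> corner_types m N" for t a b c S s
  proof -
    obtain x y y' j where tt: "t = (x, y, y', j)" by (cases t)
    then have NN: "real m * real j + real x + real y + real y' = real N"
      using t by (auto simp: corner_types_def simp flip: of_nat_mult of_nat_add)
    have "L t (a + s) (b + s) (c + s) (S + real j *\<^sub>R s) = L t a b c S + (1 / real N) *\<^sub>R ((real m * real j + real x + real y + real y') *\<^sub>R s)"
      unfolding tt L_def by (simp add: algebra_simps)
    also have "\<dots> = L t a b c S + s" unfolding NN using N by simp
    finally show ?thesis by (simp add: tt)
  qed
  have E: "(\<lambda>\<omega>. K t \<omega>) \<in> borel_measurable M"
      "(\<integral>\<^sup>+\<omega>. K t \<omega> \<partial>M) = ennreal (6 * \<rho> * (real (?j t) + 1) / pi) * emeasure lborel W * fmass (TT t)"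
    if t: "t \<in> corner_types m N" for t
    unfolding K_def
    by (rule expected_tris(1)[where L = "L t" and j = "?j t" and T = "TT t" and W = W, OF mT W], rule Lm, assumption+, rule Lc[OF t])
      (rule expected_tris(2)[where L = "L t" and j = "?j t" and T = "TT t" and W = W, OF mT W], rule Lm, assumption+, rule Lc[OF t])
  have "AE \<omega> in M. angle_count (projected_lower_boundary (wlift N ` wts m N (A \<omega>))) W T = (\<Sum>t\<in>corner_types m N. K t \<omega>)"
    using AE_generic
  proof eventually_elim
    case (elim \<omega>)
    interpret generic_set "A \<omega>" by fact
    have "angle_count (projected_lower_boundary (wlift N ` wts m N (A \<omega>))) W T =
        emeasure (count_space UNIV) {(a, b, c, w) \<in> corners m N. wpt N w \<in> W \<and> corner_angle a b c w \<in> T}"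
      by (rule angle_count_image[where q = "\<lambda>a b c w. dual_tile m N (A \<omega>) (circumcenter a b c)" and v = "\<lambda>a b c w. wpt N w"
            and th = corner_angle, OF dual_angles[OF N ne[OF elim]]])
    also have "\<dots> = (\<Sum>t\<in>corner_types m N. K t \<omega>)" unfolding K_def
    proof (rule emeasure_corners[OF M, where R = "\<lambda>a b c w. wpt N w \<in> W \<and> corner_angle a b c w \<in> T"
          and R' = "\<lambda>t a b c. L t a b c (\<Sum>(circum_pts (A \<omega>) a b c)) \<in> W \<and> vec_angle (b - a) (c - a) \<in> TT t"])
      fix x y y' j a b c assume t: "(x, y, y', j) \<in> corner_types m N" and tri: "(a, b, c) \<in> tris j (A \<omega>)"
      show "(wpt N (type_weight m (A \<omega>) x y y' a b c) \<in> W \<and> corner_angle a b c (type_weight m (A \<omega>) x y y' a b c) \<in> T) =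
        (L (x, y, y', j) a b c (\<Sum>(circum_pts (A \<omega>) a b c)) \<in> W \<and> vec_angle (b - a) (c - a) \<in> TT (x, y, y', j))"
        unfolding wpt_type_weight[OF t tri] corner_angle_type_weight[OF t tri] by (simp add: L_def TT_def refl_angles_def)
    qed
    finally show ?case .
  qed
  then have "(\<integral>\<^sup>+\<omega>. angle_count (projected_lower_boundary (wlift N ` wts m N (A \<omega>))) W T \<partial>M) = (\<integral>\<^sup>+\<omega>. (\<Sum>t\<in>corner_types m N. K t \<omega>) \<partial>M)"
    by (rule nn_integral_cong_AE)
  also have "\<dots> = (\<Sum>t\<in>corner_types m N. \<integral>\<^sup>+\<omega>. K t \<omega> \<partial>M)" using E(1) by (intro nn_integral_sum) auto
  also have "\<dots> = (\<Sum>t\<in>corner_types m N. ennreal (6 * \<rho> * (real (?j t) + 1) / pi) * emeasure lborel W * fmass (TT t))"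
    by (intro sum.cong refl E(2))
  also have "\<dots> = (\<Sum>(x, y, y', j)\<in>corner_types m N. ennreal (6 * \<rho> * (real j + 1) / pi) * emeasure lborel W * fmass (if y = y' then T else refl_angles T))"
    by (intro sum.cong refl) (simp add: TT_def split: prod.split)
  finally show ?thesis .
qed

text \<open>The same summation with the circumcenter as vertex. The supplement between primal and
  dual angles exchanges the roles of \<open>T\<close> and its reflection.\<close>

lemma expected_primal:
  assumes M: "m > 0" and W: "W \<in> sets borel" and T: "T \<in> sets borel"
    and X: "\<And>\<omega>. generic_set (A \<omega>) \<Longrightarrow> X \<omega> \<subseteq> {reg (A \<omega>) w | w. w \<in> wts m N (A \<omega>)}"
      "\<And>\<omega> w. generic_set (A \<omega>) \<Longrightarrow> w \<in> wts m N (A \<omega>) \<Longrightarrow> sreg (A \<omega>) w \<noteq> {} \<Longrightarrow> reg (A \<omega>) w \<in> X \<omega>"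
  shows "(\<integral>\<^sup>+\<omega>. angle_count (X \<omega>) W T \<partial>M) =
    (\<Sum>(x, y, y', j)\<in>corner_types m N. ennreal (6 * \<rho> * (real j + 1) / pi) * emeasure lborel W * fmass (if y = y' then refl_angles T else T))"
proof -
  define L where "L = (\<lambda>a b c (S::point). circumcenter a b c)"
  define TT where "TT = (\<lambda>(x::nat, y::nat, y'::nat, j::nat). if y = y' then refl_angles T else T)"
  let ?j = "\<lambda>t. snd (snd (snd t)) :: nat"
  define K where "K t \<omega> = emeasure (count_space UNIV) {(a, b, c) \<in> tris (?j t) (A \<omega>). L a b c (\<Sum>(circum_pts (A \<omega>) a b c)) \<in> W \<and> vec_angle (b - a) (c - a) \<in> TT t}" for t \<omega>
  have mT: "TT t \<in> sets borel" for t using T by (auto simp: TT_def split: prod.split)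
  have Lm: "(\<lambda>z. L (f z) (g z) (h z) (k z)) \<in> borel_measurable Z"
    if [measurable]: "f \<in> borel_measurable Z" "g \<in> borel_measurable Z" "h \<in> borel_measurable Z" "k \<in> borel_measurable Z" for Z :: "(nat \<Rightarrow> point) measure" and f g h k
    unfolding L_def by measurable
  have Lc: "L (a + s) (b + s) (c + s) (S + r *\<^sub>R s) = L a b c S + s" for a b c S s r
    by (simp add: L_def circumcenter_def)
  have E: "(\<lambda>\<omega>. K t \<omega>) \<in> borel_measurable M"
      "(\<integral>\<^sup>+\<omega>. K t \<omega> \<partial>M) = ennreal (6 * \<rho> * (real (?j t) + 1) / pi) * emeasure lborel W * fmass (TT t)"
    if t: "t \<in> corner_types m N" for t
    unfolding K_def
    by (rule expected_tris(1)[where L = "L" and j = "?j t" and T = "TT t" and W = W, OF mT W], rule Lm, assumption+, rule Lc)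
      (rule expected_tris(2)[where L = "L" and j = "?j t" and T = "TT t" and W = W, OF mT W], rule Lm, assumption+, rule Lc)
  have "AE \<omega> in M. angle_count (X \<omega>) W T = (\<Sum>t\<in>corner_types m N. K t \<omega>)"
    using AE_generic
  proof eventually_elim
    case (elim \<omega>)
    interpret generic_set "A \<omega>" by fact
    have "angle_count (X \<omega>) W T =
        emeasure (count_space UNIV) {(a, b, c, w) \<in> corners m N. circumcenter a b c \<in> W \<and> pi - corner_angle a b c w \<in> T}"
      by (rule angle_count_image[where q = "\<lambda>a b c w. reg (A \<omega>) w" and v = "\<lambda>a b c w. circumcenter a b c"
            and th = "\<lambda>a b c w. pi - corner_angle a b c w"])
        (rule primal_angles[OF X(1)[OF elim] X(2)[OF elim]]; assumption)+
    also have "\<dots> = (\<Sum>t\<in>corner_types m N. K t \<omega>)" unfolding K_def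
    proof (rule emeasure_corners[OF M, where R = "\<lambda>a b c w. circumcenter a b c \<in> W \<and> pi - corner_angle a b c w \<in> T"
          and R' = "\<lambda>t a b c. L a b c (\<Sum>(circum_pts (A \<omega>) a b c)) \<in> W \<and> vec_angle (b - a) (c - a) \<in> TT t"])
      fix x y y' j a b c assume t: "(x, y, y', j) \<in> corner_types m N" and tri: "(a, b, c) \<in> tris j (A \<omega>)"
      show "(circumcenter a b c \<in> W \<and> pi - corner_angle a b c (type_weight m (A \<omega>) x y y' a b c) \<in> T) =
        (L a b c (\<Sum>(circum_pts (A \<omega>) a b c)) \<in> W \<and> vec_angle (b - a) (c - a) \<in> TT (x, y, y', j))"
        unfolding corner_angle_type_weight[OF t tri] by (simp add: L_def TT_def refl_angles_def)
    qed
    finally show ?case .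
  qed
  then have "(\<integral>\<^sup>+\<omega>. angle_count (X \<omega>) W T \<partial>M) = (\<integral>\<^sup>+\<omega>. (\<Sum>t\<in>corner_types m N. K t \<omega>) \<partial>M)"
    by (rule nn_integral_cong_AE)
  also have "\<dots> = (\<Sum>t\<in>corner_types m N. \<integral>\<^sup>+\<omega>. K t \<omega> \<partial>M)" using E(1) by (intro nn_integral_sum) auto
  also have "\<dots> = (\<Sum>t\<in>corner_types m N. ennreal (6 * \<rho> * (real (?j t) + 1) / pi) * emeasure lborel W * fmass (TT t))"
    by (intro sum.cong refl E(2))
  also have "\<dots> = (\<Sum>(x, y, y', j)\<in>corner_types m N. ennreal (6 * \<rho> * (real j + 1) / pi) * emeasure lborel W * fmass (if y = y' then refl_angles T else T))"
    by (intro sum.cong refl) (simp add: TT_def split: prod.split)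
  finally show ?thesis .
qed

text \<open>The frequencies of the two types are proportional to \<open>k\<close> and
  \<open>k - 1\<close>. For \<open>k = 1\<close> the second type is absent, and the formula still
  holds because its term would vanish.\<close>

lemma sum_corner_types_1:
  assumes k: "k \<ge> 1"
  shows "(\<Sum>(x, y, y', j)\<in>corner_types 1 k. ennreal (6 * \<rho> * (real j + 1) / pi) * u * (if y = y' then v else v')) =
    ennreal (6 * \<rho> * (2 * real k - 1) / pi) * u * v"
proof (cases "k \<ge> 2")
  case True
  have "ennreal (6 * \<rho> * (real (k - 1) + 1) / pi) + ennreal (6 * \<rho> * (real (k - 2) + 1) / pi) = ennreal (6 * \<rho> * (2 * real k - 1) / pi)"
    using True intensity_pos by (subst ennreal_plus[symmetric]) (auto simp: of_nat_diff field_simps)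
  then show ?thesis unfolding corner_types_1[OF k] using True by (simp add: distrib_right[symmetric] add.commute)
next
  case False
  then have "k = 1" using k by simp
  then show ?thesis unfolding corner_types_1[OF k] by simp
qed

text \<open>Balance of the two kinds: \<open>k\<close> and \<open>k - 2\<close> from the types with
  \<open>y = y'\<close>, against \<open>k - 1\<close> twice from the mixed types. For
  \<open>k = 2\<close> the missing type would have frequency 0.\<close>

lemma sum_corner_types_2:
  assumes k: "k \<ge> 2"
  shows "(\<Sum>(x, y, y', j)\<in>corner_types 2 (2 * k - 1). ennreal (6 * \<rho> * (real j + 1) / pi) * u * (if y = y' then v else v')) =
    ennreal (12 * \<rho> * (real k - 1) / pi) * u * (v + v')"
proof -
  let ?e = "\<lambda>x. ennreal (6 * \<rho> * x / pi)"
  have add: "?e x + ?e y = ?e (x + y)" if "x \<ge> 0" "y \<ge> 0" for x y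
    using that intensity_pos by (subst ennreal_plus[symmetric]) (auto simp: algebra_simps add_divide_distrib)
  have k1: "real (k - 1) + 1 = real k" and k2: "real (k - 2) + 1 = real k - 1" using k by (auto simp: of_nat_diff)
  have tot: "?e (2 * (real k - 1)) = ennreal (12 * \<rho> * (real k - 1) / pi)" by (simp add: algebra_simps)
  have mixed: "?e (real k - 1) + ?e (real k - 1) = ennreal (12 * \<rho> * (real k - 1) / pi)"
  proof -
    have "?e (real k - 1) + ?e (real k - 1) = ?e (real k - 1 + (real k - 1))" by (rule add) (use k in auto)
    also have "real k - 1 + (real k - 1) = 2 * (real k - 1)" by simp
    finally show ?thesis unfolding tot .
  qed
  have same: "?e (real k) + (if k \<ge> 3 then ?e (real (k - 3) + 1) else 0) = ennreal (12 * \<rho> * (real k - 1) / pi)"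
  proof (cases "k \<ge> 3")
    case True
    then have "real (k - 3) + 1 = real k - 2" by (simp add: of_nat_diff)
    moreover have "?e (real k) + ?e (real k - 2) = ?e (real k + (real k - 2))" by (rule add) (use k in auto)
    moreover have "real k + (real k - 2) = 2 * (real k - 1)" by simp
    ultimately show ?thesis using True by (simp only: tot if_True)
  next
    case False
    then have "k = 2" using k by simp
    then show ?thesis by simp
  qed
  have "(\<Sum>(x, y, y', j)\<in>corner_types 2 (2 * k - 1). ?e (real j + 1) * u * (if y = y' then v else v')) =
      (?e (real k) + (if k \<ge> 3 then ?e (real (k - 3) + 1) else 0)) * u * v + (?e (real k - 1) + ?e (real k - 1)) * u * v'"
    unfolding corner_types_2[OF k] using k1 k2 by (cases "k \<ge> 3") (simp_all add: distrib_right add_ac)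
  then show ?thesis unfolding same mixed by (simp add: distrib_left)
qed

end

lemma h_angle_eq: "h_angle t = 2 / 3 * ((pi - 2 * t) * cos t + 2 * sin t) * sin t"
  unfolding h_angle_def g_angle_def f_angle_def by (simp add: field_simps)

lemma angle_functions_measurable [measurable]:
  "f_angle \<in> borel_measurable borel" "g_angle \<in> borel_measurable borel" "h_angle \<in> borel_measurable borel"
  unfolding f_angle_def[abs_def] g_angle_def[abs_def] h_angle_def[abs_def] by measurable

lemma g_angle_nonneg: "t \<in> {0..pi} \<Longrightarrow> g_angle t \<ge> 0"
  unfolding g_angle_def by (rule f_angle_nonneg) auto

lemma h_angle_nonneg: "t \<in> {0..pi} \<Longrightarrow> h_angle t \<ge> 0"
  unfolding h_angle_def using f_angle_nonneg[of t] g_angle_nonneg[of t] by simp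

lemma (in generic_set) wts_1_ne: "wts 1 k A \<noteq> {}"
  using ex_wts_1_reg by blast

lemma (in generic_set) wts_2_ne:
  assumes k: "k \<ge> 1"
  shows "wts 2 (2 * k - 1) A \<noteq> {}"
proof -
  obtain B where B: "finite B" "card B = k" "B \<subseteq> A" using infinite_arbitrarily_large[OF infinite_A] by blast
  then obtain b where "b \<in> B" using k by fastforce
  then have "wts2 B b \<in> wts 2 (2 * k - 1) A" unfolding wts_2_eq[OF k] using B by blast
  then show ?thesis by blast
qed

context stationary_poisson_process begin

lemma hmass:
  assumes T [measurable]: "T \<in> sets borel"
  shows "fmass T + fmass (refl_angles T) = 2 * (\<integral>\<^sup>+t. ennreal (h_angle t) * indicator ({0..pi} \<inter> T) t \<partial>lborel)"
proof -
  have "fmass T + fmass (refl_angles T) =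
      (\<integral>\<^sup>+t. ennreal (f_angle t) * indicator ({0..pi} \<inter> T) t + ennreal (g_angle t) * indicator ({0..pi} \<inter> T) t \<partial>lborel)"
    unfolding fmass_refl[OF T] unfolding fmass_def by (rule nn_integral_add[symmetric]) measurable
  also have "\<dots> = (\<integral>\<^sup>+t. 2 * (ennreal (h_angle t) * indicator ({0..pi} \<inter> T) t) \<partial>lborel)"
  proof (rule nn_integral_cong)
    fix t
    have "ennreal (f_angle t) + ennreal (g_angle t) = 2 * ennreal (h_angle t)" if t: "t \<in> {0..pi}"
    proof -
      have "2 * h_angle t = f_angle t + g_angle t" by (simp add: h_angle_def)
      then have "ennreal (f_angle t) + ennreal (g_angle t) = ennreal (2 * h_angle t)"
        using f_angle_nonneg[OF t] g_angle_nonneg[OF t] by (simp only: ennreal_plus)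
      also have "\<dots> = 2 * ennreal (h_angle t)" by (simp add: ennreal_mult')
      finally show ?thesis .
    qed
    then show "ennreal (f_angle t) * indicator ({0..pi} \<inter> T) t + ennreal (g_angle t) * indicator ({0..pi} \<inter> T) t =
        2 * (ennreal (h_angle t) * indicator ({0..pi} \<inter> T) t)"
      by (cases "t \<in> {0..pi} \<inter> T") auto
  qed
  also have "\<dots> = 2 * (\<integral>\<^sup>+t. ennreal (h_angle t) * indicator ({0..pi} \<inter> T) t \<partial>lborel)"
    by (rule nn_integral_cmult) measurable
  finally show ?thesis .
qed

lemma refl_angles_UNIV: "refl_angles UNIV = UNIV"
  by (simp add: refl_angles_def)

lemma g_angle_integral: "(\<integral>\<^sup>+t. ennreal (g_angle t) * indicator {0..pi} t \<partial>lborel) = ennreal pi"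
  using fmass_refl[of UNIV] fmass_UNIV by (simp add: refl_angles_UNIV)

lemma h_angle_integral: "(\<integral>\<^sup>+t. ennreal (h_angle t) * indicator {0..pi} t \<partial>lborel) = ennreal pi"
proof -
  have "2 * (\<integral>\<^sup>+t. ennreal (h_angle t) * indicator {0..pi} t \<partial>lborel) = 2 * ennreal pi"
    using hmass[of UNIV] fmass_UNIV by (simp add: refl_angles_UNIV mult_2)
  then show ?thesis by (simp add: ennreal_mult_cancel_left)
qed

lemma Del_density:
  assumes k: "k \<ge> 1"
  shows "angle_density M (\<lambda>\<omega>. Del k (A \<omega>)) f_angle"
proof (rule angle_densityI[where c = "6 * \<rho> * (2 * real k - 1)"])
  fix W :: "point set" and T :: "real set" assume W: "W \<in> sets borel" and T: "T \<in> sets borel"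
  have "(\<integral>\<^sup>+\<omega>. angle_count (Del k (A \<omega>)) W T \<partial>M) =
      (\<Sum>(x, y, y', j)\<in>corner_types 1 k. ennreal (6 * \<rho> * (real j + 1) / pi) * emeasure lborel W * fmass (if y = y' then T else refl_angles T))"
    unfolding Del_eq using k by (intro expected_dual generic_set.wts_1_ne W T) auto
  also have "\<dots> = ennreal (6 * \<rho> * (2 * real k - 1) / pi) * emeasure lborel W * fmass T"
    unfolding if_distrib[of fmass] by (rule sum_corner_types_1[OF k])
  finally show "(\<integral>\<^sup>+\<omega>. angle_count (Del k (A \<omega>)) W T \<partial>M) = ennreal (6 * \<rho> * (2 * real k - 1) / pi) * emeasure lborel W *
      (\<integral>\<^sup>+t. ennreal (f_angle t) * indicator ({0..pi} \<inter> T) t \<partial>lborel)" unfolding fmass_def .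
qed (use k intensity_pos f_angle_nonneg f_angle_integral in auto)

lemma Vor_density:
  assumes k: "k \<ge> 1"
  shows "angle_density M (\<lambda>\<omega>. Vor k (A \<omega>)) g_angle"
proof (rule angle_densityI[where c = "6 * \<rho> * (2 * real k - 1)"])
  fix W :: "point set" and T :: "real set" assume W: "W \<in> sets borel" and T: "T \<in> sets borel"
  have "(\<integral>\<^sup>+\<omega>. angle_count (Vor k (A \<omega>)) W T \<partial>M) =
      (\<Sum>(x, y, y', j)\<in>corner_types 1 k. ennreal (6 * \<rho> * (real j + 1) / pi) * emeasure lborel W * fmass (if y = y' then refl_angles T else T))"
    by (rule expected_primal[OF _ W T]) (auto simp: Vor_eq)
  also have "\<dots> = ennreal (6 * \<rho> * (2 * real k - 1) / pi) * emeasure lborel W * fmass (refl_angles T)"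
    unfolding if_distrib[of fmass] by (rule sum_corner_types_1[OF k])
  finally show "(\<integral>\<^sup>+\<omega>. angle_count (Vor k (A \<omega>)) W T \<partial>M) = ennreal (6 * \<rho> * (2 * real k - 1) / pi) * emeasure lborel W *
      (\<integral>\<^sup>+t. ennreal (g_angle t) * indicator ({0..pi} \<inter> T) t \<partial>lborel)" unfolding fmass_refl[OF T] .
qed (use k intensity_pos g_angle_nonneg g_angle_integral in auto)

text \<open>The bound \<open>k \<ge> 2\<close> is essential. For \<open>k = 1\<close> the only type
  is \<open>(1, 0, 0, 0)\<close>, so that \<open>Igl\<close> has the angles of the Delaunay mosaic,
  with density \<open>f\<close>, and \<open>Bri\<close> those of the Voronoi tessellation, with
  density \<open>g\<close>.\<close>

lemma h_angle_densityI:
  assumes k: "k \<ge> 2"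
    and E: "\<And>W T. W \<in> sets borel \<Longrightarrow> T \<in> sets borel \<Longrightarrow> (\<integral>\<^sup>+\<omega>. angle_count (X \<omega>) W T \<partial>M) =
      ennreal (12 * \<rho> * (real k - 1) / pi) * emeasure lborel W * (fmass T + fmass (refl_angles T))"
  shows "angle_density M X h_angle"
proof (rule angle_densityI[where c = "24 * \<rho> * (real k - 1)"])
  fix W :: "point set" and T :: "real set" assume W: "W \<in> sets borel" and T: "T \<in> sets borel"
  have "ennreal (24 * \<rho> * (real k - 1) / pi) = ennreal (2 * (12 * \<rho> * (real k - 1) / pi))" by (simp add: mult.assoc)
  also have "\<dots> = 2 * ennreal (12 * \<rho> * (real k - 1) / pi)" by (simp only: ennreal_mult' zero_le_numeral ennreal_numeral)
  finally have c: "ennreal (24 * \<rho> * (real k - 1) / pi) = 2 * ennreal (12 * \<rho> * (real k - 1) / pi)" .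
  show "(\<integral>\<^sup>+\<omega>. angle_count (X \<omega>) W T \<partial>M) = ennreal (24 * \<rho> * (real k - 1) / pi) * emeasure lborel W *
      (\<integral>\<^sup>+t. ennreal (h_angle t) * indicator ({0..pi} \<inter> T) t \<partial>lborel)"
    unfolding E[OF W T] hmass[OF T] c by (simp only: mult_ac)
qed (use k intensity_pos h_angle_nonneg h_angle_integral in auto)

lemma Igl_density:
  assumes k: "k \<ge> 2"
  shows "angle_density M (\<lambda>\<omega>. Igl k (A \<omega>)) h_angle"
proof (rule h_angle_densityI[OF k])
  fix W :: "point set" and T :: "real set" assume W: "W \<in> sets borel" and T: "T \<in> sets borel"
  have k1: "k \<ge> 1" using k by simp
  have "(\<integral>\<^sup>+\<omega>. angle_count (Igl k (A \<omega>)) W T \<partial>M) =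
      (\<Sum>(x, y, y', j)\<in>corner_types 2 (2 * k - 1). ennreal (6 * \<rho> * (real j + 1) / pi) * emeasure lborel W * fmass (if y = y' then T else refl_angles T))"
    unfolding Igl_eq[OF k1] using k1 by (intro expected_dual generic_set.wts_2_ne W T) auto
  also have "\<dots> = ennreal (12 * \<rho> * (real k - 1) / pi) * emeasure lborel W * (fmass T + fmass (refl_angles T))"
    unfolding if_distrib[of fmass] by (rule sum_corner_types_2[OF k])
  finally show "(\<integral>\<^sup>+\<omega>. angle_count (Igl k (A \<omega>)) W T \<partial>M) =
      ennreal (12 * \<rho> * (real k - 1) / pi) * emeasure lborel W * (fmass T + fmass (refl_angles T))" .
qed

lemma Bri_density:
  assumes k: "k \<ge> 2"
  shows "angle_density M (\<lambda>\<omega>. Bri k (A \<omega>)) h_angle"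
proof (rule h_angle_densityI[OF k])
  fix W :: "point set" and T :: "real set" assume W: "W \<in> sets borel" and T: "T \<in> sets borel"
  have B: "Bri k (A \<omega>) = {reg (A \<omega>) w | w. w \<in> wts 2 (2 * k - 1) (A \<omega>) \<and> sreg (A \<omega>) w \<noteq> {}}" if "generic_set (A \<omega>)" for \<omega>
    using generic_set.Bri_eq[OF that] k by simp
  have "(\<integral>\<^sup>+\<omega>. angle_count (Bri k (A \<omega>)) W T \<partial>M) =
      (\<Sum>(x, y, y', j)\<in>corner_types 2 (2 * k - 1). ennreal (6 * \<rho> * (real j + 1) / pi) * emeasure lborel W * fmass (if y = y' then refl_angles T else T))"
  proof (rule expected_primal[OF _ W T])
    fix \<omega> assume g: "generic_set (A \<omega>)"
    show "Bri k (A \<omega>) \<subseteq> {reg (A \<omega>) w | w. w \<in> wts 2 (2 * k - 1) (A \<omega>)}" unfolding B[OF g] by blast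
    show "reg (A \<omega>) w \<in> Bri k (A \<omega>)" if "w \<in> wts 2 (2 * k - 1) (A \<omega>)" "sreg (A \<omega>) w \<noteq> {}" for w
      unfolding B[OF g] using that by blast
  qed simp
  also have "\<dots> = ennreal (12 * \<rho> * (real k - 1) / pi) * emeasure lborel W * (fmass (refl_angles T) + fmass T)"
    unfolding if_distrib[of fmass] by (rule sum_corner_types_2[OF k])
  finally show "(\<integral>\<^sup>+\<omega>. angle_count (Bri k (A \<omega>)) W T \<partial>M) =
      ennreal (12 * \<rho> * (real k - 1) / pi) * emeasure lborel W * (fmass T + fmass (refl_angles T))"
    unfolding add.commute[of "fmass (refl_angles T)"] .
qed

end

theorem theorem4p1:
  fixes M :: "'w measure" and \<rho> :: real and A :: "'w \<Rightarrow> point set" and k :: nat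
  assumes "stationary_poisson_process M \<rho> A"
    and "k \<ge> 1"
  shows "(\<forall>t\<in>{0..pi}. h_angle t = 2 / 3 * ((pi - 2 * t) * cos t + 2 * sin t) * sin t)
    \<and> angle_density M (\<lambda>\<omega>. Del k (A \<omega>)) f_angle
    \<and> angle_density M (\<lambda>\<omega>. Vor k (A \<omega>)) g_angle
    \<and> (k \<ge> 2 \<longrightarrow>
         angle_density M (\<lambda>\<omega>. Igl k (A \<omega>)) h_angle
       \<and> angle_density M (\<lambda>\<omega>. Bri k (A \<omega>)) h_angle)"
proof -
  interpret stationary_poisson_process M \<rho> A by fact
  show ?thesis using assms(2) h_angle_eq Del_density Vor_density Igl_density Bri_density by blast
qed

end
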